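(* Let $X$ be a Banach space and let $A$ be a $0$-sectorial operator on $X$ having a bounded $\mathcal{M}^\alpha$ calculus for some $\alpha>0$. Let $(\dot\varphi_n)_{n\in\mathbb{Z}}$ be a homogeneous dyadic partition of unity on $\mathbb{R}_+$ and $(\varphi_n)_{n\in\mathbb{N}_0}$ the corresponding inhomogeneous partition. Then for every $\theta\in\mathbb{R}$, $$\|x\|_{\dot X_\theta}\cong\sup_{F\subset\mathbb{Z}\text{ finite}}\mathbb{E}\Bigl\|\sum_{n\in F}\epsilon_n2^{n\theta}\dot\varphi_n(A)x\Bigr\|_X\qquad(x\in\dot X_\theta),$$ and for every $\theta>0$, $$\|x\|_{X_\theta}\cong\sup_{F\subset\mathbb{N}_0\text{ finite}}\mathbb{E}\Bigl\|\sum_{n\in F}\epsilon_n2^{n\theta}\varphi_n(A)x\Bigr\|_X\qquad(x\in X_\theta).$$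
   Context: $\mathbb{R}_+=(0,\infty)$. $a\cong b$ means two-sided estimates with constants independent of $x$ (they may depend on $\theta$). $(\epsilon_n)$ is a sequence of independent Rademacher variables ($P(\epsilon_n=\pm1)=\frac12$), $\mathbb{E}$ is expectation. Sectorial operators. $\Sigma_\omega=\{z\in\mathbb{C}\setminus\{0\}:|\arg z|<\omega\}$ and $H^\infty(\Sigma_\omega)$ is the Banach algebra of bounded holomorphic functions on $\Sigma_\omega$ with the sup norm. A closed densely defined operator $A$ on $X$ is $\omega$-sectorial if $\sigma(A)\subset\overline{\Sigma_\omega}$, its range $R(A)$ is dense in $X$, and for every $\theta>\omega$ there is $C_\theta$ with $\|\lambda(\lambda-A)^{-1}\|\le C_\theta$ for all $\lambda\in\mathbb{C}\setminus\overline{\Sigma_\theta}$ (then $A$ is injective). $A$ is $0$-sectorial if it is $\omega$-sectorial for all $\omega>0$. Let $H^\infty_0(\Sigma_\theta)=\{f\in H^\infty(\Sigma_\theta):\exists C,\epsilon>0:\ |f(\lambda)|\le C(1+|\log\lambda|)^{-1-\epsilon}\}$. For $f\in H_0^\infty(\Sigma_\theta)$, $f(A)=\frac1{2\pi i}\int_\Gamma f(\lambda)(\lambda-A)^{-1}d\lambda\in B(X)$, $\Gamma=\partial\Sigma_\sigma$ oriented counterclockwise, $0<\sigma<\theta$. With $\rho(\lambda)=\lambda(1+\lambda)^{-2}$, if $f$ is holomorphic on $\Sigma_\theta$ and $\rho^n f\in H^\infty_0(\Sigma_\theta)$ for some $n$, then $f(A)=\rho(A)^{-n}(\rho^nf)(A)$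 with its natural domain, which is a closed densely defined operator. Besov spaces and Mihlin classes. Let $\phi_0,\phi_1\in C_c^\infty(\mathbb{R})$, $\operatorname{supp}\phi_1\subset[\frac12,2]$, $\operatorname{supp}\phi_0\subset[-1,1]$, $\phi_n=\phi_1(2^{1-n}\cdot)$ for $n\ge2$, $\phi_n=\phi_{-n}(-\cdot)$ for $n\le-1$, $\sum_{n\in\mathbb{Z}}\phi_n=1$ on $\mathbb{R}$. $\mathcal{B}^\alpha_{\infty,1}$ is the space of bounded uniformly continuous $f:\mathbb{R}\to\mathbb{C}$ with $\|f\|_{\mathcal{B}^\alpha_{\infty,1}}=\sum_{n\in\mathbb{Z}}2^{|n|\alpha}\|f*\check\phi_n\|_\infty<\infty$, $\check{\ }$ being the inverse Fourier transform. For $f:\mathbb{R}_+\to\mathbb{C}$ put $f_e(x)=f(e^x)$. $\mathcal{M}^\alpha=\{f:\mathbb{R}_+\to\mathbb{C}:\ f_e\in\mathcal{B}^\alpha_{\infty,1}\}$ with $\|f\|_{\mathcal{M}^\alpha}=\|f_e\|_{\mathcal{B}^\alpha_{\infty,1}}$. The set $\bigcap_{0<\omega<\pi}H^\infty(\Sigma_\omega)\cap\mathcal{M}^\alpha$ is dense in $\mathcal{M}^\alpha$. $A$ has a (bounded) $\mathcal{M}^\alpha$ calculus if there is $C$ with $\|f(A)\|\le C\|f\|_{\mathcal{M}^\alpha}$ for all $f\in\bigcap_{0<\omega<\pi}H^\infty(\Sigma_\omega)\cap\mathcal{M}^\alpha$; then $f\mapsto f(A)$ extends uniquely to a bounded algebra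 homomorphism $\mathcal{M}^\alpha\to B(X)$, again denoted $f\mapsto f(A)$. Partitions of unity. A homogeneous dyadic partition of unity on $\mathbb{R}_+$ is $\dot\varphi_n=\dot\varphi(2^{-n}\cdot)$, $n\in\mathbb{Z}$, with $\dot\varphi\in C_c^\infty(0,\infty)$, $\operatorname{supp}\dot\varphi\subset[\frac12,2]$, $\sum_{n\in\mathbb{Z}}\dot\varphi(2^{-n}t)=1$ for $t>0$. The corresponding inhomogeneous one is $\varphi_n=\dot\varphi_n$ for $n\ge1$, $\varphi_0=\sum_{k\le0}\dot\varphi_k$. Fractional domain spaces. $A^\theta$ is $f(A)$ for $f(\lambda)=\lambda^\theta$ in the extended calculus above. $\dot X_\theta$ ($\theta\in\mathbb{R}$) is the completion of $D(A^\theta)$ for the norm $\|A^\theta\cdot\|_X$, and $X_\theta$ ($\theta\ge0$) the completion of $D(A^\theta)$ for $\|A^\theta\cdot\|_X+\|\cdot\|_X$. The operators $\dot\varphi_n(A)$ extend continuously to bounded operators $\dot X_\theta\to X$ (on $D(A^\theta)$, $\dot\varphi_n(A)x=(\lambda^{-\theta}\dot\varphi_n)(A)A^\theta x$); these extensions are meant in the claim. *)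

theory Defs
  imports "HOL-Probability.Probability"
begin

section \<open>Complex Banach spaces\<close>

class complex_banach = banach +
  fixes scaleC :: "complex \<Rightarrow> 'a \<Rightarrow> 'a"  (infixr "*\<^sub>C" 75)
  assumes scaleC_add_right: "c *\<^sub>C (x + y) = c *\<^sub>C x + c *\<^sub>C y"
    and scaleC_add_left: "(c + d) *\<^sub>C x = c *\<^sub>C x + d *\<^sub>C x"
    and scaleC_scaleC: "c *\<^sub>C d *\<^sub>C x = (c * d) *\<^sub>C x"
    and scaleR_scaleC: "r *\<^sub>R x = complex_of_real r *\<^sub>C x"
    and norm_scaleC: "norm (c *\<^sub>C x) = cmod c * norm x"

instantiation complex :: complex_banach
begin

definition scaleC_complex :: "complex \<Rightarrow> complex \<Rightarrow> complex"
  where "scaleC_complex c z = c * z"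

instance
  by standard (simp_all add: scaleC_complex_def distrib_left distrib_right mult.assoc norm_mult scaleR_conv_of_real)

end


section \<open>Unbounded operators and sectoriality\<close>

text \<open>An operator with domain a subspace of \<open>X\<close> is represented by its graph; its domain is
  \<^const>\<open>Domain\<close>, its range \<^const>\<open>Range\<close>, and it is a closed operator iff the graph is
  a closed subset of the product space.\<close>

type_synonym 'a op_graph = "('a \<times> 'a) set"

definition linear_op :: "'a::complex_banach op_graph \<Rightarrow> bool" where
  "linear_op A \<longleftrightarrow> single_valued A \<and> (0, 0) \<in> A \<and>
     (\<forall>x y u v. (x, y) \<in> A \<longrightarrow> (u, v) \<in> A \<longrightarrow> (x + u, y + v) \<in> A) \<and>
     (\<forall>c x y. (x, y) \<in> A \<longrightarrow> (c *\<^sub>C x, c *\<^sub>C y) \<in> A)"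

definition op_val :: "'a op_graph \<Rightarrow> 'a \<Rightarrow> 'a" where
  "op_val A x = (THE y. (x, y) \<in> A)"

text \<open>\<open>resolvent A \<mu> z\<close> is the solution \<open>x \<in> D(A)\<close> of \<open>\<mu> x - A x = z\<close>, i.e. of \<open>A x = \<mu> x - z\<close>.\<close>

definition resolvent :: "'a::complex_banach op_graph \<Rightarrow> complex \<Rightarrow> 'a \<Rightarrow> 'a" where
  "resolvent A \<mu> z = (THE x. (x, \<mu> *\<^sub>C x - z) \<in> A)"

definition resolvent_set :: "'a::complex_banach op_graph \<Rightarrow> complex set" where
  "resolvent_set A =
     {\<mu>. (\<forall>z. \<exists>!x. (x, \<mu> *\<^sub>C x - z) \<in> A) \<and> bounded_linear (resolvent A \<mu>)}"

definition op_spectrum :: "'a::complex_banach op_graph \<Rightarrow> complex set" where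
  "op_spectrum A = - resolvent_set A"

definition sector :: "real \<Rightarrow> complex set" where
  "sector \<omega> = {z. z \<noteq> 0 \<and> \<bar>Arg z\<bar> < \<omega>}"

definition sectorial :: "real \<Rightarrow> 'a::complex_banach op_graph \<Rightarrow> bool" where
  "sectorial \<omega> A \<longleftrightarrow>
     linear_op A \<and> closed A \<and> closure (Domain A) = UNIV \<and>
     op_spectrum A \<subseteq> closure (sector \<omega>) \<and> closure (Range A) = UNIV \<and>
     (\<forall>\<theta>>\<omega>. \<exists>C. \<forall>\<mu>\<in>- closure (sector \<theta>). \<forall>x.
        norm (\<mu> *\<^sub>C resolvent A \<mu> x) \<le> C * norm x)"

definition zero_sectorial :: "'a::complex_banach op_graph \<Rightarrow> bool" where
  "zero_sectorial A \<longleftrightarrow> (\<forall>\<omega>>0. sectorial \<omega> A)"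


section \<open>The holomorphic functional calculus\<close>

definition Hinf :: "real \<Rightarrow> (complex \<Rightarrow> complex) set" where
  "Hinf \<omega> = {f. f holomorphic_on sector \<omega> \<and> bounded (f ` sector \<omega>)}"

definition Hinf0 :: "real \<Rightarrow> (complex \<Rightarrow> complex) set" where
  "Hinf0 \<omega> = {f \<in> Hinf \<omega>. \<exists>C>0. \<exists>\<epsilon>>0. \<forall>z\<in>sector \<omega>.
      cmod (f z) \<le> C * (1 + cmod (Ln z)) powr (- 1 - \<epsilon>)}"

text \<open>\<open>1/(2\<pi>\<i>)\<close> times the integral of \<open>f(\<lambda>) (\<lambda> - A)\<^sup>-\<^sup>1 x\<close> over the boundary of the sector of half
  angle \<open>\<sigma>\<close>, oriented counterclockwise: in from infinity along the upper ray, out along the lower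
  ray. The rays are parametrised by \<open>\<lambda> = exp (t \<plusminus> \<i> \<sigma>)\<close> with \<open>t \<in> \<real>\<close>, so that \<open>d\<lambda> = \<lambda> dt\<close>. The
  gauge integral is used because the Bochner integral of the library is restricted to separable
  spaces; for \<open>f\<close> in \<^const>\<open>Hinf0\<close> the integrands are continuous and absolutely integrable.\<close>

definition ray_integral ::
    "real \<Rightarrow> 'a::complex_banach op_graph \<Rightarrow> (complex \<Rightarrow> complex) \<Rightarrow> 'a \<Rightarrow> 'a" where
  "ray_integral \<phi> A f x = integral UNIV (\<lambda>t::real.
     let z = exp (complex_of_real t + \<i> * complex_of_real \<phi>) in (f z * z) *\<^sub>C resolvent A z x)"

definition contour_calc ::
    "real \<Rightarrow> 'a::complex_banach op_graph \<Rightarrow> (complex \<Rightarrow> complex) \<Rightarrow> 'a \<Rightarrow> 'a" where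
  "contour_calc \<sigma> A f x =
     (1 / (2 * complex_of_real pi * \<i>)) *\<^sub>C (ray_integral (- \<sigma>) A f x - ray_integral \<sigma> A f x)"

definition rho :: "complex \<Rightarrow> complex" where
  "rho z = z / (1 + z)\<^sup>2"

text \<open>The operator \<open>f(A) = \<rho>(A)\<^sup>-\<^sup>n (\<rho>\<^sup>n f)(A)\<close> with its natural domain, for a \<open>0\<close>-sectorial \<open>A\<close>: the pair
  \<open>(x, y)\<close> is in the graph iff \<open>\<rho>(A)\<^sup>n y = (\<rho>\<^sup>n f)(A) x\<close>. This does not depend on the choice of the
  angles \<open>\<sigma> < \<omega>\<close> or of \<open>n\<close>. For \<open>f\<close> in \<^const>\<open>Hinf0\<close>, \<open>n = 0\<close> gives the contour integral.\<close>

definition hol_calc ::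
    "'a::complex_banach op_graph \<Rightarrow> (complex \<Rightarrow> complex) \<Rightarrow> 'a op_graph" where
  "hol_calc A f = {(x, y). \<exists>\<sigma> \<omega> n. 0 < \<sigma> \<and> \<sigma> < \<omega> \<and> \<omega> < pi \<and>
     f holomorphic_on sector \<omega> \<and> (\<lambda>z. rho z ^ n * f z) \<in> Hinf0 \<omega> \<and>
     (contour_calc \<sigma> A rho ^^ n) y = contour_calc \<sigma> A (\<lambda>z. rho z ^ n * f z) x}"

definition frac_power :: "'a::complex_banach op_graph \<Rightarrow> real \<Rightarrow> 'a op_graph" where
  "frac_power A \<theta> = hol_calc A (\<lambda>z. z powr complex_of_real \<theta>)"


section \<open>Besov spaces and Mihlin classes\<close>

definition smooth :: "(real \<Rightarrow> complex) \<Rightarrow> bool" where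
  "smooth f \<longleftrightarrow> (\<exists>D :: nat \<Rightarrow> real \<Rightarrow> complex. D 0 = f \<and>
     (\<forall>n x. (D n has_vector_derivative D (Suc n) x) (at x)))"

definition supp :: "(real \<Rightarrow> complex) \<Rightarrow> real set" where
  "supp f = closure {x. f x \<noteq> 0}"

definition lp_fun :: "(real \<Rightarrow> complex) \<Rightarrow> (real \<Rightarrow> complex) \<Rightarrow> int \<Rightarrow> real \<Rightarrow> complex" where
  "lp_fun \<phi>\<^sub>0 \<phi>\<^sub>1 n x =
     (if n = 0 then \<phi>\<^sub>0 x
      else if n > 0 then \<phi>\<^sub>1 (2 powi (1 - n) * x)
      else \<phi>\<^sub>1 (2 powi (1 - (- n)) * (- x)))"

definition besov_partition :: "(real \<Rightarrow> complex) \<Rightarrow> (real \<Rightarrow> complex) \<Rightarrow> bool" where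
  "besov_partition \<phi>\<^sub>0 \<phi>\<^sub>1 \<longleftrightarrow>
     smooth \<phi>\<^sub>0 \<and> smooth \<phi>\<^sub>1 \<and> supp \<phi>\<^sub>1 \<subseteq> {1/2..2} \<and> supp \<phi>\<^sub>0 \<subseteq> {-1..1} \<and>
     (\<forall>x. ((\<lambda>n. lp_fun \<phi>\<^sub>0 \<phi>\<^sub>1 n x) has_sum 1) UNIV)"

text \<open>The factor \<open>1/(2\<pi>)\<close> makes \<open>f * inv_fourier \<phi>\<close> the Fourier multiplier with symbol \<open>\<phi>\<close>.\<close>

definition inv_fourier :: "(real \<Rightarrow> complex) \<Rightarrow> real \<Rightarrow> complex" where
  "inv_fourier \<phi> x =
     complex_of_real (1 / (2 * pi)) * (\<integral>\<xi>. \<phi> \<xi> * exp (\<i> * complex_of_real (x * \<xi>)) \<partial>lborel)"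

definition convolve :: "(real \<Rightarrow> complex) \<Rightarrow> (real \<Rightarrow> complex) \<Rightarrow> real \<Rightarrow> complex" where
  "convolve f g x = (\<integral>t. f (x - t) * g t \<partial>lborel)"

definition besov_term ::
    "real \<Rightarrow> (real \<Rightarrow> complex) \<Rightarrow> (real \<Rightarrow> complex) \<Rightarrow> (real \<Rightarrow> complex) \<Rightarrow> int \<Rightarrow> real" where
  "besov_term \<alpha> \<phi>\<^sub>0 \<phi>\<^sub>1 f n =
     2 powr (real_of_int \<bar>n\<bar> * \<alpha>) * (SUP x. cmod (convolve f (inv_fourier (lp_fun \<phi>\<^sub>0 \<phi>\<^sub>1 n)) x))"

definition besov ::
    "real \<Rightarrow> (real \<Rightarrow> complex) \<Rightarrow> (real \<Rightarrow> complex) \<Rightarrow> (real \<Rightarrow> complex) set" where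
  "besov \<alpha> \<phi>\<^sub>0 \<phi>\<^sub>1 = {f. bounded (range f) \<and> uniformly_continuous_on UNIV f \<and>
     besov_term \<alpha> \<phi>\<^sub>0 \<phi>\<^sub>1 f summable_on UNIV}"

definition besov_norm ::
    "real \<Rightarrow> (real \<Rightarrow> complex) \<Rightarrow> (real \<Rightarrow> complex) \<Rightarrow> (real \<Rightarrow> complex) \<Rightarrow> real" where
  "besov_norm \<alpha> \<phi>\<^sub>0 \<phi>\<^sub>1 f = infsum (besov_term \<alpha> \<phi>\<^sub>0 \<phi>\<^sub>1 f) UNIV"

text \<open>A function on \<open>(0, \<infinity>)\<close> is represented by a function on \<open>\<real>\<close> whose values outside \<open>(0, \<infinity>)\<close>
  are irrelevant.\<close>

definition mihlin ::
    "real \<Rightarrow> (real \<Rightarrow> complex) \<Rightarrow> (real \<Rightarrow> complex) \<Rightarrow> (real \<Rightarrow> complex) set" where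
  "mihlin \<alpha> \<phi>\<^sub>0 \<phi>\<^sub>1 = {f. (\<lambda>x. f (exp x)) \<in> besov \<alpha> \<phi>\<^sub>0 \<phi>\<^sub>1}"

definition mihlin_norm ::
    "real \<Rightarrow> (real \<Rightarrow> complex) \<Rightarrow> (real \<Rightarrow> complex) \<Rightarrow> (real \<Rightarrow> complex) \<Rightarrow> real" where
  "mihlin_norm \<alpha> \<phi>\<^sub>0 \<phi>\<^sub>1 f = besov_norm \<alpha> \<phi>\<^sub>0 \<phi>\<^sub>1 (\<lambda>x. f (exp x))"

abbreviation on_reals :: "(complex \<Rightarrow> complex) \<Rightarrow> real \<Rightarrow> complex" where
  "on_reals f t \<equiv> f (complex_of_real t)"

definition mihlin_hol ::
    "real \<Rightarrow> (real \<Rightarrow> complex) \<Rightarrow> (real \<Rightarrow> complex) \<Rightarrow> (complex \<Rightarrow> complex) set" where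
  "mihlin_hol \<alpha> \<phi>\<^sub>0 \<phi>\<^sub>1 =
     {f. (\<forall>\<omega>. 0 < \<omega> \<and> \<omega> < pi \<longrightarrow> f \<in> Hinf \<omega>) \<and> on_reals f \<in> mihlin \<alpha> \<phi>\<^sub>0 \<phi>\<^sub>1}"

definition has_mihlin_calculus ::
    "real \<Rightarrow> (real \<Rightarrow> complex) \<Rightarrow> (real \<Rightarrow> complex) \<Rightarrow> 'a::complex_banach op_graph \<Rightarrow> bool" where
  "has_mihlin_calculus \<alpha> \<phi>\<^sub>0 \<phi>\<^sub>1 A \<longleftrightarrow>
     (\<exists>C. \<forall>f\<in>mihlin_hol \<alpha> \<phi>\<^sub>0 \<phi>\<^sub>1. Domain (hol_calc A f) = UNIV \<and>
        (\<forall>(x, y)\<in>hol_calc A f. norm y \<le> C * mihlin_norm \<alpha> \<phi>\<^sub>0 \<phi>\<^sub>1 (on_reals f) * norm x))"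

text \<open>The value \<open>f(A) x\<close> for \<open>f\<close> in the Mihlin class: \<open>f \<mapsto> f(A)\<close> is the unique bounded extension of
  the calculus from the dense subspace \<^const>\<open>mihlin_hol\<close>, that is, the limit of \<open>F k (A) x\<close> along
  any sequence \<open>F\<close> in this subspace that converges to \<open>f\<close>.\<close>

definition mihlin_calc ::
    "real \<Rightarrow> (real \<Rightarrow> complex) \<Rightarrow> (real \<Rightarrow> complex) \<Rightarrow> 'a::complex_banach op_graph \<Rightarrow>
     (real \<Rightarrow> complex) \<Rightarrow> 'a \<Rightarrow> 'a" where
  "mihlin_calc \<alpha> \<phi>\<^sub>0 \<phi>\<^sub>1 A f x = (THE y. \<exists>F :: nat \<Rightarrow> complex \<Rightarrow> complex.
     (\<forall>k. F k \<in> mihlin_hol \<alpha> \<phi>\<^sub>0 \<phi>\<^sub>1) \<and>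
     (\<lambda>k. mihlin_norm \<alpha> \<phi>\<^sub>0 \<phi>\<^sub>1 (\<lambda>t. on_reals (F k) t - f t)) \<longlonglongrightarrow> 0 \<and>
     (\<lambda>k. op_val (hol_calc A (F k)) x) \<longlonglongrightarrow> y)"


section \<open>Dyadic partitions of unity\<close>

definition hom_part :: "(real \<Rightarrow> complex) \<Rightarrow> int \<Rightarrow> real \<Rightarrow> complex" where
  "hom_part \<phi> n t = \<phi> (2 powi (- n) * t)"

definition dyadic_partition :: "(real \<Rightarrow> complex) \<Rightarrow> bool" where
  "dyadic_partition \<phi> \<longleftrightarrow> smooth \<phi> \<and> supp \<phi> \<subseteq> {1/2..2} \<and>
     (\<forall>t>0. ((\<lambda>n. hom_part \<phi> n t) has_sum 1) UNIV)"

definition inhom_part :: "(real \<Rightarrow> complex) \<Rightarrow> nat \<Rightarrow> real \<Rightarrow> complex" where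
  "inhom_part \<phi> n t =
     (if n = 0 then (\<Sum>\<^sub>\<infinity>k\<in>{..0}. hom_part \<phi> k t) else hom_part \<phi> (int n) t)"


section \<open>Completions and fractional domain spaces\<close>

text \<open>The completion of a subspace \<open>D\<close> with respect to a norm \<open>N\<close> on \<open>D\<close>, as the set of classes of
  \<open>N\<close>-Cauchy sequences modulo \<open>N\<close>-null sequences, with the norm and the continuous extension of a
  bounded operator \<open>T\<close> from \<open>D\<close> to \<open>X\<close>.\<close>

definition cauchy_seqs :: "'a::ab_group_add set \<Rightarrow> ('a \<Rightarrow> real) \<Rightarrow> (nat \<Rightarrow> 'a) set" where
  "cauchy_seqs D N =
     {u. (\<forall>k. u k \<in> D) \<and> (\<forall>e>0. \<exists>K. \<forall>j\<ge>K. \<forall>k\<ge>K. N (u j - u k) < e)}"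

definition completion :: "'a::ab_group_add set \<Rightarrow> ('a \<Rightarrow> real) \<Rightarrow> (nat \<Rightarrow> 'a) set set" where
  "completion D N = cauchy_seqs D N //
     {(u, v). u \<in> cauchy_seqs D N \<and> v \<in> cauchy_seqs D N \<and> (\<lambda>k. N (u k - v k)) \<longlonglongrightarrow> 0}"

definition completion_norm :: "('a \<Rightarrow> real) \<Rightarrow> (nat \<Rightarrow> 'a) set \<Rightarrow> real" where
  "completion_norm N x = (THE r. \<forall>u\<in>x. (\<lambda>k. N (u k)) \<longlonglongrightarrow> r)"

definition completion_ext :: "('a \<Rightarrow> 'b::topological_space) \<Rightarrow> (nat \<Rightarrow> 'a) set \<Rightarrow> 'b" where
  "completion_ext T x = (THE y. \<forall>u\<in>x. (\<lambda>k. T (u k)) \<longlonglongrightarrow> y)"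

definition hom_pre_norm :: "'a::complex_banach op_graph \<Rightarrow> real \<Rightarrow> 'a \<Rightarrow> real" where
  "hom_pre_norm A \<theta> x = norm (op_val (frac_power A \<theta>) x)"

definition inhom_pre_norm :: "'a::complex_banach op_graph \<Rightarrow> real \<Rightarrow> 'a \<Rightarrow> real" where
  "inhom_pre_norm A \<theta> x = norm (op_val (frac_power A \<theta>) x) + norm x"

definition hom_space :: "'a::complex_banach op_graph \<Rightarrow> real \<Rightarrow> (nat \<Rightarrow> 'a) set set" where
  "hom_space A \<theta> = completion (Domain (frac_power A \<theta>)) (hom_pre_norm A \<theta>)"

definition hom_norm :: "'a::complex_banach op_graph \<Rightarrow> real \<Rightarrow> (nat \<Rightarrow> 'a) set \<Rightarrow> real" where
  "hom_norm A \<theta> = completion_norm (hom_pre_norm A \<theta>)"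

definition inhom_space :: "'a::complex_banach op_graph \<Rightarrow> real \<Rightarrow> (nat \<Rightarrow> 'a) set set" where
  "inhom_space A \<theta> = completion (Domain (frac_power A \<theta>)) (inhom_pre_norm A \<theta>)"

definition inhom_norm :: "'a::complex_banach op_graph \<Rightarrow> real \<Rightarrow> (nat \<Rightarrow> 'a) set \<Rightarrow> real" where
  "inhom_norm A \<theta> = completion_norm (inhom_pre_norm A \<theta>)"


section \<open>Rademacher variables\<close>

definition rademacher :: "'w measure \<Rightarrow> ('i \<Rightarrow> 'w \<Rightarrow> real) \<Rightarrow> bool" where
  "rademacher M \<epsilon> \<longleftrightarrow> prob_space M \<and> prob_space.indep_vars M (\<lambda>_. borel) \<epsilon> UNIV \<and>
     (\<forall>i. measure M {w \<in> space M. \<epsilon> i w = 1} = 1/2 \<and>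
          measure M {w \<in> space M. \<epsilon> i w = - 1} = 1/2)"

text \<open>The supremum over all finite \<open>F\<close> of \<open>E \<parallel>\<Sum>n\<in>F. \<epsilon>\<^sub>n v\<^sub>n\<parallel>\<close>, possibly infinite.\<close>

definition rad_sup ::
    "'w measure \<Rightarrow> ('i \<Rightarrow> 'w \<Rightarrow> real) \<Rightarrow> ('i \<Rightarrow> 'a::real_normed_vector) \<Rightarrow> ennreal" where
  "rad_sup M \<epsilon> v =
     (SUP F\<in>{F. finite F}. ennreal (\<integral>w. norm (\<Sum>n\<in>F. \<epsilon> n w *\<^sub>R v n) \<partial>M))"

end

theory Submission
  imports Defs "HOL-Complex_Analysis.Complex_Analysis"
begin

text \<open>
  Write \<open>u(log A)\<close> for the operator that the calculus assigns to \<open>t \<mapsto> u (ln t)\<close>. A bounded Mihlin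
  calculus bounds \<open>\<parallel>u(log A)\<parallel>\<close> by the sup norms of finitely many derivatives of \<open>u\<close>. Every function that
  occurs below is smooth with bounded derivatives, and dyadic dilations \<open>t \<mapsto> 2\<^sup>-\<^sup>n t\<close> become translations
  \<open>s \<mapsto> s - n ln 2\<close>, so that all multiplier estimates reduce to one remark: a signed sum of translates of
  a single compactly supported smooth function has bounded overlap, hence its derivatives are bounded
  uniformly in the signs (\<open>Cb_sum_shifts\<close>).

  Upper estimate. With \<open>y = A\<^sup>\<theta> x\<close> one has \<open>2\<^sup>n\<^sup>\<theta> \<phi>\<^sub>n(A) x = v\<^sub>n(log A) y\<close>, where \<open>v\<^sub>n\<close> is the translate by
  \<open>n ln 2\<close> of \<open>v(s) = exp(-\<theta> s) \<phi>(exp s)\<close>. All signed sums of the \<open>v\<^sub>n\<close> are bounded multipliers, so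
  \<open>\<parallel>\<Sum> \<epsilon>\<^sub>n v\<^sub>n(log A) y\<parallel> \<le> C \<parallel>y\<parallel>\<close> for every choice of signs, and in particular on average.

  Lower estimate. Let \<open>w\<^sub>n\<close> be translates of a compactly supported \<open>w\<close> with \<open>w\<^sub>n v\<^sub>n = \<phi>\<^sub>n \<circ> exp\<close>. Since
  \<open>E \<epsilon>\<^sub>n \<epsilon>\<^sub>k = 0\<close> for \<open>n \<noteq> k\<close>, linear operators \<open>T\<^sub>n\<close> satisfy
  \<open>\<Sum> T\<^sub>n a\<^sub>n = E (\<Sum>\<^sub>n \<epsilon>\<^sub>n T\<^sub>n) (\<Sum>\<^sub>k \<epsilon>\<^sub>k a\<^sub>k)\<close>, and therefore \<open>\<parallel>\<Sum> T\<^sub>n a\<^sub>n\<parallel> \<le> K E \<parallel>\<Sum> \<epsilon>\<^sub>n a\<^sub>n\<parallel>\<close> as soon as the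
  signed sums of the \<open>T\<^sub>n\<close> are bounded by \<open>K\<close> (\<open>rademacher_decoupling\<close>). For \<open>T\<^sub>n = w\<^sub>n(log A)\<close> and
  \<open>a\<^sub>n = v\<^sub>n(log A) y\<close> the left side is \<open>\<Sum>\<^bsub>|n|\<le>N\<^esub> \<phi>\<^sub>n(A) y\<close>, which converges to \<open>y\<close>: the partial sums of
  the partition are multipliers with uniformly bounded derivatives that equal one on growing
  intervals, and such multipliers converge strongly to the identity (\<open>Phi_cutoff\<close>).

  The inhomogeneous case is the same argument with the low frequency function \<open>\<phi>\<^sub>0\<close> in place of the
  pieces of negative index. It is applied twice, with multipliers that reconstruct \<open>x\<close> and with
  multipliers that reconstruct \<open>A\<^sup>\<theta> x\<close>; the condition \<open>\<theta> > 0\<close> keeps the weights \<open>2\<^sup>-\<^sup>n\<^sup>\<theta>\<close> and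
  \<open>exp(\<theta> s)\<close> on the low frequencies bounded.

  The remaining work makes the calculus available. In the variable \<open>w = log \<lambda>\<close> the contour integral
  runs over two horizontal lines; the resolvent identity, Fubini and Cauchy's formula for the kernel
  \<open>exp w / (exp w - exp w\<^sub>0)\<close> make it multiplicative (\<open>log_calc_mult\<close>). Littlewood-Paley pieces of a
  function with \<open>m\<close> bounded derivatives decay like \<open>2\<^sup>-\<^sup>m\<^sup>|\<^sup>n\<^sup>|\<close>, so such functions lie in the Besov space
  for \<open>m > \<alpha>\<close> (\<open>besov_norm_bound\<close>). Convolution with narrow Gaussians approximates them in the Besov
  norm by restrictions of entire functions that are bounded on strips (\<open>gauss_approx_exists\<close>), and so
  the calculus of smooth functions inherits linearity, multiplicativity and the norm bound from
  bounded holomorphic functions. Fractional powers are tied to it by \<open>frac_Phi\<close>. Finally, an element of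
  an abstract completion is represented by the limit of \<open>A\<^sup>\<theta> x\<^sub>k\<close>, respectively by the limits of \<open>x\<^sub>k\<close> and
  \<open>A\<^sup>\<theta> x\<^sub>k\<close>, along any of its Cauchy sequences.
\<close>

section \<open>Rademacher sums\<close>

lemma rademacher_subfamily:
  fixes f :: "'j \<Rightarrow> 'i"
  assumes "rademacher M \<epsilon>" "inj f"
  shows "rademacher M (\<lambda>i. \<epsilon> (f i))"
proof -
  interpret prob_space M using assms(1) by (simp add: rademacher_def)
  have iv: "indep_vars (\<lambda>_. borel) \<epsilon> UNIV"
    using assms(1) by (simp add: rademacher_def)
  have "indep_vars (\<lambda>_. borel) (\<lambda>i. \<epsilon> (f i)) UNIV"
    unfolding indep_vars_def2
  proof (intro conjI ballI)
    fix i :: 'j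
    show "random_variable borel (\<epsilon> (f i))"
      using iv unfolding indep_vars_def2 by auto
  next
    have "indep_sets (\<lambda>i. {\<epsilon> i -` A \<inter> space M |A. A \<in> sets borel}) UNIV"
      using iv unfolding indep_vars_def2 by auto
    show "indep_sets (\<lambda>i. {\<epsilon> (f i) -` A \<inter> space M |A. A \<in> sets borel}) UNIV"
      unfolding indep_sets_def
    proof (intro conjI ballI allI impI)
      fix i
      show "{\<epsilon> (f i) -` A \<inter> space M |A. A \<in> sets borel} \<subseteq> events"
        using iv unfolding indep_vars_def2 by (auto intro: measurable_sets)
    next
      fix J :: "'j set" and A
      assume J: "J \<subseteq> UNIV" "J \<noteq> {}" "finite J"
        and A: "A \<in> Pi J (\<lambda>i. {\<epsilon> (f i) -` A \<inter> space M |A. A \<in> sets borel})"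
      then have "\<forall>j\<in>J. \<exists>B. B \<in> sets borel \<and> A j = \<epsilon> (f j) -` B \<inter> space M" by blast
      then obtain B where B: "\<And>j. j \<in> J \<Longrightarrow> B j \<in> sets borel \<and> A j = \<epsilon> (f j) -` B j \<inter> space M"
        by metis
      define g where "g = inv f"
      have g: "g (f j) = j" for j using assms(2) by (simp add: g_def)
      have "prob (\<Inter>i\<in>f ` J. \<epsilon> i -` B (g i) \<inter> space M) = (\<Prod>i\<in>f ` J. prob (\<epsilon> i -` B (g i) \<inter> space M))"
        using J B g by (intro indep_varsD[OF iv]) auto
      moreover have "inj_on f J" using assms(2) by (auto simp: inj_def inj_on_def)
      ultimately show "prob (\<Inter>j\<in>J. A j) = (\<Prod>j\<in>J. prob (A j))"
        using B J(2) by (simp add: prod.reindex g)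
    qed
  qed
  then show ?thesis using assms(1) by (simp add: rademacher_def)
qed

text \<open>Patterns are extensional functions on \<open>F\<close>, so that there are exactly \<open>2 ^ card F\<close> of them and expectations become finite averages.\<close>

definition signs :: "'i set \<Rightarrow> ('i \<Rightarrow> real) set" where
  "signs F = PiE F (\<lambda>_. {-1, 1})"

lemma finite_signs [simp]: "finite F \<Longrightarrow> finite (signs F)"
  by (auto simp: signs_def intro!: finite_PiE)

lemma card_signs: "finite F \<Longrightarrow> card (signs F) = 2 ^ card F"
  by (simp add: signs_def card_PiE numeral_2_eq_2)

lemma signs_abs: "s \<in> signs F \<Longrightarrow> n \<in> F \<Longrightarrow> \<bar>s n\<bar> = 1"
  by (force simp: signs_def PiE_iff)

lemma rademacher_pattern:
  assumes "rademacher M \<epsilon>" "finite F" "s \<in> signs F"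
  shows "measure M {w \<in> space M. \<forall>n\<in>F. \<epsilon> n w = s n} = 1 / 2 ^ card F"
proof (cases "F = {}")
  case True
  interpret prob_space M using assms(1) by (simp add: rademacher_def)
  show ?thesis using True by (simp add: prob_space)
next
  case False
  interpret prob_space M using assms(1) by (simp add: rademacher_def)
  have iv: "indep_vars (\<lambda>_. borel) \<epsilon> UNIV"
    using assms(1) by (simp add: rademacher_def)
  have "{w \<in> space M. \<forall>n\<in>F. \<epsilon> n w = s n} = (\<Inter>n\<in>F. \<epsilon> n -` {s n} \<inter> space M)"
    using False by auto
  moreover have "prob (\<Inter>n\<in>F. \<epsilon> n -` {s n} \<inter> space M) = (\<Prod>n\<in>F. prob (\<epsilon> n -` {s n} \<inter> space M))"
    by (intro indep_varsD[OF iv]) (use assms False in auto)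
  moreover have "prob (\<epsilon> n -` {s n} \<inter> space M) = 1/2" if "n \<in> F" for n
  proof -
    have "s n = 1 \<or> s n = -1" using assms(3) that by (auto simp: signs_def)
    moreover have "\<epsilon> n -` {c} \<inter> space M = {w \<in> space M. \<epsilon> n w = c}" for c by auto
    ultimately show ?thesis using assms(1) by (auto simp: rademacher_def)
  qed
  ultimately show ?thesis by (simp add: power_one_over)
qed

text \<open>Only the finitely many variables indexed by \<open>F\<close> matter, and independence makes all their sign patterns
  equally likely. This turns the Bochner integral into a finite average, which is all that is used of
  the probability space from here on.\<close>

lemma rademacher_norm_expectation:
  fixes v :: "'i::countable \<Rightarrow> 'a::real_normed_vector"
  assumes "rademacher M \<epsilon>" "finite F"
  shows "(\<integral>w. norm (\<Sum>n\<in>F. \<epsilon> n w *\<^sub>R v n) \<partial>M) =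
         (\<Sum>s\<in>signs F. norm (\<Sum>n\<in>F. s n *\<^sub>R v n)) / 2 ^ card F"
proof -
  interpret prob_space M using assms(1) by (simp add: rademacher_def)
  have iv: "indep_vars (\<lambda>_. borel) \<epsilon> UNIV"
    using assms(1) by (simp add: rademacher_def)
  have rv[measurable]: "\<epsilon> n \<in> borel_measurable M" for n
    using iv unfolding indep_vars_def2 by auto
  define E where "E s = {w \<in> space M. \<forall>n\<in>F. \<epsilon> n w = s n}" for s
  define h where "h = (\<lambda>c::'i\<Rightarrow>real. norm (\<Sum>n\<in>F. c n *\<^sub>R v n))"
  have Em[measurable]: "E s \<in> sets M" for s
    unfolding E_def using assms(2) by measurable
  have half: "prob {w \<in> space M. \<epsilon> n w = 1} = 1/2" "prob {w \<in> space M. \<epsilon> n w = -1} = 1/2" for n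
    using assms(1) by (simp_all add: rademacher_def)
  have one: "AE w in M. \<epsilon> n w \<in> {-1, 1}" for n
  proof -
    have "prob ({w \<in> space M. \<epsilon> n w = 1} \<union> {w \<in> space M. \<epsilon> n w = -1}) = 1/2 + 1/2"
      using half[of n] by (subst finite_measure_Union) auto
    then have "AE w in M. w \<in> {w \<in> space M. \<epsilon> n w = 1} \<union> {w \<in> space M. \<epsilon> n w = -1}"
      by (intro AE_prob_1) simp
    then show ?thesis by eventually_elim auto
  qed
  have all: "AE w in M. \<forall>n\<in>F. \<epsilon> n w \<in> {-1, 1}"
    using assms(2) one by (simp add: AE_finite_all)
  have "continuous_on UNIV h"
    unfolding h_def by (intro continuous_intros continuous_on_product_coordinates)
  then have "h \<in> borel_measurable borel" by (rule borel_measurable_continuous_onI)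
  moreover have "(\<lambda>w n. \<epsilon> n w) \<in> borel_measurable M"
    by (rule measurable_coordinatewise_then_product) simp
  ultimately have hm[measurable]: "(\<lambda>w. h (\<lambda>n. \<epsilon> n w)) \<in> borel_measurable M"
    by (rule measurable_compose[rotated])
  have "(\<integral>w. h (\<lambda>n. \<epsilon> n w) \<partial>M) = (\<integral>w. (\<Sum>s\<in>signs F. indicator (E s) w * h s) \<partial>M)"
  proof (rule integral_cong_AE)
    show "AE w in M. h (\<lambda>n. \<epsilon> n w) = (\<Sum>s\<in>signs F. indicator (E s) w * h s)"
      using all AE_space
    proof eventually_elim
      case (elim w)
      define s0 where "s0 = restrict (\<lambda>n. \<epsilon> n w) F"
      have s0: "s0 \<in> signs F" using elim by (auto simp: signs_def s0_def)
      have "indicator (E s) w * h s = (if s = s0 then h s0 else 0)" if "s \<in> signs F" for s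
      proof (cases "s = s0")
        case True
        then show ?thesis using elim by (auto simp: E_def s0_def)
      next
        case False
        then obtain x where "s x \<noteq> s0 x" by (auto simp: fun_eq_iff)
        moreover from this have "x \<in> F"
          using that unfolding s0_def signs_def PiE_iff extensional_def by (metis (mono_tags, lifting) mem_Collect_eq restrict_apply)
        ultimately have "w \<notin> E s"
          by (force simp: E_def s0_def)
        then show ?thesis using False by simp
      qed
      then have "(\<Sum>s\<in>signs F. indicator (E s) w * h s) = (\<Sum>s\<in>signs F. if s = s0 then h s0 else 0)"
        by (intro sum.cong) auto
      also have "\<dots> = h s0" using s0 assms(2) by simp
      also have "h s0 = h (\<lambda>n. \<epsilon> n w)" unfolding h_def s0_def by (auto intro!: arg_cong[where f=norm] sum.cong)
      finally show ?case by simp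
    qed
  qed measurable
  also have "\<dots> = (\<Sum>s\<in>signs F. h s * prob (E s))"
    by (subst Bochner_Integration.integral_sum) (auto simp: mult.commute emeasure_eq_measure)
  also have "\<dots> = (\<Sum>s\<in>signs F. h s * (1 / 2 ^ card F))"
    using rademacher_pattern[OF assms] by (intro sum.cong) (auto simp: E_def)
  finally show ?thesis by (simp add: h_def sum_divide_distrib)
qed

text \<open>Orthogonality of the signs: for \<open>n \<noteq> k\<close>, flipping the sign at \<open>n\<close> cancels the sum in pairs.\<close>

lemma sum_signs_product:
  assumes F: "finite F" and "n \<in> F" "k \<in> F"
  shows "(\<Sum>s\<in>signs F. s n * s k) = (if n = k then 2 ^ card F else 0)"
proof (cases "n = k")
  case True
  have "s n * s n = 1" if "s \<in> signs F" for s
    using that assms by (force simp: signs_def PiE_iff)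
  then show ?thesis using True F by (simp add: card_signs)
next
  case False
  define flip where "flip = (\<lambda>s::'a\<Rightarrow>real. s(n := - s n))"
  have fl: "flip s \<in> signs F" if "s \<in> signs F" for s
    using that assms by (force simp: signs_def flip_def PiE_iff extensional_def)
  have "(\<Sum>s\<in>signs F. s n * s k) = (\<Sum>s\<in>signs F. flip s n * flip s k)"
    by (rule sum.reindex_bij_witness[of _ flip flip]) (use fl in \<open>auto simp: flip_def\<close>)
  also have "\<dots> = - (\<Sum>s\<in>signs F. s n * s k)"
    using False by (simp add: flip_def sum_negf)
  finally show ?thesis using False by simp
qed

text \<open>By orthogonality of the signs the diagonal sum is the average of \<open>(\<Sum>n. s n T n) (\<Sum>k. s k a k)\<close> over all
  sign patterns \<open>s\<close>; each term is estimated by the hypothesis on signed sums of operators. This is the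
  source of all lower estimates.\<close>

lemma rademacher_decoupling:
  fixes a :: "'i::countable \<Rightarrow> 'a::real_normed_vector" and T :: "'i \<Rightarrow> 'a \<Rightarrow> 'b::real_normed_vector"
  assumes rad: "rademacher M \<epsilon>" and F: "finite F"
    and lin: "\<And>n. n \<in> F \<Longrightarrow> linear (T n)"
    and bd: "\<And>s z. s \<in> signs F \<Longrightarrow> norm (\<Sum>n\<in>F. s n *\<^sub>R T n z) \<le> K * norm z"
  shows "norm (\<Sum>n\<in>F. T n (a n)) \<le> K * (\<integral>w. norm (\<Sum>n\<in>F. \<epsilon> n w *\<^sub>R a n) \<partial>M)"
proof -
  have "(\<Sum>s\<in>signs F. \<Sum>n\<in>F. s n *\<^sub>R T n (\<Sum>k\<in>F. s k *\<^sub>R a k))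
      = (\<Sum>s\<in>signs F. \<Sum>n\<in>F. \<Sum>k\<in>F. (s n * s k) *\<^sub>R T n (a k))"
    using lin by (intro sum.cong refl)
      (simp add: linear_sum linear_cmul scaleR_sum_right)
  also have "\<dots> = (\<Sum>n\<in>F. \<Sum>k\<in>F. \<Sum>s\<in>signs F. (s n * s k) *\<^sub>R T n (a k))"
    by (subst sum.swap, intro sum.cong refl, subst sum.swap) simp
  also have "\<dots> = (\<Sum>n\<in>F. \<Sum>k\<in>F. if k = n then 2 ^ card F *\<^sub>R T n (a n) else 0)"
    using F by (intro sum.cong refl) (auto simp: scaleR_sum_left[symmetric] sum_signs_product)
  also have "\<dots> = (\<Sum>n\<in>F. 2 ^ card F *\<^sub>R T n (a n))"
    using F by simp
  finally have eq: "2 ^ card F *\<^sub>R (\<Sum>n\<in>F. T n (a n))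
      = (\<Sum>s\<in>signs F. \<Sum>n\<in>F. s n *\<^sub>R T n (\<Sum>k\<in>F. s k *\<^sub>R a k))"
    by (simp add: scaleR_sum_right)
  have "2 ^ card F * norm (\<Sum>n\<in>F. T n (a n)) = norm (2 ^ card F *\<^sub>R (\<Sum>n\<in>F. T n (a n)))"
    by simp
  also have "\<dots> \<le> (\<Sum>s\<in>signs F. K * norm (\<Sum>k\<in>F. s k *\<^sub>R a k))"
    unfolding eq by (rule sum_norm_le) (rule bd)
  finally show ?thesis
    unfolding rademacher_norm_expectation[OF rad F]
    by (simp add: sum_distrib_left[symmetric] field_simps)
qed

lemma rademacher_norm_le:
  fixes v :: "'i::countable \<Rightarrow> 'a::real_normed_vector"
  assumes rad: "rademacher M \<epsilon>" and F: "finite F"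
    and bd: "\<And>s. s \<in> signs F \<Longrightarrow> norm (\<Sum>n\<in>F. s n *\<^sub>R v n) \<le> K"
  shows "(\<integral>w. norm (\<Sum>n\<in>F. \<epsilon> n w *\<^sub>R v n) \<partial>M) \<le> K"
proof -
  have "(\<Sum>s\<in>signs F. norm (\<Sum>n\<in>F. s n *\<^sub>R v n)) \<le> (\<Sum>s\<in>signs F. K)"
    by (intro sum_mono bd)
  then show ?thesis
    unfolding rademacher_norm_expectation[OF rad F] using F by (simp add: card_signs field_simps)
qed

section \<open>Vector-valued integrals over the line and over strips\<close>

interpretation scaleC: bounded_bilinear "scaleC :: complex \<Rightarrow> 'a::complex_banach \<Rightarrow> 'a"
proof
  fix a b :: complex and x y :: 'a and r :: real
  show "(a + b) *\<^sub>C x = a *\<^sub>C x + b *\<^sub>C x" by (rule scaleC_add_left)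
  show "a *\<^sub>C (x + y) = a *\<^sub>C x + a *\<^sub>C y" by (rule scaleC_add_right)
  show "(r *\<^sub>R a) *\<^sub>C x = r *\<^sub>R (a *\<^sub>C x)"
    by (simp add: scaleR_scaleC[of r x] scaleR_scaleC[of r "a *\<^sub>C x"] scaleC_scaleC scaleR_conv_of_real)
  show "a *\<^sub>C (r *\<^sub>R x) = r *\<^sub>R (a *\<^sub>C x)"
    by (simp add: scaleR_scaleC[of r x] scaleR_scaleC[of r "a *\<^sub>C x"] scaleC_scaleC mult.commute)
  show "\<exists>K. \<forall>(a::complex) (x::'a). norm (a *\<^sub>C x) \<le> norm a * norm x * K"
    by (rule exI[of _ 1]) (simp add: norm_scaleC)
qed

lemma scaleC_one [simp]: "1 *\<^sub>C (x::'a::complex_banach) = x"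
  using scaleR_scaleC[of 1 x] by simp

lemma integral_growing_intervals_tendsto:
  fixes f :: "real \<Rightarrow> 'a::banach"
  assumes "f integrable_on UNIV"
  shows "((\<lambda>T. integral {-T..T} f) \<longlongrightarrow> integral UNIV f) at_top"
proof (rule tendstoI)
  fix e :: real assume "e > 0"
  moreover have "(f has_integral integral UNIV f) UNIV" using assms by blast
  ultimately obtain B where B: "B > 0" "\<And>a b. ball 0 B \<subseteq> cbox a b \<Longrightarrow>
      norm (integral (cbox a b) (\<lambda>x. if x \<in> UNIV then f x else 0) - integral UNIV f) < e"
    unfolding has_integral_alt'[of f] by blast
  have "dist (integral {-T..T} f) (integral UNIV f) < e" if "T \<ge> B" for T
    using B(2)[of "-T" T] that by (force simp: dist_norm ball_def dist_real_def)
  then show "\<forall>\<^sub>F T in at_top. dist (integral {-T..T} f) (integral UNIV f) < e"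
    unfolding eventually_at_top_linorder by blast
qed

text \<open>The part of the integral outside \<open>{u..v}\<close> is dominated by the part of the majorant there. With a
  majorant integrable on the line this makes truncated integrals a Cauchy family.\<close>

lemma integral_annulus_bound:
  fixes f :: "real \<Rightarrow> 'a::banach"
  assumes f: "\<And>a b. f integrable_on {a..b}" and b: "b integrable_on UNIV"
    and bd: "\<And>t. norm (f t) \<le> b t" and le: "c \<le> u" "u \<le> v" "v \<le> d"
  shows "norm (integral {c..d} f - integral {u..v} f) \<le> integral {c..d} b - integral {u..v} b"
proof -
  have bi: "b integrable_on {p..q}" for p q
    using b by (rule integrable_on_subinterval) auto
  have split: "integral {c..d} g = integral {c..u} g + integral {u..v} g + integral {v..d} g"
    if "\<And>a b. g integrable_on {a..b}" for g :: "real \<Rightarrow> 'x::banach"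
    using Henstock_Kurzweil_Integration.integral_combine[OF le(1) _ that, of d]
      Henstock_Kurzweil_Integration.integral_combine[OF le(2,3) that] le
    by (metis (no_types, opaque_lifting) add.assoc order_trans)
  have "norm (integral {c..d} f - integral {u..v} f) = norm (integral {c..u} f + integral {v..d} f)"
    using split[OF f] by simp
  also have "\<dots> \<le> norm (integral {c..u} f) + norm (integral {v..d} f)" by (rule norm_triangle_ineq)
  also have "\<dots> \<le> integral {c..u} b + integral {v..d} b"
    by (intro add_mono integral_norm_bound_integral f bi bd)
  also have "\<dots> = integral {c..d} b - integral {u..v} b" using split[OF bi] by simp
  finally show ?thesis .
qed

lemma integrable_on_UNIV_dominated:
  fixes f :: "real \<Rightarrow> 'a::banach"
  assumes f: "\<And>a b. f integrable_on {a..b}" and b: "b integrable_on UNIV"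
    and bd: "\<And>t. norm (f t) \<le> b t"
  shows "f integrable_on UNIV"
proof (rule iffD2[OF integrable_alt_subset], intro conjI allI impI)
  show "(\<lambda>x. if x \<in> UNIV then f x else 0) integrable_on cbox p q" for p q :: real
    using f[of p q] by simp
next
  fix e :: real assume "e > 0"
  have "\<exists>B>0. \<forall>p q c d. ball 0 B \<subseteq> cbox p q \<and> cbox p q \<subseteq> cbox c d \<longrightarrow>
      norm (integral (cbox p q) b - integral (cbox c d) b) < e"
    using iffD1[OF integrable_alt_subset b, THEN conjunct2, rule_format, OF \<open>e > 0\<close>] by simp
  then obtain B where B: "B > 0" "\<And>p q c d. ball 0 B \<subseteq> cbox p q \<Longrightarrow> cbox p q \<subseteq> cbox c d \<Longrightarrow>
      norm (integral (cbox p q) b - integral (cbox c d) b) < e"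
    by (elim exE conjE) simp
  show "\<exists>B>0. \<forall>p q c d. ball 0 B \<subseteq> cbox p q \<and> cbox p q \<subseteq> cbox c d \<longrightarrow>
     norm (integral (cbox p q) (\<lambda>x. if x \<in> UNIV then f x else 0) -
           integral (cbox c d) (\<lambda>x. if x \<in> UNIV then f x else 0)) < e"
  proof (intro exI[of _ B] conjI allI impI B(1); elim conjE)
    fix p q c d :: real assume s: "ball 0 B \<subseteq> cbox p q" "cbox p q \<subseteq> cbox c d"
    then have pq: "p \<le> q" using B(1)
      by (metis atLeastatMost_empty_iff2 box_real(2) centre_in_ball empty_iff subsetD linear)
    then have "c \<le> p" "q \<le> d" using s(2) by auto
    then have "norm (integral {c..d} f - integral {p..q} f) \<le> integral {c..d} b - integral {p..q} b"
      using pq by (intro integral_annulus_bound f b bd)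
    then show "norm (integral (cbox p q) (\<lambda>x. if x \<in> UNIV then f x else 0) -
           integral (cbox c d) (\<lambda>x. if x \<in> UNIV then f x else 0)) < e"
      using B(2)[OF s] by (simp add: norm_minus_commute)
  qed
qed

lemma integral_tail_bound:
  fixes f :: "real \<Rightarrow> 'a::banach"
  assumes f: "\<And>a b. f integrable_on {a..b}" and b: "b integrable_on UNIV"
    and bd: "\<And>t. norm (f t) \<le> b t" and T: "0 \<le> T"
  shows "norm (integral UNIV f - integral {-T..T} f) \<le> integral UNIV b - integral {-T..T} b"
proof (rule tendsto_le[OF trivial_limit_at_top_linorder])
  show "((\<lambda>S. integral {-S..S} b - integral {-T..T} b) \<longlongrightarrow> integral UNIV b - integral {-T..T} b) at_top"
    by (intro tendsto_intros integral_growing_intervals_tendsto b)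
  show "((\<lambda>S. norm (integral {-S..S} f - integral {-T..T} f)) \<longlongrightarrow>
      norm (integral UNIV f - integral {-T..T} f)) at_top"
    by (intro tendsto_intros integral_growing_intervals_tendsto integrable_on_UNIV_dominated[OF f b bd])
  show "\<forall>\<^sub>F S in at_top. norm (integral {-S..S} f - integral {-T..T} f) \<le> integral {-S..S} b - integral {-T..T} b"
    using eventually_ge_at_top[of T]
    by eventually_elim (use T in \<open>intro integral_annulus_bound f b bd; simp\<close>)
qed

lemma integrable_lborel_log_weight:
  assumes "\<epsilon> > 0"
  shows "integrable lborel (\<lambda>t::real. (1 + \<bar>t\<bar>) powr (-1 - \<epsilon>))"
proof -
  define f where "f x = indicator {1..} x * x powr (-1 - \<epsilon>)" for x :: real
  have "((\<lambda>x. x powr (-1 - \<epsilon>)) has_integral - (1 powr ((-1 - \<epsilon>) + 1)) / ((-1 - \<epsilon>) + 1)) {1..}"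
    using assms by (intro has_integral_powr_to_inf) auto
  then have "(\<lambda>x. x powr (-1 - \<epsilon>)) absolutely_integrable_on {1..}"
    by (intro nonnegative_absolutely_integrable_1) auto
  then have "integrable lebesgue f"
    by (simp add: set_integrable_def f_def[abs_def])
  moreover have [measurable]: "f \<in> borel_measurable borel" unfolding f_def by measurable
  ultimately have f: "integrable lborel f"
    using integrable_completion[of f lborel] by simp
  have "integrable lborel (\<lambda>t. f (1 + 1 * t) + f (1 + (-1) * t))"
    by (intro Bochner_Integration.integrable_add lborel_integrable_real_affine f) auto
  then show ?thesis
    by (rule Bochner_Integration.integrable_bound) (auto simp: f_def indicator_def)
qed

lemma integrable_on_UNIV_log_weight:
  "\<epsilon> > 0 \<Longrightarrow> (\<lambda>t::real. (1 + \<bar>t\<bar>) powr (-1 - \<epsilon>)) integrable_on UNIV"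
  by (intro integrable_on_lborel integrable_lborel_log_weight)

text \<open>The inner integrals over the line are uniform limits of truncated ones, because the error is at most
  \<open>a t\<close> times a tail of \<open>b\<close>; so continuity and the limit of truncated double integrals pass through.\<close>

lemma dominated_product_iterated_integral:
  fixes K :: "real \<Rightarrow> real \<Rightarrow> 'a::banach"
  assumes K: "continuous_on UNIV (\<lambda>(t, s). K t s)"
    and a: "continuous_on UNIV a" "a integrable_on UNIV"
    and b: "b integrable_on UNIV"
    and bd: "\<And>t s. norm (K t s) \<le> a t * b s" and nn: "\<And>t. 0 \<le> a t" "\<And>s. 0 \<le> b s"
  shows "(\<lambda>t. integral UNIV (K t)) integrable_on UNIV"
    and "((\<lambda>T. integral {-T..T} (\<lambda>t. integral {-T..T} (K t))) \<longlongrightarrow>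
      integral UNIV (\<lambda>t. integral UNIV (K t))) at_top"
proof -
  define I where "I t = integral UNIV (K t)" for t
  define J where "J T t = integral {-T..T} (K t)" for T t
  define tl where "tl T = integral UNIV b - integral {-T..T} b" for T
  have Kt: "K t integrable_on {p..q}" for t p q
  proof (rule integrable_continuous_real)
    have "continuous_on {p..q} ((\<lambda>(t, s). K t s) \<circ> (\<lambda>s. (t, s)))"
      by (intro continuous_on_compose continuous_intros continuous_on_subset[OF K]) auto
    then show "continuous_on {p..q} (K t)" by (simp add: o_def)
  qed
  have ab: "(\<lambda>s. a t * b s) integrable_on UNIV" for t using b by (rule integrable_on_mult_right)
  have IJ: "norm (I t - J T t) \<le> a t * tl T" if "T \<ge> 0" for t T
    using integral_tail_bound[OF Kt ab bd that, of t] by (simp add: I_def J_def tl_def algebra_simps)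
  have tl0: "(tl \<longlongrightarrow> 0) at_top"
    unfolding tl_def using tendsto_diff[OF tendsto_const integral_growing_intervals_tendsto[OF b], of "integral UNIV b"] by simp
  have Jc: "continuous_on UNIV (J T)" for T
    unfolding J_def box_real(2)[symmetric] using K
    by (intro integral_continuous_on_param) (auto intro: continuous_on_subset)
  have Ic: "continuous_on {p..q} I" for p q
  proof (rule uniform_limit_theorem[of _ J at_top])
    show "\<forall>\<^sub>F T in at_top. continuous_on {p..q} (J T)"
      using Jc continuous_on_subset by (intro always_eventually) blast
    have "compact (a ` {p..q})"
      using a(1) by (intro compact_continuous_image) (auto intro: continuous_on_subset)
    then obtain A where A: "\<And>t. t \<in> {p..q} \<Longrightarrow> a t \<le> A" "A > 0"
      by (metis (no_types) bounded_pos compact_imp_bounded imageI real_norm_def abs_le_D1)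
    show "uniform_limit {p..q} J I at_top"
    proof (rule uniform_limitI)
      fix e :: real assume e: "e > 0"
      then have "\<forall>\<^sub>F T in at_top. tl T < e / A"
        using order_tendstoD(2)[OF tl0, of "e / A"] A(2) by simp
      then show "\<forall>\<^sub>F T in at_top. \<forall>t\<in>{p..q}. dist (J T t) (I t) < e"
        using eventually_ge_at_top[of 0]
      proof eventually_elim
        case (elim T)
        have tl: "tl T \<ge> 0" using order_trans[OF norm_ge_zero IJ[of T]] elim nn(1)
          integral_tail_bound[of b b T] b nn(2) integrable_on_subinterval[OF b]
          by (smt (verit) norm_ge_zero real_norm_def subset_UNIV tl_def)
        show ?case
        proof
          fix t assume t: "t \<in> {p..q}"
          have "dist (J T t) (I t) \<le> a t * tl T"
            using IJ[of T t] elim by (simp add: dist_norm norm_minus_commute)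
          also have "\<dots> \<le> A * tl T" using A(1)[OF t] tl by (rule mult_right_mono)
          also have "\<dots> < e" using elim A(2) by (simp add: field_simps)
          finally show "dist (J T t) (I t) < e" .
        qed
      qed
    qed
  qed (rule trivial_limit_at_top_linorder)
  have Ii: "I integrable_on {p..q}" for p q by (intro integrable_continuous_real Ic)
  have Ib: "norm (I t) \<le> a t * integral UNIV b" for t
    using integral_norm_bound_integral[OF integrable_on_UNIV_dominated[OF Kt ab bd] ab bd, of t]
    by (simp add: I_def)
  have aB: "(\<lambda>t. a t * integral UNIV b) integrable_on UNIV" using a(2) by (rule integrable_on_mult_left)
  have IU: "I integrable_on UNIV" by (rule integrable_on_UNIV_dominated[OF Ii aB Ib])
  then show "(\<lambda>t. integral UNIV (K t)) integrable_on UNIV" by (simp add: I_def[abs_def])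
  have "((\<lambda>T. integral {-T..T} I - integral {-T..T} (J T)) \<longlongrightarrow> 0) at_top"
  proof (rule Lim_null_comparison)
    show "\<forall>\<^sub>F T in at_top. norm (integral {-T..T} I - integral {-T..T} (J T)) \<le> integral {-T..T} a * tl T"
      using eventually_ge_at_top[of 0]
    proof eventually_elim
      case (elim T)
      have Ji: "J T integrable_on {-T..T}"
        using Jc by (intro integrable_continuous_real) (auto intro: continuous_on_subset)
      have ai: "(\<lambda>t. a t * tl T) integrable_on {-T..T}"
        using a(1) by (intro integrable_continuous_real continuous_intros) (auto intro: continuous_on_subset)
      have "norm (integral {-T..T} (\<lambda>t. I t - J T t)) \<le> integral {-T..T} (\<lambda>t. a t * tl T)"
        using elim by (intro integral_norm_bound_integral integrable_diff Ii Ji ai IJ)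
      then show ?case using Ii Ji by (simp add: integral_diff)
    qed
    show "((\<lambda>T. integral {-T..T} a * tl T) \<longlongrightarrow> 0) at_top"
      using tendsto_mult[OF integral_growing_intervals_tendsto[OF a(2)] tl0] by simp
  qed
  from tendsto_diff[OF integral_growing_intervals_tendsto[OF IU] this]
  show "((\<lambda>T. integral {-T..T} (\<lambda>t. integral {-T..T} (K t))) \<longlongrightarrow>
      integral UNIV (\<lambda>t. integral UNIV (K t))) at_top" by (simp add: I_def[abs_def] J_def[abs_def])
qed

text \<open>Fubini for the gauge integral of a continuous kernel dominated by a product. Truncation to squares
  reduces it to compact intervals. The gauge integral is used because values lie in a general Banach
  space, which may be non-separable.\<close>

lemma integral_swap_UNIV_dominated:
  fixes K :: "real \<Rightarrow> real \<Rightarrow> 'a::banach"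
  assumes K: "continuous_on UNIV (\<lambda>(t, s). K t s)"
    and a: "continuous_on UNIV a" "a integrable_on UNIV"
    and b: "continuous_on UNIV b" "b integrable_on UNIV"
    and bd: "\<And>t s. norm (K t s) \<le> a t * b s" and nn: "\<And>t. 0 \<le> a t" "\<And>s. 0 \<le> b s"
  shows "(\<lambda>t. integral UNIV (\<lambda>s. K t s)) integrable_on UNIV"
    and "(\<lambda>s. integral UNIV (\<lambda>t. K t s)) integrable_on UNIV"
    and "integral UNIV (\<lambda>t. integral UNIV (\<lambda>s. K t s)) = integral UNIV (\<lambda>s. integral UNIV (\<lambda>t. K t s))"
proof -
  have K': "continuous_on UNIV (\<lambda>(s, t). K t s)"
  proof -
    have "continuous_on UNIV ((\<lambda>(t, s). K t s) \<circ> prod.swap)"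
      by (intro continuous_on_compose continuous_intros continuous_on_subset[OF K]) auto
    then show ?thesis by (simp add: o_def case_prod_unfold)
  qed
  show "(\<lambda>t. integral UNIV (\<lambda>s. K t s)) integrable_on UNIV"
    by (rule dominated_product_iterated_integral(1)[OF K a b(2) bd nn])
  show "(\<lambda>s. integral UNIV (\<lambda>t. K t s)) integrable_on UNIV"
    by (rule dominated_product_iterated_integral(1)[OF K' b a(2) _ nn(2,1)]) (use bd in \<open>simp add: mult.commute\<close>)
  have sw: "integral {-T..T} (\<lambda>t. integral {-T..T} (\<lambda>s. K t s)) = integral {-T..T} (\<lambda>s. integral {-T..T} (\<lambda>t. K t s))" for T
    using integral_swap_continuous[OF continuous_on_subset[OF K], of "-T" "-T" T T] by simp
  have "((\<lambda>T. integral {-T..T} (\<lambda>t. integral {-T..T} (K t))) \<longlongrightarrow>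
      integral UNIV (\<lambda>t. integral UNIV (K t))) at_top"
    by (rule dominated_product_iterated_integral(2)[OF K a b(2) bd nn])
  moreover have "((\<lambda>T. integral {-T..T} (\<lambda>s. integral {-T..T} (\<lambda>t. K t s))) \<longlongrightarrow>
      integral UNIV (\<lambda>s. integral UNIV (\<lambda>t. K t s))) at_top"
    by (rule dominated_product_iterated_integral(2)[OF K' b a(2) _ nn(2,1)]) (use bd in \<open>simp add: mult.commute\<close>)
  ultimately show "integral UNIV (\<lambda>t. integral UNIV (\<lambda>s. K t s)) = integral UNIV (\<lambda>s. integral UNIV (\<lambda>t. K t s))"
    using tendsto_unique[OF trivial_limit_at_top_linorder] by (simp add: sw)
qed

text \<open>Cauchy's theorem for horizontal lines. Instead of a contour, differentiate the truncated integral
  with respect to the height: the derivative is \<open>\<i>\<close> times the difference of the end point values, which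
  tends to zero as the truncation is removed.\<close>

lemma strip_integral_shift:
  fixes H :: "complex \<Rightarrow> 'a::complex_banach"
  assumes ab: "a \<le> b"
    and der: "\<And>w. a \<le> Im w \<Longrightarrow> Im w \<le> b \<Longrightarrow> (H has_derivative (\<lambda>d. d *\<^sub>C H' w)) (at w)"
    and cont: "continuous_on {w. a \<le> Im w \<and> Im w \<le> b} H'"
    and bd: "\<And>w. a \<le> Im w \<Longrightarrow> Im w \<le> b \<Longrightarrow> norm (H w) \<le> \<beta> (Re w)"
    and \<beta>: "\<beta> integrable_on UNIV" "(\<beta> \<longlongrightarrow> 0) at_top" "(\<beta> \<longlongrightarrow> 0) at_bot"
  shows "integral UNIV (\<lambda>t. H (of_real t + \<i> * of_real a)) = integral UNIV (\<lambda>t. H (of_real t + \<i> * of_real b))"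
proof -
  define P where "P s T = integral {-T..T} (\<lambda>t. H (of_real t + \<i> * of_real s))" for s T
  let ?w = "\<lambda>t s. complex_of_real t + \<i> * complex_of_real s"
  have Hc: "isCont H (?w t s)" if "a \<le> s" "s \<le> b" for t s
    using der[of "?w t s"] that has_derivative_continuous by auto
  have Hi: "(\<lambda>t. H (?w t s)) integrable_on {p..q}" if "a \<le> s" "s \<le> b" for s p q
    using Hc[OF that]
    by (intro integrable_continuous_real continuous_at_imp_continuous_on ballI isCont_o2[of _ "\<lambda>t. ?w t s" H])
      (auto intro!: continuous_intros)
  have HU: "(\<lambda>t. H (?w t s)) integrable_on UNIV" if "a \<le> s" "s \<le> b" for s
    using bd[of "?w _ s"] that by (intro integrable_on_UNIV_dominated[OF Hi \<beta>(1)]) auto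
  have dt: "((\<lambda>t. H (?w t s)) has_vector_derivative H' (?w t s)) (at t within S)" if "a \<le> s" "s \<le> b" for s t S
    unfolding has_vector_derivative_def
    by (rule has_derivative_eq_rhs, rule has_derivative_compose[where g = H and f = "\<lambda>t. ?w t s"])
      (use that der[of "?w t s"] in \<open>auto intro!: derivative_eq_intros simp: scaleR_scaleC\<close>)
  have ds: "((\<lambda>s. H (?w t s)) has_vector_derivative \<i> *\<^sub>C H' (?w t s)) (at s within S)" if "a \<le> s" "s \<le> b" for s t S
    unfolding has_vector_derivative_def
    by (rule has_derivative_eq_rhs, rule has_derivative_compose[where g = H and f = "\<lambda>s. ?w t s"])
      (use that der[of "?w t s"] in \<open>auto intro!: derivative_eq_intros simp: scaleR_scaleC scaleC_scaleC mult.commute\<close>)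
  have dP: "((\<lambda>s. P s T) has_vector_derivative
      \<i> *\<^sub>C (H (?w T s) - H (?w (-T) s))) (at s within {a..b})"
    if s: "s \<in> {a..b}" and T: "T \<ge> 0" for s T
  proof -
    have "((\<lambda>s. integral (cbox (-T) T) (\<lambda>t. H (?w t s))) has_vector_derivative
        integral (cbox (-T) T) (\<lambda>t. \<i> *\<^sub>C H' (?w t s))) (at s within {a..b})"
    proof (rule leibniz_rule_vector_derivative)
      show "((\<lambda>s. H (?w t s)) has_vector_derivative \<i> *\<^sub>C H' (?w t s)) (at s within {a..b})"
        if "s \<in> {a..b}" "t \<in> cbox (-T) T" for s t using ds that by auto
      show "(\<lambda>t. H (?w t s)) integrable_on cbox (-T) T" if "s \<in> {a..b}" for s
        using Hi that by auto
      have "continuous_on ({a..b} \<times> cbox (-T) T) (\<lambda>p. H' (?w (snd p) (fst p)))"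
        by (intro continuous_on_compose2[OF cont] continuous_intros) auto
      then show "continuous_on ({a..b} \<times> cbox (-T) T) (\<lambda>(s, t). \<i> *\<^sub>C H' (?w t s))"
        by (auto simp: case_prod_unfold intro!: scaleC.continuous_on continuous_intros)
    qed (use s in auto)
    moreover have "((\<lambda>t. \<i> *\<^sub>C H' (?w t s)) has_integral \<i> *\<^sub>C H (?w T s) - \<i> *\<^sub>C H (?w (-T) s)) {-T..T}"
      using T s dt
      by (intro fundamental_theorem_of_calculus bounded_linear.has_vector_derivative[OF scaleC.bounded_linear_right]) auto
    ultimately show ?thesis
      by (simp add: P_def integral_unique scaleC.diff_right)
  qed
  have est: "norm (P b T - P a T) \<le> (\<beta> T + \<beta> (-T)) * norm (b - a)" if T: "T \<ge> 0" for T
  proof (rule differentiable_bound[where f = "\<lambda>s. P s T" and S = "{a..b}"])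
    show "((\<lambda>s. P s T) has_derivative (\<lambda>h. h *\<^sub>R (\<i> *\<^sub>C (H (?w T s) - H (?w (-T) s))))) (at s within {a..b})"
      if "s \<in> {a..b}" for s using dP[OF that T] by (simp add: has_vector_derivative_def)
    show "onorm (\<lambda>h. h *\<^sub>R (\<i> *\<^sub>C (H (?w T s) - H (?w (-T) s)))) \<le> \<beta> T + \<beta> (-T)" if "s \<in> {a..b}" for s
    proof (rule onorm_le)
      fix h :: real
      have "norm (H (?w T s) - H (?w (-T) s)) \<le> \<beta> T + \<beta> (-T)"
        using bd[of "?w T s"] bd[of "?w (-T) s"] that norm_triangle_ineq4[of "H (?w T s)" "H (?w (-T) s)"] by simp
      then show "norm (h *\<^sub>R (\<i> *\<^sub>C (H (?w T s) - H (?w (-T) s)))) \<le> (\<beta> T + \<beta> (-T)) * norm h"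
        using mult_left_mono[of "norm (H (?w T s) - H (?w (-T) s))" "\<beta> T + \<beta> (-T)" "\<bar>h\<bar>"]
        by (simp add: norm_scaleC mult.commute)
    qed
  qed (use ab in auto)
  have "((\<lambda>T. P b T - P a T) \<longlongrightarrow> 0) at_top"
  proof (rule Lim_null_comparison)
    show "\<forall>\<^sub>F T in at_top. norm (P b T - P a T) \<le> (\<beta> T + \<beta> (-T)) * norm (b - a)"
      using eventually_ge_at_top[of 0] by eventually_elim (rule est)
    have "((\<lambda>T. \<beta> (- T)) \<longlongrightarrow> 0) at_top"
      using \<beta>(3) by (simp add: filterlim_at_bot_mirror)
    from tendsto_add[OF \<beta>(2) this] show "((\<lambda>T. (\<beta> T + \<beta> (-T)) * norm (b - a)) \<longlongrightarrow> 0) at_top"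
      by (auto intro: tendsto_mult_left_zero)
  qed
  moreover have "((\<lambda>T. P b T - P a T) \<longlongrightarrow> integral UNIV (\<lambda>t. H (?w t b)) - integral UNIV (\<lambda>t. H (?w t a))) at_top"
    unfolding P_def using ab by (intro tendsto_diff integral_growing_intervals_tendsto HU) auto
  ultimately show ?thesis
    using tendsto_unique[OF trivial_limit_at_top_linorder] by fastforce
qed

section \<open>Resolvents of 0-sectorial operators\<close>

text \<open>Conditions on the argument are replaced by comparisons of \<open>Re z\<close> with \<open>cmod z * cos \<omega>\<close>, which define
  closed or open sets without case distinctions. The condition \<open>Re z < cmod z\<close> below says that \<open>z\<close> is off the
  non-negative half line.\<close>

lemma closure_sector_Re_ge:
  assumes "0 < \<omega>" "\<omega> < pi" "z \<in> closure (sector \<omega>)"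
  shows "cmod z * cos \<omega> \<le> Re z"
proof -
  have "sector \<omega> \<subseteq> {z. cmod z * cos \<omega> \<le> Re z}"
  proof
    fix z assume z: "z \<in> sector \<omega>"
    then have "cos \<omega> \<le> cos \<bar>Arg z\<bar>"
      using assms by (intro cos_monotone_0_pi_le) (auto simp: sector_def)
    also have "\<dots> = Re z / cmod z" using z by (simp add: sector_def cos_Arg)
    finally show "z \<in> {z. cmod z * cos \<omega> \<le> Re z}"
      using z by (simp add: sector_def field_simps)
  qed
  moreover have "closed {z. cmod z * cos \<omega> \<le> Re z}"
    by (intro closed_Collect_le continuous_intros)
  ultimately have "closure (sector \<omega>) \<subseteq> {z. cmod z * cos \<omega> \<le> Re z}" by (rule closure_minimal)
  then show ?thesis using assms(3) by blast
qed

lemma exp_in_sector: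
  assumes "\<bar>Im w\<bar> < \<omega>" "\<omega> \<le> pi"
  shows "exp w \<in> sector \<omega>"
proof -
  have "Ln (exp w) = w" using assms by (intro Ln_exp) auto
  then have "Arg (exp w) = Im w" using Arg_eq_Im_Ln[of "exp w"] by simp
  then show ?thesis using assms by (simp add: sector_def)
qed

lemma Re_exp_le: "cos (Im w) \<le> cos \<sigma> \<Longrightarrow> Re (exp w) \<le> cmod (exp w) * cos \<sigma>"
  by (simp add: Re_exp)

locale zero_sectorial_operator =
  fixes A :: "'a::complex_banach op_graph"
  assumes zero_sectorial: "zero_sectorial A"
begin

lemma sectorial: "\<omega> > 0 \<Longrightarrow> sectorial \<omega> A"
  using zero_sectorial by (simp add: zero_sectorial_def)

lemma linear_op: "linear_op A" using sectorial[of 1] by (simp add: sectorial_def)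

lemma off_axis_angle:
  assumes "Re z < cmod z"
  obtains \<sigma> where "0 < \<sigma>" "\<sigma> < pi" "Re z < cmod z * cos \<sigma>"
proof -
  have z: "z \<noteq> 0" using assms by auto
  have "((\<lambda>\<sigma>. cmod z * cos \<sigma>) \<longlongrightarrow> cmod z * cos 0) (at_right 0)"
    by (intro tendsto_intros isCont_tendsto_compose[OF isCont_cos]) 
  then have "\<forall>\<^sub>F \<sigma> in at_right 0. Re z < cmod z * cos \<sigma>"
    using assms by (intro order_tendstoD) auto
  then have "\<forall>\<^sub>F \<sigma> in at_right 0. Re z < cmod z * cos \<sigma> \<and> 0 < \<sigma> \<and> \<sigma> < pi"
    using eventually_at_right_real[OF pi_gt_zero] by eventually_elim auto
  then show ?thesis using that eventually_happens[of _ "at_right (0::real)"] by (auto simp: trivial_limit_at_right_real)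
qed

lemma in_resolvent_set:
  assumes "Re z < cmod z"
  shows "z \<in> resolvent_set A"
proof -
  obtain \<sigma> where "0 < \<sigma>" "\<sigma> < pi" "Re z < cmod z * cos \<sigma>" by (rule off_axis_angle[OF assms])
  then have "z \<notin> closure (sector \<sigma>)" "0 < \<sigma>" using closure_sector_Re_ge[of \<sigma> z] by auto
  then show ?thesis using sectorial[of \<sigma>] by (auto simp: sectorial_def op_spectrum_def)
qed

lemma resolvent_in_graph: "Re z < cmod z \<Longrightarrow> (resolvent A z x, z *\<^sub>C resolvent A z x - x) \<in> A"
  unfolding resolvent_def by (rule theI') (use in_resolvent_set in \<open>auto simp: resolvent_set_def\<close>)

lemma resolvent_unique: "Re z < cmod z \<Longrightarrow> (v, z *\<^sub>C v - x) \<in> A \<Longrightarrow> resolvent A z x = v"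
  unfolding resolvent_def by (rule the1_equality) (use in_resolvent_set in \<open>auto simp: resolvent_set_def\<close>)

lemma bounded_linear_resolvent: "Re z < cmod z \<Longrightarrow> bounded_linear (resolvent A z)"
  using in_resolvent_set by (auto simp: resolvent_set_def)

lemma resolvent_scaleC:
  assumes "Re z < cmod z"
  shows "resolvent A z (c *\<^sub>C x) = c *\<^sub>C resolvent A z x"
proof (rule resolvent_unique[OF assms])
  have "(c *\<^sub>C resolvent A z x, c *\<^sub>C (z *\<^sub>C resolvent A z x - x)) \<in> A"
    using linear_op resolvent_in_graph[OF assms] by (simp add: linear_op_def)
  then show "(c *\<^sub>C resolvent A z x, z *\<^sub>C c *\<^sub>C resolvent A z x - c *\<^sub>C x) \<in> A"
    by (simp add: scaleC.diff_right scaleC_scaleC mult.commute)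
qed

text \<open>The bounds of 0-sectoriality for some angle below \<open>\<sigma>\<close>, since points with \<open>Re z \<le> cmod z * cos \<sigma>\<close>
  avoid the closure of every smaller sector.\<close>

lemma resolvent_bound:
  assumes "0 < \<sigma>" "\<sigma> < pi"
  obtains C where "C \<ge> 0" "\<And>z x. z \<noteq> 0 \<Longrightarrow> Re z \<le> cmod z * cos \<sigma> \<Longrightarrow> cmod z * norm (resolvent A z x) \<le> C * norm x"
proof -
  obtain C where C: "\<And>z x. z \<notin> closure (sector (\<sigma>/2)) \<Longrightarrow> norm (z *\<^sub>C resolvent A z x) \<le> C * norm x"
    using sectorial[of "\<sigma>/4"] assms by (auto simp: sectorial_def dest!: spec[of _ "\<sigma>/2"]) blast
  have "cmod z * norm (resolvent A z x) \<le> \<bar>C\<bar> * norm x" if "z \<noteq> 0" "Re z \<le> cmod z * cos \<sigma>" for z x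
  proof -
    have "cos \<sigma> < cos (\<sigma>/2)" using assms by (intro cos_monotone_0_pi) auto
    then have "Re z < cmod z * cos (\<sigma>/2)"
      using that by (smt (verit) mult_strict_left_mono zero_less_norm_iff)
    then have "z \<notin> closure (sector (\<sigma>/2))"
      using closure_sector_Re_ge[of "\<sigma>/2" z] assms by auto
    from C[OF this, of x] show ?thesis
      by (simp add: norm_scaleC) (smt (verit) mult_right_mono norm_ge_zero)
  qed
  then show ?thesis using that[of "\<bar>C\<bar>"] by auto
qed

lemma resolvent_identity:
  assumes z: "Re z < cmod z" and w: "Re w < cmod w"
  shows "resolvent A z x - resolvent A w x = (w - z) *\<^sub>C resolvent A z (resolvent A w x)"
proof -
  define v where "v = resolvent A w x"
  have "(v, w *\<^sub>C v - x) \<in> A" unfolding v_def by (rule resolvent_in_graph[OF w])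
  then have "resolvent A z ((z - w) *\<^sub>C v + x) = v"
    by (intro resolvent_unique[OF z]) (simp add: scaleC.diff_left)
  then have "(z - w) *\<^sub>C resolvent A z v + resolvent A z x = v"
    using bounded_linear_resolvent[OF z]
    by (simp add: linear_simps resolvent_scaleC[OF z])
  then have "resolvent A z x - v = - ((z - w) *\<^sub>C resolvent A z v)"
    by (simp add: algebra_simps)
  also have "\<dots> = (w - z) *\<^sub>C resolvent A z v" by (metis minus_diff_eq scaleC.minus_left)
  finally show ?thesis by (simp add: v_def)
qed

lemma resolvent_commute:
  assumes z: "Re z < cmod z" and w: "Re w < cmod w"
  shows "resolvent A z (resolvent A w x) = resolvent A w (resolvent A z x)"
proof (cases "z = w")
  case False
  have "(w - z) *\<^sub>C resolvent A z (resolvent A w x) = - (resolvent A w x - resolvent A z x)"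
    using resolvent_identity[OF z w, of x] by simp
  also have "\<dots> = - ((z - w) *\<^sub>C resolvent A w (resolvent A z x))"
    using resolvent_identity[OF w z, of x] by simp
  also have "\<dots> = (w - z) *\<^sub>C resolvent A w (resolvent A z x)"
    by (metis minus_diff_eq scaleC.minus_left)
  finally have "inverse (w - z) *\<^sub>C (w - z) *\<^sub>C resolvent A z (resolvent A w x) =
      inverse (w - z) *\<^sub>C (w - z) *\<^sub>C resolvent A w (resolvent A z x)" by simp
  then show ?thesis using False by (simp add: scaleC_scaleC)
qed simp

text \<open>The operator norm bound is read off from the sectorial estimate at an angle below that of \<open>z\<close>; it is
  what turns the resolvent identity into continuity and differentiability of \<open>w \<mapsto> resolvent A w x\<close>.\<close>

lemma resolvent_locally_bounded:
  assumes "Re z < cmod z"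
  obtains K where "K \<ge> 0" "\<forall>\<^sub>F w in nhds z. Re w < cmod w \<and> (\<forall>x. norm (resolvent A w x) \<le> K * norm x)"
proof -
  obtain \<sigma> where \<sigma>: "0 < \<sigma>" "\<sigma> < pi" "Re z < cmod z * cos \<sigma>" by (rule off_axis_angle[OF assms])
  obtain C where C: "C \<ge> 0" "\<And>z x. z \<noteq> 0 \<Longrightarrow> Re z \<le> cmod z * cos \<sigma> \<Longrightarrow> cmod z * norm (resolvent A z x) \<le> C * norm x"
    using resolvent_bound[OF \<sigma>(1,2)] by blast
  have z: "z \<noteq> 0" using assms by auto
  define U where "U = {w. Re w < cmod w * cos \<sigma>} \<inter> {w. Re w < cmod w} \<inter> {w. cmod z / 2 < cmod w}"
  have "open U" unfolding U_def by (intro open_Int open_Collect_less continuous_intros)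
  moreover have "z \<in> U" using \<sigma> assms z by (auto simp: U_def)
  ultimately have "\<forall>\<^sub>F w in nhds z. w \<in> U" by (rule eventually_nhds_in_open)
  then have "\<forall>\<^sub>F w in nhds z. Re w < cmod w \<and> (\<forall>x. norm (resolvent A w x) \<le> (2 * C / cmod z) * norm x)"
  proof eventually_elim
    case (elim w)
    have "norm (resolvent A w x) \<le> (2 * C / cmod z) * norm x" for x
    proof -
      have w: "cmod z / 2 < cmod w" "w \<noteq> 0" using elim z by (auto simp: U_def)
      have "cmod z / 2 * norm (resolvent A w x) \<le> cmod w * norm (resolvent A w x)"
        using w by (intro mult_right_mono) auto
      also have "\<dots> \<le> C * norm x" using elim w by (intro C) (auto simp: U_def)
      finally show ?thesis using z by (simp add: field_simps)
    qed
    then show ?case using elim by (auto simp: U_def)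
  qed
  then show ?thesis using that[of "2 * C / cmod z"] C(1) by simp
qed

lemma isCont_resolvent_apply:
  assumes z: "Re z < cmod z" and g: "isCont g z"
  shows "isCont (\<lambda>w. resolvent A w (g w)) z"
proof -
  obtain K where K: "K \<ge> 0" "\<forall>\<^sub>F w in nhds z. Re w < cmod w \<and> (\<forall>x. norm (resolvent A w x) \<le> K * norm x)"
    by (rule resolvent_locally_bounded[OF z])
  have K': "\<forall>\<^sub>F w in at z. Re w < cmod w \<and> (\<forall>x. norm (resolvent A w x) \<le> K * norm x)"
    using K(2) by (rule eventually_nhds_conv_at[THEN iffD1, THEN conjunct1])
  have "((\<lambda>w. resolvent A w (g w) - resolvent A z (g z)) \<longlongrightarrow> 0) (at z)"
  proof (rule Lim_null_comparison)
    show "\<forall>\<^sub>F w in at z. norm (resolvent A w (g w) - resolvent A z (g z)) \<le>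
        K * norm (g w - g z) + cmod (z - w) * (K * norm (resolvent A z (g z)))"
      using K'
    proof eventually_elim
      case (elim w)
      have "resolvent A w (g w) - resolvent A z (g z) =
          resolvent A w (g w - g z) + (resolvent A w (g z) - resolvent A z (g z))"
        using bounded_linear_resolvent[of w] elim by (simp add: linear_simps)
      also have "\<dots> = resolvent A w (g w - g z) + (z - w) *\<^sub>C resolvent A w (resolvent A z (g z))"
        using resolvent_identity[of w z "g z"] elim z by simp
      finally have "norm (resolvent A w (g w) - resolvent A z (g z)) \<le>
          norm (resolvent A w (g w - g z)) + cmod (z - w) * norm (resolvent A w (resolvent A z (g z)))"
        by (metis norm_triangle_ineq norm_scaleC)
      also have "\<dots> \<le> K * norm (g w - g z) + cmod (z - w) * (K * norm (resolvent A z (g z)))"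
        using elim by (intro add_mono mult_left_mono) auto
      finally show ?case .
    qed
    have "((\<lambda>w. K * norm (g w - g z) + cmod (z - w) * (K * norm (resolvent A z (g z)))) \<longlongrightarrow>
       K * norm (g z - g z) + cmod (z - z) * (K * norm (resolvent A z (g z)))) (at z)"
      using g by (intro tendsto_intros) (auto simp: isCont_def)
    then show "((\<lambda>w. K * norm (g w - g z) + cmod (z - w) * (K * norm (resolvent A z (g z)))) \<longlongrightarrow> 0) (at z)"
      by simp
  qed
  then show ?thesis unfolding isCont_def by (rule LIM_zero_cancel)
qed

text \<open>Complex differentiability in the form that matches \<open>strip_integral_shift\<close>.\<close>

lemma resolvent_has_derivative:
  assumes z: "Re z < cmod z"
  shows "((\<lambda>w. resolvent A w x) has_derivative (\<lambda>d. d *\<^sub>C (- resolvent A z (resolvent A z x)))) (at z)"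
proof -
  let ?D = "- resolvent A z (resolvent A z x)"
  have K': "\<forall>\<^sub>F w in at z. Re w < cmod w \<and> w \<noteq> z"
  proof -
    have "open {w. Re w < cmod w}" by (intro open_Collect_less continuous_intros)
    then have "\<forall>\<^sub>F w in at z. w \<in> {w. Re w < cmod w}" using z by (intro eventually_at_in_open') auto
    then show ?thesis using eventually_neq_at_within[of z z UNIV] by eventually_elim auto
  qed
  have "((\<lambda>w. norm (resolvent A z (resolvent A z x) - resolvent A w (resolvent A z x))) \<longlongrightarrow> 0) (at z)"
  proof -
    have "isCont (\<lambda>w. resolvent A w (resolvent A z x)) z" by (intro isCont_resolvent_apply z) auto
    then have "((\<lambda>w. norm (resolvent A z (resolvent A z x) - resolvent A w (resolvent A z x))) \<longlongrightarrow>
       norm (resolvent A z (resolvent A z x) - resolvent A z (resolvent A z x))) (at z)"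
      by (intro tendsto_intros) (simp add: isCont_def)
    then show ?thesis by simp
  qed
  moreover have "\<forall>\<^sub>F w in at z. norm (resolvent A z (resolvent A z x) - resolvent A w (resolvent A z x)) =
      norm (resolvent A w x - resolvent A z x - (w - z) *\<^sub>C ?D) / norm (w - z)"
    using K'
  proof eventually_elim
    case (elim w)
    have "resolvent A w x - resolvent A z x - (w - z) *\<^sub>C ?D
        = (z - w) *\<^sub>C resolvent A w (resolvent A z x) + (w - z) *\<^sub>C resolvent A z (resolvent A z x)"
      using resolvent_identity[of w z x] elim z by (simp add: scaleC.minus_right)
    also have "\<dots> = (w - z) *\<^sub>C (resolvent A z (resolvent A z x) - resolvent A w (resolvent A z x))"
      by (simp add: scaleC.diff_right scaleC.diff_left)
    finally show ?case using elim by (simp add: norm_scaleC)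
  qed
  ultimately have "((\<lambda>w. norm (resolvent A w x - resolvent A z x - (w - z) *\<^sub>C ?D) / norm (w - z)) \<longlongrightarrow> 0) (at z)"
    by (rule Lim_transform_eventually)
  then show ?thesis
    unfolding has_derivative_iff_norm using scaleC.bounded_linear_left by auto
qed

end

section \<open>The Cauchy kernel in the logarithmic variable\<close>

text \<open>The decay of \<open>Hinf0\<close>, read in the logarithmic variable.\<close>

definition log_weight :: "real \<Rightarrow> real \<Rightarrow> real" where
  "log_weight \<epsilon> t = (1 + \<bar>t\<bar>) powr (- 1 - \<epsilon>)"

lemma log_weight_nonneg [simp]: "0 \<le> log_weight \<epsilon> t"
  by (simp add: log_weight_def)

lemma continuous_log_weight: "continuous_on S (log_weight \<epsilon>)"
  unfolding log_weight_def[abs_def] by (intro continuous_intros) (auto simp: add_eq_0_iff)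

lemma integrable_log_weight: "\<epsilon> > 0 \<Longrightarrow> log_weight \<epsilon> integrable_on UNIV"
  unfolding log_weight_def[abs_def] by (rule integrable_on_UNIV_log_weight)

lemma log_weight_tendsto:
  assumes "\<epsilon> > 0"
  shows "(log_weight \<epsilon> \<longlongrightarrow> 0) at_top" "(log_weight \<epsilon> \<longlongrightarrow> 0) at_bot"
proof -
  show 1: "(log_weight \<epsilon> \<longlongrightarrow> 0) at_top"
    unfolding log_weight_def[abs_def] using assms
    by (intro tendsto_neg_powr filterlim_tendsto_add_at_top[OF tendsto_const] filterlim_abs_real) auto
  then show "(log_weight \<epsilon> \<longlongrightarrow> 0) at_bot"
    by (simp add: filterlim_at_bot_mirror log_weight_def[abs_def])
qed

text \<open>If the angle between \<open>exp w\<close> and \<open>exp w0\<close> is at least \<open>\<delta>\<close>, the distance of \<open>exp w\<close> to the ray through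
  \<open>exp w0\<close> is at least \<open>\<bar>exp w\<bar> sin \<delta>\<close>. The hypothesis on cosines expresses the angle modulo \<open>2 * pi\<close>.\<close>

lemma exp_diff_lower_bound:
  assumes "cos (Im w - Im w0) \<le> cos \<delta>"
  shows "cmod (exp w) * sin \<delta> \<le> cmod (exp w - exp w0)"
proof -
  define a b where "a = exp (Re w)" and "b = exp (Re w0)"
  have pos: "a > 0" "b > 0" by (auto simp: a_def b_def)
  have "(cmod (exp w - exp w0))\<^sup>2 = (a * cos (Im w) - b * cos (Im w0))\<^sup>2 + (a * sin (Im w) - b * sin (Im w0))\<^sup>2"
    by (simp add: cmod_power2 Re_exp Im_exp a_def b_def)
  also have "\<dots> = a\<^sup>2 * ((cos (Im w))\<^sup>2 + (sin (Im w))\<^sup>2) + b\<^sup>2 * ((cos (Im w0))\<^sup>2 + (sin (Im w0))\<^sup>2)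
      - 2 * (a * b) * (cos (Im w) * cos (Im w0) + sin (Im w) * sin (Im w0))"
    by algebra
  also have "\<dots> = a\<^sup>2 + b\<^sup>2 - 2 * (a * b) * cos (Im w - Im w0)"
    by (simp add: cos_diff)
  also have "\<dots> \<ge> a\<^sup>2 + b\<^sup>2 - 2 * (a * b) * cos \<delta>"
    using mult_left_mono[OF assms, of "2 * (a * b)"] pos by simp
  also have "a\<^sup>2 + b\<^sup>2 - 2 * (a * b) * cos \<delta> = (b - a * cos \<delta>)\<^sup>2 + a\<^sup>2 * (1 - (cos \<delta>)\<^sup>2)"
    by (simp add: power2_eq_square algebra_simps)
  also have "\<dots> = (b - a * cos \<delta>)\<^sup>2 + (a * sin \<delta>)\<^sup>2"
    by (simp add: sin_squared_eq power_mult_distrib)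
  finally have "(a * sin \<delta>)\<^sup>2 \<le> (cmod (exp w - exp w0))\<^sup>2"
    using zero_le_power2[of "b - a * cos \<delta>"] by linarith
  then have "a * sin \<delta> \<le> cmod (exp w - exp w0)" by (rule power2_le_imp_le) simp
  then show ?thesis by (simp add: a_def)
qed

lemma exp_kernel_bound:
  assumes "cos (Im w - Im w0) \<le> cos \<delta>" "sin \<delta> > 0"
  shows "exp w \<noteq> exp w0" "cmod (exp w / (exp w - exp w0)) \<le> 1 / sin \<delta>"
proof -
  have "0 < cmod (exp w) * sin \<delta>" using assms by simp
  then have *: "0 < cmod (exp w - exp w0)" using exp_diff_lower_bound[OF assms(1)] by linarith
  then show "exp w \<noteq> exp w0" by auto
  show "cmod (exp w / (exp w - exp w0)) \<le> 1 / sin \<delta>"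
    using exp_diff_lower_bound[OF assms(1)] * assms(2) by (simp add: norm_divide field_simps)
qed

lemma scalar_strip_integral_shift:
  assumes hol: "p holomorphic_on S" "open S" and S: "\<And>w. a \<le> Im w \<Longrightarrow> Im w \<le> b \<Longrightarrow> w \<in> S" and ab: "a \<le> b"
    and bd: "\<And>w. a \<le> Im w \<Longrightarrow> Im w \<le> b \<Longrightarrow> cmod (p w) \<le> C * log_weight \<epsilon> (Re w)" and "\<epsilon> > 0"
  shows "integral UNIV (\<lambda>t. p (of_real t + \<i> * of_real a)) = integral UNIV (\<lambda>t. p (of_real t + \<i> * of_real b))"
proof (rule strip_integral_shift[where H' = "deriv p", OF ab])
  show "(p has_derivative (\<lambda>d. d *\<^sub>C deriv p w)) (at w)" if "a \<le> Im w" "Im w \<le> b" for w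
  proof -
    have "(\<lambda>d. d *\<^sub>C deriv p w) = (*) (deriv p w)"
      by (simp add: fun_eq_iff scaleC_complex_def mult.commute)
    then show ?thesis
      using holomorphic_derivI[OF hol S[OF that]] by (simp add: has_field_derivative_def)
  qed
  show "continuous_on {w. a \<le> Im w \<and> Im w \<le> b} (deriv p)"
    by (rule continuous_on_subset[OF holomorphic_on_imp_continuous_on[OF holomorphic_deriv[OF hol]]])
      (use S in auto)
  show "(\<lambda>t. C * log_weight \<epsilon> t) integrable_on UNIV"
    using integrable_on_mult_right[OF integrable_log_weight[OF \<open>\<epsilon> > 0\<close>]] by blast
  show "((\<lambda>t. C * log_weight \<epsilon> t) \<longlongrightarrow> 0) at_top" "((\<lambda>t. C * log_weight \<epsilon> t) \<longlongrightarrow> 0) at_bot"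
    using log_weight_tendsto[OF \<open>\<epsilon> > 0\<close>] by (auto intro: tendsto_mult_right_zero)
qed (use bd in auto)

lemma open_strip: "open {w. \<bar>Im w\<bar> < \<omega>}"
  by (intro open_Collect_less continuous_intros)

text \<open>The kernel has no pole between the two lines, so the line integrals agree. This is Cauchy's theorem
  for a pole \<open>exp w0\<close> outside the sector.\<close>

lemma cauchy_kernel_outside:
  assumes hol: "p holomorphic_on {w. \<bar>Im w\<bar> < \<omega>}" and \<sigma>: "0 < \<sigma>" "\<sigma> < \<omega>"
    and bd: "\<And>w. \<bar>Im w\<bar> < \<omega> \<Longrightarrow> cmod (p w) \<le> C * log_weight \<epsilon> (Re w)" and \<epsilon>: "\<epsilon> > 0" and C: "C \<ge> 0"
    and out: "\<And>s. \<bar>s\<bar> \<le> \<sigma> \<Longrightarrow> cos (s - Im w0) \<le> cos \<delta>" and \<delta>: "sin \<delta> > 0"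
  shows "integral UNIV (\<lambda>t. let w = of_real t + \<i> * of_real (-\<sigma>) in p w * exp w / (exp w - exp w0)) =
    integral UNIV (\<lambda>t. let w = of_real t + \<i> * of_real \<sigma> in p w * exp w / (exp w - exp w0))"
  unfolding Let_def
proof (rule scalar_strip_integral_shift[where S = "{w. \<bar>Im w\<bar> < \<omega> \<and> exp w \<noteq> exp w0}" and C = "C / sin \<delta>" and \<epsilon> = \<epsilon>])
  show "(\<lambda>w. p w * exp w / (exp w - exp w0)) holomorphic_on {w. \<bar>Im w\<bar> < \<omega> \<and> exp w \<noteq> exp w0}"
    by (intro holomorphic_intros holomorphic_on_subset[OF hol]) auto
  show "open {w. \<bar>Im w\<bar> < \<omega> \<and> exp w \<noteq> exp w0}"
    by (intro open_Collect_conj open_Collect_less open_Collect_neq continuous_intros)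
  fix w assume w: "- \<sigma> \<le> Im w" "Im w \<le> \<sigma>"
  then have k: "cos (Im w - Im w0) \<le> cos \<delta>" by (intro out) auto
  show "w \<in> {w. \<bar>Im w\<bar> < \<omega> \<and> exp w \<noteq> exp w0}"
    using w \<sigma> exp_kernel_bound(1)[OF k \<delta>] by auto
  have "cmod (p w * (exp w / (exp w - exp w0))) \<le> (C * log_weight \<epsilon> (Re w)) * (1 / sin \<delta>)"
    unfolding norm_mult using w \<sigma> C by (intro mult_mono bd exp_kernel_bound(2)[OF k \<delta>]) auto
  then show "cmod (p w * exp w / (exp w - exp w0)) \<le> C / sin \<delta> * log_weight \<epsilon> (Re w)" by (simp add: mult_ac)
qed (use \<sigma> \<epsilon> in auto)

lemma has_contour_integral_horizontal_iff:
  assumes "Im a = Im b" "Re a < Re b"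
  shows "(f has_contour_integral I) (linepath a b) \<longleftrightarrow>
    ((\<lambda>t. f (of_real t + of_real (Im a) * \<i>)) has_integral I) {Re a..Re b}"
proof -
  have ba: "b - a = of_real (Re b - Re a)" using assms by (simp add: complex_eq_iff)
  have "(f has_contour_integral I) (linepath a b) \<longleftrightarrow>
      ((\<lambda>x. f (linepath a b x) * (b - a)) has_integral I) {0..1}"
    by (rule has_contour_integral_linepath)
  also have "\<dots> \<longleftrightarrow> ((\<lambda>x. (Re b - Re a) *\<^sub>R f (of_real ((Re b - Re a) * x + Re a) + of_real (Im a) * \<i>)) has_integral I) {0..1}"
  proof (rule has_integral_cong)
    fix x :: real
    have "linepath a b x = of_real ((Re b - Re a) * x + Re a) + of_real (Im a) * \<i>"
      using assms by (simp add: linepath_def complex_eq_iff algebra_simps)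
    then show "f (linepath a b x) * (b - a) = (Re b - Re a) *\<^sub>R f (of_real ((Re b - Re a) * x + Re a) + of_real (Im a) * \<i>)"
      unfolding ba by (simp add: scaleR_conv_of_real mult.commute)
  qed
  also have "\<dots> \<longleftrightarrow> ((\<lambda>x. (Re b - Re a) *\<^sub>R (f (of_real ((Re b - Re a) *\<^sub>R x + Re a) + of_real (Im a) * \<i>))) has_integral
      (Re b - Re a) *\<^sub>R (I /\<^sub>R (Re b - Re a))) {0..1}"
    using assms by simp
  also have "\<dots> \<longleftrightarrow> ((\<lambda>x. f (of_real ((Re b - Re a) *\<^sub>R x + Re a) + of_real (Im a) * \<i>)) has_integral
      (I /\<^sub>R (Re b - Re a))) {0..1}"
    using assms by (subst has_integral_cmul_iff) auto
  also have "\<dots> \<longleftrightarrow> ((\<lambda>t. f (of_real t + of_real (Im a) * \<i>)) has_integral I) {Re a..Re b}"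
    using has_integral_affinity_iff[of "Re b - Re a" "\<lambda>t. f (of_real t + of_real (Im a) * \<i>)" "Re a" I "Re a" "Re b"] assms
    by simp
  finally show ?thesis .
qed

text \<open>Cauchy's formula on the rectangles with real part in \<open>{-T..T}\<close>; the vertical sides vanish in the limit.
  The quotient \<open>(exp w - exp w0) / (w - w0)\<close> is holomorphic without zeros in the strip, which replaces the
  kernel by the standard one \<open>1 / (w - w0)\<close>.\<close>

lemma cauchy_kernel_inside:
  assumes hol: "p holomorphic_on {w. \<bar>Im w\<bar> < \<omega>}" and \<sigma>: "0 < \<sigma>" "\<sigma> < \<omega>" "\<omega> \<le> pi / 2" and w0: "\<bar>Im w0\<bar> < \<sigma>"
    and bd: "\<And>w. \<bar>Im w\<bar> < \<omega> \<Longrightarrow> cmod (p w) \<le> C * log_weight \<epsilon> (Re w)" and \<epsilon>: "\<epsilon> > 0" and C: "C \<ge> 0"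
  shows "integral UNIV (\<lambda>t. let w = of_real t + \<i> * of_real (-\<sigma>) in p w * exp w / (exp w - exp w0)) -
    integral UNIV (\<lambda>t. let w = of_real t + \<i> * of_real \<sigma> in p w * exp w / (exp w - exp w0)) = 2 * of_real pi * \<i> * p w0"
proof -
  define Q where "Q w = p w * exp w / (exp w - exp w0)" for w
  \<comment> \<open>The holomorphic quotient that relates the exponential kernel to \<open>1 / (w - w0)\<close>.\<close>
  define E where "E w = (if w = w0 then deriv exp w0 else (exp w - exp w0) / (w - w0))" for w
  define S where "S = {w::complex. \<bar>Im w\<bar> < \<omega>}"
  have S: "open S" "convex S"
  proof -
    show "open S" unfolding S_def by (rule open_strip)
    have "S = {w. Im w < \<omega>} \<inter> {w. - \<omega> < Im w}" unfolding S_def by auto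
    then show "convex S" by (simp add: convex_Int convex_halfspace_Im_lt convex_halfspace_Im_gt)
  qed
  have neq: "exp w \<noteq> exp w0" if "w \<in> S" "w \<noteq> w0" for w
  proof
    assume "exp w = exp w0"
    moreover have "\<bar>Im w - Im w0\<bar> < 2 * pi" using that w0 \<sigma> by (auto simp: S_def)
    ultimately show False using that(2) exp_complex_eqI[of w w0] by simp
  qed
  have Ehol: "E holomorphic_on UNIV"
    unfolding E_def[abs_def] by (rule pole_lemma_open) (auto intro: holomorphic_intros)
  have E0: "E w \<noteq> 0" if "w \<in> S" for w
    using neq[OF that] by (auto simp: E_def DERIV_imp_deriv[OF DERIV_exp])
  have Gh: "(\<lambda>w. p w * exp w / E w) holomorphic_on S"
    using E0 by (intro holomorphic_intros holomorphic_on_subset[OF Ehol]) (use hol in \<open>auto simp: S_def\<close>)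
  have QG: "Q w = (p w * exp w / E w) / (w - w0)" if "w \<noteq> w0" for w
    using that by (auto simp: Q_def E_def)
  have Qc: "continuous_on (S - {w0}) Q"
    unfolding Q_def using neq
    by (intro continuous_intros continuous_on_subset[OF holomorphic_on_imp_continuous_on[OF hol]]) (auto simp: S_def)
  define B where "B s T = integral {-T..T} (\<lambda>t. Q (of_real t + \<i> * of_real s))" for s T
  define V where "V T = contour_integral (linepath (Complex T (-\<sigma>)) (Complex T \<sigma>)) Q
     + contour_integral (linepath (Complex (-T) \<sigma>) (Complex (-T) (-\<sigma>))) Q" for T
  have eq: "B (-\<sigma>) T - B \<sigma> T + V T = 2 * of_real pi * \<i> * p w0" if T: "T > \<bar>Re w0\<bar>" for T
  proof -
    define a1 a2 a3 a4 where "a1 = Complex (-T) (-\<sigma>)" and "a2 = Complex T (-\<sigma>)" and "a3 = Complex T \<sigma>" and "a4 = Complex (-T) \<sigma>"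
    note adefs = a1_def a2_def a3_def a4_def
    have rp: "rectpath a1 a3 = linepath a1 a2 +++ linepath a2 a3 +++ linepath a3 a4 +++ linepath a4 a1"
      by (simp add: rectpath_def Let_def adefs)
    have segs: "closed_segment a1 a2 \<subseteq> S - {w0}" "closed_segment a2 a3 \<subseteq> S - {w0}"
       "closed_segment a3 a4 \<subseteq> S - {w0}" "closed_segment a4 a1 \<subseteq> S - {w0}"
      using T \<sigma> w0 by (auto simp: adefs S_def closed_segment_same_Im closed_segment_same_Re closed_segment_eq_real_ivl)
    have ci: "Q contour_integrable_on linepath a1 a2" "Q contour_integrable_on linepath a2 a3"
       "Q contour_integrable_on linepath a3 a4" "Q contour_integrable_on linepath a4 a1"
      using segs by (auto intro!: contour_integrable_continuous_linepath continuous_on_subset[OF Qc])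
    have pim: "path_image (rectpath a1 a3) \<subseteq> S - {w0}"
      using segs unfolding rp by (auto simp: path_image_join)
    have "((\<lambda>w. (p w * exp w / E w) / (w - w0)) has_contour_integral
        (2 * pi * \<i> * winding_number (rectpath a1 a3) w0 * (p w0 * exp w0 / E w0))) (rectpath a1 a3)"
    proof (rule Cauchy_integral_formula_convex_simple[OF S(2) Gh _ _ pim])
      show "w0 \<in> interior S" using S(1) w0 \<sigma> by (simp add: interior_open S_def)
    qed auto
    moreover have "winding_number (rectpath a1 a3) w0 = 1"
      using T w0 by (intro winding_number_rectpath) (auto simp: adefs in_box_complex_iff)
    moreover have "E w0 = exp w0" by (simp add: E_def DERIV_imp_deriv[OF DERIV_exp])
    ultimately have "((\<lambda>w. (p w * exp w / E w) / (w - w0)) has_contour_integral (2 * of_real pi * \<i> * p w0)) (rectpath a1 a3)"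
      by simp
    then have "(Q has_contour_integral (2 * of_real pi * \<i> * p w0)) (rectpath a1 a3)"
      by (rule has_contour_integral_eq) (metis QG pim DiffD2 singletonI subsetD)
    then have "2 * of_real pi * \<i> * p w0 = contour_integral (rectpath a1 a3) Q" by (simp add: contour_integral_unique)
    also have "\<dots> = contour_integral (linepath a1 a2) Q + (contour_integral (linepath a2 a3) Q +
        (contour_integral (linepath a3 a4) Q + contour_integral (linepath a4 a1) Q))"
      unfolding rp using ci by (simp add: contour_integrable_joinI)
    also have "contour_integral (linepath a1 a2) Q = B (-\<sigma>) T"
    proof -
      have "((\<lambda>t. Q (of_real t + Im a1 * \<i>)) has_integral contour_integral (linepath a1 a2) Q) {Re a1..Re a2}"
        using has_contour_integral_integral[OF ci(1)] T
        by (subst has_contour_integral_horizontal_iff[symmetric]) (auto simp: adefs)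
      then show ?thesis by (simp add: B_def adefs mult.commute integral_unique)
    qed
    also have "contour_integral (linepath a3 a4) Q = - B \<sigma> T"
    proof -
      have ci': "Q contour_integrable_on linepath a4 a3"
        using ci(3) contour_integrable_reversepath[of "linepath a3 a4" Q] by simp
      have "((\<lambda>t. Q (of_real t + Im a4 * \<i>)) has_integral contour_integral (linepath a4 a3) Q) {Re a4..Re a3}"
        using has_contour_integral_integral[OF ci'] T
        by (subst has_contour_integral_horizontal_iff[symmetric]) (auto simp: adefs)
      then have "contour_integral (linepath a4 a3) Q = B \<sigma> T" by (simp add: B_def adefs mult.commute integral_unique)
      then show ?thesis using contour_integral_reversepath[of "linepath a3 a4" Q] by simp
    qed
    finally show ?thesis by (simp add: V_def adefs)
  qed
  have kb: "cmod (Q w) \<le> 2 * C * log_weight \<epsilon> T" if "\<bar>Im w\<bar> \<le> \<sigma>" "\<bar>Re w\<bar> = T" "T \<ge> \<bar>Re w0\<bar> + 1" for w T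
  proof -
    \<comment> \<open>At distance one in real part the moduli of \<open>exp w\<close> and \<open>exp w0\<close> differ by a factor \<open>exp 1 \<ge> 2\<close>.\<close>
    have k: "cmod (exp w) \<le> 2 * cmod (exp w - exp w0)"
    proof (cases "Re w \<ge> 0")
      case True
      have "cmod (exp w0) * 2 \<le> cmod (exp w0) * exp 1" using exp_ge_add_one_self[of 1] by (intro mult_left_mono) auto
      also have "\<dots> = exp (Re w0 + 1)" by (simp add: exp_add)
      also have "\<dots> \<le> cmod (exp w)" using True that by simp
      finally show ?thesis using norm_triangle_ineq2[of "exp w" "exp w0"] by simp
    next
      case False
      have "cmod (exp w) * 2 \<le> cmod (exp w) * exp 1" using exp_ge_add_one_self[of 1] by (intro mult_left_mono) auto
      also have "\<dots> = exp (Re w + 1)" by (simp add: exp_add)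
      also have "\<dots> \<le> cmod (exp w0)" using False that by simp
      finally show ?thesis using norm_triangle_ineq2[of "exp w0" "exp w"] norm_ge_zero[of "exp w"]
        by (smt (verit) norm_minus_commute)
    qed
    have "cmod (exp w / (exp w - exp w0)) \<le> 2"
      using k by (cases "exp w = exp w0") (auto simp: norm_divide divide_le_eq)
    then have "cmod (p w * (exp w / (exp w - exp w0))) \<le> (C * log_weight \<epsilon> (Re w)) * 2"
      unfolding norm_mult using that \<sigma> C by (intro mult_mono bd) auto
    moreover have "log_weight \<epsilon> (Re w) = log_weight \<epsilon> T" using that by (simp add: log_weight_def)
    ultimately show ?thesis by (simp add: Q_def mult_ac)
  qed
  have V0: "(V \<longlongrightarrow> 0) at_top"
  proof (rule Lim_null_comparison)
    show "\<forall>\<^sub>F T in at_top. norm (V T) \<le> 8 * C * \<sigma> * log_weight \<epsilon> T"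
      using eventually_ge_at_top[of "\<bar>Re w0\<bar> + 1"]
    proof eventually_elim
      case (elim T)
      have T: "T > 0" using elim by linarith
      have seg: "closed_segment (Complex T (-\<sigma>)) (Complex T \<sigma>) \<subseteq> S - {w0}"
        "closed_segment (Complex (-T) \<sigma>) (Complex (-T) (-\<sigma>)) \<subseteq> S - {w0}"
        using elim \<sigma> w0 by (auto simp: S_def closed_segment_same_Re closed_segment_eq_real_ivl)
      have "cmod (contour_integral (linepath (Complex T (-\<sigma>)) (Complex T \<sigma>)) Q)
          \<le> (2 * C * log_weight \<epsilon> T) * cmod (Complex T \<sigma> - Complex T (-\<sigma>))"
        using elim \<sigma> C T by (intro contour_integral_bound_linepath kb contour_integrable_continuous_linepath continuous_on_subset[OF Qc seg(1)])
          (auto simp: closed_segment_same_Re closed_segment_eq_real_ivl)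
      moreover have "cmod (contour_integral (linepath (Complex (-T) \<sigma>) (Complex (-T) (-\<sigma>))) Q)
          \<le> (2 * C * log_weight \<epsilon> T) * cmod (Complex (-T) (-\<sigma>) - Complex (-T) \<sigma>)"
        using elim \<sigma> C T by (intro contour_integral_bound_linepath kb contour_integrable_continuous_linepath continuous_on_subset[OF Qc seg(2)])
          (auto simp: closed_segment_same_Re closed_segment_eq_real_ivl)
      moreover have "cmod (Complex T \<sigma> - Complex T (-\<sigma>)) = 2 * \<sigma>" "cmod (Complex (-T) (-\<sigma>) - Complex (-T) \<sigma>) = 2 * \<sigma>"
        using \<sigma> by (auto simp: cmod_eq_Im)
      ultimately have "cmod (V T) \<le> (2 * C * log_weight \<epsilon> T) * (2 * \<sigma>) + (2 * C * log_weight \<epsilon> T) * (2 * \<sigma>)"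
        unfolding V_def by (intro order_trans[OF norm_triangle_ineq] add_mono) simp_all
      then show ?case by (simp add: algebra_simps)
    qed
    show "((\<lambda>T. 8 * C * \<sigma> * log_weight \<epsilon> T) \<longlongrightarrow> 0) at_top"
      using log_weight_tendsto[OF \<epsilon>] by (auto intro: tendsto_mult_right_zero)
  qed
  have B0: "(B s \<longlongrightarrow> integral UNIV (\<lambda>t. Q (of_real t + \<i> * of_real s))) at_top" if s: "\<bar>s\<bar> = \<sigma>" for s
    unfolding B_def
  proof (rule integral_growing_intervals_tendsto, rule integrable_on_UNIV_dominated)
    have "continuous_on UNIV (\<lambda>t. Q (of_real t + \<i> * of_real s))"
    proof (rule continuous_on_compose2[OF Qc])
      show "continuous_on UNIV (\<lambda>t. complex_of_real t + \<i> * complex_of_real s)" by (intro continuous_intros)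
      show "(\<lambda>t. complex_of_real t + \<i> * complex_of_real s) ` UNIV \<subseteq> S - {w0}"
        using s \<sigma> w0 by (auto simp: S_def)
    qed
    then show "(\<lambda>t. Q (of_real t + \<i> * of_real s)) integrable_on {a..b}" for a b
      by (intro integrable_continuous_real) (rule continuous_on_subset[OF _ subset_UNIV])
    define \<delta> where "\<delta> = \<sigma> - \<bar>Im w0\<bar>"
    have \<delta>: "0 < \<delta>" "\<delta> < pi" using w0 \<sigma> by (auto simp: \<delta>_def)
    have "cos (s - Im w0) \<le> cos \<delta>"
    proof -
      have "cos \<bar>s - Im w0\<bar> \<le> cos \<delta>"
        using \<delta> s \<sigma> w0 by (intro cos_monotone_0_pi_le) (auto simp: \<delta>_def)
      then show ?thesis by simp
    qed
    then have k: "cmod (exp w / (exp w - exp w0)) \<le> 1 / sin \<delta>" if "Im w = s" for w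
      using that \<delta> by (intro exp_kernel_bound) (auto simp: sin_gt_zero)
    show "norm (Q (of_real t + \<i> * of_real s)) \<le> C / sin \<delta> * log_weight \<epsilon> t" for t
    proof -
      let ?w = "of_real t + \<i> * of_real s"
      have "cmod (p ?w * (exp ?w / (exp ?w - exp w0))) \<le> (C * log_weight \<epsilon> (Re ?w)) * (1 / sin \<delta>)"
        unfolding norm_mult[of "p ?w"] using s \<sigma> C by (intro mult_mono bd k) auto
      then show ?thesis by (simp add: Q_def mult_ac)
    qed
    show "(\<lambda>t. C / sin \<delta> * log_weight \<epsilon> t) integrable_on UNIV"
      using integrable_on_mult_right[OF integrable_log_weight[OF \<open>\<epsilon> > 0\<close>]] by blast
  qed
  define L where "L = 2 * of_real pi * \<i> * p w0"
  define J where "J s = integral UNIV (\<lambda>t. Q (of_real t + \<i> * of_real s))" for s :: real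
  have B1: "(B \<sigma> \<longlongrightarrow> J \<sigma>) at_top" and B2: "(B (-\<sigma>) \<longlongrightarrow> J (-\<sigma>)) at_top"
    unfolding J_def using B0[of \<sigma>] B0[of "-\<sigma>"] \<sigma>(1) by simp_all
  have lim: "((\<lambda>T. B (-\<sigma>) T - B \<sigma> T + V T) \<longlongrightarrow> J (-\<sigma>) - J \<sigma> + 0) at_top"
    by (rule tendsto_add[OF tendsto_diff[OF B2 B1] V0])
  have eqL: "T > \<bar>Re w0\<bar> \<Longrightarrow> B (-\<sigma>) T - B \<sigma> T + V T = L" for T
    unfolding L_def by (rule eq)
  have "\<forall>\<^sub>F T in at_top. B (-\<sigma>) T - B \<sigma> T + V T = L"
    by (rule eventually_mono[OF eventually_gt_at_top[of "\<bar>Re w0\<bar>"]]) (rule eqL)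
  then have "((\<lambda>T. B (-\<sigma>) T - B \<sigma> T + V T) \<longlongrightarrow> L) at_top" by (rule tendsto_eventually)
  then have "J (-\<sigma>) - J \<sigma> + 0 = L" by (rule tendsto_unique[OF trivial_limit_at_top_linorder lim])
  then show ?thesis by (simp add: Q_def J_def L_def Let_def)
qed

section \<open>The contour calculus in the logarithmic variable\<close>

definition log_ray :: "real \<Rightarrow> real \<Rightarrow> complex" where
  "log_ray \<phi> t = of_real t + \<i> * of_real \<phi>"

lemma Re_log_ray [simp]: "Re (log_ray \<phi> t) = t" and Im_log_ray [simp]: "Im (log_ray \<phi> t) = \<phi>"
  by (simp_all add: log_ray_def)

lemma continuous_log_ray [continuous_intros]: "continuous_on S (log_ray \<phi>)"
  unfolding log_ray_def[abs_def] by (intro continuous_intros)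

definition ray_decay :: "real \<Rightarrow> (complex \<Rightarrow> complex) \<Rightarrow> bool" where
  "ray_decay \<phi> k \<longleftrightarrow> continuous_on UNIV (\<lambda>t. k (log_ray \<phi> t)) \<and>
     (\<exists>C\<ge>0. \<exists>\<epsilon>>0. \<forall>t. cmod (k (log_ray \<phi> t)) \<le> C * log_weight \<epsilon> t)"

definition strip_decay :: "real \<Rightarrow> (complex \<Rightarrow> complex) \<Rightarrow> bool" where
  "strip_decay \<omega> p \<longleftrightarrow> p holomorphic_on {w. \<bar>Im w\<bar> < \<omega>} \<and>
     (\<exists>C\<ge>0. \<exists>\<epsilon>>0. \<forall>w. \<bar>Im w\<bar> < \<omega> \<longrightarrow> cmod (p w) \<le> C * log_weight \<epsilon> (Re w))"

lemma ray_decayI: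
  assumes "continuous_on UNIV (\<lambda>t. k (log_ray \<phi> t))" "C \<ge> 0" "\<epsilon> > 0"
    "\<And>t. cmod (k (log_ray \<phi> t)) \<le> C * log_weight \<epsilon> t"
  shows "ray_decay \<phi> k"
  using assms unfolding ray_decay_def by blast

lemma strip_decayI:
  assumes "p holomorphic_on {w. \<bar>Im w\<bar> < \<omega>}" "C \<ge> 0" "\<epsilon> > 0"
    "\<And>w. \<bar>Im w\<bar> < \<omega> \<Longrightarrow> cmod (p w) \<le> C * log_weight \<epsilon> (Re w)"
  shows "strip_decay \<omega> p"
  using assms unfolding strip_decay_def by blast

lemma strip_decayE:
  assumes "strip_decay \<omega> p"
  obtains C \<epsilon> where "p holomorphic_on {w. \<bar>Im w\<bar> < \<omega>}" "C \<ge> 0" "\<epsilon> > 0"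
    "\<And>w. \<bar>Im w\<bar> < \<omega> \<Longrightarrow> cmod (p w) \<le> C * log_weight \<epsilon> (Re w)"
  using assms unfolding strip_decay_def by blast

lemma strip_decay_imp_ray_decay:
  assumes "strip_decay \<omega> p" "\<bar>\<phi>\<bar> < \<omega>"
  shows "ray_decay \<phi> p"
proof -
  have "continuous_on {w. \<bar>Im w\<bar> < \<omega>} p"
    using assms(1) holomorphic_on_imp_continuous_on by (auto simp: strip_decay_def)
  then have "continuous_on UNIV (\<lambda>t. p (log_ray \<phi> t))"
    by (rule continuous_on_compose2) (use assms(2) in \<open>auto intro: continuous_log_ray\<close>)
  moreover obtain C \<epsilon> where "C \<ge> 0" "\<epsilon> > 0" "\<And>w. \<bar>Im w\<bar> < \<omega> \<Longrightarrow> cmod (p w) \<le> C * log_weight \<epsilon> (Re w)"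
    using assms(1) by (auto simp: strip_decay_def)
  moreover from this(3)[of "log_ray \<phi> _"] have "cmod (p (log_ray \<phi> t)) \<le> C * log_weight \<epsilon> t" for t
    using assms(2) by simp
  ultimately show ?thesis by (intro ray_decayI[of p \<phi> C \<epsilon>])
qed

lemma ray_decay_mult_bounded:
  assumes "ray_decay \<phi> k" "continuous_on UNIV (\<lambda>t. h (log_ray \<phi> t))" "\<And>t. cmod (h (log_ray \<phi> t)) \<le> B"
  shows "ray_decay \<phi> (\<lambda>w. k w * h w)"
proof -
  obtain C \<epsilon> where C: "C \<ge> 0" "\<epsilon> > 0" "\<And>t. cmod (k (log_ray \<phi> t)) \<le> C * log_weight \<epsilon> t"
    using assms(1) by (auto simp: ray_decay_def)
  have B: "B \<ge> 0" using order_trans[OF norm_ge_zero assms(3)] .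
  have "cmod (k (log_ray \<phi> t) * h (log_ray \<phi> t)) \<le> (C * log_weight \<epsilon> t) * B" for t
    unfolding norm_mult using C B by (intro mult_mono assms(3)) auto
  then have "cmod (k (log_ray \<phi> t) * h (log_ray \<phi> t)) \<le> (C * B) * log_weight \<epsilon> t" for t
    by (simp add: mult_ac)
  moreover have "continuous_on UNIV (\<lambda>t. k (log_ray \<phi> t) * h (log_ray \<phi> t))"
    using assms(1,2) by (intro continuous_intros) (auto simp: ray_decay_def)
  ultimately show ?thesis using C(1,2) B by (intro ray_decayI[of _ \<phi> "C * B" \<epsilon>]) simp_all
qed

lemma ray_decay_integrable:
  assumes "ray_decay \<phi> k"
  shows "(\<lambda>t. k (log_ray \<phi> t)) integrable_on UNIV"
proof -
  obtain C \<epsilon> where C: "C \<ge> 0" "\<epsilon> > 0" "\<And>t. cmod (k (log_ray \<phi> t)) \<le> C * log_weight \<epsilon> t"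
    and c: "continuous_on UNIV (\<lambda>t. k (log_ray \<phi> t))"
    using assms by (auto simp: ray_decay_def)
  show ?thesis
  proof (rule integrable_on_UNIV_dominated)
    show "(\<lambda>t. k (log_ray \<phi> t)) integrable_on {a..b}" for a b
      by (intro integrable_continuous_real continuous_on_subset[OF c]) auto
    show "(\<lambda>t. C * log_weight \<epsilon> t) integrable_on UNIV"
      using integrable_on_mult_right[OF integrable_log_weight[OF C(2)]] by blast
  qed (use C in auto)
qed

lemma strip_decay_subset: "strip_decay \<omega> p \<Longrightarrow> \<omega>' \<le> \<omega> \<Longrightarrow> strip_decay \<omega>' p"
  by (elim strip_decayE, rule strip_decayI) (auto elim: holomorphic_on_subset)

lemma strip_decay_mult_bounded:
  assumes "strip_decay \<omega> p" "q holomorphic_on {w. \<bar>Im w\<bar> < \<omega>}" "\<And>w. \<bar>Im w\<bar> < \<omega> \<Longrightarrow> cmod (q w) \<le> B"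
  shows "strip_decay \<omega> (\<lambda>w. p w * q w)"
proof -
  obtain C \<epsilon> where C: "C \<ge> 0" "\<epsilon> > 0" "\<And>w. \<bar>Im w\<bar> < \<omega> \<Longrightarrow> cmod (p w) \<le> C * log_weight \<epsilon> (Re w)"
    using assms(1) by (auto simp: strip_decay_def)
  have "cmod (p w * q w) \<le> (C * \<bar>B\<bar>) * log_weight \<epsilon> (Re w)" if "\<bar>Im w\<bar> < \<omega>" for w
  proof -
    have "cmod (p w * q w) \<le> (C * log_weight \<epsilon> (Re w)) * \<bar>B\<bar>"
      unfolding norm_mult using C that assms(3)[OF that] by (intro mult_mono) auto
    then show ?thesis by (simp add: mult_ac)
  qed
  moreover have "(\<lambda>w. p w * q w) holomorphic_on {w. \<bar>Im w\<bar> < \<omega>}"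
    using assms by (intro holomorphic_intros) (auto simp: strip_decay_def)
  ultimately show ?thesis using C(1,2) by (intro strip_decayI[of _ \<omega> "C * \<bar>B\<bar>" \<epsilon>]) simp_all
qed

lemma strip_decay_bounded:
  assumes "strip_decay \<omega> p"
  obtains B where "\<And>w. \<bar>Im w\<bar> < \<omega> \<Longrightarrow> cmod (p w) \<le> B"
proof -
  obtain C \<epsilon> where C: "C \<ge> 0" "\<epsilon> > 0" "\<And>w. \<bar>Im w\<bar> < \<omega> \<Longrightarrow> cmod (p w) \<le> C * log_weight \<epsilon> (Re w)"
    using assms by (auto simp: strip_decay_def)
  have w: "log_weight \<epsilon> t \<le> 1" for t
    using powr_mono[of "- 1 - \<epsilon>" 0 "1 + \<bar>t\<bar>"] C(2) by (simp add: log_weight_def add_nonneg_eq_0_iff)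
  have "cmod (p w) \<le> C" if "\<bar>Im w\<bar> < \<omega>" for w
    using C(3)[OF that] mult_left_mono[OF w[of "Re w"] C(1)] by simp
  then show ?thesis using that by blast
qed

lemma strip_decay_mult:
  assumes "strip_decay \<omega> p" "strip_decay \<omega> q"
  shows "strip_decay \<omega> (\<lambda>w. p w * q w)"
proof -
  obtain B where "\<And>w. \<bar>Im w\<bar> < \<omega> \<Longrightarrow> cmod (q w) \<le> B" by (rule strip_decay_bounded[OF assms(2)]) blast
  then show ?thesis using assms by (intro strip_decay_mult_bounded[where B = B]) (auto simp: strip_decay_def)
qed

context zero_sectorial_operator
begin

text \<open>The integral over one boundary ray of the sector of half angle \<open>\<bar>\<phi>\<bar>\<close>, with \<open>k\<close> a function of \<open>w = log \<lambda>\<close>;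
  the factor \<open>exp w\<close> comes from \<open>d\<lambda> = \<lambda> dw\<close>.\<close>

definition res_int :: "(complex \<Rightarrow> complex) \<Rightarrow> real \<Rightarrow> 'a \<Rightarrow> 'a" where
  "res_int k \<phi> x = integral UNIV (\<lambda>t. (k (log_ray \<phi> t) * exp (log_ray \<phi> t)) *\<^sub>C resolvent A (exp (log_ray \<phi> t)) x)"

definition log_calc :: "real \<Rightarrow> (complex \<Rightarrow> complex) \<Rightarrow> 'a \<Rightarrow> 'a" where
  "log_calc \<sigma> p x = (1 / (2 * complex_of_real pi * \<i>)) *\<^sub>C (res_int p (- \<sigma>) x - res_int p \<sigma> x)"

lemma contour_calc_eq_log_calc: "contour_calc \<sigma> A f x = log_calc \<sigma> (\<lambda>w. f (exp w)) x"
  by (simp add: contour_calc_def log_calc_def ray_integral_def res_int_def log_ray_def Let_def)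

lemma cos_less_one: "0 < \<bar>\<phi>\<bar> \<Longrightarrow> \<bar>\<phi>\<bar> \<le> pi \<Longrightarrow> cos \<phi> < 1"
  using cos_monotone_0_pi[of 0 "\<bar>\<phi>\<bar>"] by simp

lemma exp_off_axis: "0 < \<bar>Im w\<bar> \<Longrightarrow> \<bar>Im w\<bar> \<le> pi \<Longrightarrow> Re (exp w) < cmod (exp w)"
  using cos_less_one[of "Im w"] by (simp add: Re_exp)

text \<open>Sectoriality says precisely that \<open>\<lambda> (\<lambda> - A)\<^sup>-\<^sup>1\<close> is bounded on the rays, so that in the logarithmic
  variable the integrand is dominated by the multiplier alone.\<close>

lemma scaled_resolvent_bound:
  assumes "0 < \<delta>" "\<delta> < pi"
  obtains K where "K \<ge> 0" "\<And>w c x. cos (Im w) \<le> cos \<delta> \<Longrightarrow> norm ((c * exp w) *\<^sub>C resolvent A (exp w) x) \<le> cmod c * (K * norm x)"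
proof -
  obtain K where K: "K \<ge> 0" "\<And>z x. z \<noteq> 0 \<Longrightarrow> Re z \<le> cmod z * cos \<delta> \<Longrightarrow> cmod z * norm (resolvent A z x) \<le> K * norm x"
    by (rule resolvent_bound[OF assms]) blast
  show ?thesis
  proof (rule that[OF K(1)])
    fix w c x assume "cos (Im w) \<le> cos \<delta>"
    then have "cmod (exp w) * norm (resolvent A (exp w) x) \<le> K * norm x"
      by (intro K(2) Re_exp_le) auto
    then show "norm ((c * exp w) *\<^sub>C resolvent A (exp w) x) \<le> cmod c * (K * norm x)"
      unfolding norm_scaleC norm_mult mult.assoc by (rule mult_left_mono) simp
  qed
qed

lemma cont_resolvent_ray:
  assumes "0 < \<bar>\<phi>\<bar>" "\<bar>\<phi>\<bar> \<le> pi"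
  shows "continuous_on UNIV (\<lambda>t. resolvent A (exp (log_ray \<phi> t)) x)"
proof (intro continuous_at_imp_continuous_on ballI)
  fix t
  have "isCont (\<lambda>z. resolvent A z x) (exp (log_ray \<phi> t))"
    using assms by (intro isCont_resolvent_apply exp_off_axis) auto
  moreover have "isCont (\<lambda>t. exp (log_ray \<phi> t)) t" unfolding log_ray_def by (intro continuous_intros)
  ultimately show "isCont (\<lambda>t. resolvent A (exp (log_ray \<phi> t)) x) t"
    using isCont_o2 by blast
qed

lemma res_int_integrable_bound:
  assumes \<phi>: "0 < \<bar>\<phi>\<bar>" "\<bar>\<phi>\<bar> < pi" and k: "ray_decay \<phi> k"
  shows "(\<lambda>t. (k (log_ray \<phi> t) * exp (log_ray \<phi> t)) *\<^sub>C resolvent A (exp (log_ray \<phi> t)) x) integrable_on UNIV"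
    and "\<exists>K. \<forall>x. norm (res_int k \<phi> x) \<le> norm x * K"
proof -
  obtain C \<epsilon> where C: "C \<ge> 0" "\<epsilon> > 0" "\<And>t. cmod (k (log_ray \<phi> t)) \<le> C * log_weight \<epsilon> t"
    and c: "continuous_on UNIV (\<lambda>t. k (log_ray \<phi> t))"
    using k by (auto simp: ray_decay_def)
  obtain K where K: "K \<ge> 0" "\<And>w c x. cos (Im w) \<le> cos \<bar>\<phi>\<bar> \<Longrightarrow> norm ((c * exp w) *\<^sub>C resolvent A (exp w) x) \<le> cmod c * (K * norm x)"
    by (rule scaled_resolvent_bound[OF \<phi>]) blast
  let ?F = "\<lambda>x t. (k (log_ray \<phi> t) * exp (log_ray \<phi> t)) *\<^sub>C resolvent A (exp (log_ray \<phi> t)) x"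
  have cont: "continuous_on UNIV (?F x)" for x
    by (intro scaleC.continuous_on continuous_intros c cont_resolvent_ray) (use \<phi> in auto)
  have ii: "?F x integrable_on {a..b}" for x a b
    by (intro integrable_continuous_real continuous_on_subset[OF cont]) auto
  have bd: "norm (?F x t) \<le> (C * (K * norm x)) * log_weight \<epsilon> t" for x t
  proof -
    have "norm (?F x t) \<le> cmod (k (log_ray \<phi> t)) * (K * norm x)" by (rule K(2)) simp
    also have "\<dots> \<le> (C * log_weight \<epsilon> t) * (K * norm x)" using C(3) K(1) by (intro mult_right_mono) auto
    finally show ?thesis by (simp add: mult_ac)
  qed
  have wi: "(\<lambda>t. (C * (K * norm x)) * log_weight \<epsilon> t) integrable_on UNIV" for x
    using integrable_on_mult_right[OF integrable_log_weight[OF C(2)]] by blast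
  show i: "?F x integrable_on UNIV" for x by (rule integrable_on_UNIV_dominated[OF ii wi bd])
  have "norm (res_int k \<phi> x) \<le> integral UNIV (\<lambda>t. (C * (K * norm x)) * log_weight \<epsilon> t)" for x
    unfolding res_int_def by (rule integral_norm_bound_integral[OF i wi bd])
  then have "norm (res_int k \<phi> x) \<le> norm x * (C * K * integral UNIV (log_weight \<epsilon>))" for x
    by (simp add: mult_ac)
  then show "\<exists>K. \<forall>x. norm (res_int k \<phi> x) \<le> norm x * K" by blast
qed

lemma bounded_linear_res_int:
  assumes \<phi>: "0 < \<bar>\<phi>\<bar>" "\<bar>\<phi>\<bar> < pi" and k: "ray_decay \<phi> k"
  shows "bounded_linear (res_int k \<phi>)" and "res_int k \<phi> (c *\<^sub>C x) = c *\<^sub>C res_int k \<phi> x"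
proof -
  have R: "bounded_linear (resolvent A (exp (log_ray \<phi> t)))" for t
    using \<phi> by (intro bounded_linear_resolvent exp_off_axis) auto
  have add: "res_int k \<phi> (x + y) = res_int k \<phi> x + res_int k \<phi> y" for x y
    unfolding res_int_def
    by (subst integral_add[symmetric, OF res_int_integrable_bound(1)[OF assms] res_int_integrable_bound(1)[OF assms]])
      (simp add: linear_simps[OF R] scaleC.add_right)
  have scC: "res_int k \<phi> (c *\<^sub>C x) = c *\<^sub>C res_int k \<phi> x" for c x
  proof -
    have Rc: "resolvent A (exp (log_ray \<phi> t)) (c *\<^sub>C x) = c *\<^sub>C resolvent A (exp (log_ray \<phi> t)) x" for t
      using \<phi> by (intro resolvent_scaleC exp_off_axis) auto
    show ?thesis unfolding res_int_def
      using integral_linear[OF res_int_integrable_bound(1)[OF assms, of x] scaleC.bounded_linear_right[of c]]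
      by (simp add: o_def Rc scaleC_scaleC mult_ac)
  qed
  show "res_int k \<phi> (c *\<^sub>C x) = c *\<^sub>C res_int k \<phi> x" by (rule scC)
  obtain K where "\<And>x. norm (res_int k \<phi> x) \<le> norm x * K"
    using res_int_integrable_bound(2)[OF assms] by blast
  then show "bounded_linear (res_int k \<phi>)"
    by (intro bounded_linear_intro[where K = K] add) (auto simp: scaleR_scaleC scC)
qed

lemma res_int_add:
  assumes \<phi>: "0 < \<bar>\<phi>\<bar>" "\<bar>\<phi>\<bar> < pi" and k: "ray_decay \<phi> k" and l: "ray_decay \<phi> l"
  shows "res_int (\<lambda>w. k w + l w) \<phi> x = res_int k \<phi> x + res_int l \<phi> x"
  unfolding res_int_def
  by (subst integral_add[symmetric, OF res_int_integrable_bound(1)[OF \<phi> k] res_int_integrable_bound(1)[OF \<phi> l]])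
    (simp add: distrib_right scaleC.add_left)

lemma res_int_cmult:
  assumes \<phi>: "0 < \<bar>\<phi>\<bar>" "\<bar>\<phi>\<bar> < pi" and k: "ray_decay \<phi> k"
  shows "res_int (\<lambda>w. c * k w) \<phi> x = c *\<^sub>C res_int k \<phi> x"
  unfolding res_int_def
  using integral_linear[OF res_int_integrable_bound(1)[OF assms, of x] scaleC.bounded_linear_right[of c]]
  by (simp add: o_def scaleC_scaleC mult_ac)

text \<open>The contour may be moved as long as it does not cross the spectrum, which lies on the line of height 0.\<close>

lemma res_int_shift:
  assumes p: "strip_decay \<omega> p" and \<omega>: "\<omega> \<le> pi" and ab: "a \<le> b" "-\<omega> < a" "b < \<omega>" "0 < a \<or> b < 0"
  shows "res_int p a x = res_int p b x"
proof -
  obtain C \<epsilon> where C: "C \<ge> 0" "\<epsilon> > 0" "\<And>w. \<bar>Im w\<bar> < \<omega> \<Longrightarrow> cmod (p w) \<le> C * log_weight \<epsilon> (Re w)"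
    and hol: "p holomorphic_on {w. \<bar>Im w\<bar> < \<omega>}"
    using p by (auto simp: strip_decay_def)
  define \<delta> where "\<delta> = min \<bar>a\<bar> \<bar>b\<bar>"
  have \<delta>: "0 < \<delta>" "\<delta> < pi" using ab \<omega> by (auto simp: \<delta>_def)
  have Im: "0 < \<bar>Im w\<bar>" "\<bar>Im w\<bar> < \<omega>" "\<bar>Im w\<bar> \<le> pi" "\<delta> \<le> \<bar>Im w\<bar>" if "a \<le> Im w" "Im w \<le> b" for w
    using that ab \<omega> by (auto simp: \<delta>_def)
  have cosIm: "cos (Im w) \<le> cos \<delta>" if "a \<le> Im w" "Im w \<le> b" for w
    using cos_monotone_0_pi_le[of \<delta> "\<bar>Im w\<bar>"] Im[OF that] \<delta> by simp
  obtain K where K: "K \<ge> 0" "\<And>w c x. cos (Im w) \<le> cos \<delta> \<Longrightarrow> norm ((c * exp w) *\<^sub>C resolvent A (exp w) x) \<le> cmod c * (K * norm x)"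
    by (rule scaled_resolvent_bound[OF \<delta>]) blast
  define q where "q w = p w * exp w" for w
  have qhol: "q holomorphic_on {w. \<bar>Im w\<bar> < \<omega>}" unfolding q_def by (intro holomorphic_intros hol)
  define H' where "H' w = deriv q w *\<^sub>C resolvent A (exp w) x
      + q w *\<^sub>C (exp w *\<^sub>C (- resolvent A (exp w) (resolvent A (exp w) x)))" for w
  have "integral UNIV (\<lambda>t. q (of_real t + \<i> * of_real a) *\<^sub>C resolvent A (exp (of_real t + \<i> * of_real a)) x) =
      integral UNIV (\<lambda>t. q (of_real t + \<i> * of_real b) *\<^sub>C resolvent A (exp (of_real t + \<i> * of_real b)) x)"
  proof (rule strip_integral_shift[where H' = H' and \<beta> = "\<lambda>t. (C * (K * norm x)) * log_weight \<epsilon> t", OF ab(1)])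
    fix w assume w: "a \<le> Im w" "Im w \<le> b"
    have off: "Re (exp w) < cmod (exp w)" by (intro exp_off_axis Im[OF w])
    have dq: "(q has_derivative (\<lambda>d. d * deriv q w)) (at w)"
      using holomorphic_derivI[OF qhol open_strip, of w] Im[OF w]
      by (simp add: has_field_derivative_def mult.commute[of _ "deriv q w"])
    have de: "(exp has_derivative (\<lambda>d. d * exp w)) (at w)"
      using DERIV_exp[of w] by (simp add: has_field_derivative_def mult.commute[of _ "exp w"])
    have "((\<lambda>w. resolvent A (exp w) x) has_derivative
        (\<lambda>d. (d * exp w) *\<^sub>C (- resolvent A (exp w) (resolvent A (exp w) x)))) (at w)"
      using has_derivative_compose[OF de resolvent_has_derivative[OF off]] by simp
    from scaleC.FDERIV[OF dq this]
    show "((\<lambda>w. q w *\<^sub>C resolvent A (exp w) x) has_derivative (\<lambda>d. d *\<^sub>C H' w)) (at w)"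
      by (rule has_derivative_eq_rhs) (simp add: fun_eq_iff H'_def scaleC.add_right scaleC_scaleC mult_ac add.commute)
    show "norm (q w *\<^sub>C resolvent A (exp w) x) \<le> (C * (K * norm x)) * log_weight \<epsilon> (Re w)"
    proof -
      have "norm (q w *\<^sub>C resolvent A (exp w) x) \<le> cmod (p w) * (K * norm x)"
        unfolding q_def by (rule K(2)[OF cosIm[OF w]])
      also have "\<dots> \<le> (C * log_weight \<epsilon> (Re w)) * (K * norm x)"
        using C(3)[of w] Im[OF w] K(1) by (intro mult_right_mono) auto
      finally show ?thesis by (simp add: mult_ac)
    qed
  next
    show "continuous_on {w. a \<le> Im w \<and> Im w \<le> b} H'"
    proof (intro continuous_at_imp_continuous_on ballI)
      fix w assume "w \<in> {w. a \<le> Im w \<and> Im w \<le> b}"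
      then have w: "a \<le> Im w" "Im w \<le> b" by auto
      have off: "Re (exp w) < cmod (exp w)" by (intro exp_off_axis Im[OF w])
      have c1: "isCont (deriv q) w" "isCont q w"
        using holomorphic_on_imp_continuous_on[OF holomorphic_deriv[OF qhol open_strip]]
          holomorphic_on_imp_continuous_on[OF qhol] Im[OF w] open_strip[of \<omega>]
        by (auto simp: continuous_on_eq_continuous_at)
      have c2: "isCont (\<lambda>w. resolvent A (exp w) x) w"
        by (rule isCont_o2[of _ exp]) (auto intro!: isCont_resolvent_apply off)
      have c3: "isCont (\<lambda>w. resolvent A (exp w) (resolvent A (exp w) x)) w"
        by (rule isCont_o2[of _ exp "\<lambda>z. resolvent A z (resolvent A z x)"]) (auto intro!: isCont_resolvent_apply off)
      show "isCont H' w" unfolding H'_def[abs_def]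
        by (intro continuous_intros scaleC.isCont c1 c2 c3)
    qed
    show "(\<lambda>t. C * (K * norm x) * log_weight \<epsilon> t) integrable_on UNIV"
      using integrable_on_mult_right[OF integrable_log_weight[OF C(2)]] by blast
    show "((\<lambda>t. C * (K * norm x) * log_weight \<epsilon> t) \<longlongrightarrow> 0) at_top"
      "((\<lambda>t. C * (K * norm x) * log_weight \<epsilon> t) \<longlongrightarrow> 0) at_bot"
      using log_weight_tendsto[OF C(2)] by (auto intro: tendsto_mult_right_zero)
  qed
  then show ?thesis by (simp add: res_int_def q_def log_ray_def)
qed

lemma log_calc_angle:
  assumes p: "strip_decay \<omega> p" and \<omega>: "\<omega> \<le> pi" and "0 < \<sigma>" "\<sigma> < \<omega>" "0 < \<sigma>'" "\<sigma>' < \<omega>"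
  shows "log_calc \<sigma> p x = log_calc \<sigma>' p x"
proof -
  have *: "log_calc \<sigma> p x = log_calc \<sigma>' p x" if "\<sigma> \<le> \<sigma>'" "0 < \<sigma>" "\<sigma>' < \<omega>" for \<sigma> \<sigma>'
  proof -
    have 1: "res_int p (-\<sigma>') x = res_int p (-\<sigma>) x"
      by (rule res_int_shift[OF p \<omega>]) (use that in auto)
    have 2: "res_int p \<sigma> x = res_int p \<sigma>' x"
      by (rule res_int_shift[OF p \<omega>]) (use that in auto)
    show ?thesis unfolding log_calc_def 1 2 ..
  qed
  show ?thesis
  proof (cases "\<sigma> \<le> \<sigma>'")
    case True
    then show ?thesis by (rule *) (use assms in auto)
  next
    case False
    then have "\<sigma>' \<le> \<sigma>" by simp
    then show ?thesis by (rule *[symmetric]) (use assms in auto)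
  qed
qed

end

section \<open>Multiplicativity of the contour calculus\<close>

context zero_sectorial_operator
begin

lemma log_calc_bounded_linear:
  assumes p: "strip_decay \<omega> p" and "\<omega> \<le> pi" "0 < \<sigma>" "\<sigma> < \<omega>"
  shows "bounded_linear (log_calc \<sigma> p)" and "log_calc \<sigma> p (c *\<^sub>C x) = c *\<^sub>C log_calc \<sigma> p x"
proof -
  have rd: "ray_decay \<sigma> p" "ray_decay (-\<sigma>) p"
    using assms by (auto intro!: strip_decay_imp_ray_decay[OF p])
  have b: "bounded_linear (res_int p (-\<sigma>))" "bounded_linear (res_int p \<sigma>)"
    using rd assms by (auto intro!: bounded_linear_res_int(1))
  show "bounded_linear (log_calc \<sigma> p)" unfolding log_calc_def[abs_def]
    by (intro bounded_linear_compose[OF scaleC.bounded_linear_right] bounded_linear_sub b)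
  have "res_int p (-\<sigma>) (c *\<^sub>C x) = c *\<^sub>C res_int p (-\<sigma>) x" "res_int p \<sigma> (c *\<^sub>C x) = c *\<^sub>C res_int p \<sigma> x"
    using rd assms by (auto intro!: bounded_linear_res_int(2))
  then show "log_calc \<sigma> p (c *\<^sub>C x) = c *\<^sub>C log_calc \<sigma> p x"
    by (simp add: log_calc_def scaleC_scaleC scaleC.diff_right[symmetric] mult.commute)
qed

lemma log_calc_add:
  assumes p: "strip_decay \<omega> p" and q: "strip_decay \<omega> q" and "\<omega> \<le> pi" "0 < \<sigma>" "\<sigma> < \<omega>"
  shows "log_calc \<sigma> (\<lambda>w. p w + q w) x = log_calc \<sigma> p x + log_calc \<sigma> q x"
proof -
  have rd: "ray_decay \<sigma> p" "ray_decay (-\<sigma>) p" "ray_decay \<sigma> q" "ray_decay (-\<sigma>) q"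
    using assms by (auto intro!: strip_decay_imp_ray_decay[OF p] strip_decay_imp_ray_decay[OF q])
  have e1: "res_int (\<lambda>w. p w + q w) (-\<sigma>) x = res_int p (-\<sigma>) x + res_int q (-\<sigma>) x"
    by (rule res_int_add) (use rd assms in auto)
  have e2: "res_int (\<lambda>w. p w + q w) \<sigma> x = res_int p \<sigma> x + res_int q \<sigma> x"
    by (rule res_int_add) (use rd assms in auto)
  show ?thesis unfolding log_calc_def e1 e2 scaleC.add_right[symmetric] by (simp add: algebra_simps)
qed

lemma log_calc_cmult:
  assumes p: "strip_decay \<omega> p" and "\<omega> \<le> pi" "0 < \<sigma>" "\<sigma> < \<omega>"
  shows "log_calc \<sigma> (\<lambda>w. c * p w) x = c *\<^sub>C log_calc \<sigma> p x"
proof -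
  have rd: "ray_decay \<sigma> p" "ray_decay (-\<sigma>) p"
    using assms by (auto intro!: strip_decay_imp_ray_decay[OF p])
  have e1: "res_int (\<lambda>w. c * p w) (-\<sigma>) x = c *\<^sub>C res_int p (-\<sigma>) x"
    by (rule res_int_cmult) (use rd assms in auto)
  have e2: "res_int (\<lambda>w. c * p w) \<sigma> x = c *\<^sub>C res_int p \<sigma> x"
    by (rule res_int_cmult) (use rd assms in auto)
  show ?thesis unfolding log_calc_def e1 e2 scaleC.diff_right[symmetric] by (simp add: scaleC_scaleC mult.commute)
qed

text \<open>Inserting the resolvent under the integral and splitting it by the resolvent identity leaves the
  multiplier \<open>k w / (exp w0 - exp w)\<close> and a scalar Cauchy integral times the resolvent at \<open>exp w0\<close>.\<close>

lemma resolvent_res_int: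
  assumes \<phi>: "0 < \<bar>\<phi>\<bar>" "\<bar>\<phi>\<bar> < pi" and k: "ray_decay \<phi> k"
    and w0: "0 < \<bar>Im w0\<bar>" "\<bar>Im w0\<bar> \<le> pi" and out: "cos (\<phi> - Im w0) \<le> cos \<delta>" "sin \<delta> > 0"
  shows "resolvent A (exp w0) (res_int k \<phi> x) =
    res_int (\<lambda>w. k w / (exp w0 - exp w)) \<phi> x
    - integral UNIV (\<lambda>t. k (log_ray \<phi> t) * exp (log_ray \<phi> t) / (exp w0 - exp (log_ray \<phi> t))) *\<^sub>C resolvent A (exp w0) x"
    and "ray_decay \<phi> (\<lambda>w. k w / (exp w0 - exp w))"
    and "ray_decay \<phi> (\<lambda>w. k w * (exp w / (exp w0 - exp w)))"
proof -
  let ?m = "exp w0" and ?l = "\<lambda>t. exp (log_ray \<phi> t)"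
  have neq: "?l t \<noteq> ?m" and kb: "cmod (?l t / (?l t - ?m)) \<le> 1 / sin \<delta>" for t
    using exp_kernel_bound[of "log_ray \<phi> t" w0 \<delta>] out by auto
  have neq': "?m - ?l t \<noteq> 0" for t using neq[of t] by simp
  have cr: "continuous_on UNIV (\<lambda>t. ?l t / (?m - ?l t))"
    by (intro continuous_intros ballI neq' continuous_on_exp)
  have kb': "cmod (?l t / (?m - ?l t)) \<le> 1 / sin \<delta>" for t
    using kb[of t] by (simp add: norm_divide norm_minus_commute)
  show rd1: "ray_decay \<phi> (\<lambda>w. k w * (exp w / (?m - exp w)))"
    by (rule ray_decay_mult_bounded[OF k cr kb'])
  show rd2: "ray_decay \<phi> (\<lambda>w. k w / (?m - exp w))"
  proof -
    have kb2: "cmod (1 / (?m - ?l t)) \<le> (1 / sin \<delta>) / cmod ?m" for t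
    proof -
      have "cos (Im w0 - Im (log_ray \<phi> t)) \<le> cos \<delta>"
        using out(1) cos_minus[of "\<phi> - Im w0"] by simp
      from exp_kernel_bound(2)[OF this out(2)]
      have "cmod ?m / cmod (?m - ?l t) \<le> 1 / sin \<delta>" by (simp only: norm_divide)
      then have "(cmod ?m / cmod (?m - ?l t)) / cmod ?m \<le> (1 / sin \<delta>) / cmod ?m"
        by (rule divide_right_mono) simp
      then show ?thesis by (simp add: norm_divide)
    qed
    have "continuous_on UNIV (\<lambda>t. 1 / (?m - ?l t))"
      by (intro continuous_intros ballI neq' continuous_on_exp)
    from ray_decay_mult_bounded[OF k, of "\<lambda>w. 1 / (?m - exp w)", OF this kb2]
    show ?thesis by simp
  qed
  have offm: "Re ?m < cmod ?m" by (rule exp_off_axis[OF w0])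
  have offl: "Re (?l t) < cmod (?l t)" for t using \<phi> by (intro exp_off_axis) auto
  note R = bounded_linear_resolvent[OF offm]
  have rho_log: "resolvent A ?m (resolvent A (?l t) x) = (1 / (?m - ?l t)) *\<^sub>C (resolvent A (?l t) x - resolvent A ?m x)" for t
  proof -
    have "resolvent A (?l t) x - resolvent A ?m x = - (resolvent A ?m x - resolvent A (?l t) x)" by simp
    also have "\<dots> = (?m - ?l t) *\<^sub>C resolvent A ?m (resolvent A (?l t) x)"
      unfolding resolvent_identity[OF offm offl] by (metis minus_diff_eq scaleC.minus_left)
    finally show ?thesis using neq[of t] by (simp add: scaleC_scaleC)
  qed
  have int1: "(\<lambda>t. (k (log_ray \<phi> t) / (?m - ?l t) * ?l t) *\<^sub>C resolvent A (?l t) x) integrable_on UNIV"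
    by (rule res_int_integrable_bound(1)[OF \<phi> rd2])
  have int2: "(\<lambda>t. k (log_ray \<phi> t) * ?l t / (?m - ?l t)) integrable_on UNIV"
    using ray_decay_integrable[OF rd1] by simp
  have "resolvent A ?m (res_int k \<phi> x) = integral UNIV (\<lambda>t. resolvent A ?m ((k (log_ray \<phi> t) * ?l t) *\<^sub>C resolvent A (?l t) x))"
    unfolding res_int_def using integral_linear[OF res_int_integrable_bound(1)[OF \<phi> k] R, of x] by (simp add: o_def)
  also have "\<dots> = integral UNIV (\<lambda>t. (k (log_ray \<phi> t) / (?m - ?l t) * ?l t) *\<^sub>C resolvent A (?l t) x
      - (k (log_ray \<phi> t) * ?l t / (?m - ?l t)) *\<^sub>C resolvent A ?m x)"
    by (simp add: resolvent_scaleC[OF offm] rho_log scaleC_scaleC scaleC.diff_right)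
  also have "\<dots> = res_int (\<lambda>w. k w / (?m - exp w)) \<phi> x
     - integral UNIV (\<lambda>t. (k (log_ray \<phi> t) * ?l t / (?m - ?l t)) *\<^sub>C resolvent A ?m x)"
    unfolding res_int_def
    by (rule integral_diff[OF int1 integrable_linear[OF int2 scaleC.bounded_linear_left, unfolded o_def]])
  also have "integral UNIV (\<lambda>t. (k (log_ray \<phi> t) * ?l t / (?m - ?l t)) *\<^sub>C resolvent A ?m x)
     = integral UNIV (\<lambda>t. k (log_ray \<phi> t) * ?l t / (?m - ?l t)) *\<^sub>C resolvent A ?m x"
    using integral_linear[OF int2 scaleC.bounded_linear_left] by (simp add: o_def)
  finally show "resolvent A ?m (res_int k \<phi> x) =
    res_int (\<lambda>w. k w / (?m - exp w)) \<phi> x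
    - integral UNIV (\<lambda>t. k (log_ray \<phi> t) * ?l t / (?m - ?l t)) *\<^sub>C resolvent A ?m x" .
qed

text \<open>The resolvent at a point outside the contour acts as the multiplier \<open>1 / (\<lambda>\<^sub>0 - \<lambda>)\<close>: the two scalar
  Cauchy integrals of \<open>resolvent_res_int\<close> are equal and cancel in the difference of the two rays.\<close>

lemma resolvent_log_calc:
  assumes p: "strip_decay \<omega> p" and \<omega>: "\<omega> \<le> pi" and \<sigma>: "0 < \<sigma>" "\<sigma> < \<omega>"
    and w0: "0 < \<bar>Im w0\<bar>" "\<bar>Im w0\<bar> \<le> pi"
    and out: "\<And>s. \<bar>s\<bar> \<le> \<sigma> \<Longrightarrow> cos (s - Im w0) \<le> cos \<delta>" and \<delta>: "sin \<delta> > 0"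
  shows "resolvent A (exp w0) (log_calc \<sigma> p x) = log_calc \<sigma> (\<lambda>w. p w / (exp w0 - exp w)) x"
proof -
  have offm: "Re (exp w0) < cmod (exp w0)" by (rule exp_off_axis[OF w0])
  have rd: "ray_decay \<sigma> p" "ray_decay (-\<sigma>) p"
    using \<sigma> by (auto intro!: strip_decay_imp_ray_decay[OF p])
  obtain C \<epsilon> where C: "p holomorphic_on {w. \<bar>Im w\<bar> < \<omega>}" "C \<ge> 0" "\<epsilon> > 0"
    "\<And>w. \<bar>Im w\<bar> < \<omega> \<Longrightarrow> cmod (p w) \<le> C * log_weight \<epsilon> (Re w)" by (rule strip_decayE[OF p]) blast
  define I where "I \<phi> = integral UNIV (\<lambda>t. p (log_ray \<phi> t) * exp (log_ray \<phi> t) / (exp w0 - exp (log_ray \<phi> t)))" for \<phi>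
  have "I (-\<sigma>) = I \<sigma>"
  proof -
    have "integral UNIV (\<lambda>t. p (log_ray \<phi> t) * exp (log_ray \<phi> t) / (exp (log_ray \<phi> t) - exp w0)) = - I \<phi>" for \<phi>
    proof -
      have "- I \<phi> = integral UNIV (\<lambda>t. - (p (log_ray \<phi> t) * exp (log_ray \<phi> t) / (exp w0 - exp (log_ray \<phi> t))))"
        unfolding I_def by simp
      also have "\<dots> = integral UNIV (\<lambda>t. p (log_ray \<phi> t) * exp (log_ray \<phi> t) / (exp (log_ray \<phi> t) - exp w0))"
        by (metis (no_types, lifting) minus_diff_eq minus_divide_right)
      finally show ?thesis ..
    qed
    note * = this
    have "integral UNIV (\<lambda>t. p (log_ray (-\<sigma>) t) * exp (log_ray (-\<sigma>) t) / (exp (log_ray (-\<sigma>) t) - exp w0)) =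
       integral UNIV (\<lambda>t. p (log_ray \<sigma> t) * exp (log_ray \<sigma> t) / (exp (log_ray \<sigma> t) - exp w0))"
      using cauchy_kernel_outside[OF C(1) \<sigma> C(4,3,2) out \<delta>]
      by (simp add: Let_def log_ray_def)
    then show ?thesis unfolding * by simp
  qed
  have e: "resolvent A (exp w0) (res_int p \<phi> x) = res_int (\<lambda>w. p w / (exp w0 - exp w)) \<phi> x - I \<phi> *\<^sub>C resolvent A (exp w0) x"
    if "\<bar>\<phi>\<bar> = \<sigma>" "ray_decay \<phi> p" for \<phi>
    unfolding I_def using that \<sigma> \<omega> by (intro resolvent_res_int(1)[where \<delta> = \<delta>] w0 out \<delta>) auto
  have "resolvent A (exp w0) (log_calc \<sigma> p x) = (1 / (2 * complex_of_real pi * \<i>)) *\<^sub>C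
      (resolvent A (exp w0) (res_int p (- \<sigma>) x) - resolvent A (exp w0) (res_int p \<sigma> x))"
    unfolding log_calc_def resolvent_scaleC[OF offm] using bounded_linear_resolvent[OF offm] by (simp add: linear_simps)
  also have "resolvent A (exp w0) (res_int p (- \<sigma>) x) - resolvent A (exp w0) (res_int p \<sigma> x) =
      res_int (\<lambda>w. p w / (exp w0 - exp w)) (-\<sigma>) x - res_int (\<lambda>w. p w / (exp w0 - exp w)) \<sigma> x"
    using e[OF _ rd(1)] e[OF _ rd(2)] \<sigma>(1) \<open>I (-\<sigma>) = I \<sigma>\<close> by simp
  finally show ?thesis by (simp only: log_calc_def)
qed

text \<open>Both weights decay, and the kernel \<open>exp w / (exp w - exp w')\<close> is bounded when the rays have different
  angles, so the integrand is dominated by a product.\<close>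

lemma res_int_swap:
  fixes x :: 'a
  assumes \<phi>: "\<bar>\<phi>\<bar> = \<sigma>2" and \<psi>: "\<bar>\<psi>\<bar> = \<sigma>1" and \<sigma>: "0 < \<sigma>1" "\<sigma>1 < \<sigma>2" "\<sigma>2 < pi / 2"
    and p: "ray_decay \<phi> p" and q: "ray_decay \<psi> q"
  defines "K \<equiv> \<lambda>t s. (p (log_ray \<phi> t) * exp (log_ray \<phi> t) *
      (q (log_ray \<psi> s) / (exp (log_ray \<phi> t) - exp (log_ray \<psi> s)) * exp (log_ray \<psi> s))) *\<^sub>C resolvent A (exp (log_ray \<psi> s)) x"
  shows "(\<lambda>t. integral UNIV (K t)) integrable_on UNIV"
    and "(\<lambda>s. integral UNIV (\<lambda>t. K t s)) integrable_on UNIV"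
    and "integral UNIV (\<lambda>t. integral UNIV (K t)) = integral UNIV (\<lambda>s. integral UNIV (\<lambda>t. K t s))"
proof -
  define \<delta> where "\<delta> = \<sigma>2 - \<sigma>1"
  have \<delta>: "0 < \<delta>" "\<delta> < pi" using \<sigma> by (auto simp: \<delta>_def)
  have sd: "sin \<delta> > 0" using \<delta> by (rule sin_gt_zero)
  have cosd: "cos (\<phi> - \<psi>) \<le> cos \<delta>"
    using cos_monotone_0_pi_le[of \<delta> "\<bar>\<phi> - \<psi>\<bar>"] \<delta> \<phi> \<psi> \<sigma> by (simp add: \<delta>_def)
  have neq: "exp (log_ray \<phi> t) \<noteq> exp (log_ray \<psi> s)"
    and kb: "cmod (exp (log_ray \<phi> t) / (exp (log_ray \<phi> t) - exp (log_ray \<psi> s))) \<le> 1 / sin \<delta>" for t s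
    using exp_kernel_bound[of "log_ray \<phi> t" "log_ray \<psi> s" \<delta>] cosd sd by auto
  obtain C \<epsilon> where C: "C \<ge> 0" "\<epsilon> > 0" "\<And>t. cmod (p (log_ray \<phi> t)) \<le> C * log_weight \<epsilon> t"
    and c: "continuous_on UNIV (\<lambda>t. p (log_ray \<phi> t))"
    using p by (auto simp: ray_decay_def)
  obtain D \<eta> where D: "D \<ge> 0" "\<eta> > 0" "\<And>t. cmod (q (log_ray \<psi> t)) \<le> D * log_weight \<eta> t"
    and d: "continuous_on UNIV (\<lambda>t. q (log_ray \<psi> t))"
    using q by (auto simp: ray_decay_def)
  have \<psi>': "0 < \<bar>\<psi>\<bar>" "\<bar>\<psi>\<bar> < pi" using \<psi> \<sigma> by auto
  obtain L where L: "L \<ge> 0" "\<And>w c x. cos (Im w) \<le> cos \<bar>\<psi>\<bar> \<Longrightarrow> norm ((c * exp w) *\<^sub>C resolvent A (exp w) x) \<le> cmod c * (L * norm x)"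
    by (rule scaled_resolvent_bound[OF \<psi>']) blast
  have bd: "norm (K t s) \<le> (C / sin \<delta> * log_weight \<epsilon> t) * (D * (L * norm x) * log_weight \<eta> s)" for t s
  proof -
    let ?k = "exp (log_ray \<phi> t) / (exp (log_ray \<phi> t) - exp (log_ray \<psi> s))"
    have "K t s = ((p (log_ray \<phi> t) * ?k * q (log_ray \<psi> s)) * exp (log_ray \<psi> s)) *\<^sub>C resolvent A (exp (log_ray \<psi> s)) x"
      unfolding K_def by (simp add: mult_ac)
    also have "norm \<dots> \<le> cmod (p (log_ray \<phi> t) * ?k * q (log_ray \<psi> s)) * (L * norm x)"
      by (rule L(2)) simp
    also have "\<dots> \<le> ((C * log_weight \<epsilon> t) * (1 / sin \<delta>) * (D * log_weight \<eta> s)) * (L * norm x)"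
      unfolding norm_mult using C D L sd
      by (intro mult_right_mono mult_mono kb C(3) D(3)) auto
    finally show ?thesis by (simp add: mult_ac)
  qed
  have cc: "continuous_on UNIV (\<lambda>x. p (log_ray \<phi> (fst x)))" "continuous_on UNIV (\<lambda>x. q (log_ray \<psi> (snd x)))"
     "continuous_on UNIV (\<lambda>y. resolvent A (exp (log_ray \<psi> (snd y))) x)"
    "continuous_on UNIV (\<lambda>y. exp (log_ray \<psi> (snd y)))" "continuous_on UNIV (\<lambda>y. exp (log_ray \<phi> (fst y)))"
    by (rule continuous_on_compose2[OF c] continuous_on_compose2[OF d]
        continuous_on_compose2[OF cont_resolvent_ray[of \<psi> x]] continuous_on_compose2[OF continuous_on_exp[OF continuous_log_ray]]
        continuous_on_fst continuous_on_snd continuous_on_id subset_UNIV | (use \<psi>' in simp; fail))+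
  have cK: "continuous_on UNIV (\<lambda>(t, s). K t s)"
    unfolding K_def case_prod_unfold
    by (intro scaleC.continuous_on continuous_on_mult continuous_on_divide continuous_on_diff cc) (use neq in auto)
  have ca: "continuous_on UNIV (\<lambda>t. C / sin \<delta> * log_weight \<epsilon> t)" "continuous_on UNIV (\<lambda>s. D * (L * norm x) * log_weight \<eta> s)"
    by (intro continuous_intros continuous_log_weight)+
  have ia: "(\<lambda>t. C / sin \<delta> * log_weight \<epsilon> t) integrable_on UNIV" "(\<lambda>s. D * (L * norm x) * log_weight \<eta> s) integrable_on UNIV"
    using integrable_on_mult_right[OF integrable_log_weight[OF C(2)]] integrable_on_mult_right[OF integrable_log_weight[OF D(2)]] by blast+
  have nn: "0 \<le> C / sin \<delta> * log_weight \<epsilon> t" "0 \<le> D * (L * norm x) * log_weight \<eta> s" for t s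
    using C(1) D(1) L(1) sd by auto
  note sw = integral_swap_UNIV_dominated[OF cK ca(1) ia(1) ca(2) ia(2) bd nn]
  show "(\<lambda>t. integral UNIV (K t)) integrable_on UNIV"
    and "(\<lambda>s. integral UNIV (\<lambda>t. K t s)) integrable_on UNIV"
    and "integral UNIV (\<lambda>t. integral UNIV (K t)) = integral UNIV (\<lambda>s. integral UNIV (\<lambda>t. K t s))"
    using sw by simp_all
qed


text \<open>The two factors are represented on contours of different angles \<open>\<sigma>1 < \<sigma>2\<close>. The resolvent on the outer
  contour acts on the inner integral by \<open>resolvent_log_calc\<close>; after Fubini the integral over the outer
  contour is Cauchy's formula for \<open>p\<close> at a point of the inner one.\<close>

theorem log_calc_mult:
  assumes p: "strip_decay \<omega> p" and q: "strip_decay \<omega> q" and \<omega>: "\<omega> \<le> pi" and \<sigma>: "0 < \<sigma>" "\<sigma> < \<omega>"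
  shows "log_calc \<sigma> p (log_calc \<sigma> q x) = log_calc \<sigma> (\<lambda>w. p w * q w) x"
proof -
  \<comment> \<open>Cauchy's formula is available on strips of half width at most \<open>pi / 2\<close>, so both contours are moved there.\<close>
  define \<omega>' where "\<omega>' = min \<omega> (pi / 2)"
  define \<sigma>1 \<sigma>2 where "\<sigma>1 = \<omega>' / 3" and "\<sigma>2 = 2 * \<omega>' / 3"
  have \<omega>': "0 < \<omega>'" "\<omega>' \<le> \<omega>" "\<omega>' \<le> pi / 2" using \<sigma> by (auto simp: \<omega>'_def)
  have s12: "0 < \<sigma>1" "\<sigma>1 < \<sigma>2" "\<sigma>2 < pi / 2" "\<sigma>2 < \<omega>'" "\<sigma>1 < \<omega>'" "\<sigma>1 < \<omega>" "\<sigma>2 < \<omega>" "0 < \<sigma>2"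
    using \<omega>' by (auto simp: \<sigma>1_def \<sigma>2_def)
  define \<delta> where "\<delta> = \<sigma>2 - \<sigma>1"
  have \<delta>: "0 < \<delta>" "\<delta> < pi" using s12 by (auto simp: \<delta>_def)
  have sd: "sin \<delta> > 0" using \<delta> by (rule sin_gt_zero)
  have cosd: "cos (s - \<phi>) \<le> cos \<delta>" if "\<bar>s\<bar> \<le> \<sigma>1" "\<bar>\<phi>\<bar> = \<sigma>2" for s \<phi>
    using cos_monotone_0_pi_le[of \<delta> "\<bar>s - \<phi>\<bar>"] \<delta> that s12 by (simp add: \<delta>_def)
  have cosd': "cos (\<phi> - s) \<le> cos \<delta>" if "\<bar>s\<bar> \<le> \<sigma>1" "\<bar>\<phi>\<bar> = \<sigma>2" for s \<phi>
    using cosd[OF that] cos_minus[of "s - \<phi>"] by simp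
  have rp: "ray_decay \<phi> p" if "\<bar>\<phi>\<bar> = \<sigma>2" for \<phi> using that s12 by (intro strip_decay_imp_ray_decay[OF p]) auto
  have rq: "ray_decay \<psi> q" if "\<bar>\<psi>\<bar> = \<sigma>1" for \<psi> using that s12 by (intro strip_decay_imp_ray_decay[OF q]) auto
  define c where "c = 1 / (2 * complex_of_real pi * \<i>)"
  define y where "y = log_calc \<sigma>1 q x"
  define K where "K = (\<lambda>\<phi> \<psi> t s. (p (log_ray \<phi> t) * exp (log_ray \<phi> t) *
      (q (log_ray \<psi> s) / (exp (log_ray \<phi> t) - exp (log_ray \<psi> s)) * exp (log_ray \<psi> s))) *\<^sub>C resolvent A (exp (log_ray \<psi> s)) x)"
  define h where "h \<phi> w0 = integral UNIV (\<lambda>t. p (log_ray \<phi> t) * exp (log_ray \<phi> t) / (exp (log_ray \<phi> t) - exp w0))" for \<phi> w0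
  define g where "g = (\<lambda>\<phi> \<psi> s. (h \<phi> (log_ray \<psi> s) * (q (log_ray \<psi> s) * exp (log_ray \<psi> s))) *\<^sub>C resolvent A (exp (log_ray \<psi> s)) x)"
  have inner: "integral UNIV (\<lambda>t. K \<phi> \<psi> t s) = g \<phi> \<psi> s" if \<phi>: "\<bar>\<phi>\<bar> = \<sigma>2" and \<psi>: "\<bar>\<psi>\<bar> = \<sigma>1" for \<phi> \<psi> s
  proof -
    let ?l = "log_ray \<psi> s"
    have "ray_decay \<phi> (\<lambda>w. p w * (exp w / (exp ?l - exp w)))"
      using that s12 by (intro resolvent_res_int(3)[where \<delta> = \<delta>] rp) (auto intro!: cosd' sd)
    from integrable_neg[OF ray_decay_integrable[OF this]]
    have i: "(\<lambda>t. p (log_ray \<phi> t) * exp (log_ray \<phi> t) / (exp (log_ray \<phi> t) - exp ?l)) integrable_on UNIV"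
      by (rule integrable_eq) (metis (no_types, lifting) minus_diff_eq minus_divide_right mult_minus_right times_divide_eq_right)
    have bl: "bounded_linear (\<lambda>z. (z * (q ?l * exp ?l)) *\<^sub>C resolvent A (exp ?l) x)"
      by (intro bounded_linear_compose[OF scaleC.bounded_linear_left] bounded_linear_mult_left)
    show ?thesis
      using integral_linear[OF i bl] by (simp add: o_def K_def g_def h_def mult_ac)
  qed
  have gi: "g \<phi> \<psi> integrable_on UNIV" and sw: "integral UNIV (\<lambda>t. integral UNIV (K \<phi> \<psi> t)) = integral UNIV (g \<phi> \<psi>)"
    and Ki: "(\<lambda>t. integral UNIV (K \<phi> \<psi> t)) integrable_on UNIV"
    if \<phi>: "\<bar>\<phi>\<bar> = \<sigma>2" and \<psi>: "\<bar>\<psi>\<bar> = \<sigma>1" for \<phi> \<psi>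
  proof -
    note S = res_int_swap[OF \<phi> \<psi> s12(1-3) rp[OF \<phi>] rq[OF \<psi>], of x]
    show "(\<lambda>t. integral UNIV (K \<phi> \<psi> t)) integrable_on UNIV" unfolding K_def by (rule S(1))
    have "(\<lambda>s. integral UNIV (\<lambda>t. K \<phi> \<psi> t s)) integrable_on UNIV" unfolding K_def by (rule S(2))
    then show "g \<phi> \<psi> integrable_on UNIV" by (simp add: inner[OF that])
    have "integral UNIV (\<lambda>t. integral UNIV (K \<phi> \<psi> t)) = integral UNIV (\<lambda>s. integral UNIV (\<lambda>t. K \<phi> \<psi> t s))"
      unfolding K_def by (rule S(3))
    then show "integral UNIV (\<lambda>t. integral UNIV (K \<phi> \<psi> t)) = integral UNIV (g \<phi> \<psi>)"
      by (simp add: inner[OF that])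
  qed
  have outer: "res_int p \<phi> y = c *\<^sub>C (integral UNIV (g \<phi> (-\<sigma>1)) - integral UNIV (g \<phi> \<sigma>1))" if \<phi>: "\<bar>\<phi>\<bar> = \<sigma>2" for \<phi>
  proof -
    have ps: "\<bar>-\<sigma>1\<bar> = \<sigma>1" "\<bar>\<sigma>1\<bar> = \<sigma>1" using s12 by auto
    have "(p (log_ray \<phi> t) * exp (log_ray \<phi> t)) *\<^sub>C resolvent A (exp (log_ray \<phi> t)) y =
        c *\<^sub>C (integral UNIV (K \<phi> (-\<sigma>1) t) - integral UNIV (K \<phi> \<sigma>1 t))" for t
    proof -
      let ?m = "log_ray \<phi> t" and ?pe = "p (log_ray \<phi> t) * exp (log_ray \<phi> t)"
      have "resolvent A (exp ?m) y = log_calc \<sigma>1 (\<lambda>w. q w / (exp ?m - exp w)) x"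
        unfolding y_def using \<phi> s12 by (intro resolvent_log_calc[OF q \<omega>, where \<delta> = \<delta>]) (auto intro!: cosd sd)
      moreover have "?pe *\<^sub>C res_int (\<lambda>w. q w / (exp ?m - exp w)) \<psi> x = integral UNIV (K \<phi> \<psi> t)" if "\<bar>\<psi>\<bar> = \<sigma>1" for \<psi>
      proof -
        have rd: "ray_decay \<psi> (\<lambda>w. q w / (exp ?m - exp w))"
          using that \<phi> s12 by (intro resolvent_res_int(2)[where \<delta> = \<delta>] rq) (auto intro!: cosd sd)
        have \<psi>: "0 < \<bar>\<psi>\<bar>" "\<bar>\<psi>\<bar> < pi" using that s12 by auto
        show ?thesis unfolding res_int_def
          using integral_linear[OF res_int_integrable_bound(1)[OF \<psi> rd, of x] scaleC.bounded_linear_right[of ?pe]]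
          by (simp add: o_def K_def scaleC_scaleC)
      qed
      note this[OF ps(1)] this[OF ps(2)]
      ultimately show ?thesis
        by (simp add: log_calc_def c_def[symmetric] scaleC_scaleC mult.commute[of _ c])
          (simp add: scaleC_scaleC[symmetric] scaleC.diff_right)
    qed
    then have "res_int p \<phi> y = integral UNIV (\<lambda>t. c *\<^sub>C (integral UNIV (K \<phi> (-\<sigma>1) t) - integral UNIV (K \<phi> \<sigma>1 t)))"
      by (simp add: res_int_def)
    also have "\<dots> = c *\<^sub>C integral UNIV (\<lambda>t. integral UNIV (K \<phi> (-\<sigma>1) t) - integral UNIV (K \<phi> \<sigma>1 t))"
      using integral_linear[OF integrable_diff[OF Ki[OF \<phi> ps(1)] Ki[OF \<phi> ps(2)]] scaleC.bounded_linear_right[of c]]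
      by (simp add: o_def)
    also have "integral UNIV (\<lambda>t. integral UNIV (K \<phi> (-\<sigma>1) t) - integral UNIV (K \<phi> \<sigma>1 t)) =
        integral UNIV (g \<phi> (-\<sigma>1)) - integral UNIV (g \<phi> \<sigma>1)"
      unfolding integral_diff[OF Ki[OF \<phi> ps(1)] Ki[OF \<phi> ps(2)]] sw[OF \<phi> ps(1)] sw[OF \<phi> ps(2)] ..
    finally show ?thesis .
  qed
  obtain C \<epsilon> where C: "p holomorphic_on {w. \<bar>Im w\<bar> < \<omega>'}" "C \<ge> 0" "\<epsilon> > 0"
    "\<And>w. \<bar>Im w\<bar> < \<omega>' \<Longrightarrow> cmod (p w) \<le> C * log_weight \<epsilon> (Re w)"
    by (rule strip_decayE[OF strip_decay_subset[OF p \<omega>'(2)]]) blast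
  have cauchy: "h (-\<sigma>2) w0 - h \<sigma>2 w0 = 2 * of_real pi * \<i> * p w0" if "\<bar>Im w0\<bar> = \<sigma>1" for w0
    using cauchy_kernel_inside[OF C(1) s12(8,4) \<omega>'(3) _ C(4,3,2), of w0] that s12
    by (simp add: h_def Let_def log_ray_def)
  have diff: "integral UNIV (g (-\<sigma>2) \<psi>) - integral UNIV (g \<sigma>2 \<psi>) = (2 * of_real pi * \<i>) *\<^sub>C res_int (\<lambda>w. p w * q w) \<psi> x"
    if \<psi>: "\<bar>\<psi>\<bar> = \<sigma>1" for \<psi>
  proof -
    have ps: "\<bar>-\<sigma>2\<bar> = \<sigma>2" "\<bar>\<sigma>2\<bar> = \<sigma>2" using s12 by auto
    have \<psi>': "0 < \<bar>\<psi>\<bar>" "\<bar>\<psi>\<bar> < pi" using that s12 by auto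
    have rpq: "ray_decay \<psi> (\<lambda>w. p w * q w)"
      using s12 \<psi> by (intro strip_decay_imp_ray_decay[OF strip_decay_mult[OF p q]]) auto
    have "integral UNIV (g (-\<sigma>2) \<psi>) - integral UNIV (g \<sigma>2 \<psi>) = integral UNIV (\<lambda>s. g (-\<sigma>2) \<psi> s - g \<sigma>2 \<psi> s)"
      by (rule integral_diff[symmetric, OF gi[OF ps(1) \<psi>] gi[OF ps(2) \<psi>]])
    also have "\<dots> = integral UNIV (\<lambda>s. (2 * of_real pi * \<i>) *\<^sub>C
        ((p (log_ray \<psi> s) * q (log_ray \<psi> s) * exp (log_ray \<psi> s)) *\<^sub>C resolvent A (exp (log_ray \<psi> s)) x))"
    proof (rule integral_cong)
      fix s
      have "g (-\<sigma>2) \<psi> s - g \<sigma>2 \<psi> s = ((h (-\<sigma>2) (log_ray \<psi> s) - h \<sigma>2 (log_ray \<psi> s)) * (q (log_ray \<psi> s) * exp (log_ray \<psi> s))) *\<^sub>C resolvent A (exp (log_ray \<psi> s)) x"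
        by (simp add: g_def scaleC.diff_left[symmetric] left_diff_distrib)
      then show "g (-\<sigma>2) \<psi> s - g \<sigma>2 \<psi> s = (2 * of_real pi * \<i>) *\<^sub>C
        ((p (log_ray \<psi> s) * q (log_ray \<psi> s) * exp (log_ray \<psi> s)) *\<^sub>C resolvent A (exp (log_ray \<psi> s)) x)"
        using cauchy[of "log_ray \<psi> s"] \<psi> by (simp add: scaleC_scaleC mult_ac)
    qed
    also have "\<dots> = (2 * of_real pi * \<i>) *\<^sub>C res_int (\<lambda>w. p w * q w) \<psi> x"
      unfolding res_int_def
      using integral_linear[OF res_int_integrable_bound(1)[OF \<psi>' rpq, of x] scaleC.bounded_linear_right[of "2 * of_real pi * \<i>"]]
      by (simp add: o_def)
    finally show ?thesis .
  qed
  have "log_calc \<sigma> p (log_calc \<sigma> q x) = log_calc \<sigma>2 p y"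
    unfolding y_def
    using log_calc_angle[OF p \<omega> \<sigma> s12(8,7)] log_calc_angle[OF q \<omega> \<sigma> s12(1,6)] by simp
  also have "\<dots> = c *\<^sub>C (res_int p (-\<sigma>2) y - res_int p \<sigma>2 y)" by (simp add: log_calc_def c_def)
  also have "res_int p (-\<sigma>2) y - res_int p \<sigma>2 y = c *\<^sub>C ((integral UNIV (g (-\<sigma>2) (-\<sigma>1)) - integral UNIV (g \<sigma>2 (-\<sigma>1)))
      - (integral UNIV (g (-\<sigma>2) \<sigma>1) - integral UNIV (g \<sigma>2 \<sigma>1)))"
    using outer[of "-\<sigma>2"] outer[of \<sigma>2] s12 by (simp add: scaleC.diff_right)
  also have "\<dots> = c *\<^sub>C ((2 * of_real pi * \<i>) *\<^sub>C (res_int (\<lambda>w. p w * q w) (-\<sigma>1) x - res_int (\<lambda>w. p w * q w) \<sigma>1 x))"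
    using diff[of "-\<sigma>1"] diff[of \<sigma>1] s12 by (simp add: scaleC.diff_right)
  also have "\<dots> = res_int (\<lambda>w. p w * q w) (-\<sigma>1) x - res_int (\<lambda>w. p w * q w) \<sigma>1 x"
    by (simp add: c_def scaleC_scaleC)
  also have "c *\<^sub>C \<dots> = log_calc \<sigma>1 (\<lambda>w. p w * q w) x" by (simp add: c_def log_calc_def)
  also have "\<dots> = log_calc \<sigma> (\<lambda>w. p w * q w) x"
    by (rule log_calc_angle[OF strip_decay_mult[OF p q] \<omega> s12(1,6) \<sigma>])
  finally show ?thesis .
qed

end

section \<open>Functions with bounded derivatives\<close>

text \<open>\<open>Cb_le m B u\<close> says that \<open>u\<close> has \<open>m\<close> derivatives which are, like \<open>u\<close>, bounded by \<open>B\<close>: the norm of the space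
  of m times boundedly differentiable functions is at most \<open>B\<close>. Keeping the bound as an argument makes
  uniform statements about families direct.\<close>

primrec Cb_le :: "nat \<Rightarrow> real \<Rightarrow> (real \<Rightarrow> complex) \<Rightarrow> bool" where
  "Cb_le 0 B u \<longleftrightarrow> continuous_on UNIV u \<and> (\<forall>x. cmod (u x) \<le> B)"
| "Cb_le (Suc m) B u \<longleftrightarrow> (\<forall>x. cmod (u x) \<le> B) \<and>
     (\<exists>u'. (\<forall>x. (u has_vector_derivative u' x) (at x)) \<and> Cb_le m B u')"

lemma Cb_bound: "Cb_le m B u \<Longrightarrow> cmod (u x) \<le> B"
  by (cases m) auto

lemma Cb_nonneg: "Cb_le m B u \<Longrightarrow> 0 \<le> B"
  using order_trans[OF norm_ge_zero Cb_bound] .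

lemma Cb_continuous: "Cb_le m B u \<Longrightarrow> continuous_on S u"
  by (cases m) (auto intro: continuous_on_subset continuous_at_imp_continuous_on has_vector_derivative_continuous)

lemma Cb_Suc_imp: "Cb_le (Suc m) B u \<Longrightarrow> Cb_le m B u"
proof (induction m arbitrary: u)
  case 0
  then show ?case using Cb_continuous[OF 0] Cb_bound[OF 0] by simp
next
  case (Suc m)
  then show ?case by (subst Cb_le.simps(2)) (metis Cb_le.simps(2))
qed

lemma Cb_le_order: "Cb_le n B u \<Longrightarrow> m \<le> n \<Longrightarrow> Cb_le m B u"
proof (induction n)
  case (Suc n)
  then show ?case using Cb_Suc_imp by (cases "m = Suc n") auto
qed simp

lemma Cb_mono: "Cb_le m B u \<Longrightarrow> B \<le> B' \<Longrightarrow> Cb_le m B' u"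
  by (induction m arbitrary: u) (auto intro: order_trans)

lemma Cb_derivE:
  assumes "Cb_le (Suc m) B u"
  obtains u' where "\<And>x. (u has_vector_derivative u' x) (at x)" "Cb_le m B u'"
  using assms by auto

lemma Cb_SucI:
  assumes "\<And>x. cmod (u x) \<le> B" "\<And>x. (u has_vector_derivative u' x) (at x)" "Cb_le m B u'"
  shows "Cb_le (Suc m) B u"
  using assms by auto

lemma Cb_add:
  assumes "Cb_le m B u" "Cb_le m C v"
  shows "Cb_le m (B + C) (\<lambda>x. u x + v x)"
  using assms
proof (induction m arbitrary: u v)
  case 0
  then show ?case by (auto intro!: continuous_intros norm_triangle_le add_mono)
next
  case (Suc m)
  obtain u' where u': "\<And>x. (u has_vector_derivative u' x) (at x)" "Cb_le m B u'" using Suc.prems(1) by (rule Cb_derivE) blast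
  obtain v' where v': "\<And>x. (v has_vector_derivative v' x) (at x)" "Cb_le m C v'" using Suc.prems(2) by (rule Cb_derivE) blast
  show ?case
  proof (rule Cb_SucI)
    show "cmod (u x + v x) \<le> B + C" for x
      using Cb_bound[OF Suc.prems(1)] Cb_bound[OF Suc.prems(2)] by (intro norm_triangle_le add_mono)
    show "((\<lambda>x. u x + v x) has_vector_derivative u' x + v' x) (at x)" for x
      by (intro has_vector_derivative_add u' v')
  qed (rule Suc.IH[OF u'(2) v'(2)])
qed

lemma Cb_cmult:
  assumes "Cb_le m B u"
  shows "Cb_le m (cmod c * B) (\<lambda>x. c * u x)"
  using assms
proof (induction m arbitrary: u)
  case 0
  then show ?case by (auto intro!: continuous_intros mult_left_mono simp: norm_mult)
next
  case (Suc m)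
  obtain u' where u': "\<And>x. (u has_vector_derivative u' x) (at x)" "Cb_le m B u'" using Suc.prems(1) by (rule Cb_derivE) blast
  show ?case
  proof (rule Cb_SucI)
    show "cmod (c * u x) \<le> cmod c * B" for x
      unfolding norm_mult by (intro mult_left_mono Cb_bound[OF Suc.prems]) simp
    show "((\<lambda>x. c * u x) has_vector_derivative c * u' x) (at x)" for x
      by (intro has_vector_derivative_mult_right u')
  qed (rule Suc.IH[OF u'(2)])
qed

lemma Cb_diff: "Cb_le m B u \<Longrightarrow> Cb_le m C v \<Longrightarrow> Cb_le m (B + C) (\<lambda>x. u x - v x)"
  using Cb_add[of m B u C "\<lambda>x. -1 * v x"] Cb_cmult[of m C v "-1"] by simp

text \<open>The Leibniz rule, with the binomial coefficients summed to \<open>2 ^ m\<close>.\<close>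

lemma Cb_mult:
  assumes "Cb_le m B u" "Cb_le m C v"
  shows "Cb_le m (2 ^ m * B * C) (\<lambda>x. u x * v x)"
  using assms
proof (induction m arbitrary: u v)
  case 0
  then show ?case using Cb_nonneg[OF 0(1)] by (auto intro!: continuous_intros mult_mono simp: norm_mult)
next
  case (Suc m)
  obtain u' where u': "\<And>x. (u has_vector_derivative u' x) (at x)" "Cb_le m B u'" using Suc.prems(1) by (rule Cb_derivE) blast
  obtain v' where v': "\<And>x. (v has_vector_derivative v' x) (at x)" "Cb_le m C v'" using Suc.prems(2) by (rule Cb_derivE) blast
  have BC: "0 \<le> B" "0 \<le> C" using Cb_nonneg Suc.prems by auto
  show ?case
  proof (rule Cb_SucI)
    show "cmod (u x * v x) \<le> 2 ^ Suc m * B * C" for x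
    proof -
      have "cmod (u x * v x) \<le> B * C"
        unfolding norm_mult using Cb_bound[OF Suc.prems(1)] Cb_bound[OF Suc.prems(2)] BC by (intro mult_mono) auto
      also have "B * C \<le> 2 ^ Suc m * (B * C)" using BC mult_right_mono[OF one_le_power[of "2::real" "Suc m"], of "B * C"] by simp
      finally show ?thesis by (simp add: mult.assoc)
    qed
    show "((\<lambda>x. u x * v x) has_vector_derivative u x * v' x + u' x * v x) (at x)" for x
      by (rule has_vector_derivative_mult[OF u'(1) v'(1)])
    have "Cb_le m (2 ^ m * B * C + 2 ^ m * B * C) (\<lambda>x. u x * v' x + u' x * v x)"
      by (rule Cb_add[OF Suc.IH[OF Cb_Suc_imp[OF Suc.prems(1)] v'(2)] Suc.IH[OF u'(2) Cb_Suc_imp[OF Suc.prems(2)]]])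
    moreover have "2 ^ m * B * C + 2 ^ m * B * C = 2 ^ Suc m * B * C" by simp
    ultimately show "Cb_le m (2 ^ Suc m * B * C) (\<lambda>x. u x * v' x + u' x * v x)" by metis
  qed
qed

lemma Cb_const: "Cb_le m (cmod c) (\<lambda>_. c)"
proof -
  have z: "Cb_le m 0 (\<lambda>_. 0)" for m
  proof (induction m)
    case (Suc m)
    show ?case by (rule Cb_SucI[OF _ _ Suc]) auto
  qed auto
  show ?thesis
  proof (cases m)
    case (Suc m')
    show ?thesis unfolding Suc by (rule Cb_SucI[OF _ _ Cb_mono[OF z]]) auto
  qed auto
qed

lemma Cb_shift: "Cb_le m B u \<Longrightarrow> Cb_le m B (\<lambda>x. u (x - a))"
proof (induction m arbitrary: u)
  case 0
  then show ?case by (auto intro!: continuous_on_compose2[of UNIV u] continuous_intros)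
next
  case (Suc m)
  obtain u' where u': "\<And>x. (u has_vector_derivative u' x) (at x)" "Cb_le m B u'" using Suc.prems(1) by (rule Cb_derivE) blast
  show ?case
  proof (rule Cb_SucI)
    show "cmod (u (x - a)) \<le> B" for x by (rule Cb_bound[OF Suc.prems])
    show "((\<lambda>x. u (x - a)) has_vector_derivative u' (x - a)) (at x)" for x
    proof -
      have "((\<lambda>x. x - a) has_vector_derivative 1) (at x)" by (auto intro!: derivative_eq_intros)
      from vector_diff_chain_at[OF this u'(1)] show ?thesis by (simp add: o_def)
    qed
  qed (rule Suc.IH[OF u'(2)])
qed

lemma derivative_zero_outside:
  assumes "\<And>x. (u has_vector_derivative u' x) (at x)" "\<And>x. x \<notin> {a..b} \<Longrightarrow> u x = 0" "x \<notin> {a..b::real}"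
  shows "u' x = (0::complex)"
proof -
  have "((\<lambda>_. 0) has_vector_derivative 0) (at x)" by simp
  moreover have "open (- {a..b})" by (intro open_Compl) auto
  ultimately have "(u has_vector_derivative 0) (at x)"
    by (rule has_vector_derivative_transform_within_open[where S = "- {a..b}"]) (use assms in auto)
  then show ?thesis using assms(1) vector_derivative_unique_at by blast
qed

lemma card_shifts:
  assumes "l > 0" "R \<ge> 0"
  shows "finite {n::int. \<bar>s - real_of_int n * l\<bar> \<le> R}" "real (card {n::int. \<bar>s - real_of_int n * l\<bar> \<le> R}) \<le> 2 * R / l + 1"
proof -
  have sub: "{n::int. \<bar>s - real_of_int n * l\<bar> \<le> R} \<subseteq> {\<lceil>(s - R) / l\<rceil> .. \<lfloor>(s + R) / l\<rfloor>}"
    using assms by (auto simp: ceiling_le_iff le_floor_iff field_simps)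
  then show "finite {n::int. \<bar>s - real_of_int n * l\<bar> \<le> R}" by (rule finite_subset) simp
  have "card {n::int. \<bar>s - real_of_int n * l\<bar> \<le> R} \<le> nat (\<lfloor>(s + R) / l\<rfloor> - \<lceil>(s - R) / l\<rceil> + 1)"
    using card_mono[OF _ sub] by simp
  moreover have "real_of_int (\<lfloor>(s + R) / l\<rfloor> - \<lceil>(s - R) / l\<rceil> + 1) \<le> (s + R) / l - (s - R) / l + 1"
    by (simp add: algebra_simps) (smt (verit) of_int_floor_le le_of_int_ceiling)
  moreover have "(s + R) / l - (s - R) / l = 2 * R / l" by (simp add: add_divide_distrib diff_divide_distrib)
  ultimately show "real (card {n::int. \<bar>s - real_of_int n * l\<bar> \<le> R}) \<le> 2 * R / l + 1"
    using assms by (cases "\<lfloor>(s + R) / l\<rfloor> - \<lceil>(s - R) / l\<rceil> + 1 \<ge> 0") (auto simp: of_nat_nat intro: order_trans)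
qed

text \<open>At each point at most \<open>2 * R / l + 1\<close> of the translates are non-zero, and derivatives of the sum have
  the same structure. The bound depends neither on the coefficients nor on the number of terms, which
  is what makes random signs harmless.\<close>

lemma Cb_sum_shifts:
  assumes "Cb_le m B w" "\<And>x. x \<notin> {-R..R} \<Longrightarrow> w x = 0" "l > 0" "R \<ge> 0" "finite F" "\<And>n. n \<in> F \<Longrightarrow> cmod (c n) \<le> 1"
  shows "Cb_le m ((2 * R / l + 1) * B) (\<lambda>x. \<Sum>n\<in>F. c n * w (x - real_of_int n * l))"
proof -
  have bound: "cmod (\<Sum>n\<in>F. c n * w (x - real_of_int n * l)) \<le> (2 * R / l + 1) * B"
    if w: "Cb_le m B w" "\<And>x. x \<notin> {-R..R} \<Longrightarrow> w x = 0" for m w x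
  proof -
    define G where "G = F \<inter> {n. \<bar>x - real_of_int n * l\<bar> \<le> R}"
    have "(\<Sum>n\<in>F. c n * w (x - real_of_int n * l)) = (\<Sum>n\<in>G. c n * w (x - real_of_int n * l))"
    proof (rule sum.mono_neutral_right)
      show "\<forall>n\<in>F - G. c n * w (x - real_of_int n * l) = 0"
      proof
        fix n assume "n \<in> F - G"
        then have "x - real_of_int n * l \<notin> {-R..R}" by (auto simp: G_def abs_le_iff)
        then show "c n * w (x - real_of_int n * l) = 0" using w(2) by simp
      qed
    qed (use assms(5) in \<open>auto simp: G_def\<close>)
    also have "cmod \<dots> \<le> (\<Sum>n\<in>G. B)"
    proof (rule sum_norm_le)
      fix n assume "n \<in> G"
      then have "cmod (c n) * cmod (w (x - real_of_int n * l)) \<le> 1 * B"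
        using Cb_bound[OF w(1)] assms(6) by (intro mult_mono) (auto simp: G_def)
      then show "cmod (c n * w (x - real_of_int n * l)) \<le> B" by (simp add: norm_mult)
    qed
    also have "\<dots> = real (card G) * B" by simp
    also have "\<dots> \<le> (2 * R / l + 1) * B"
    proof (rule mult_right_mono)
      have "card G \<le> card {n. \<bar>x - real_of_int n * l\<bar> \<le> R}"
        unfolding G_def by (intro card_mono card_shifts(1) assms) auto
      then show "real (card G) \<le> 2 * R / l + 1" using card_shifts(2)[OF assms(3,4), of x] by linarith
    qed (rule Cb_nonneg[OF w(1)])
    finally show ?thesis .
  qed
  show ?thesis
    using assms(1,2)
  proof (induction m arbitrary: w)
  case 0
  have "continuous_on UNIV (\<lambda>x. w (x - a))" for a
    using Cb_continuous[OF Cb_shift[OF 0(1)]] .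
  then show ?case using bound[OF 0] by (auto intro!: continuous_intros)
  next
  case (Suc m)
  obtain w' where w': "\<And>x. (w has_vector_derivative w' x) (at x)" "Cb_le m B w'" using Suc.prems(1) by (rule Cb_derivE) blast
  show ?case
  proof (rule Cb_SucI)
    show "cmod (\<Sum>n\<in>F. c n * w (x - real_of_int n * l)) \<le> (2 * R / l + 1) * B" for x by (rule bound[OF Suc.prems])
    show "((\<lambda>x. \<Sum>n\<in>F. c n * w (x - real_of_int n * l)) has_vector_derivative (\<Sum>n\<in>F. c n * w' (x - real_of_int n * l))) (at x)" for x
    proof (intro has_vector_derivative_sum has_vector_derivative_mult_right)
      fix n
      have "((\<lambda>x. x - real_of_int n * l) has_vector_derivative 1) (at x)" by (auto intro!: derivative_eq_intros)
      from vector_diff_chain_at[OF this w'(1)]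
      show "((\<lambda>x. w (x - real_of_int n * l)) has_vector_derivative w' (x - real_of_int n * l)) (at x)" by (simp add: o_def)
    qed
    show "Cb_le m ((2 * R / l + 1) * B) (\<lambda>x. \<Sum>n\<in>F. c n * w' (x - real_of_int n * l))"
      by (rule Suc.IH[OF w'(2) derivative_zero_outside[OF w'(1) Suc.prems(2)]])
  qed
qed
qed

text \<open>The space of smooth functions with all derivatives bounded on the line.\<close>

definition Cinf :: "(real \<Rightarrow> complex) \<Rightarrow> bool" where
  "Cinf u \<longleftrightarrow> (\<forall>m. \<exists>B. Cb_le m B u)"

lemma Cinf_add: "Cinf u \<Longrightarrow> Cinf v \<Longrightarrow> Cinf (\<lambda>x. u x + v x)"
  unfolding Cinf_def using Cb_add by blast

lemma Cinf_diff: "Cinf u \<Longrightarrow> Cinf v \<Longrightarrow> Cinf (\<lambda>x. u x - v x)"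
  unfolding Cinf_def using Cb_diff by blast

lemma Cinf_mult: "Cinf u \<Longrightarrow> Cinf v \<Longrightarrow> Cinf (\<lambda>x. u x * v x)"
  unfolding Cinf_def using Cb_mult by blast

lemma Cinf_const: "Cinf (\<lambda>_. c)"
  unfolding Cinf_def using Cb_const by blast

lemma Cinf_cmult: "Cinf u \<Longrightarrow> Cinf (\<lambda>x. c * u x)"
  by (intro Cinf_mult Cinf_const)

lemma Cinf_shift: "Cinf u \<Longrightarrow> Cinf (\<lambda>x. u (x - a))"
  unfolding Cinf_def using Cb_shift by blast

lemma Cinf_sum: "(\<And>n. n \<in> F \<Longrightarrow> Cinf (u n)) \<Longrightarrow> Cinf (\<lambda>x. \<Sum>n\<in>F. u n x)"
  by (induction F rule: infinite_finite_induct) (auto intro: Cinf_add Cinf_const)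

text \<open>Cauchy's estimate on discs inside the strip; the radius shrinks with each derivative, hence the
  unspecified bound.\<close>

lemma holomorphic_strip_Cb:
  assumes "H holomorphic_on {w. \<bar>Im w\<bar> < \<omega>}" "\<omega> > 0" "\<And>w. \<bar>Im w\<bar> < \<omega> \<Longrightarrow> cmod (H w) \<le> B"
  shows "\<exists>B'. Cb_le m B' (\<lambda>x. H (of_real x))"
  using assms
proof (induction m arbitrary: H \<omega> B)
  case 0
  have "continuous_on UNIV (\<lambda>x. H (of_real x))"
    by (rule continuous_on_compose2[OF holomorphic_on_imp_continuous_on[OF 0(1)]]) (use 0 in \<open>auto intro!: continuous_intros\<close>)
  then show ?case using 0(2) 0(3) by (intro exI[of _ B]) simp
next
  case (Suc m)
  let ?S = "{w. \<bar>Im w\<bar> < \<omega>}"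
  have op: "open ?S" by (intro open_Collect_less continuous_intros)
  have dh: "deriv H holomorphic_on {w. \<bar>Im w\<bar> < \<omega> / 2}"
    by (rule holomorphic_on_subset[OF holomorphic_deriv[OF Suc.prems(1) op]]) (use Suc.prems(2) in auto)
  have db: "cmod (deriv H w) \<le> B / (\<omega> / 2)" if "\<bar>Im w\<bar> < \<omega> / 2" for w
  proof -
    have sub: "cball w (\<omega> / 2) \<subseteq> ?S"
    proof
      fix v assume "v \<in> cball w (\<omega> / 2)"
      then have "\<bar>Im w - Im v\<bar> \<le> \<omega> / 2" using abs_Im_le_cmod[of "w - v"] by (simp add: dist_norm)
      then have "\<bar>Im v\<bar> < \<omega>" using that by linarith
      then show "v \<in> ?S" by simp
    qed
    have "cmod ((deriv ^^ 1) H w) \<le> fact 1 * B / (\<omega> / 2) ^ 1"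
    proof (rule Cauchy_inequality)
      show "H holomorphic_on ball w (\<omega> / 2)" by (rule holomorphic_on_subset[OF Suc.prems(1) order_trans[OF ball_subset_cball sub]])
      show "continuous_on (cball w (\<omega> / 2)) H"
        using sub by (intro continuous_on_subset[OF holomorphic_on_imp_continuous_on[OF Suc.prems(1)]])
      show "0 < \<omega> / 2" using Suc.prems(2) by simp
      show "cmod (H v) \<le> B" if "cmod (w - v) = \<omega> / 2" for v
        using that sub by (intro Suc.prems(3)) (auto simp: subset_iff dist_norm)
    qed
    then show ?thesis by simp
  qed
  have w2: "\<omega> / 2 > 0" using Suc.prems(2) by simp
  obtain B' where B': "Cb_le m B' (\<lambda>x. deriv H (of_real x))" using Suc.IH[OF dh w2 db] by blast
  have "Cb_le (Suc m) (max B B') (\<lambda>x. H (of_real x))"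
  proof (rule Cb_SucI)
    show "cmod (H (of_real x)) \<le> max B B'" for x using Suc.prems(3)[of "of_real x"] Suc.prems(2) by simp
    show "((\<lambda>x. H (of_real x)) has_vector_derivative deriv H (of_real x)) (at x)" for x
      using holomorphic_derivI[OF Suc.prems(1) op, of "of_real x" UNIV] Suc.prems(2)
      by (intro has_vector_derivative_real_field) auto
    show "Cb_le m (max B B') (\<lambda>x. deriv H (of_real x))" using B' by (rule Cb_mono) simp
  qed
  then show ?case by blast
qed

lemma holomorphic_strip_Cinf:
  assumes "H holomorphic_on {w. \<bar>Im w\<bar> < \<omega>}" "\<omega> > 0" "\<And>w. \<bar>Im w\<bar> < \<omega> \<Longrightarrow> cmod (H w) \<le> B"
  shows "Cinf (\<lambda>x. H (of_real x))"
  unfolding Cinf_def using holomorphic_strip_Cb[OF assms] by blast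

lemma Cb_Lipschitz:
  assumes u': "\<And>x. (u has_vector_derivative u' x) (at x)" and b: "\<And>x. cmod (u' x) \<le> B"
  shows "cmod (u y - u x) \<le> B * \<bar>y - x\<bar>"
proof -
  have "norm (u y - u x) \<le> B * norm (y - x)"
  proof (rule differentiable_bound[of UNIV u "\<lambda>x h. h *\<^sub>R u' x"])
    show "(u has_derivative (\<lambda>h. h *\<^sub>R u' x)) (at x within UNIV)" for x
      using u'[of x] by (simp add: has_vector_derivative_def)
    show "onorm (\<lambda>h. h *\<^sub>R u' x) \<le> B" for x
    proof (rule onorm_le)
      show "norm (h *\<^sub>R u' x) \<le> B * norm h" for h
        using mult_left_mono[OF b[of x], of "\<bar>h\<bar>"] by (simp add: mult.commute)
    qed
  qed auto
  then show ?thesis by simp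
qed

lemma Cb_Taylor:
  assumes u': "\<And>x. (u has_vector_derivative u' x) (at x)" and b: "Cb_le (Suc 0) B u'"
  shows "cmod (u (x + h) - u x - h *\<^sub>R u' x) \<le> B * h\<^sup>2"
proof -
  obtain u'' where u'': "\<And>x. (u' has_vector_derivative u'' x) (at x)" "Cb_le 0 B u''" using b by (rule Cb_derivE) blast
  have lip: "cmod (u' y - u' x) \<le> B * \<bar>y - x\<bar>" for x y
    by (rule Cb_Lipschitz[OF u''(1) Cb_bound[OF u''(2)]])
  define S where "S = closed_segment x (x + h)"
  have "norm ((u (x + h) - (x + h) *\<^sub>R u' x) - (u x - x *\<^sub>R u' x)) \<le> (B * \<bar>h\<bar>) * norm ((x + h) - x)"
  proof (rule differentiable_bound[of S "\<lambda>t. u t - t *\<^sub>R u' x" "\<lambda>t d. d *\<^sub>R (u' t - u' x)"])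
    show "((\<lambda>t. u t - t *\<^sub>R u' x) has_derivative (\<lambda>d. d *\<^sub>R (u' t - u' x))) (at t within S)" for t
    proof -
      have "((\<lambda>t. u t - t *\<^sub>R u' x) has_derivative (\<lambda>d. d *\<^sub>R u' t - d *\<^sub>R u' x)) (at t within S)"
        by (rule has_derivative_diff[OF has_derivative_at_withinI[OF u'[of t, unfolded has_vector_derivative_def]]
            bounded_linear.has_derivative[OF bounded_linear_scaleR_left has_derivative_ident]])
      then show ?thesis by (simp add: scaleR_diff_right)
    qed
    show "onorm (\<lambda>d. d *\<^sub>R (u' t - u' x)) \<le> B * \<bar>h\<bar>" if "t \<in> S" for t
    proof (rule onorm_le)
      have "\<bar>t - x\<bar> \<le> \<bar>h\<bar>" using that by (auto simp: S_def closed_segment_eq_real_ivl split: if_splits)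
      then have "cmod (u' t - u' x) \<le> B * \<bar>h\<bar>"
        using lip[of t x] mult_left_mono[of "\<bar>t - x\<bar>" "\<bar>h\<bar>" B] Cb_nonneg[OF b] by linarith
      then show "norm (d *\<^sub>R (u' t - u' x)) \<le> B * \<bar>h\<bar> * norm d" for d
        by (simp add: mult.commute mult_left_mono)
    qed
  qed (auto simp: S_def)
  then show ?thesis by (simp add: algebra_simps power2_eq_square)
qed

text \<open>Landau's interpolation: by Taylor's formula with step \<open>h\<close>, a derivative is bounded by \<open>2 e / h + B h\<close>,
  and \<open>h\<close> is chosen near \<open>sqrt e\<close>. So sup norm convergence upgrades to convergence of all derivatives
  when these stay bounded.\<close>

lemma Cb_sequence_small:
  assumes "\<And>m. \<exists>B. \<forall>k. Cb_le m B (u k)" "e \<longlonglongrightarrow> 0" "\<And>k x. cmod (u k x) \<le> e k"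
  shows "\<exists>e. e \<longlonglongrightarrow> 0 \<and> (\<forall>k::nat. Cb_le m (e k) (u k))"
  using assms
proof (induction m arbitrary: u e)
  case 0
  have "continuous_on UNIV (u k)" for k using 0(1)[of 0] by auto
  then show ?case using 0 by auto
next
  case (Suc m)
  have "\<exists>u'. (\<forall>x. (u k has_vector_derivative u' x) (at x))" for k
  proof -
    obtain B where "\<forall>k. Cb_le (Suc 0) B (u k)" using Suc.prems(1) by blast
    then have "Cb_le (Suc 0) B (u k)" by blast
    then show ?thesis by (rule Cb_derivE) blast
  qed
  then obtain u' where u': "\<And>k x. (u k has_vector_derivative u' k x) (at x)" by metis
  have bu': "\<exists>B. \<forall>k. Cb_le m B (u' k)" for m
  proof -
    obtain B where "\<And>k. Cb_le (Suc m) B (u k)" using Suc.prems(1) by blast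
    then have "Cb_le m B (u' k)" for k
    proof -
      obtain v where v: "\<And>x. (u k has_vector_derivative v x) (at x)" "Cb_le m B v"
        using \<open>\<And>k. Cb_le (Suc m) B (u k)\<close> by (rule Cb_derivE) blast
      have "v = u' k" using vector_derivative_unique_at[OF v(1) u'] by blast
      then show ?thesis using v(2) by simp
    qed
    then show ?thesis by blast
  qed
  obtain B where B: "\<And>k. Cb_le (Suc 0) B (u' k)" using bu' by blast
  have B0: "B \<ge> 0" using Cb_nonneg[OF B] .
  have e0: "e k \<ge> 0" for k using order_trans[OF norm_ge_zero Suc.prems(3)] .
  \<comment> \<open>The step of the interpolation; the added null sequence keeps it positive when \<open>e k = 0\<close>.\<close>
  define h where "h k = sqrt (e k + inverse (real (Suc k)))" for k
  have h: "h k > 0" "e k \<le> h k * h k" for k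
    using e0[of k] by (auto simp: h_def add_nonneg_pos)
  have "(\<lambda>k. e k + inverse (real (Suc k))) \<longlonglongrightarrow> 0 + 0"
    by (rule tendsto_add[OF Suc.prems(2) LIMSEQ_inverse_real_of_nat])
  then have "(\<lambda>k. (2 + B) * h k) \<longlonglongrightarrow> (2 + B) * sqrt (0 + 0)"
    unfolding h_def by (rule tendsto_mult[OF tendsto_const tendsto_real_sqrt])
  then have lim: "(\<lambda>k. (2 + B) * h k) \<longlonglongrightarrow> 0" by simp
  have small: "cmod (u' k x) \<le> (2 + B) * h k" for k x
  proof -
    have T: "cmod (u k (x + h k) - u k x - h k *\<^sub>R u' k x) \<le> B * (h k)\<^sup>2" by (rule Cb_Taylor[OF u' B])
    have "h k * cmod (u' k x) = cmod ((u k (x + h k) - u k x) - (u k (x + h k) - u k x - h k *\<^sub>R u' k x))"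
      using h(1)[of k] by simp
    also have "\<dots> \<le> (e k + e k) + B * (h k)\<^sup>2"
    proof (rule order_trans[OF norm_triangle_ineq4 add_mono[OF _ T]])
      show "cmod (u k (x + h k) - u k x) \<le> e k + e k"
        by (rule order_trans[OF norm_triangle_ineq4 add_mono[OF Suc.prems(3) Suc.prems(3)]])
    qed
    also have "\<dots> \<le> h k * ((2 + B) * h k)" using h(2)[of k] by (simp add: power2_eq_square algebra_simps)
    finally show ?thesis using h(1)[of k] by simp
  qed
  obtain e' where e': "e' \<longlonglongrightarrow> 0" "\<And>k. Cb_le m (e' k) (u' k)"
    using Suc.IH[OF bu' lim small] by blast
  show ?case
  proof (intro exI[of _ "\<lambda>k. e k + e' k"] conjI allI)
    show "(\<lambda>k. e k + e' k) \<longlonglongrightarrow> 0" using tendsto_add[OF Suc.prems(2) e'(1)] by simp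
    fix k
    have e'0: "0 \<le> e' k" by (rule Cb_nonneg[OF e'(2)])
    show "Cb_le (Suc m) (e k + e' k) (u k)"
    proof (rule Cb_SucI)
      show "cmod (u k x) \<le> e k + e' k" for x using Suc.prems(3)[of k x] e'0 by linarith
      show "(u k has_vector_derivative u' k x) (at x)" for x by (rule u')
      show "Cb_le m (e k + e' k) (u' k)" by (rule Cb_mono[OF e'(2)]) (use e0 in simp)
    qed
  qed
qed

section \<open>Gaussian regularisation\<close>

abbreviation gauss :: "real \<Rightarrow> real \<Rightarrow> real" where "gauss \<epsilon> \<equiv> normal_density 0 \<epsilon>"

definition gauss_conv :: "(real \<Rightarrow> complex) \<Rightarrow> real \<Rightarrow> real \<Rightarrow> complex" where
  "gauss_conv u \<epsilon> x = (\<integral>t. u (x - t) * of_real (gauss \<epsilon> t) \<partial>lborel)"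

lemma bounded_mult_integrable:
  assumes "continuous_on UNIV u" "\<And>x. cmod (u x) \<le> B" "integrable lborel g"
  shows "integrable lborel (\<lambda>t. u t * (g t :: complex))"
proof (rule Bochner_Integration.integrable_bound[of _ "\<lambda>t. B * norm (g t)"])
  show "integrable lborel (\<lambda>t. B * norm (g t))" using assms(3) by auto
  have "u \<in> borel_measurable borel" using assms(1) by (rule borel_measurable_continuous_onI)
  moreover have "g \<in> borel_measurable lborel" using assms(3) by auto
  ultimately show "(\<lambda>t. u t * g t) \<in> borel_measurable lborel" by simp
  have "0 \<le> B" using order_trans[OF norm_ge_zero assms(2)] .
  then show "AE t in lborel. norm (u t * g t) \<le> norm (B * norm (g t))"
    using assms(2) by (auto simp: norm_mult intro!: mult_right_mono)
qed

lemma integrable_gauss: "\<epsilon> > 0 \<Longrightarrow> integrable lborel (\<lambda>t. complex_of_real (gauss \<epsilon> t))"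
  by (intro integrable_of_real integrable_normal_density)

lemma gauss_conv_integrable:
  assumes "Cb_le m B u" "\<epsilon> > 0"
  shows "integrable lborel (\<lambda>t. u (x - t) * of_real (gauss \<epsilon> t))"
proof (rule bounded_mult_integrable[OF _ _ integrable_gauss[OF assms(2)]])
  show "continuous_on UNIV (\<lambda>t. u (x - t))"
    by (rule continuous_on_compose2[OF Cb_continuous[OF assms(1), of UNIV]]) (auto intro!: continuous_intros)
  show "cmod (u (x - t)) \<le> B" for t by (rule Cb_bound[OF assms(1)])
qed

lemma norm_integral_gauss_le:
  assumes "integrable lborel (\<lambda>t. f t * complex_of_real (gauss \<epsilon> t))" "\<epsilon> > 0" "integrable lborel (\<lambda>t. b t * gauss \<epsilon> t)"
    "\<And>t. cmod (f t) \<le> b t"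
  shows "cmod (\<integral>t. f t * of_real (gauss \<epsilon> t) \<partial>lborel) \<le> (\<integral>t. b t * gauss \<epsilon> t \<partial>lborel)"
proof -
  have "cmod (\<integral>t. f t * of_real (gauss \<epsilon> t) \<partial>lborel) \<le> (\<integral>t. norm (f t * of_real (gauss \<epsilon> t)) \<partial>lborel)"
    by (rule integral_norm_bound)
  also have "\<dots> \<le> (\<integral>t. b t * gauss \<epsilon> t \<partial>lborel)"
    using assms by (intro integral_mono integrable_norm) (auto simp: norm_mult intro!: mult_right_mono)
  finally show ?thesis .
qed

text \<open>A function with derivative bounded by \<open>B\<close> changes by at most \<open>B \<bar>t\<bar>\<close>, and the first absolute moment of
  the Gaussian is at most \<open>\<epsilon>\<close>; \<open>2 \<epsilon> \<bar>t\<bar> \<le> \<epsilon>\<^sup>2 + t\<^sup>2\<close> reduces it to the second moment.\<close>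

lemma gauss_conv_approx:
  assumes u: "Cb_le (Suc 0) B u" and "\<epsilon> > 0"
  shows "cmod (gauss_conv u \<epsilon> x - u x) \<le> B * \<epsilon>"
proof -
  obtain u' where u': "\<And>x. (u has_vector_derivative u' x) (at x)" "Cb_le 0 B u'" using u by (rule Cb_derivE) blast
  have B: "0 \<le> B" by (rule Cb_nonneg[OF u])
  have one: "(\<integral>t. complex_of_real (gauss \<epsilon> t) \<partial>lborel) = 1"
    using integral_normal_density[OF assms(2), of 0] by (simp add: integral_complex_of_real)
  have sq: "has_bochner_integral lborel (\<lambda>t. gauss \<epsilon> t * t\<^sup>2) (\<epsilon>\<^sup>2)"
    using normal_moment_even[of \<epsilon> 0 1] assms(2) by (simp add: fact_numeral power_divide)
  have lin: "cmod (u (x - t) - u x) \<le> B * ((\<epsilon>\<^sup>2 + t\<^sup>2) / (2 * \<epsilon>))" for t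
  proof -
    have "cmod (u (x - t) - u x) \<le> B * \<bar>(x - t) - x\<bar>" by (rule Cb_Lipschitz[OF u'(1) Cb_bound[OF u'(2)]])
    also have "\<bar>(x - t) - x\<bar> \<le> (\<epsilon>\<^sup>2 + t\<^sup>2) / (2 * \<epsilon>)"
    proof -
      have "0 \<le> (\<epsilon> - \<bar>t\<bar>)\<^sup>2" by simp
      then have "2 * \<epsilon> * \<bar>t\<bar> \<le> \<epsilon>\<^sup>2 + t\<^sup>2" by (simp add: power2_eq_square algebra_simps)
      then show ?thesis using assms(2) by (simp add: field_simps)
    qed
    finally show ?thesis using B by (simp add: mult_left_mono)
  qed
  have "gauss_conv u \<epsilon> x - u x = (\<integral>t. u (x - t) * of_real (gauss \<epsilon> t) \<partial>lborel) - (\<integral>t. u x * of_real (gauss \<epsilon> t) \<partial>lborel)"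
    using integral_normal_density[OF assms(2), of 0] by (simp add: gauss_conv_def)
  also have "\<dots> = (\<integral>t. u (x - t) * of_real (gauss \<epsilon> t) - u x * of_real (gauss \<epsilon> t) \<partial>lborel)"
    by (rule Bochner_Integration.integral_diff[symmetric, OF gauss_conv_integrable[OF u assms(2)] integrable_mult_right[OF integrable_gauss[OF assms(2)]]])
  also have "\<dots> = (\<integral>t. (u (x - t) - u x) * of_real (gauss \<epsilon> t) \<partial>lborel)" by (simp add: left_diff_distrib)
  also have "cmod \<dots> \<le> (\<integral>t. B * ((\<epsilon>\<^sup>2 + t\<^sup>2) / (2 * \<epsilon>)) * gauss \<epsilon> t \<partial>lborel)"
  proof (rule norm_integral_gauss_le[OF _ assms(2) _ lin])
    show "integrable lborel (\<lambda>t. (u (x - t) - u x) * complex_of_real (gauss \<epsilon> t))"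
      using Bochner_Integration.integrable_diff[OF gauss_conv_integrable[OF u assms(2)] integrable_mult_right[OF integrable_gauss[OF assms(2)]]]
      by (simp add: left_diff_distrib)
    have "integrable lborel (\<lambda>t. B / (2 * \<epsilon>) * (\<epsilon>\<^sup>2 * gauss \<epsilon> t + gauss \<epsilon> t * t\<^sup>2))"
      using assms(2) sq by (intro integrable_mult_right Bochner_Integration.integrable_add integrable_normal_density) (auto simp: has_bochner_integral_iff)
    then show "integrable lborel (\<lambda>t. B * ((\<epsilon>\<^sup>2 + t\<^sup>2) / (2 * \<epsilon>)) * gauss \<epsilon> t)"
      by (rule Bochner_Integration.integrable_cong[THEN iffD1, rotated -1]) (simp_all add: algebra_simps add_divide_distrib)
  qed
  also have "\<dots> = (\<integral>t. B / (2 * \<epsilon>) * (\<epsilon>\<^sup>2 * gauss \<epsilon> t + gauss \<epsilon> t * t\<^sup>2) \<partial>lborel)"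
    by (rule Bochner_Integration.integral_cong) (simp_all add: algebra_simps add_divide_distrib)
  also have "\<dots> = B / (2 * \<epsilon>) * (\<epsilon>\<^sup>2 * 1 + \<epsilon>\<^sup>2)"
    using assms(2) sq integral_normal_density[OF assms(2), of 0]
    by (subst integral_mult_right_zero, subst Bochner_Integration.integral_add)
      (auto simp: has_bochner_integral_iff)
  also have "\<dots> = B * \<epsilon>" using assms(2) by (simp add: power2_eq_square field_simps)
  finally show ?thesis .
qed

lemma has_vector_derivative_quadratic:
  fixes f :: "real \<Rightarrow> 'a::real_normed_vector"
  assumes "\<And>h. norm (f (x + h) - f x - h *\<^sub>R d) \<le> B * h\<^sup>2"
  shows "(f has_vector_derivative d) (at x)"
  unfolding has_vector_derivative_def has_derivative_at
proof (intro conjI bounded_linear_scaleR_left)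
  show "(\<lambda>h. norm (f (x + h) - f x - h *\<^sub>R d) / norm h) \<midarrow>0\<rightarrow> 0"
  proof (rule Lim_null_comparison)
    show "\<forall>\<^sub>F h in at 0. norm (norm (f (x + h) - f x - h *\<^sub>R d) / norm h) \<le> B * \<bar>h\<bar>"
    proof (rule always_eventually, rule allI)
      fix h :: real
      have "norm (f (x + h) - f x - h *\<^sub>R d) / \<bar>h\<bar> \<le> B * \<bar>h\<bar>"
        using assms[of h] by (cases "h = 0") (auto simp: divide_le_eq power2_eq_square mult.assoc abs_mult_self_eq)
      then show "norm (norm (f (x + h) - f x - h *\<^sub>R d) / norm h) \<le> B * \<bar>h\<bar>" by simp
    qed
    have "((\<lambda>h. B * \<bar>h\<bar>) \<longlongrightarrow> B * \<bar>0\<bar>) (at 0)" by (rule tendsto_mult[OF tendsto_const tendsto_rabs[OF tendsto_ident_at]])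
    then show "((\<lambda>h. B * \<bar>h\<bar>) \<longlongrightarrow> 0) (at 0)" by simp
  qed
qed

lemma gauss_conv_has_derivative:
  assumes u: "Cb_le (Suc (Suc 0)) B u" and u': "\<And>x. (u has_vector_derivative u' x) (at x)" "Cb_le (Suc 0) B u'" and \<epsilon>: "\<epsilon> > 0"
  shows "(gauss_conv u \<epsilon> has_vector_derivative gauss_conv u' \<epsilon> x) (at x)"
proof (rule has_vector_derivative_quadratic)
  fix h
  note i = gauss_conv_integrable[OF u \<epsilon>] gauss_conv_integrable[OF u'(2) \<epsilon>]
  let ?g = "\<lambda>t. (u ((x - t) + h) - u (x - t) - h *\<^sub>R u' (x - t))"
  have "gauss_conv u \<epsilon> (x + h) - gauss_conv u \<epsilon> x - h *\<^sub>R gauss_conv u' \<epsilon> x = (\<integral>t. u (x + h - t) * of_real (gauss \<epsilon> t) - u (x - t) * of_real (gauss \<epsilon> t)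
       - h *\<^sub>R (u' (x - t) * of_real (gauss \<epsilon> t)) \<partial>lborel)"
    unfolding gauss_conv_def using i by (simp add: Bochner_Integration.integral_diff)
  also have "\<dots> = (\<integral>t. ?g t * of_real (gauss \<epsilon> t) \<partial>lborel)"
    by (rule Bochner_Integration.integral_cong) (simp_all add: left_diff_distrib add_diff_eq[symmetric] diff_add_eq)
  also have "cmod \<dots> \<le> (\<integral>t. B * h\<^sup>2 * gauss \<epsilon> t \<partial>lborel)"
  proof (rule norm_integral_gauss_le[OF _ \<epsilon>])
    have "integrable lborel (\<lambda>t. u (x + h - t) * of_real (gauss \<epsilon> t) - u (x - t) * of_real (gauss \<epsilon> t)
       - h *\<^sub>R (u' (x - t) * of_real (gauss \<epsilon> t)))"
      using i by (intro Bochner_Integration.integrable_diff integrable_scaleR_right)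
    then show "integrable lborel (\<lambda>t. ?g t * of_real (gauss \<epsilon> t))"
      by (rule Bochner_Integration.integrable_cong[THEN iffD1, rotated -1]) (simp_all add: left_diff_distrib add_diff_eq[symmetric] diff_add_eq)
    show "integrable lborel (\<lambda>t. B * h\<^sup>2 * gauss \<epsilon> t)" using \<epsilon> by (intro integrable_mult_right integrable_normal_density)
    show "cmod (?g t) \<le> B * h\<^sup>2" for t by (rule Cb_Taylor[OF u'])
  qed
  also have "\<dots> = B * h\<^sup>2" using integral_normal_density[OF \<epsilon>, of 0] by simp
  finally show "cmod (gauss_conv u \<epsilon> (x + h) - gauss_conv u \<epsilon> x - h *\<^sub>R gauss_conv u' \<epsilon> x) \<le> B * h\<^sup>2" .
qed

text \<open>Derivatives commute with the convolution. One spare derivative gives the rate, the other one lets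
  the difference quotients converge.\<close>

lemma gauss_conv_Cb:
  assumes "Cb_le (Suc (Suc m)) B u" "\<epsilon> > 0"
  shows "Cb_le m (B * \<epsilon>) (\<lambda>x. gauss_conv u \<epsilon> x - u x)"
  using assms(1)
proof (induction m arbitrary: u)
  case 0
  obtain u' where u': "\<And>x. (u has_vector_derivative u' x) (at x)" "Cb_le (Suc 0) B u'" using 0 by (rule Cb_derivE) blast
  have "continuous_on UNIV (gauss_conv u \<epsilon>)"
    by (intro continuous_at_imp_continuous_on ballI
        has_vector_derivative_continuous[OF gauss_conv_has_derivative[OF 0 u' assms(2)]])
  then show ?case using gauss_conv_approx[OF Cb_Suc_imp[OF 0] assms(2)] Cb_continuous[OF 0, of UNIV]
    by (auto intro!: continuous_intros)
next
  case (Suc m)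
  obtain u' where u': "\<And>x. (u has_vector_derivative u' x) (at x)" "Cb_le (Suc (Suc m)) B u'" using Suc.prems by (rule Cb_derivE) blast
  show ?case
  proof (rule Cb_SucI)
    show "cmod (gauss_conv u \<epsilon> x - u x) \<le> B * \<epsilon>" for x
      by (rule gauss_conv_approx[OF Cb_le_order[OF Suc.prems] assms(2)]) simp
    have "(gauss_conv u \<epsilon> has_vector_derivative gauss_conv u' \<epsilon> x) (at x)" for x
      by (rule gauss_conv_has_derivative[OF Cb_le_order[OF Suc.prems] u'(1) Cb_le_order[OF u'(2)] assms(2)]) simp_all
    then show "((\<lambda>x. gauss_conv u \<epsilon> x - u x) has_vector_derivative gauss_conv u' \<epsilon> x - u' x) (at x)" for x
      by (intro has_vector_derivative_diff u'(1))
  qed (rule Suc.IH[OF u'(2)])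
qed

text \<open>The Gaussian density continued to the plane.\<close>

definition gauss_cx :: "real \<Rightarrow> complex \<Rightarrow> complex" where
  "gauss_cx \<epsilon> w = of_real (1 / sqrt (2 * pi * \<epsilon>\<^sup>2)) * exp (- w\<^sup>2 / of_real (2 * \<epsilon>\<^sup>2))"

lemma gauss_cx_of_real: "gauss_cx \<epsilon> (of_real t) = of_real (gauss \<epsilon> t)"
  by (simp add: gauss_cx_def normal_density_def exp_of_real[symmetric])

lemma cmod_gauss_cx: "cmod (gauss_cx \<epsilon> (w - of_real s)) = normal_density (Re w) \<epsilon> s * exp ((Im w)\<^sup>2 / (2 * \<epsilon>\<^sup>2))"
proof -
  have "Re (- (w - of_real s)\<^sup>2 / of_real (2 * \<epsilon>\<^sup>2)) = - (s - Re w)\<^sup>2 / (2 * \<epsilon>\<^sup>2) + (Im w)\<^sup>2 / (2 * \<epsilon>\<^sup>2)"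
    unfolding Re_divide_of_real by (simp add: power2_eq_square algebra_simps add_divide_distrib[symmetric])
  note Re_eq = this
  show ?thesis unfolding gauss_cx_def norm_mult norm_exp_eq_Re Re_eq norm_of_real exp_add normal_density_def
    by simp
qed

definition gauss_ext :: "(real \<Rightarrow> complex) \<Rightarrow> real \<Rightarrow> complex \<Rightarrow> complex" where
  "gauss_ext u \<epsilon> w = (\<integral>s. u s * gauss_cx \<epsilon> (w - of_real s) \<partial>lborel)"

lemma gauss_cx_measurable [measurable]: "(\<lambda>s. gauss_cx \<epsilon> (w - of_real s)) \<in> borel_measurable borel"
  unfolding gauss_cx_def divide_inverse by (intro borel_measurable_continuous_onI continuous_intros)

lemma integrable_gauss_cx: "\<epsilon> > 0 \<Longrightarrow> integrable lborel (\<lambda>s. gauss_cx \<epsilon> (w - of_real s))"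
  by (rule Bochner_Integration.integrable_bound[of _ "\<lambda>s. normal_density (Re w) \<epsilon> s * exp ((Im w)\<^sup>2 / (2 * \<epsilon>\<^sup>2))"])
    (auto simp: cmod_gauss_cx)

lemma gauss_ext_integrable:
  assumes "Cb_le m B u" "\<epsilon> > 0"
  shows "integrable lborel (\<lambda>s. u s * gauss_cx \<epsilon> (w - of_real s))"
  by (rule bounded_mult_integrable[OF Cb_continuous[OF assms(1)] Cb_bound[OF assms(1)] integrable_gauss_cx[OF assms(2)]])

text \<open>On the line of height \<open>h\<close> the modulus of the complex Gaussian is a real Gaussian times
  \<open>exp (h\<^sup>2 / (2 \<epsilon>\<^sup>2))\<close>, so the extension is bounded on every horizontal strip.\<close>

lemma gauss_ext_bound:
  assumes "Cb_le m B u" "\<epsilon> > 0"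
  shows "cmod (gauss_ext u \<epsilon> w) \<le> B * exp ((Im w)\<^sup>2 / (2 * \<epsilon>\<^sup>2))"
proof -
  have "cmod (gauss_ext u \<epsilon> w) \<le> (\<integral>s. norm (u s * gauss_cx \<epsilon> (w - of_real s)) \<partial>lborel)"
    unfolding gauss_ext_def by (rule integral_norm_bound)
  also have "\<dots> \<le> (\<integral>s. B * exp ((Im w)\<^sup>2 / (2 * \<epsilon>\<^sup>2)) * normal_density (Re w) \<epsilon> s \<partial>lborel)"
  proof (rule integral_mono)
    show "integrable lborel (\<lambda>s. norm (u s * gauss_cx \<epsilon> (w - of_real s)))" by (intro integrable_norm gauss_ext_integrable[OF assms])
    show "integrable lborel (\<lambda>s. B * exp ((Im w)\<^sup>2 / (2 * \<epsilon>\<^sup>2)) * normal_density (Re w) \<epsilon> s)"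
      using assms(2) by (intro integrable_mult_right integrable_normal_density)
    show "norm (u s * gauss_cx \<epsilon> (w - of_real s)) \<le> B * exp ((Im w)\<^sup>2 / (2 * \<epsilon>\<^sup>2)) * normal_density (Re w) \<epsilon> s" for s
      using mult_right_mono[OF Cb_bound[OF assms(1), of s], of "cmod (gauss_cx \<epsilon> (w - of_real s))"]
      by (simp add: norm_mult cmod_gauss_cx mult_ac)
  qed
  also have "\<dots> = B * exp ((Im w)\<^sup>2 / (2 * \<epsilon>\<^sup>2))" using integral_normal_density[OF assms(2)] by simp
  finally show ?thesis .
qed

lemma gauss_ext_of_real: "gauss_ext u \<epsilon> (of_real x) = gauss_conv u \<epsilon> x"
proof -
  have "gauss_ext u \<epsilon> (of_real x) = (\<integral>s. u s * of_real (gauss \<epsilon> (x - s)) \<partial>lborel)"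
    unfolding gauss_ext_def by (simp add: gauss_cx_of_real[symmetric])
  also have "\<dots> = \<bar>-1::real\<bar> *\<^sub>R (\<integral>t. u (x + -1 * t) * of_real (gauss \<epsilon> (x - (x + -1 * t))) \<partial>lborel)"
    by (rule lborel_integral_real_affine) simp
  finally show ?thesis by (simp add: gauss_conv_def)
qed

text \<open>Moving the centre by at most one is absorbed by widening the Gaussian by the factor \<open>sqrt 2\<close>. This
  gives one integrable majorant for all nearby points.\<close>

lemma gauss_cx_dominated:
  assumes "\<epsilon> > 0" "dist w0 w \<le> 1"
  shows "cmod (gauss_cx \<epsilon> (w - of_real s)) \<le> (sqrt 2 * exp ((\<bar>Im w0\<bar> + 1)\<^sup>2 / (2 * \<epsilon>\<^sup>2) + 1 / (2 * \<epsilon>\<^sup>2))) * normal_density (Re w0) (sqrt 2 * \<epsilon>) s"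
proof -
  have d: "\<bar>Re w0 - Re w\<bar> \<le> 1" "\<bar>Im w0 - Im w\<bar> \<le> 1"
    using assms(2) abs_Re_le_cmod[of "w0 - w"] abs_Im_le_cmod[of "w0 - w"] by (auto simp: dist_norm)
  have sq: "(s - Re w0)\<^sup>2 \<le> 2 * (s - Re w)\<^sup>2 + 2"
  proof -
    have "(s - Re w0)\<^sup>2 = ((s - Re w) + (Re w - Re w0))\<^sup>2" by simp
    also have "\<dots> \<le> 2 * (s - Re w)\<^sup>2 + 2 * (Re w - Re w0)\<^sup>2"
      using zero_le_power2[of "(s - Re w) - (Re w - Re w0)"] by (simp add: power2_eq_square algebra_simps)
    also have "(Re w - Re w0)\<^sup>2 \<le> 1" using d(1) by (simp add: abs_square_le_1 abs_minus_commute)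
    finally show ?thesis by simp
  qed
  have "(Im w)\<^sup>2 \<le> (\<bar>Im w0\<bar> + 1)\<^sup>2" using d(2) by (intro power2_le_iff_abs_le[THEN iffD2]) auto
  then have im: "(Im w)\<^sup>2 / (2 * \<epsilon>\<^sup>2) \<le> (\<bar>Im w0\<bar> + 1)\<^sup>2 / (2 * \<epsilon>\<^sup>2)" by (intro divide_right_mono) auto
  have re: "- (s - Re w)\<^sup>2 / (2 * \<epsilon>\<^sup>2) \<le> 1 / (2 * \<epsilon>\<^sup>2) - (s - Re w0)\<^sup>2 / (2 * (sqrt 2 * \<epsilon>)\<^sup>2)"
  proof -
    have "- (s - Re w)\<^sup>2 / (2 * \<epsilon>\<^sup>2) \<le> (1 - (s - Re w0)\<^sup>2 / 2) / (2 * \<epsilon>\<^sup>2)"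
      using sq by (intro divide_right_mono) auto
    also have "\<dots> = 1 / (2 * \<epsilon>\<^sup>2) - (s - Re w0)\<^sup>2 / (2 * (sqrt 2 * \<epsilon>)\<^sup>2)"
      by (simp add: diff_divide_distrib power_mult_distrib)
    finally show ?thesis .
  qed
  have "cmod (gauss_cx \<epsilon> (w - of_real s)) = 1 / sqrt (2 * pi * \<epsilon>\<^sup>2) * exp (- (s - Re w)\<^sup>2 / (2 * \<epsilon>\<^sup>2) + (Im w)\<^sup>2 / (2 * \<epsilon>\<^sup>2))"
    unfolding cmod_gauss_cx normal_density_def exp_add by (simp add: mult.assoc)
  also have "\<dots> \<le> 1 / sqrt (2 * pi * \<epsilon>\<^sup>2) * exp ((1 / (2 * \<epsilon>\<^sup>2) - (s - Re w0)\<^sup>2 / (2 * (sqrt 2 * \<epsilon>)\<^sup>2)) + (\<bar>Im w0\<bar> + 1)\<^sup>2 / (2 * \<epsilon>\<^sup>2))"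
    using re im by (intro mult_left_mono) (auto intro!: add_mono)
  also have "\<dots> = (sqrt 2 * exp ((\<bar>Im w0\<bar> + 1)\<^sup>2 / (2 * \<epsilon>\<^sup>2) + 1 / (2 * \<epsilon>\<^sup>2))) * normal_density (Re w0) (sqrt 2 * \<epsilon>) s"
  proof -
    have "1 / sqrt (2 * pi * \<epsilon>\<^sup>2) = sqrt 2 * (1 / sqrt (2 * pi * (sqrt 2 * \<epsilon>)\<^sup>2))"
    proof -
      have e: "2 * pi * (sqrt 2 * \<epsilon>)\<^sup>2 = 2 * (2 * pi * \<epsilon>\<^sup>2)" by (simp add: power_mult_distrib)
      show ?thesis unfolding e real_sqrt_mult[of 2 "2 * pi * \<epsilon>\<^sup>2"] by simp
    qed
    moreover have "exp ((1 / (2 * \<epsilon>\<^sup>2) - (s - Re w0)\<^sup>2 / (2 * (sqrt 2 * \<epsilon>)\<^sup>2)) + (\<bar>Im w0\<bar> + 1)\<^sup>2 / (2 * \<epsilon>\<^sup>2))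
        = exp ((\<bar>Im w0\<bar> + 1)\<^sup>2 / (2 * \<epsilon>\<^sup>2) + 1 / (2 * \<epsilon>\<^sup>2)) * exp (- (s - Re w0)\<^sup>2 / (2 * (sqrt 2 * \<epsilon>)\<^sup>2))"
      unfolding exp_add[symmetric] by (rule arg_cong[of _ _ exp]) (simp add: algebra_simps)
    ultimately show ?thesis unfolding normal_density_def by (simp only: mult_ac)
  qed
  finally show ?thesis .
qed

text \<open>The integrals over bounded intervals are holomorphic by differentiation under the integral sign, and
  the majorant of \<open>gauss_cx_dominated\<close> makes them converge locally uniformly.\<close>

lemma gauss_ext_holomorphic:
  assumes u: "Cb_le m B u" and \<epsilon>: "\<epsilon> > 0"
  shows "gauss_ext u \<epsilon> holomorphic_on UNIV"
proof (rule holomorphic_uniform_sequence[OF open_UNIV])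
  define I where "I n w = integral (cbox (- real n) (real n)) (\<lambda>s. u s * gauss_cx \<epsilon> (w - of_real s))" for n w
  have Gcd: "((\<lambda>w. gauss_cx \<epsilon> (w - of_real s)) has_field_derivative gauss_cx \<epsilon> (w - of_real s) * (- (w - of_real s) / of_real (\<epsilon>\<^sup>2))) (at w within S)" for w s S
    unfolding gauss_cx_def using \<epsilon> by (auto intro!: derivative_eq_intros simp: field_simps power2_eq_square)
  have Gcc: "continuous_on S (\<lambda>p. gauss_cx \<epsilon> (fst p - complex_of_real (snd p)))" for S
    unfolding gauss_cx_def using \<epsilon> by (intro continuous_intros) auto
  show "I n holomorphic_on UNIV" for n
    unfolding I_def
  proof (rule leibniz_rule_holomorphic[where fx = "\<lambda>w s. u s * (gauss_cx \<epsilon> (w - of_real s) * (- (w - of_real s) / of_real (\<epsilon>\<^sup>2)))"])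
    show "((\<lambda>w. u s * gauss_cx \<epsilon> (w - of_real s)) has_field_derivative u s * (gauss_cx \<epsilon> (w - of_real s) * (- (w - of_real s) / of_real (\<epsilon>\<^sup>2)))) (at w within UNIV)" for w s
      by (rule DERIV_cmult[OF Gcd])
    have uc: "continuous_on S (\<lambda>p. u (snd p))" for S :: "(complex \<times> real) set"
      by (rule continuous_on_compose2[OF Cb_continuous[OF u, of UNIV] continuous_on_snd[OF continuous_on_id]]) auto
    show "continuous_on (UNIV \<times> cbox (- real n) (real n)) (\<lambda>(w, s). u s * (gauss_cx \<epsilon> (w - of_real s) * (- (w - of_real s) / of_real (\<epsilon>\<^sup>2))))"
      unfolding case_prod_unfold using \<epsilon> by (intro continuous_intros uc Gcc) auto
    show "(\<lambda>s. u s * gauss_cx \<epsilon> (w - of_real s)) integrable_on cbox (- real n) (real n)" for w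
      using \<epsilon> by (intro integrable_continuous continuous_intros Cb_continuous[OF u]) (auto simp: gauss_cx_def intro!: continuous_intros)
  qed simp
  fix w0 :: complex
  define D where "D s = B * ((sqrt 2 * exp ((\<bar>Im w0\<bar> + 1)\<^sup>2 / (2 * \<epsilon>\<^sup>2) + 1 / (2 * \<epsilon>\<^sup>2))) * normal_density (Re w0) (sqrt 2 * \<epsilon>) s)" for s
  have B: "0 \<le> B" by (rule Cb_nonneg[OF u])
  have Di: "integrable lborel D" unfolding D_def using \<epsilon> by (intro integrable_mult_right integrable_normal_density) auto
  have D0: "0 \<le> D s" for s unfolding D_def using B \<epsilon> by (intro mult_nonneg_nonneg) auto
  define T where "T n = (\<integral>s. indicator (- {- real n..real n}) s *\<^sub>R D s \<partial>lborel)" for n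
  have "T \<longlonglongrightarrow> (\<integral>s. 0 \<partial>(lborel :: real measure))"
    unfolding T_def
  proof (rule integral_dominated_convergence[where w = D])
    show "AE s in lborel. (\<lambda>n. indicator (- {- real n..real n}) s *\<^sub>R D s) \<longlonglongrightarrow> 0"
    proof (rule AE_I2, rule tendsto_eventually)
      fix s :: real
      obtain k where "\<bar>s\<bar> \<le> real k" using real_arch_simple by blast
      then have "indicator (- {- real n..real n}) s *\<^sub>R D s = 0" if "n \<ge> k" for n
        using that by (auto simp: indicator_def abs_le_iff)
      then show "\<forall>\<^sub>F n in sequentially. indicator (- {- real n..real n}) s *\<^sub>R D s = 0"
        unfolding eventually_sequentially by blast
    qed
    show "AE s in lborel. norm (indicator (- {- real n..real n}) s *\<^sub>R D s) \<le> D s" for n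
      using D0 by (auto simp: indicator_def)
  qed (use Di in auto)
  then have T0: "T \<longlonglongrightarrow> 0" by simp
  have tail: "cmod (gauss_ext u \<epsilon> w - I n w) \<le> T n" if w: "dist w0 w \<le> 1" for n w
  proof -
    let ?f = "\<lambda>s. u s * gauss_cx \<epsilon> (w - of_real s)"
    have fi: "integrable lborel ?f" by (rule gauss_ext_integrable[OF u \<epsilon>])
    have ii: "integrable lborel (\<lambda>s. indicator {- real n..real n} s *\<^sub>R ?f s)"
      using integrable_mult_indicator[OF _ fi, of "{- real n..real n}"] by simp
    have "I n w = (\<integral>s. indicator {- real n..real n} s *\<^sub>R ?f s \<partial>lborel)"
      unfolding I_def using set_borel_integral_eq_integral(2)[of "{- real n..real n}" ?f] ii
      by (simp add: set_integrable_def set_lebesgue_integral_def)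
    then have "gauss_ext u \<epsilon> w - I n w = (\<integral>s. ?f s - indicator {- real n..real n} s *\<^sub>R ?f s \<partial>lborel)"
      unfolding gauss_ext_def using Bochner_Integration.integral_diff[OF fi ii] by simp
    also have "cmod \<dots> \<le> (\<integral>s. norm (?f s - indicator {- real n..real n} s *\<^sub>R ?f s) \<partial>lborel)" by (rule integral_norm_bound)
    also have "\<dots> \<le> T n"
      unfolding T_def
    proof (rule integral_mono)
      show "integrable lborel (\<lambda>s. norm (?f s - indicator {- real n..real n} s *\<^sub>R ?f s))"
        by (intro integrable_norm Bochner_Integration.integrable_diff fi ii)
      show "integrable lborel (\<lambda>s. indicator (- {- real n..real n}) s *\<^sub>R D s)"
        using integrable_mult_indicator[OF _ Di, of "- {- real n..real n}"] by simp
      fix s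
      have "cmod (?f s) \<le> D s"
        unfolding D_def norm_mult[of "u s"] by (intro mult_mono Cb_bound[OF u] gauss_cx_dominated[OF \<epsilon> w] B) auto
      then show "norm (?f s - indicator {- real n..real n} s *\<^sub>R ?f s) \<le> indicator (- {- real n..real n}) s *\<^sub>R D s"
        by (auto simp: indicator_def)
    qed
    finally show ?thesis .
  qed
  have "uniform_limit (cball w0 1) I (gauss_ext u \<epsilon>) sequentially"
  proof (rule uniform_limitI)
    fix e :: real assume "e > 0"
    with T0 have "\<forall>\<^sub>F n in sequentially. T n < e" by (rule order_tendstoD(2))
    then show "\<forall>\<^sub>F n in sequentially. \<forall>w\<in>cball w0 1. dist (I n w) (gauss_ext u \<epsilon> w) < e"
    proof eventually_elim
      case (elim n)
      show ?case
      proof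
        fix w assume "w \<in> cball w0 1"
        then have "cmod (gauss_ext u \<epsilon> w - I n w) \<le> T n" by (intro tail) simp
        then show "dist (I n w) (gauss_ext u \<epsilon> w) < e" using elim by (simp add: dist_norm norm_minus_commute)
      qed
    qed
  qed
  then show "\<exists>d>0. cball w0 d \<subseteq> UNIV \<and> uniform_limit (cball w0 d) I (gauss_ext u \<epsilon>) sequentially"
    by (intro exI[of _ 1]) auto
qed

section \<open>Inverse Fourier transforms of test functions\<close>

lemma compact_support_integrable:
  fixes f :: "real \<Rightarrow> complex"
  assumes "continuous_on UNIV f" "\<And>x. x \<notin> {a..b} \<Longrightarrow> f x = 0"
  shows "integrable lborel f" "(\<integral>x. f x \<partial>lborel) = integral {a..b} f"
proof -
  have eq: "(\<lambda>x. indicator {a..b} x *\<^sub>R f x) = f" using assms(2) by (auto simp: indicator_def fun_eq_iff)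
  have i: "integrable lborel (\<lambda>x. indicator {a..b} x *\<^sub>R f x)"
    by (rule borel_integrable_compact[OF _ continuous_on_subset[OF assms(1)]]) auto
  then show "integrable lborel f" unfolding eq .
  have "(\<integral>x. indicator {a..b} x *\<^sub>R f x \<partial>lborel) = integral {a..b} f"
    using set_borel_integral_eq_integral(2)[of "{a..b}" f] i by (simp add: set_integrable_def set_lebesgue_integral_def)
  then show "(\<integral>x. f x \<partial>lborel) = integral {a..b} f" unfolding eq .
qed

lemma integral_derivative_vanishing:
  fixes g :: "real \<Rightarrow> complex"
  assumes d: "\<And>x. (g has_vector_derivative g' x) (at x)" and i: "integrable lborel g'"
    and l: "(g \<longlongrightarrow> 0) at_top" "(g \<longlongrightarrow> 0) at_bot"
  shows "(\<integral>x. g' x \<partial>lborel) = 0"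
proof -
  have iu: "g' integrable_on UNIV" using i by (rule integrable_on_lborel)
  have "((\<lambda>T. integral {-T..T} g') \<longlongrightarrow> integral UNIV g') at_top" by (rule integral_growing_intervals_tendsto[OF iu])
  moreover have "((\<lambda>T. integral {-T..T} g') \<longlongrightarrow> 0) at_top"
  proof (rule Lim_transform_eventually)
    have "((\<lambda>T. g (- T)) \<longlongrightarrow> 0) at_top" using l(2) by (simp only: filterlim_at_bot_mirror)
    from tendsto_diff[OF l(1) this] show "((\<lambda>T. g T - g (- T)) \<longlongrightarrow> 0) at_top" by simp
    have "g T - g (- T) = integral {-T..T} g'" if "0 \<le> T" for T
    proof -
      have "(g' has_integral g T - g (-T)) {-T..T}"
        by (rule fundamental_theorem_of_calculus[OF _ has_vector_derivative_at_within[OF d]]) (use that in simp)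
      then show ?thesis by (simp only: integral_unique)
    qed
    then show "\<forall>\<^sub>F T in at_top. g T - g (- T) = integral {-T..T} g'"
      by (intro eventually_mono[OF eventually_ge_at_top[of 0]]) blast
  qed
  ultimately have "integral UNIV g' = 0" by (rule tendsto_unique[OF trivial_limit_at_top_linorder])
  then show ?thesis using integral_lborel[OF i] by simp
qed

lemma inv_fourier_eq_integral:
  assumes "continuous_on UNIV \<psi>" "\<forall>\<xi>. \<xi> \<notin> {a..b} \<longrightarrow> \<psi> \<xi> = 0"
  shows "inv_fourier \<psi> x = of_real (1 / (2 * pi)) * integral {a..b} (\<lambda>\<xi>. \<psi> \<xi> * exp (\<i> * of_real (x * \<xi>)))"
    and "integrable lborel (\<lambda>\<xi>. \<psi> \<xi> * exp (\<i> * of_real (x * \<xi>)))"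
proof -
  have c: "continuous_on UNIV (\<lambda>\<xi>. \<psi> \<xi> * exp (\<i> * of_real (x * \<xi>)))"
    using assms(1) by (intro continuous_intros)
  show "inv_fourier \<psi> x = of_real (1 / (2 * pi)) * integral {a..b} (\<lambda>\<xi>. \<psi> \<xi> * exp (\<i> * of_real (x * \<xi>)))"
    unfolding inv_fourier_def using compact_support_integrable(2)[OF c, of a b] assms(2) by simp
  show "integrable lborel (\<lambda>\<xi>. \<psi> \<xi> * exp (\<i> * of_real (x * \<xi>)))"
    using compact_support_integrable(1)[OF c, of a b] assms(2) by simp
qed

lemma cmod_exp_i [simp]: "cmod (exp (\<i> * complex_of_real t)) = 1"
  by (simp add: norm_exp_eq_Re)

lemma inv_fourier_bounded:
  assumes "Cb_le 0 B \<psi>" "\<forall>\<xi>. \<xi> \<notin> {a..b} \<longrightarrow> \<psi> \<xi> = 0"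
  shows "cmod (inv_fourier \<psi> x) \<le> B * \<bar>b - a\<bar>"
proof -
  have c: "continuous_on UNIV \<psi>" by (rule Cb_continuous[OF assms(1)])
  have B: "0 \<le> B" by (rule Cb_nonneg[OF assms(1)])
  have "cmod (integral {a..b} (\<lambda>\<xi>. \<psi> \<xi> * exp (\<i> * of_real (x * \<xi>)))) \<le> integral {a..b} (\<lambda>_. B)"
  proof (rule integral_norm_bound_integral)
    show "(\<lambda>\<xi>. \<psi> \<xi> * exp (\<i> * of_real (x * \<xi>))) integrable_on {a..b}"
      by (intro integrable_continuous_real continuous_intros continuous_on_subset[OF c]) auto
    show "norm (\<psi> \<xi> * exp (\<i> * of_real (x * \<xi>))) \<le> B" for \<xi>
      unfolding norm_mult cmod_exp_i using Cb_bound[OF assms(1)] by simp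
  qed auto
  also have "\<dots> \<le> B * \<bar>b - a\<bar>" using B by (cases "a \<le> b") (auto simp: mult.commute)
  finally have "cmod (integral {a..b} (\<lambda>\<xi>. \<psi> \<xi> * exp (\<i> * of_real (x * \<xi>)))) \<le> B * \<bar>b - a\<bar>" .
  moreover have "cmod (inv_fourier \<psi> x) = 1 / (2 * pi) * cmod (integral {a..b} (\<lambda>\<xi>. \<psi> \<xi> * exp (\<i> * of_real (x * \<xi>))))"
    unfolding inv_fourier_eq_integral(1)[OF c assms(2)] norm_mult norm_of_real by simp
  moreover have "1 / (2 * pi) * cmod (integral {a..b} (\<lambda>\<xi>. \<psi> \<xi> * exp (\<i> * of_real (x * \<xi>)))) \<le>
      1 * cmod (integral {a..b} (\<lambda>\<xi>. \<psi> \<xi> * exp (\<i> * of_real (x * \<xi>))))"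
    using pi_ge_two by (intro mult_right_mono) auto
  ultimately show ?thesis by linarith
qed

text \<open>Integration by parts; the boundary terms vanish by compact support.\<close>

lemma inv_fourier_derivative_symbol:
  assumes d: "\<And>x. (\<psi> has_vector_derivative \<psi>' x) (at x)" and b: "Cb_le 0 B \<psi>'"
    and s: "\<forall>\<xi>. \<xi> \<notin> {a..b} \<longrightarrow> \<psi> \<xi> = 0"
  shows "inv_fourier \<psi>' x = - (\<i> * of_real x) * inv_fourier \<psi> x"
proof -
  have s': "\<forall>\<xi>. \<xi> \<notin> {a..b} \<longrightarrow> \<psi>' \<xi> = 0" using derivative_zero_outside[OF d, of a b] s by blast
  have c: "continuous_on UNIV \<psi>" using d has_vector_derivative_continuous by (blast intro: continuous_at_imp_continuous_on)
  have c': "continuous_on UNIV \<psi>'" by (rule Cb_continuous[OF b])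
  let ?e = "\<lambda>\<xi>. exp (\<i> * of_real (x * \<xi>))"
  have de: "(?e has_vector_derivative \<i> * of_real x * ?e \<xi>) (at \<xi>)" for \<xi>
    by (rule has_vector_derivative_eq_rhs[OF has_vector_derivative_real_field[where f = "\<lambda>z. exp (\<i> * (of_real x * z))" and f' = "\<i> * of_real x * ?e \<xi>", unfolded of_real_mult[symmetric]]])
      (auto intro!: derivative_eq_intros)
  note i1 = inv_fourier_eq_integral(2)[OF c s, of x] and i2 = inv_fourier_eq_integral(2)[OF c' s', of x]
  have i: "integrable lborel (\<lambda>\<xi>. \<psi> \<xi> * (\<i> * of_real x * ?e \<xi>) + \<psi>' \<xi> * ?e \<xi>)"
  proof -
    have "(\<lambda>\<xi>. (\<i> * of_real x) * (\<psi> \<xi> * ?e \<xi>) + \<psi>' \<xi> * ?e \<xi>) = (\<lambda>\<xi>. \<psi> \<xi> * (\<i> * of_real x * ?e \<xi>) + \<psi>' \<xi> * ?e \<xi>)"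
      by (simp only: mult_ac)
    then show ?thesis
      using Bochner_Integration.integrable_add[OF integrable_mult_right[OF i1, of "\<i> * of_real x"] i2] by metis
  qed
  have ev: "\<forall>\<^sub>F \<xi> in at_top. \<psi> \<xi> * ?e \<xi> = 0" "\<forall>\<^sub>F \<xi> in at_bot. \<psi> \<xi> * ?e \<xi> = 0"
    by (rule eventually_mono[OF eventually_gt_at_top[of b]], use s in simp)
      (rule eventually_mono[OF eventually_gt_at_bot[of a]], use s in simp)
  have "(\<integral>\<xi>. \<psi> \<xi> * (\<i> * of_real x * ?e \<xi>) + \<psi>' \<xi> * ?e \<xi> \<partial>lborel) = 0"
    by (rule integral_derivative_vanishing[where g = "\<lambda>\<xi>. \<psi> \<xi> * ?e \<xi>", OF has_vector_derivative_mult[OF d de] i])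
      (intro tendsto_eventually ev)+
  moreover have "(\<integral>\<xi>. \<psi> \<xi> * (\<i> * of_real x * ?e \<xi>) + \<psi>' \<xi> * ?e \<xi> \<partial>lborel)
     = \<i> * of_real x * (\<integral>\<xi>. \<psi> \<xi> * ?e \<xi> \<partial>lborel) + (\<integral>\<xi>. \<psi>' \<xi> * ?e \<xi> \<partial>lborel)"
  proof -
    have "(\<integral>\<xi>. \<psi> \<xi> * (\<i> * of_real x * ?e \<xi>) + \<psi>' \<xi> * ?e \<xi> \<partial>lborel)
        = (\<integral>\<xi>. (\<i> * of_real x) * (\<psi> \<xi> * ?e \<xi>) + \<psi>' \<xi> * ?e \<xi> \<partial>lborel)"
      by (simp only: mult_ac)
    also have "\<dots> = (\<integral>\<xi>. (\<i> * of_real x) * (\<psi> \<xi> * ?e \<xi>) \<partial>lborel) + (\<integral>\<xi>. \<psi>' \<xi> * ?e \<xi> \<partial>lborel)"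
      by (rule Bochner_Integration.integral_add[OF integrable_mult_right[OF i1] i2])
    finally show ?thesis by (simp only: integral_mult_right_zero)
  qed
  ultimately have "(\<integral>\<xi>. \<psi>' \<xi> * ?e \<xi> \<partial>lborel) = - (\<i> * of_real x) * (\<integral>\<xi>. \<psi> \<xi> * ?e \<xi> \<partial>lborel)"
    by (simp add: eq_neg_iff_add_eq_0 add.commute)
  then show ?thesis by (simp add: inv_fourier_def)
qed

text \<open>Two integrations by parts give the decay \<open>x\<^sup>-\<^sup>2\<close>, the sup bound handles small \<open>x\<close>.\<close>

lemma inv_fourier_decay:
  assumes b: "Cb_le (Suc (Suc 0)) B \<psi>" and s: "\<forall>\<xi>. \<xi> \<notin> {a..b} \<longrightarrow> \<psi> \<xi> = 0"
  shows "cmod (inv_fourier \<psi> x) \<le> 2 * B * \<bar>b - a\<bar> / (1 + x\<^sup>2)"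
proof -
  obtain \<psi>' where d: "\<And>x. (\<psi> has_vector_derivative \<psi>' x) (at x)" and b': "Cb_le (Suc 0) B \<psi>'"
    using b by (rule Cb_derivE) blast
  obtain \<psi>'' where d': "\<And>x. (\<psi>' has_vector_derivative \<psi>'' x) (at x)" and b'': "Cb_le 0 B \<psi>''"
    using b' by (rule Cb_derivE) blast
  have s': "\<forall>\<xi>. \<xi> \<notin> {a..b} \<longrightarrow> \<psi>' \<xi> = 0" using derivative_zero_outside[OF d, of a b] s by blast
  have s'': "\<forall>\<xi>. \<xi> \<notin> {a..b} \<longrightarrow> \<psi>'' \<xi> = 0" using derivative_zero_outside[OF d', of a b] s' by blast
  have "inv_fourier \<psi>'' x = - (\<i> * of_real x) * (- (\<i> * of_real x) * inv_fourier \<psi> x)"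
    using inv_fourier_derivative_symbol[OF d' b'' s'] inv_fourier_derivative_symbol[OF d Cb_Suc_imp[OF b'] s] by metis
  then have "cmod (inv_fourier \<psi>'' x) = x\<^sup>2 * cmod (inv_fourier \<psi> x)"
    by (simp add: norm_mult power2_eq_square)
  moreover have "cmod (inv_fourier \<psi>'' x) \<le> B * \<bar>b - a\<bar>" by (rule inv_fourier_bounded[OF b'' s''])
  moreover have "cmod (inv_fourier \<psi> x) \<le> B * \<bar>b - a\<bar>" by (rule inv_fourier_bounded[OF Cb_le_order[OF b] s]) simp_all
  ultimately have "(1 + x\<^sup>2) * cmod (inv_fourier \<psi> x) \<le> 2 * B * \<bar>b - a\<bar>" by (simp add: distrib_right)
  moreover have "1 + x\<^sup>2 > 0" by (simp add: add_pos_nonneg)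
  ultimately show ?thesis by (simp add: pos_le_divide_eq mult.commute)
qed

lemma inv_fourier_has_derivative:
  assumes c: "continuous_on UNIV \<psi>" and s: "\<forall>\<xi>. \<xi> \<notin> {a..b} \<longrightarrow> \<psi> \<xi> = 0"
  shows "(inv_fourier \<psi> has_vector_derivative inv_fourier (\<lambda>\<xi>. \<i> * of_real \<xi> * \<psi> \<xi>) x) (at x)"
proof -
  have c': "continuous_on UNIV (\<lambda>\<xi>. \<i> * of_real \<xi> * \<psi> \<xi>)" using c by (intro continuous_intros)
  have "((\<lambda>x. integral (cbox a b) (\<lambda>\<xi>. \<psi> \<xi> * exp (\<i> * of_real (x * \<xi>)))) has_vector_derivative
      integral (cbox a b) (\<lambda>\<xi>. \<psi> \<xi> * (\<i> * of_real \<xi> * exp (\<i> * of_real (x * \<xi>))))) (at x within UNIV)"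
  proof (rule leibniz_rule_vector_derivative)
    show "((\<lambda>x. \<psi> \<xi> * exp (\<i> * of_real (x * \<xi>))) has_vector_derivative \<psi> \<xi> * (\<i> * of_real \<xi> * exp (\<i> * of_real (x * \<xi>)))) (at x within UNIV)" for x \<xi>
    proof (rule has_vector_derivative_mult_right)
      have "((\<lambda>z. exp (\<i> * (z * of_real \<xi>))) has_field_derivative \<i> * of_real \<xi> * exp (\<i> * (of_real x * of_real \<xi>))) (at (of_real x) within UNIV)"
        by (auto intro!: derivative_eq_intros)
      from has_vector_derivative_real_field[OF this]
      show "((\<lambda>x. exp (\<i> * of_real (x * \<xi>))) has_vector_derivative \<i> * of_real \<xi> * exp (\<i> * of_real (x * \<xi>))) (at x within UNIV)"
        by simp
    qed
    show "(\<lambda>\<xi>. \<psi> \<xi> * exp (\<i> * of_real (x * \<xi>))) integrable_on cbox a b" for x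
      by (intro integrable_continuous continuous_intros continuous_on_subset[OF c]) auto
    have "continuous_on (UNIV \<times> cbox a b) (\<lambda>p. \<psi> (snd p))"
      by (rule continuous_on_compose2[OF c continuous_on_snd[OF continuous_on_id]]) auto
    then show "continuous_on (UNIV \<times> cbox a b) (\<lambda>(x, \<xi>). \<psi> \<xi> * (\<i> * of_real \<xi> * exp (\<i> * of_real (x * \<xi>))))"
      unfolding case_prod_unfold by (intro continuous_intros)
  qed auto
  then have "((\<lambda>x. of_real (1 / (2 * pi)) * integral {a..b} (\<lambda>\<xi>. \<psi> \<xi> * exp (\<i> * of_real (x * \<xi>)))) has_vector_derivative
      of_real (1 / (2 * pi)) * integral {a..b} (\<lambda>\<xi>. \<i> * of_real \<xi> * \<psi> \<xi> * exp (\<i> * of_real (x * \<xi>)))) (at x)"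
    by (intro has_vector_derivative_mult_right) (simp add: mult_ac)
  moreover have "inv_fourier \<psi> = (\<lambda>x. of_real (1 / (2 * pi)) * integral {a..b} (\<lambda>\<xi>. \<psi> \<xi> * exp (\<i> * of_real (x * \<xi>))))"
    using inv_fourier_eq_integral(1)[OF c s] by blast
  moreover have "inv_fourier (\<lambda>\<xi>. \<i> * of_real \<xi> * \<psi> \<xi>) x =
      of_real (1 / (2 * pi)) * integral {a..b} (\<lambda>\<xi>. \<i> * of_real \<xi> * \<psi> \<xi> * exp (\<i> * of_real (x * \<xi>)))"
    using inv_fourier_eq_integral(1)[OF c', of a b x] s by simp
  ultimately show ?thesis by simp
qed

lemma lorentz_integrable: "integrable lborel (\<lambda>x::real. C / (1 + x\<^sup>2))"
proof -
  have m: "(\<lambda>x::real. C / (1 + x\<^sup>2)) \<in> borel_measurable borel" by measurable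
  have "integrable lborel (\<lambda>x::real. (1 + \<bar>x\<bar>) powr (-1 - 1))"
    by (rule integrable_lborel_log_weight) simp
  then have "integrable lborel (\<lambda>x::real. 2 * \<bar>C\<bar> * (1 + \<bar>x\<bar>) powr (-1 - 1))" by (rule integrable_mult_right)
  then show ?thesis
  proof (rule Bochner_Integration.integrable_bound)
    show "(\<lambda>x::real. C / (1 + x\<^sup>2)) \<in> borel_measurable lborel" using m by simp
    have le: "\<bar>C\<bar> / (1 + x\<^sup>2) \<le> 2 * \<bar>C\<bar> / (1 + \<bar>x\<bar>)\<^sup>2" for x :: real
    proof -
      define a where "a = \<bar>x\<bar>"
      have a2: "x\<^sup>2 = a\<^sup>2" by (simp add: a_def)
      have "(1 + a)\<^sup>2 + (1 - a)\<^sup>2 = 2 * (1 + a\<^sup>2)" by algebra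
      then have "(1 + a)\<^sup>2 \<le> 2 * (1 + a\<^sup>2)" using zero_le_power2[of "1 - a"] by linarith
      moreover have "0 < (1 + a)\<^sup>2" by (simp add: a_def add_pos_nonneg)
      ultimately have "2 * \<bar>C\<bar> / (2 * (1 + a\<^sup>2)) \<le> 2 * \<bar>C\<bar> / (1 + a)\<^sup>2"
        by (intro divide_left_mono mult_pos_pos) (auto simp: add_pos_nonneg)
      moreover have "2 * \<bar>C\<bar> / (2 * (1 + a\<^sup>2)) = \<bar>C\<bar> / (1 + a\<^sup>2)"
        by (rule mult_divide_mult_cancel_left) simp
      ultimately show ?thesis unfolding a2 a_def[symmetric] by metis
    qed
    have pw: "(1 + \<bar>x\<bar>) powr (-1 - 1) = 1 / (1 + \<bar>x\<bar>)\<^sup>2" for x :: real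
      using powr_minus[of "1 + \<bar>x\<bar>" 2] by (simp add: divide_inverse powr_numeral)
    show "AE x in lborel. norm (C / (1 + x\<^sup>2)) \<le> norm (2 * \<bar>C\<bar> * (1 + \<bar>x\<bar>) powr (-1 - 1))"
    proof (rule AE_I2)
      fix x :: real
      have "norm (C / (1 + x\<^sup>2)) = \<bar>C\<bar> / (1 + x\<^sup>2)" by (simp add: abs_divide)
      moreover have "norm (2 * \<bar>C\<bar> * (1 + \<bar>x\<bar>) powr (-1 - 1)) = 2 * \<bar>C\<bar> / (1 + \<bar>x\<bar>)\<^sup>2"
        unfolding pw by (simp add: abs_mult)
      ultimately show "norm (C / (1 + x\<^sup>2)) \<le> norm (2 * \<bar>C\<bar> * (1 + \<bar>x\<bar>) powr (-1 - 1))"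
        using le[of x] by simp
    qed
  qed
qed

section \<open>Localised products and integration by parts\<close>

lemma smooth_compact_Cinf:
  assumes "smooth \<phi>" "supp \<phi> \<subseteq> {a..b}"
  shows "Cinf \<phi>" "\<forall>x. x \<notin> {a..b} \<longrightarrow> \<phi> x = 0"
proof -
  obtain D where D: "D 0 = \<phi>" "\<And>n x. (D n has_vector_derivative D (Suc n) x) (at x)"
    using assms(1) unfolding smooth_def by blast
  show z: "\<forall>x. x \<notin> {a..b} \<longrightarrow> \<phi> x = 0"
    using assms(2) closure_subset[of "{x. \<phi> x \<noteq> 0}"] by (auto simp: supp_def)
  have zD: "\<forall>x. x \<notin> {a..b} \<longrightarrow> D n x = 0" for n
  proof (induction n)
    case (Suc n)
    then show ?case using derivative_zero_outside[OF D(2)[of n], of a b] by blast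
  qed (use z D(1) in simp)
  have cD: "continuous_on UNIV (D n)" for n
    using D(2)[of n] has_vector_derivative_continuous by (blast intro: continuous_at_imp_continuous_on)
  have bD: "\<exists>B. \<forall>x. cmod (D n x) \<le> B" for n
  proof -
    have "bounded (D n ` {a..b})"
      by (intro compact_imp_bounded compact_continuous_image continuous_on_subset[OF cD]) auto
    then obtain B where B: "\<forall>x\<in>{a..b}. cmod (D n x) \<le> B" unfolding bounded_iff by blast
    have "cmod (D n x) \<le> max B 0" for x
      using B zD[of n] by (cases "x \<in> {a..b}") (auto simp: le_max_iff_disj)
    then show ?thesis by blast
  qed
  have "\<exists>B. Cb_le m B (D n)" for m n
  proof (induction m arbitrary: n)
    case 0
    then show ?case using bD[of n] cD[of n] by auto
  next
    case (Suc m)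
    obtain B where B: "\<forall>x. cmod (D n x) \<le> B" using bD by blast
    obtain B' where B': "Cb_le m B' (D (Suc n))" using Suc.IH by blast
    have "Cb_le (Suc m) (max B B') (D n)"
    proof (rule Cb_SucI[OF _ D(2)])
      show "cmod (D n x) \<le> max B B'" for x using B by (simp add: le_max_iff_disj)
      show "Cb_le m (max B B') (D (Suc n))" by (rule Cb_mono[OF B']) simp
    qed
    then show ?case by blast
  qed
  then show "Cinf \<phi>" unfolding Cinf_def D(1)[symmetric] by blast
qed

lemma Cinf_derivE:
  assumes "Cinf u"
  obtains u' where "\<And>x. (u has_vector_derivative u' x) (at x)" "Cinf u'"
proof -
  have "\<exists>u'. \<forall>x. (u has_vector_derivative u' x) (at x)"
  proof -
    obtain B where "Cb_le (Suc 0) B u" using assms unfolding Cinf_def by blast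
    then show ?thesis by (rule Cb_derivE) blast
  qed
  then obtain u' where u': "\<And>x. (u has_vector_derivative u' x) (at x)" by blast
  have "\<exists>B. Cb_le m B u'" for m
  proof -
    obtain B where "Cb_le (Suc m) B u" using assms unfolding Cinf_def by blast
    then obtain v where v: "\<And>x. (u has_vector_derivative v x) (at x)" "Cb_le m B v" by (rule Cb_derivE) blast
    have "v = u'" using vector_derivative_unique_at[OF v(1) u'] by blast
    then show ?thesis using v(2) by blast
  qed
  then have "Cinf u'" unfolding Cinf_def by blast
  with u' show ?thesis by (rule that)
qed

text \<open>On the support of \<open>\<phi>\<close> the factors \<open>h j\<close> may be differentiated along the chain \<open>h j \<mapsto> h (Suc j)\<close>, and
  products keep this shape. Outside the support \<open>h\<close> may be anything; this covers negative powers and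
  exponentials.\<close>

lemma Cinf_mult_local:
  fixes h :: "nat \<Rightarrow> real \<Rightarrow> complex" and c :: "nat \<Rightarrow> complex"
  assumes "Cinf \<phi>" "\<forall>x. x \<notin> {a..b} \<longrightarrow> \<phi> x = 0"
    and h: "\<And>j x. x \<in> {a..b} \<Longrightarrow> (h j has_vector_derivative c j * h (Suc j) x) (at x)"
  shows "Cinf (\<lambda>x. \<phi> x * h j x)"
proof -
  have "\<exists>B. Cb_le m B (\<lambda>x. \<phi> x * h j x)" if "Cinf \<phi>" "\<forall>x. x \<notin> {a..b} \<longrightarrow> \<phi> x = 0" for m j \<phi>
    using that
  proof (induction m arbitrary: \<phi> j)
    have der: "\<exists>\<phi>'. Cinf \<phi>' \<and> (\<forall>x. x \<notin> {a..b} \<longrightarrow> \<phi>' x = 0) \<and>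
        (\<forall>x. ((\<lambda>x. \<phi> x * h j x) has_vector_derivative \<phi>' x * h j x + c j * (\<phi> x * h (Suc j) x)) (at x))"
      if \<phi>: "Cinf \<phi>" "\<forall>x. x \<notin> {a..b} \<longrightarrow> \<phi> x = 0" for \<phi> j
    proof -
      obtain \<phi>' where p': "\<And>x. (\<phi> has_vector_derivative \<phi>' x) (at x)" "Cinf \<phi>'" using Cinf_derivE[OF \<phi>(1)] by blast
      have z': "\<forall>x. x \<notin> {a..b} \<longrightarrow> \<phi>' x = 0" using derivative_zero_outside[OF p'(1), of a b] \<phi>(2) by blast
      have "((\<lambda>x. \<phi> x * h j x) has_vector_derivative \<phi>' x * h j x + c j * (\<phi> x * h (Suc j) x)) (at x)" for x
      proof (cases "x \<in> {a..b}")
        case True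
        from has_vector_derivative_mult[OF p'(1) h[OF True, of j]]
        show ?thesis by (simp add: mult_ac add.commute)
      next
        case False
        have "((\<lambda>_. 0) has_vector_derivative 0) (at x)" by simp
        moreover have "open (- {a..b})" by (intro open_Compl) auto
        ultimately have "((\<lambda>x. \<phi> x * h j x) has_vector_derivative 0) (at x)"
          by (rule has_vector_derivative_transform_within_open[where S = "- {a..b}"]) (use False \<phi>(2) in auto)
        then show ?thesis using False \<phi>(2) z' by simp
      qed
      then show ?thesis using p'(2) z' by blast
    qed
    have bound: "\<exists>B. \<forall>x. cmod (\<phi> x * h j x) \<le> B" if \<phi>: "Cinf \<phi>" "\<forall>x. x \<notin> {a..b} \<longrightarrow> \<phi> x = 0" for \<phi> j
    proof -
      have "continuous_on {a..b} (\<lambda>x. \<phi> x * h j x)"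
        using der[OF \<phi>, of j] has_vector_derivative_continuous by (blast intro: continuous_at_imp_continuous_on)
      then have "bounded ((\<lambda>x. \<phi> x * h j x) ` {a..b})"
        by (intro compact_imp_bounded compact_continuous_image) auto
      then obtain B where B: "\<forall>x\<in>{a..b}. cmod (\<phi> x * h j x) \<le> B" unfolding bounded_iff by blast
      have "cmod (\<phi> x * h j x) \<le> max B 0" for x
        using B \<phi>(2) by (cases "x \<in> {a..b}") (auto simp: le_max_iff_disj)
      then show ?thesis by blast
    qed
    {
      case 0
      have "continuous_on UNIV (\<lambda>x. \<phi> x * h j x)"
        using der[OF 0, of j] has_vector_derivative_continuous by (blast intro: continuous_at_imp_continuous_on)
      then show ?case using bound[OF 0, of j] by auto
    next
      case (Suc m)
      obtain \<phi>' where p': "Cinf \<phi>'" "\<forall>x. x \<notin> {a..b} \<longrightarrow> \<phi>' x = 0"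
        "\<And>x. ((\<lambda>x. \<phi> x * h j x) has_vector_derivative \<phi>' x * h j x + c j * (\<phi> x * h (Suc j) x)) (at x)"
        using der[OF Suc.prems, of j] by blast
      obtain B where B: "\<forall>x. cmod (\<phi> x * h j x) \<le> B" using bound[OF Suc.prems, of j] by blast
      obtain B1 where B1: "Cb_le m B1 (\<lambda>x. \<phi>' x * h j x)" using Suc.IH[OF p'(1,2), of j] by blast
      obtain B2 where B2: "Cb_le m B2 (\<lambda>x. \<phi> x * h (Suc j) x)" using Suc.IH[OF Suc.prems, of "Suc j"] by blast
      have B12: "Cb_le m (B1 + cmod (c j) * B2) (\<lambda>x. \<phi>' x * h j x + c j * (\<phi> x * h (Suc j) x))"
        by (rule Cb_add[OF B1 Cb_cmult[OF B2]])
      have "Cb_le (Suc m) (max B (B1 + cmod (c j) * B2)) (\<lambda>x. \<phi> x * h j x)"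
      proof (rule Cb_SucI[OF _ p'(3)])
        show "cmod (\<phi> x * h j x) \<le> max B (B1 + cmod (c j) * B2)" for x using B by (simp add: le_max_iff_disj)
        show "Cb_le m (max B (B1 + cmod (c j) * B2)) (\<lambda>x. \<phi>' x * h j x + c j * (\<phi> x * h (Suc j) x))"
          by (rule Cb_mono[OF B12]) simp
      qed
      then show ?case by blast
    }
  qed
  then show ?thesis using assms(1,2) unfolding Cinf_def by blast
qed

lemma integrable_bounded_lorentz:
  assumes "continuous_on UNIV f" "\<And>x. cmod (f x) \<le> B" "continuous_on UNIV e" "\<And>x::real. cmod (e x) \<le> C / (1 + x\<^sup>2)"
  shows "integrable lborel (\<lambda>x. f x * e x)" "cmod (\<integral>x. f x * e x \<partial>lborel) \<le> B * (\<integral>x. C / (1 + x\<^sup>2) \<partial>lborel)"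
proof -
  have B: "0 \<le> B" using order_trans[OF norm_ge_zero assms(2)] .
  have le: "cmod (f x * e x) \<le> B * (C / (1 + x\<^sup>2))" for x
    unfolding norm_mult by (intro mult_mono assms B) simp
  have m: "(\<lambda>x. f x * e x) \<in> borel_measurable lborel"
    using borel_measurable_continuous_onI[OF assms(1)] borel_measurable_continuous_onI[OF assms(3)] by simp
  have i: "integrable lborel (\<lambda>x::real. B * (C / (1 + x\<^sup>2)))" by (rule integrable_mult_right[OF lorentz_integrable])
  show j: "integrable lborel (\<lambda>x. f x * e x)"
  proof (rule Bochner_Integration.integrable_bound[OF i m], rule AE_I2)
    show "norm (f x * e x) \<le> norm (B * (C / (1 + x\<^sup>2)))" for x
      using le[of x] abs_ge_self[of "B * (C / (1 + x\<^sup>2))"] unfolding real_norm_def by linarith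
  qed
  have "cmod (\<integral>x. f x * e x \<partial>lborel) \<le> (\<integral>x. cmod (f x * e x) \<partial>lborel)" by (rule integral_norm_bound)
  also have "\<dots> \<le> (\<integral>x. B * (C / (1 + x\<^sup>2)) \<partial>lborel)" by (rule integral_mono[OF integrable_norm[OF j] i le])
  also have "\<dots> = B * (\<integral>x. C / (1 + x\<^sup>2) \<partial>lborel)" by (rule integral_mult_right_zero)
  finally show "cmod (\<integral>x. f x * e x \<partial>lborel) \<le> B * (\<integral>x. C / (1 + x\<^sup>2) \<partial>lborel)" .
qed

lemma lorentz_tendsto: "((\<lambda>x::real. C / (1 + x\<^sup>2)) \<longlongrightarrow> 0) at_top" "((\<lambda>x::real. C / (1 + x\<^sup>2)) \<longlongrightarrow> 0) at_bot"
proof -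
  have t: "filterlim (\<lambda>x::real. 1 + x\<^sup>2) at_top at_top"
    by (intro filterlim_tendsto_add_at_top[OF tendsto_const] filterlim_pow_at_top filterlim_ident) simp
  show 1: "((\<lambda>x::real. C / (1 + x\<^sup>2)) \<longlongrightarrow> 0) at_top"
    by (rule tendsto_divide_0[OF tendsto_const filterlim_at_top_imp_at_infinity[OF t]])
  show "((\<lambda>x::real. C / (1 + x\<^sup>2)) \<longlongrightarrow> 0) at_bot"
    unfolding filterlim_at_bot_mirror using 1 by simp
qed

lemma convolution_by_parts:
  assumes f: "\<And>x. (f has_vector_derivative f' x) (at x)" "Cb_le 0 B f" "Cb_le 0 B f'"
    and e: "\<And>x. (e has_vector_derivative e' x) (at x)" "continuous_on UNIV e" "continuous_on UNIV e'"
      "\<And>x. cmod (e x) \<le> C / (1 + x\<^sup>2)" "\<And>x. cmod (e' x) \<le> C' / (1 + x\<^sup>2)"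
  shows "(\<integral>r. f (x - s * r) * e' r \<partial>lborel) = of_real s * (\<integral>r. f' (x - s * r) * e r \<partial>lborel)"
proof -
  have cs: "continuous_on UNIV (\<lambda>r. g (x - s * r))" if "Cb_le 0 B g" for g
    by (rule continuous_on_compose2[OF Cb_continuous[OF that, of UNIV]]) (auto intro!: continuous_intros)
  have bs: "cmod (g (x - s * r)) \<le> B" if "Cb_le 0 B g" for g r using Cb_bound[OF that] .
  have i1: "integrable lborel (\<lambda>r. f (x - s * r) * e' r)"
    by (rule integrable_bounded_lorentz(1)[OF cs[OF f(2)] bs[OF f(2)] e(3) e(5)])
  have i2: "integrable lborel (\<lambda>r. f' (x - s * r) * e r)"
    by (rule integrable_bounded_lorentz(1)[OF cs[OF f(3)] bs[OF f(3)] e(2) e(4)])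
  have df: "((\<lambda>r. f (x - s * r)) has_vector_derivative (- of_real s) * f' (x - s * r)) (at r)" for r
  proof -
    have "((\<lambda>r. x - s * r) has_vector_derivative - s) (at r)" by (auto intro!: derivative_eq_intros)
    from vector_diff_chain_at[OF this f(1)] show ?thesis by (simp add: o_def scaleR_conv_of_real)
  qed
  have B: "0 \<le> B" by (rule Cb_nonneg[OF f(2)])
  have bg: "cmod (f (x - s * r) * e r) \<le> B * C / (1 + r\<^sup>2)" for r
  proof -
    have "cmod (f (x - s * r)) * cmod (e r) \<le> B * (C / (1 + r\<^sup>2))"
      by (rule mult_mono[OF bs[OF f(2)] e(4) B norm_ge_zero])
    then show ?thesis by (simp add: norm_mult)
  qed
  have "(\<integral>r. f (x - s * r) * e' r + (- of_real s) * (f' (x - s * r) * e r) \<partial>lborel) = 0"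
  proof (rule integral_derivative_vanishing[where g = "\<lambda>r. f (x - s * r) * e r"])
    show "((\<lambda>r. f (x - s * r) * e r) has_vector_derivative f (x - s * r) * e' r + (- of_real s) * (f' (x - s * r) * e r)) (at r)" for r
      using has_vector_derivative_mult[OF df e(1)] by (simp add: mult.assoc)
    show "integrable lborel (\<lambda>r. f (x - s * r) * e' r + (- of_real s) * (f' (x - s * r) * e r))"
      by (intro Bochner_Integration.integrable_add i1 integrable_mult_right i2)
    show "((\<lambda>r. f (x - s * r) * e r) \<longlongrightarrow> 0) at_top"
      by (rule Lim_null_comparison[OF always_eventually lorentz_tendsto(1)[of "B * C"]]) (use bg in simp)
    show "((\<lambda>r. f (x - s * r) * e r) \<longlongrightarrow> 0) at_bot"
      by (rule Lim_null_comparison[OF always_eventually lorentz_tendsto(2)[of "B * C"]]) (use bg in simp)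
  qed
  also have "(\<integral>r. f (x - s * r) * e' r + (- of_real s) * (f' (x - s * r) * e r) \<partial>lborel)
     = (\<integral>r. f (x - s * r) * e' r \<partial>lborel) + (\<integral>r. (- of_real s) * (f' (x - s * r) * e r) \<partial>lborel)"
    by (rule Bochner_Integration.integral_add[OF i1 integrable_mult_right[OF i2]])
  also have "(\<integral>r. (- of_real s) * (f' (x - s * r) * e r) \<partial>lborel) = - of_real s * (\<integral>r. f' (x - s * r) * e r \<partial>lborel)"
    by (rule integral_mult_right_zero)
  finally show ?thesis by simp
qed

lemma inv_fourier_continuous:
  assumes "continuous_on UNIV \<psi>" "\<forall>\<xi>. \<xi> \<notin> {a..b} \<longrightarrow> \<psi> \<xi> = 0"
  shows "continuous_on UNIV (inv_fourier \<psi>)"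
  by (intro continuous_at_imp_continuous_on ballI has_vector_derivative_continuous[OF inv_fourier_has_derivative[OF assms]])

text \<open>The symbol of the j-fold antiderivative of the function with symbol \<open>\<phi>\<close>. It is a test function because
  \<open>\<phi>\<close> vanishes near zero.\<close>

definition symbol_div :: "(real \<Rightarrow> complex) \<Rightarrow> nat \<Rightarrow> real \<Rightarrow> complex" where
  "symbol_div \<phi> j \<xi> = \<phi> \<xi> * inverse ((\<i> * of_real \<xi>) ^ j)"

lemma symbol_div_Cinf:
  assumes "Cinf \<phi>" "\<forall>x. x \<notin> {1/2..2} \<longrightarrow> \<phi> x = 0"
  shows "Cinf (symbol_div \<phi> j)"
proof -
  have "((\<lambda>\<xi>. inverse ((\<i> * of_real \<xi>) ^ j)) has_vector_derivative (- of_nat j * \<i>) * inverse ((\<i> * of_real x) ^ Suc j)) (at x)"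
    if "x \<in> {1/2..2}" for j x
  proof -
    have x: "\<i> * complex_of_real x \<noteq> 0" using that by auto
    have "((\<lambda>z. inverse ((\<i> * z) ^ j)) has_field_derivative (- of_nat j * \<i>) * inverse ((\<i> * of_real x) ^ Suc j)) (at (of_real x))"
    proof (cases j)
      case (Suc k)
      have "((\<lambda>z. inverse ((\<i> * z) ^ j)) has_field_derivative
          - (inverse ((\<i> * of_real x) ^ j) * (of_nat j * (\<i> * of_real x) ^ (j - 1) * \<i>) * inverse ((\<i> * of_real x) ^ j))) (at (of_real x))"
        using x by (auto intro!: derivative_eq_intros)
      moreover have "- (inverse ((\<i> * of_real x) ^ j) * (of_nat j * (\<i> * of_real x) ^ (j - 1) * \<i>) * inverse ((\<i> * of_real x) ^ j))
          = (- of_nat j * \<i>) * inverse ((\<i> * of_real x) ^ Suc j)"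
        using x unfolding Suc by (simp add: field_simps del: of_nat_Suc)
      ultimately show ?thesis by metis
    qed (auto intro!: derivative_eq_intros)
    from has_vector_derivative_real_field[OF this] show ?thesis by simp
  qed
  from Cinf_mult_local[where h = "\<lambda>j \<xi>. inverse ((\<i> * of_real \<xi>) ^ j)" and c = "\<lambda>j. - of_nat j * \<i>", OF assms this]
  show ?thesis unfolding symbol_div_def[abs_def] by blast
qed

section \<open>Bounded derivatives and Besov norms\<close>

lemma symbol_div_0 [simp]: "symbol_div \<phi> 0 = \<phi>"
  by (simp add: symbol_div_def[abs_def])

lemma inv_fourier_symbol_div:
  assumes "Cinf \<phi>" "\<forall>x. x \<notin> {1/2..2} \<longrightarrow> \<phi> x = 0"
  shows "\<exists>C. \<forall>x. cmod (inv_fourier (symbol_div \<phi> j) x) \<le> C / (1 + x\<^sup>2)"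
    and "continuous_on UNIV (inv_fourier (symbol_div \<phi> j))"
    and "(inv_fourier (symbol_div \<phi> (Suc j)) has_vector_derivative inv_fourier (symbol_div \<phi> j) x) (at x)"
proof -
  have z: "\<forall>x. x \<notin> {1/2..2} \<longrightarrow> symbol_div \<phi> j x = 0" for j using assms(2) by (simp add: symbol_div_def)
  have c: "continuous_on UNIV (symbol_div \<phi> j)" for j
    using symbol_div_Cinf[OF assms, of j] Cb_continuous unfolding Cinf_def by blast
  obtain B where "Cb_le (Suc (Suc 0)) B (symbol_div \<phi> j)" using symbol_div_Cinf[OF assms, of j] unfolding Cinf_def by blast
  from inv_fourier_decay[OF this z] show "\<exists>C. \<forall>x. cmod (inv_fourier (symbol_div \<phi> j) x) \<le> C / (1 + x\<^sup>2)" by blast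
  show "continuous_on UNIV (inv_fourier (symbol_div \<phi> j))" by (rule inv_fourier_continuous[OF c z])
  have "\<i> * of_real \<xi> * symbol_div \<phi> (Suc j) \<xi> = symbol_div \<phi> j \<xi>" for \<xi>
  proof (cases "\<xi> = 0")
    case True
    then show ?thesis using assms(2) by (simp add: symbol_div_def)
  next
    case False
    then have "\<i> * complex_of_real \<xi> \<noteq> 0" by simp
    then show ?thesis by (simp add: symbol_div_def field_simps)
  qed
  then have "(\<lambda>\<xi>. \<i> * of_real \<xi> * symbol_div \<phi> (Suc j) \<xi>) = symbol_div \<phi> j" by blast
  then show "(inv_fourier (symbol_div \<phi> (Suc j)) has_vector_derivative inv_fourier (symbol_div \<phi> j) x) (at x)"
    using inv_fourier_has_derivative[OF c z, of "Suc j" x] by simp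
qed

text \<open>Each derivative of \<open>f\<close> is traded for one antiderivative of the kernel at the price of a factor \<open>s\<close>. The
  number \<open>s\<close> is the wave length of the Littlewood-Paley piece.\<close>

lemma convolution_high_frequency:
  assumes "Cinf \<phi>" "\<forall>x. x \<notin> {1/2..2} \<longrightarrow> \<phi> x = 0"
  shows "\<exists>L. \<forall>B f s x. Cb_le m B f \<longrightarrow> cmod (\<integral>r. f (x - s * r) * inv_fourier (symbol_div \<phi> j) r \<partial>lborel) \<le> \<bar>s\<bar> ^ m * B * L"
proof (induction m arbitrary: j)
  case 0
  obtain C where C: "\<And>x. cmod (inv_fourier (symbol_div \<phi> j) x) \<le> C / (1 + x\<^sup>2)"
    using inv_fourier_symbol_div(1)[OF assms] by blast
  show ?case
  proof (rule exI[of _ "\<integral>x. C / (1 + x\<^sup>2) \<partial>lborel"], intro allI impI)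
    fix B f and s x :: real assume f: "Cb_le 0 B f"
    have "continuous_on UNIV (\<lambda>r. f (x - s * r))"
      by (rule continuous_on_compose2[OF Cb_continuous[OF f, of UNIV]]) (auto intro!: continuous_intros)
    from integrable_bounded_lorentz(2)[OF this Cb_bound[OF f] inv_fourier_symbol_div(2)[OF assms] C]
    show "cmod (\<integral>r. f (x - s * r) * inv_fourier (symbol_div \<phi> j) r \<partial>lborel) \<le> \<bar>s\<bar> ^ 0 * B * (\<integral>x. C / (1 + x\<^sup>2) \<partial>lborel)"
      by simp
  qed
next
  case (Suc m)
  obtain L where L: "\<And>B f s x. Cb_le m B f \<Longrightarrow> cmod (\<integral>r. f (x - s * r) * inv_fourier (symbol_div \<phi> (Suc j)) r \<partial>lborel) \<le> \<bar>s\<bar> ^ m * B * L"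
    using Suc.IH[of "Suc j"] by blast
  obtain C where C: "\<And>x. cmod (inv_fourier (symbol_div \<phi> (Suc j)) x) \<le> C / (1 + x\<^sup>2)"
    using inv_fourier_symbol_div(1)[OF assms] by blast
  obtain C' where C': "\<And>x. cmod (inv_fourier (symbol_div \<phi> j) x) \<le> C' / (1 + x\<^sup>2)"
    using inv_fourier_symbol_div(1)[OF assms] by blast
  show ?case
  proof (rule exI[of _ L], intro allI impI)
    fix B f and s x :: real assume f: "Cb_le (Suc m) B f"
    obtain f' where f': "\<And>x. (f has_vector_derivative f' x) (at x)" "Cb_le m B f'" using f by (rule Cb_derivE) blast
    have "(\<integral>r. f (x - s * r) * inv_fourier (symbol_div \<phi> j) r \<partial>lborel)
        = of_real s * (\<integral>r. f' (x - s * r) * inv_fourier (symbol_div \<phi> (Suc j)) r \<partial>lborel)"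
      by (rule convolution_by_parts[OF f'(1) Cb_le_order[OF f] Cb_le_order[OF f'(2)] inv_fourier_symbol_div(3)[OF assms]
            inv_fourier_symbol_div(2)[OF assms] inv_fourier_symbol_div(2)[OF assms] C C']) simp_all
    then have "cmod (\<integral>r. f (x - s * r) * inv_fourier (symbol_div \<phi> j) r \<partial>lborel)
        = \<bar>s\<bar> * cmod (\<integral>r. f' (x - s * r) * inv_fourier (symbol_div \<phi> (Suc j)) r \<partial>lborel)"
      by (simp add: norm_mult)
    also have "\<dots> \<le> \<bar>s\<bar> * (\<bar>s\<bar> ^ m * B * L)" by (intro mult_left_mono L f'(2)) simp
    finally show "cmod (\<integral>r. f (x - s * r) * inv_fourier (symbol_div \<phi> j) r \<partial>lborel) \<le> \<bar>s\<bar> ^ Suc m * B * L"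
      by (simp add: mult_ac)
  qed
qed

lemma inv_fourier_scale:
  assumes "s \<noteq> 0"
  shows "inv_fourier (\<lambda>\<xi>. \<phi> (s * \<xi>)) x = of_real (1 / \<bar>s\<bar>) * inv_fourier \<phi> (x / s)"
proof -
  have "(\<integral>\<xi>. \<phi> (s * \<xi>) * exp (\<i> * of_real (x * \<xi>)) \<partial>lborel)
     = \<bar>1 / s\<bar> *\<^sub>R (\<integral>\<xi>. \<phi> (s * (0 + 1 / s * \<xi>)) * exp (\<i> * of_real (x * (0 + 1 / s * \<xi>))) \<partial>lborel)"
    by (rule lborel_integral_real_affine) (use assms in simp)
  also have "\<dots> = of_real (1 / \<bar>s\<bar>) * (\<integral>\<xi>. \<phi> \<xi> * exp (\<i> * of_real (x / s * \<xi>)) \<partial>lborel)"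
    using assms by (simp add: scaleR_conv_of_real)
  finally show ?thesis by (simp add: inv_fourier_def mult_ac)
qed

lemma convolve_scale:
  assumes "s \<noteq> 0"
  shows "convolve f (inv_fourier (\<lambda>\<xi>. \<phi> (s * \<xi>))) x = (\<integral>r. f (x - s * r) * inv_fourier \<phi> r \<partial>lborel)"
proof -
  have "convolve f (inv_fourier (\<lambda>\<xi>. \<phi> (s * \<xi>))) x
      = \<bar>s\<bar> *\<^sub>R (\<integral>r. f (x - (0 + s * r)) * inv_fourier (\<lambda>\<xi>. \<phi> (s * \<xi>)) (0 + s * r) \<partial>lborel)"
    unfolding convolve_def by (rule lborel_integral_real_affine[OF assms])
  also have "\<dots> = \<bar>s\<bar> *\<^sub>R (\<integral>r. of_real (1 / \<bar>s\<bar>) * (f (x - s * r) * inv_fourier \<phi> r) \<partial>lborel)"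
  proof -
    have "inv_fourier (\<lambda>\<xi>. \<phi> (s * \<xi>)) (0 + s * r) = of_real (1 / \<bar>s\<bar>) * inv_fourier \<phi> r" for r
      using inv_fourier_scale[OF assms, of \<phi> "s * r"] assms by simp
    then show ?thesis by (simp only: add_0 mult.left_commute)
  qed
  also have "\<dots> = (\<integral>r. f (x - s * r) * inv_fourier \<phi> r \<partial>lborel)"
    unfolding integral_mult_right_zero using assms by (simp add: scaleR_conv_of_real)
  finally show ?thesis .
qed

definition lp_scale :: "int \<Rightarrow> real" where
  "lp_scale n = (if n > 0 then 2 powi (1 - n) else - (2 powi (1 + n)))"

lemma lp_fun_scale: "n \<noteq> 0 \<Longrightarrow> lp_fun \<phi>0 \<phi>1 n = (\<lambda>\<xi>. \<phi>1 (lp_scale n * \<xi>))"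
  by (auto simp: lp_fun_def fun_eq_iff lp_scale_def)

lemma lp_scale_nonzero: "lp_scale n \<noteq> 0" and lp_scale_abs: "n \<noteq> 0 \<Longrightarrow> \<bar>lp_scale n\<bar> = 2 powr (1 - real_of_int \<bar>n\<bar>)"
  by (auto simp: lp_scale_def powr_real_of_int'[symmetric])

lemma summable_two_sided: "(\<lambda>n::int. 2 powr (- real_of_int \<bar>n\<bar>)) summable_on UNIV"
proof -
  have g: "(\<lambda>n::nat. c * (1/2) ^ n :: real) summable_on UNIV" for c
    by (intro norm_summable_imp_summable_on) (auto simp: abs_mult power_abs intro!: summable_mult summable_geometric)
  have e: "2 powr (- real n) = (1/2) ^ n" for n by (simp add: powr_minus powr_realpow power_one_over inverse_eq_divide)
  have "(\<lambda>n::int. 2 powr (- real_of_int \<bar>n\<bar>)) summable_on range int"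
    by (subst summable_on_reindex) (use g[of 1] in \<open>auto simp: o_def e\<close>)
  moreover have "(\<lambda>n::int. 2 powr (- real_of_int \<bar>n\<bar>)) summable_on range (\<lambda>n. - int n)"
    by (subst summable_on_reindex) (use g[of 1] in \<open>auto simp: o_def e inj_on_def\<close>)
  moreover have "range int \<union> range (\<lambda>n. - int n) = UNIV"
  proof -
    have "n \<in> range int \<union> range (\<lambda>n. - int n)" for n by (cases n rule: int_cases2) auto
    then show ?thesis by blast
  qed
  ultimately show ?thesis using summable_on_union by metis
qed

locale besov_setting =
  fixes \<alpha> :: real and \<phi>0 \<phi>1 :: "real \<Rightarrow> complex"
  assumes part: "besov_partition \<phi>0 \<phi>1"
begin

text \<open>Since \<open>ord \<ge> \<alpha> + 1\<close>, the weights satisfy \<open>2 powr (\<bar>n\<bar> * (\<alpha> - ord)) \<le> 2 powr (- \<bar>n\<bar>)\<close>, a summable majorant.\<close>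

definition ord :: nat where "ord = Suc (nat \<lceil>\<alpha> + 1\<rceil>)"

lemma ord_ge: "real ord \<ge> \<alpha> + 1"
  unfolding ord_def by linarith

text \<open>The pieces with \<open>n \<noteq> 0\<close> are rescaled copies of the one with symbol \<open>\<phi>1\<close> at wave length about \<open>2\<^sup>-\<^sup>|\<^sup>n\<^sup>|\<close>;
  the piece \<open>n = 0\<close> is convolution with an integrable kernel.\<close>

lemma convolve_bound:
  "\<exists>L\<ge>0. \<forall>B f n x. Cb_le ord B f \<longrightarrow> cmod (convolve f (inv_fourier (lp_fun \<phi>0 \<phi>1 n)) x) \<le> 2 powr (- real_of_int \<bar>n\<bar> * real ord) * (B * L)"
proof -
  have c1: "Cinf \<phi>1" "\<forall>x. x \<notin> {1/2..2} \<longrightarrow> \<phi>1 x = 0" and c0: "Cinf \<phi>0" "\<forall>x. x \<notin> {-1..1} \<longrightarrow> \<phi>0 x = 0"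
    using part smooth_compact_Cinf by (auto simp: besov_partition_def)
  obtain L where L: "\<And>B f s x. Cb_le ord B f \<Longrightarrow> cmod (\<integral>r. f (x - s * r) * inv_fourier \<phi>1 r \<partial>lborel) \<le> \<bar>s\<bar> ^ ord * B * L"
    using convolution_high_frequency[OF c1, of ord 0] unfolding symbol_div_0 by blast
  obtain B0 where B0: "Cb_le (Suc (Suc 0)) B0 \<phi>0" using c0(1) unfolding Cinf_def by blast
  define C0 where "C0 = 2 * B0 * \<bar>1 - (-1::real)\<bar>"
  define L0 where "L0 = (\<integral>x. C0 / (1 + x\<^sup>2) \<partial>(lborel :: real measure))"
  have z: "cmod (convolve f (inv_fourier \<phi>0) x) \<le> B * L0" if f: "Cb_le ord B f" for f B x
  proof -
    have cf: "continuous_on UNIV (\<lambda>t. f (x - t))"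
      by (rule continuous_on_compose2[OF Cb_continuous[OF f, of UNIV]]) (auto intro!: continuous_intros)
    show ?thesis unfolding convolve_def L0_def C0_def
      by (rule integrable_bounded_lorentz(2)[OF cf Cb_bound[OF f] inv_fourier_continuous[OF Cb_continuous[OF B0] c0(2)] inv_fourier_decay[OF B0 c0(2)]])
  qed
  define K where "K = 2 ^ ord * \<bar>L\<bar> + \<bar>L0\<bar>"
  have "cmod (convolve f (inv_fourier (lp_fun \<phi>0 \<phi>1 n)) x) \<le> 2 powr (- real_of_int \<bar>n\<bar> * real ord) * (B * K)"
    if f: "Cb_le ord B f" for B f n x
  proof (cases "n = 0")
    case True
    have lp: "lp_fun \<phi>0 \<phi>1 0 = \<phi>0" by (simp add: lp_fun_def fun_eq_iff)
    have "0 \<le> 2 ^ ord * \<bar>L\<bar>" by simp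
    then have "L0 \<le> K" unfolding K_def by linarith
    then have "B * L0 \<le> B * K" using Cb_nonneg[OF f] by (rule mult_left_mono)
    then show ?thesis using z[OF f, of x] True lp by simp
  next
    case False
    have "cmod (convolve f (inv_fourier (lp_fun \<phi>0 \<phi>1 n)) x) \<le> \<bar>lp_scale n\<bar> ^ ord * B * L"
      unfolding lp_fun_scale[OF False] convolve_scale[OF lp_scale_nonzero] by (rule L[OF f])
    also have "\<dots> \<le> \<bar>lp_scale n\<bar> ^ ord * B * \<bar>L\<bar>" using Cb_nonneg[OF f] by (intro mult_left_mono) auto
    also have "\<bar>lp_scale n\<bar> ^ ord = 2 powr (- real_of_int \<bar>n\<bar> * real ord) * 2 ^ ord"
    proof -
      have "\<bar>lp_scale n\<bar> ^ ord = 2 powr ((1 - real_of_int \<bar>n\<bar>) * real ord)"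
        unfolding lp_scale_abs[OF False] by (simp add: powr_powr[symmetric] powr_realpow)
      also have "(1 - real_of_int \<bar>n\<bar>) * real ord = - real_of_int \<bar>n\<bar> * real ord + real ord" by (simp add: algebra_simps)
      finally show ?thesis by (simp only: powr_add powr_realpow[of 2, simplified])
    qed
    also have "2 powr (- real_of_int \<bar>n\<bar> * real ord) * 2 ^ ord * B * \<bar>L\<bar> = 2 powr (- real_of_int \<bar>n\<bar> * real ord) * (B * (2 ^ ord * \<bar>L\<bar>))"
      by (simp only: mult_ac)
    also have "\<dots> \<le> 2 powr (- real_of_int \<bar>n\<bar> * real ord) * (B * K)"
      using Cb_nonneg[OF f] by (intro mult_left_mono) (auto simp: K_def)
    finally show ?thesis .
  qed
  moreover have "K \<ge> 0" by (simp add: K_def)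
  ultimately show ?thesis by blast
qed

definition conv_const :: real where
  "conv_const = (SOME L. L \<ge> 0 \<and> (\<forall>B f n x. Cb_le ord B f \<longrightarrow>
     cmod (convolve f (inv_fourier (lp_fun \<phi>0 \<phi>1 n)) x) \<le> 2 powr (- real_of_int \<bar>n\<bar> * real ord) * (B * L)))"

lemma conv_const: "conv_const \<ge> 0" "Cb_le ord B f \<Longrightarrow>
     cmod (convolve f (inv_fourier (lp_fun \<phi>0 \<phi>1 n)) x) \<le> 2 powr (- real_of_int \<bar>n\<bar> * real ord) * (B * conv_const)"
  using someI_ex[OF convolve_bound] unfolding conv_const_def by blast+

lemma besov_term_bounds:
  assumes f: "Cb_le ord B f"
  shows "0 \<le> besov_term \<alpha> \<phi>0 \<phi>1 f n" "besov_term \<alpha> \<phi>0 \<phi>1 f n \<le> B * conv_const * 2 powr (- real_of_int \<bar>n\<bar>)"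
    "bdd_above (range (\<lambda>x. cmod (convolve f (inv_fourier (lp_fun \<phi>0 \<phi>1 n)) x)))"
proof -
  let ?g = "\<lambda>x. cmod (convolve f (inv_fourier (lp_fun \<phi>0 \<phi>1 n)) x)"
  let ?b = "2 powr (- real_of_int \<bar>n\<bar> * real ord) * (B * conv_const)"
  show bdd: "bdd_above (range ?g)" by (rule bdd_aboveI2) (rule conv_const(2)[OF f])
  have "0 \<le> ?g 0" by simp
  also have "?g 0 \<le> (SUP x. ?g x)" by (rule cSUP_upper[OF _ bdd]) simp
  finally show "0 \<le> besov_term \<alpha> \<phi>0 \<phi>1 f n" by (simp add: besov_term_def)
  have "(SUP x. ?g x) \<le> ?b" by (rule cSUP_least) (use conv_const(2)[OF f] in auto)
  then have "besov_term \<alpha> \<phi>0 \<phi>1 f n \<le> 2 powr (real_of_int \<bar>n\<bar> * \<alpha>) * ?b"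
    unfolding besov_term_def by (rule mult_left_mono) simp
  also have "\<dots> = B * conv_const * 2 powr (real_of_int \<bar>n\<bar> * \<alpha> + - real_of_int \<bar>n\<bar> * real ord)"
    by (simp only: powr_add mult_ac)
  also have "\<dots> \<le> B * conv_const * 2 powr (- real_of_int \<bar>n\<bar>)"
  proof (rule mult_left_mono)
    have "real_of_int \<bar>n\<bar> * (\<alpha> + 1) \<le> real_of_int \<bar>n\<bar> * real ord" by (rule mult_left_mono[OF ord_ge]) simp
    then show "2 powr (real_of_int \<bar>n\<bar> * \<alpha> + - real_of_int \<bar>n\<bar> * real ord) \<le> 2 powr (- real_of_int \<bar>n\<bar>)"
      by (intro powr_mono) (auto simp: algebra_simps)
  qed (use conv_const(1) Cb_nonneg[OF f] in simp)
  finally show "besov_term \<alpha> \<phi>0 \<phi>1 f n \<le> B * conv_const * 2 powr (- real_of_int \<bar>n\<bar>)" .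
qed

lemma besov_term_summable:
  assumes f: "Cb_le ord B f"
  shows "besov_term \<alpha> \<phi>0 \<phi>1 f summable_on UNIV"
  by (rule summable_on_comparison_test[OF summable_on_cmult_right[OF summable_two_sided, of "B * conv_const"]])
    (use besov_term_bounds[OF f] in auto)

definition emb_const :: real where
  "emb_const = conv_const * infsum (\<lambda>n::int. 2 powr (- real_of_int \<bar>n\<bar>)) UNIV"

lemma emb_const_nonneg: "emb_const \<ge> 0"
  unfolding emb_const_def using conv_const(1) by (intro mult_nonneg_nonneg infsum_nonneg) auto

text \<open>Bounded derivatives up to order \<open>ord\<close> control the Besov norm, by summing the geometric decay of the
  pieces.\<close>

lemma besov_norm_bound:
  assumes f: "Cb_le ord B f"
  shows "0 \<le> besov_norm \<alpha> \<phi>0 \<phi>1 f" "besov_norm \<alpha> \<phi>0 \<phi>1 f \<le> emb_const * B"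
proof -
  show "0 \<le> besov_norm \<alpha> \<phi>0 \<phi>1 f"
    unfolding besov_norm_def by (rule infsum_nonneg) (rule besov_term_bounds(1)[OF f])
  have "besov_norm \<alpha> \<phi>0 \<phi>1 f \<le> infsum (\<lambda>n::int. B * conv_const * 2 powr (- real_of_int \<bar>n\<bar>)) UNIV"
    unfolding besov_norm_def
    by (rule infsum_mono[OF besov_term_summable[OF f] summable_on_cmult_right[OF summable_two_sided]])
      (rule besov_term_bounds(2)[OF f])
  also have "\<dots> = B * conv_const * infsum (\<lambda>n::int. 2 powr (- real_of_int \<bar>n\<bar>)) UNIV"
    by (rule infsum_cmult_right') 
  finally show "besov_norm \<alpha> \<phi>0 \<phi>1 f \<le> emb_const * B" by (simp add: emb_const_def mult_ac)
qed

lemma Cb_in_besov: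
  assumes f: "Cb_le ord B f"
  shows "f \<in> besov \<alpha> \<phi>0 \<phi>1"
proof -
  have "Cb_le (Suc (nat \<lceil>\<alpha> + 1\<rceil>)) B f" using f by (simp only: ord_def)
  then obtain f' where f': "\<And>x. (f has_vector_derivative f' x) (at x)" "Cb_le (nat \<lceil>\<alpha> + 1\<rceil>) B f'" by (rule Cb_derivE) blast
  have lip: "dist (f x) (f y) \<le> (B + 1) * dist x y" for x y
  proof -
    have "cmod (f x - f y) \<le> B * \<bar>x - y\<bar>" by (rule Cb_Lipschitz[OF f'(1) Cb_bound[OF f'(2)]])
    also have "\<dots> \<le> (B + 1) * \<bar>x - y\<bar>" by (intro mult_right_mono) auto
    finally show ?thesis by (simp add: dist_norm)
  qed
  have B: "0 \<le> B" by (rule Cb_nonneg[OF f])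
  have "uniformly_continuous_on UNIV f"
    unfolding uniformly_continuous_on_def
  proof (intro allI impI)
    fix e :: real assume "e > 0"
    show "\<exists>d>0. \<forall>x\<in>UNIV. \<forall>x'\<in>UNIV. dist x' x < d \<longrightarrow> dist (f x') (f x) < e"
    proof (intro exI[of _ "e / (B + 1)"] conjI ballI impI)
      show "0 < e / (B + 1)" using \<open>e > 0\<close> B by simp
      fix x x' :: real assume "dist x' x < e / (B + 1)"
      then have "(B + 1) * dist x' x < e" using B by (simp add: pos_less_divide_eq mult.commute)
      then show "dist (f x') (f x) < e" using lip[of x' x] by linarith
    qed
  qed
  moreover have "bounded (range f)" using Cb_bound[OF f] unfolding bounded_iff by blast
  ultimately show ?thesis using besov_term_summable[OF f] by (simp add: besov_def)
qed

lemma inv_fourier_lp_integrable: "integrable lborel (inv_fourier (lp_fun \<phi>0 \<phi>1 n))"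
proof -
  have c1: "Cinf \<phi>1" "\<forall>x. x \<notin> {1/2..2} \<longrightarrow> \<phi>1 x = 0" and c0: "Cinf \<phi>0" "\<forall>x. x \<notin> {-1..1} \<longrightarrow> \<phi>0 x = 0"
    using part smooth_compact_Cinf by (auto simp: besov_partition_def)
  have *: "integrable lborel (inv_fourier \<phi>)" if c: "Cinf \<phi>" and z: "\<forall>x. x \<notin> {a..b} \<longrightarrow> \<phi> x = 0" for \<phi> a b
  proof -
    obtain B where B: "Cb_le (Suc (Suc 0)) B \<phi>" using c unfolding Cinf_def by blast
    have "integrable lborel (\<lambda>x. 1 * inv_fourier \<phi> x)"
      by (rule integrable_bounded_lorentz(1)[OF _ _ inv_fourier_continuous[OF Cb_continuous[OF B] z] inv_fourier_decay[OF B z], of _ 1]) auto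
    then show ?thesis by simp
  qed
  show ?thesis
  proof (cases "n = 0")
    case True
    have "lp_fun \<phi>0 \<phi>1 0 = \<phi>0" by (simp add: lp_fun_def fun_eq_iff)
    then show ?thesis using True *[OF c0] by simp
  next
    case False
    have "inv_fourier (lp_fun \<phi>0 \<phi>1 n) = (\<lambda>x. of_real (1 / \<bar>lp_scale n\<bar>) * inv_fourier \<phi>1 (0 + (1 / lp_scale n) * x))"
      unfolding lp_fun_scale[OF False] by (rule ext) (simp add: inv_fourier_scale[OF lp_scale_nonzero])
    moreover have "integrable lborel (\<lambda>x. inv_fourier \<phi>1 (0 + (1 / lp_scale n) * x))"
      by (rule lborel_integrable_real_affine[OF *[OF c1]]) (use lp_scale_nonzero in simp)
    ultimately show ?thesis by (simp only: integrable_mult_right)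
  qed
qed

text \<open>The norm is an infinite sum of suprema, which are meaningful only for bounded ranges and summable
  terms; bounded derivatives provide both.\<close>

lemma besov_norm_triangle:
  assumes f: "Cb_le ord B f" and g: "Cb_le ord C g"
  shows "besov_norm \<alpha> \<phi>0 \<phi>1 (\<lambda>x. f x - g x) \<le> besov_norm \<alpha> \<phi>0 \<phi>1 f + besov_norm \<alpha> \<phi>0 \<phi>1 g"
proof -
  let ?K = "\<lambda>n. inv_fourier (lp_fun \<phi>0 \<phi>1 n)"
  have fg: "Cb_le ord (B + C) (\<lambda>x. f x - g x)" by (rule Cb_diff[OF f g])
  have int: "integrable lborel (\<lambda>t. h (x - t) * ?K n t)" if h: "Cb_le ord D h" for h D x n
  proof -
    have "continuous_on UNIV (\<lambda>t. h (x - t))"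
      by (rule continuous_on_compose2[OF Cb_continuous[OF h, of UNIV]]) (auto intro!: continuous_intros)
    then have m: "(\<lambda>t. h (x - t)) \<in> borel_measurable borel" by (rule borel_measurable_continuous_onI)
    have i: "integrable lborel (\<lambda>t. D * cmod (?K n t))" using inv_fourier_lp_integrable by auto
    show ?thesis
    proof (rule Bochner_Integration.integrable_bound[OF i])
      show "(\<lambda>t. h (x - t) * ?K n t) \<in> borel_measurable lborel"
        using m borel_measurable_integrable[OF inv_fourier_lp_integrable[of n]] by simp
      show "AE t in lborel. norm (h (x - t) * ?K n t) \<le> norm (D * cmod (?K n t))"
        using Cb_bound[OF h] Cb_nonneg[OF h] by (intro AE_I2) (simp add: norm_mult mult_right_mono)
    qed
  qed
  have lin: "convolve (\<lambda>x. f x - g x) (?K n) x = convolve f (?K n) x - convolve g (?K n) x" for n x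
    unfolding convolve_def left_diff_distrib by (rule Bochner_Integration.integral_diff[OF int[OF f] int[OF g]])
  have le: "besov_term \<alpha> \<phi>0 \<phi>1 (\<lambda>x. f x - g x) n \<le> besov_term \<alpha> \<phi>0 \<phi>1 f n + besov_term \<alpha> \<phi>0 \<phi>1 g n" for n
    unfolding besov_term_def distrib_left[symmetric]
  proof (rule mult_left_mono[OF cSUP_least])
    fix x
    have "cmod (convolve (\<lambda>x. f x - g x) (?K n) x) \<le> cmod (convolve f (?K n) x) + cmod (convolve g (?K n) x)"
      unfolding lin by (rule norm_triangle_ineq4)
    also have "\<dots> \<le> (SUP x. cmod (convolve f (?K n) x)) + (SUP x. cmod (convolve g (?K n) x))"
      by (intro add_mono cSUP_upper besov_term_bounds(3)[OF f] besov_term_bounds(3)[OF g]) simp_all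
    finally show "cmod (convolve (\<lambda>x. f x - g x) (?K n) x) \<le> (SUP x. cmod (convolve f (?K n) x)) + (SUP x. cmod (convolve g (?K n) x))" .
  qed auto
  have "besov_norm \<alpha> \<phi>0 \<phi>1 (\<lambda>x. f x - g x) \<le> infsum (\<lambda>n. besov_term \<alpha> \<phi>0 \<phi>1 f n + besov_term \<alpha> \<phi>0 \<phi>1 g n) UNIV"
    unfolding besov_norm_def
    by (rule infsum_mono[OF besov_term_summable[OF fg] summable_on_add[OF besov_term_summable[OF f] besov_term_summable[OF g]] le])
  also have "\<dots> = besov_norm \<alpha> \<phi>0 \<phi>1 f + besov_norm \<alpha> \<phi>0 \<phi>1 g"
    unfolding besov_norm_def by (rule infsum_add[OF besov_term_summable[OF f] besov_term_summable[OF g]])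
  finally show ?thesis .
qed

end

section \<open>The calculus of bounded holomorphic functions\<close>

lemma Hinf0_strip_decay:
  assumes "f \<in> Hinf0 \<omega>" "\<omega> \<le> pi"
  shows "strip_decay \<omega> (\<lambda>w. f (exp w))"
proof -
  obtain C \<epsilon> where C: "C > 0" "\<epsilon> > 0" "\<And>z. z \<in> sector \<omega> \<Longrightarrow> cmod (f z) \<le> C * (1 + cmod (Ln z)) powr (- 1 - \<epsilon>)"
    and hol: "f holomorphic_on sector \<omega>"
    using assms(1) by (auto simp: Hinf0_def Hinf_def)
  have e: "exp ` {w. \<bar>Im w\<bar> < \<omega>} \<subseteq> sector \<omega>" using exp_in_sector assms(2) by auto
  show ?thesis
  proof (rule strip_decayI)
    show "(\<lambda>w. f (exp w)) holomorphic_on {w. \<bar>Im w\<bar> < \<omega>}"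
      using holomorphic_on_compose_gen[OF holomorphic_on_exp hol e] by (simp add: o_def)
    show "C \<ge> 0" "\<epsilon> > 0" using C by auto
    fix w assume w: "\<bar>Im w\<bar> < \<omega>"
    have "Ln (exp w) = w" using w assms(2) by (intro Ln_exp) auto
    then have "cmod (f (exp w)) \<le> C * (1 + cmod w) powr (- 1 - \<epsilon>)"
      using C(3)[OF exp_in_sector[OF w assms(2)]] by simp
    also have "\<dots> \<le> C * (1 + \<bar>Re w\<bar>) powr (- 1 - \<epsilon>)"
      using C abs_Re_le_cmod[of w] by (intro mult_left_mono powr_mono2') auto
    finally show "cmod (f (exp w)) \<le> C * log_weight \<epsilon> (Re w)" by (simp add: log_weight_def)
  qed
qed

text \<open>Exponential decay in \<open>Re (log \<lambda>)\<close> beats every power of the logarithm.\<close>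

lemma Hinf0_expI:
  assumes \<omega>: "0 < \<omega>" "\<omega> < pi" and hol: "f holomorphic_on sector \<omega>"
    and bd: "\<And>w. \<bar>Im w\<bar> < \<omega> \<Longrightarrow> cmod (f (exp w)) \<le> C * exp (- \<bar>Re w\<bar>)"
  shows "f \<in> Hinf0 \<omega>"
proof -
  have z: "cmod (f z) \<le> C * exp (- \<bar>Re (Ln z)\<bar>)" "\<bar>Im (Ln z)\<bar> < \<omega>" if "z \<in> sector \<omega>" for z
  proof -
    have "z \<noteq> 0" "\<bar>Arg z\<bar> < \<omega>" using that by (auto simp: sector_def)
    then show "\<bar>Im (Ln z)\<bar> < \<omega>" by (simp add: Arg_eq_Im_Ln)
    from bd[OF this] show "cmod (f z) \<le> C * exp (- \<bar>Re (Ln z)\<bar>)" using \<open>z \<noteq> 0\<close> by simp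
  qed
  have "0 \<le> C * exp (- \<bar>Re 0\<bar>)" using order_trans[OF norm_ge_zero bd[of 0]] \<omega> by simp
  then have C: "0 \<le> C" by simp
  have "cmod (f z) \<le> C" if "z \<in> sector \<omega>" for z
  proof -
    have "exp (- \<bar>Re (Ln z)\<bar>) \<le> 1" by simp
    from mult_left_mono[OF this C] z(1)[OF that] show ?thesis by simp
  qed
  then have bdd: "bounded (f ` sector \<omega>)" unfolding bounded_iff by blast
  define D where "D = 2 * (1 + pi)\<^sup>2 * (C + 1)"
  have "0 < 1 + pi" using pi_gt_zero by linarith
  then have D: "D > 0" using C unfolding D_def by (intro mult_pos_pos zero_less_power) auto
  have "cmod (f z) \<le> D * (1 + cmod (Ln z)) powr (- 1 - 1)" if "z \<in> sector \<omega>" for z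
  proof -
    define t where "t = \<bar>Re (Ln z)\<bar>"
    have t: "0 \<le> t" by (simp add: t_def)
    have "cmod (Ln z) \<le> t + pi" using cmod_le[of "Ln z"] z(2)[OF that] \<omega> by (simp add: t_def)
    also have "1 + (t + pi) \<le> (1 + pi) * (1 + t)" using t by (simp add: algebra_simps)
    finally have "1 + cmod (Ln z) \<le> (1 + pi) * (1 + t)" by simp
    then have "(1 + cmod (Ln z))\<^sup>2 \<le> ((1 + pi) * (1 + t))\<^sup>2" by (rule power_mono) simp
    also have "\<dots> = (1 + pi)\<^sup>2 * (1 + t)\<^sup>2" by (rule power_mult_distrib)
    also have "\<dots> \<le> (1 + pi)\<^sup>2 * (2 * exp t)"
    proof (rule mult_left_mono)
      have "1 + t + t\<^sup>2 / 2 \<le> exp t" using exp_lower_Taylor_quadratic[OF t] .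
      then show "(1 + t)\<^sup>2 \<le> 2 * exp t" by (simp add: power2_eq_square algebra_simps)
    qed simp
    finally have q: "(1 + cmod (Ln z))\<^sup>2 \<le> 2 * (1 + pi)\<^sup>2 * exp t" by simp
    have "cmod (f z) * (1 + cmod (Ln z))\<^sup>2 \<le> (C * exp (- t)) * (2 * (1 + pi)\<^sup>2 * exp t)"
      using z(1)[OF that] q C by (intro mult_mono) (auto simp: t_def)
    also have "\<dots> = 2 * (1 + pi)\<^sup>2 * C" by (simp add: exp_minus)
    also have "\<dots> \<le> D" unfolding D_def by (intro mult_left_mono) auto
    finally have "cmod (f z) \<le> D / (1 + cmod (Ln z))\<^sup>2"
    proof (rule mult_imp_le_div_pos[rotated])
      have "0 < 1 + cmod (Ln z)" by (simp add: add_pos_nonneg)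
      then show "0 < (1 + cmod (Ln z))\<^sup>2" by (rule zero_less_power)
    qed
    moreover have "(1 + cmod (Ln z)) powr (- 1 - 1) = 1 / (1 + cmod (Ln z))\<^sup>2"
      using powr_minus[of "1 + cmod (Ln z)" 2] by (simp add: divide_inverse powr_numeral)
    ultimately show ?thesis by simp
  qed
  then have "\<exists>C>0. \<exists>\<epsilon>>0. \<forall>z\<in>sector \<omega>. cmod (f z) \<le> C * (1 + cmod (Ln z)) powr (- 1 - \<epsilon>)"
    using D by (intro exI[of _ D] conjI exI[of _ 1]) auto
  then show ?thesis using hol bdd by (simp add: Hinf0_def Hinf_def)
qed

lemma rho_holomorphic: "\<omega> \<le> pi \<Longrightarrow> rho holomorphic_on sector \<omega>"
proof -
  assume "\<omega> \<le> pi"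
  have "1 + z \<noteq> 0" if "z \<in> sector \<omega>" for z
  proof
    assume "1 + z = 0"
    then have "z = -1" by (simp add: eq_neg_iff_add_eq_0 add.commute)
    moreover have "Arg (-1) = pi" by (simp add: Arg_eq_pi)
    ultimately show False using that \<open>\<omega> \<le> pi\<close> by (simp add: sector_def)
  qed
  then show ?thesis unfolding rho_def[abs_def] by (intro holomorphic_intros) auto
qed

lemma rho_bound:
  assumes "0 < \<omega>" "\<omega> < pi"
  obtains K where "K \<ge> 0" "\<And>w. \<bar>Im w\<bar> < \<omega> \<Longrightarrow> cmod (rho (exp w)) \<le> K * exp (- \<bar>Re w\<bar>)"
proof (rule that[of "1 / (sin \<omega>)\<^sup>2"])
  have sw: "0 < sin \<omega>" using assms by (rule sin_gt_zero)
  show "0 \<le> 1 / (sin \<omega>)\<^sup>2" by simp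
  fix w assume w: "\<bar>Im w\<bar> < \<omega>"
  have "cos \<omega> \<le> cos \<bar>Im w\<bar>" using w assms by (intro cos_monotone_0_pi_le) auto
  then have c: "cos (Im w - pi) \<le> cos (pi - \<omega>)" "cos (pi - Im w) \<le> cos (pi - \<omega>)" by auto
  have m1: "exp (\<i> * complex_of_real pi) = -1" by simp
  have "cmod (exp w) * sin (pi - \<omega>) \<le> cmod (exp w - exp (\<i> * complex_of_real pi))"
    by (rule exp_diff_lower_bound) (use c in simp)
  then have l1: "exp (Re w) * sin \<omega> \<le> cmod (1 + exp w)" unfolding m1 by (simp add: add.commute)
  have "cmod (exp (\<i> * complex_of_real pi)) * sin (pi - \<omega>) \<le> cmod (exp (\<i> * complex_of_real pi) - exp w)"
    by (rule exp_diff_lower_bound) (use c in simp)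
  moreover have "cmod (- 1 - exp w) = cmod (1 + exp w)" by (metis minus_add_distrib norm_minus_cancel uminus_add_conv_diff add_uminus_conv_diff)
  ultimately have l2: "sin \<omega> \<le> cmod (1 + exp w)" unfolding m1 by simp
  have c0: "0 < cmod (1 + exp w)" using l2 sw by linarith
  have "cmod (rho (exp w)) = exp (Re w) / (cmod (1 + exp w))\<^sup>2" by (simp add: rho_def norm_divide norm_power)
  also have "\<dots> \<le> 1 / (sin \<omega>)\<^sup>2 * exp (- \<bar>Re w\<bar>)"
  proof (cases "Re w \<ge> 0")
    case True
    have "(exp (Re w) * sin \<omega>)\<^sup>2 \<le> (cmod (1 + exp w))\<^sup>2" using l1 sw by (intro power_mono) auto
    then have "exp (Re w) / (cmod (1 + exp w))\<^sup>2 \<le> exp (Re w) / (exp (Re w) * sin \<omega>)\<^sup>2"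
      using sw c0 by (intro divide_left_mono mult_pos_pos zero_less_power) auto
    also have "\<dots> = 1 / (sin \<omega>)\<^sup>2 * exp (- \<bar>Re w\<bar>)"
      using True sw by (simp add: exp_minus power2_eq_square field_simps)
    finally show ?thesis .
  next
    case False
    have "(sin \<omega>)\<^sup>2 \<le> (cmod (1 + exp w))\<^sup>2" using l2 sw by (intro power_mono) auto
    then have "exp (Re w) / (cmod (1 + exp w))\<^sup>2 \<le> exp (Re w) / (sin \<omega>)\<^sup>2"
      using sw c0 by (intro divide_left_mono mult_pos_pos zero_less_power) auto
    then show ?thesis using False by simp
  qed
  finally show "cmod (rho (exp w)) \<le> 1 / (sin \<omega>)\<^sup>2 * exp (- \<bar>Re w\<bar>)" .
qed

text \<open>\<open>\<rho>(exp w)\<close> decays like \<open>exp (- \<bar>Re w\<bar>)\<close>, so its n-th power compensates growth of exponential order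
  below \<open>n\<close>.\<close>

lemma rho_power_Hinf0:
  assumes \<omega>: "0 < \<omega>" "\<omega> < pi" and hol: "f holomorphic_on sector \<omega>"
    and bd: "\<And>w. \<bar>Im w\<bar> < \<omega> \<Longrightarrow> cmod (f (exp w)) \<le> C * exp ((real n - 1) * \<bar>Re w\<bar>)"
  shows "(\<lambda>z. rho z ^ n * f z) \<in> Hinf0 \<omega>"
proof -
  obtain K where K: "K \<ge> 0" "\<And>w. \<bar>Im w\<bar> < \<omega> \<Longrightarrow> cmod (rho (exp w)) \<le> K * exp (- \<bar>Re w\<bar>)"
    by (rule rho_bound[OF \<omega>]) blast
  show ?thesis
  proof (rule Hinf0_expI[OF \<omega>, where C = "K ^ n * C"])
    show "(\<lambda>z. rho z ^ n * f z) holomorphic_on sector \<omega>"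
      using rho_holomorphic[of \<omega>] \<omega> by (intro holomorphic_intros hol) auto
    fix w assume w: "\<bar>Im w\<bar> < \<omega>"
    have "cmod (rho (exp w) ^ n * f (exp w)) = cmod (rho (exp w)) ^ n * cmod (f (exp w))"
      by (simp add: norm_mult norm_power)
    also have "\<dots> \<le> (K * exp (- \<bar>Re w\<bar>)) ^ n * (C * exp ((real n - 1) * \<bar>Re w\<bar>))"
      using K w by (intro mult_mono power_mono bd) auto
    also have "\<dots> = K ^ n * C * (exp (- \<bar>Re w\<bar>) ^ n * exp ((real n - 1) * \<bar>Re w\<bar>))"
      by (simp add: power_mult_distrib mult_ac)
    also have "exp (- \<bar>Re w\<bar>) ^ n * exp ((real n - 1) * \<bar>Re w\<bar>) = exp (- \<bar>Re w\<bar>)"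
      unfolding exp_of_nat_mult[symmetric] exp_add[symmetric] by (simp add: algebra_simps)
    finally show "cmod (rho (exp w) ^ n * f (exp w)) \<le> K ^ n * C * exp (- \<bar>Re w\<bar>)" .
  qed
qed

text \<open>By \<open>Hinf_all_Cinf\<close> and \<open>Cb_in_besov\<close> these functions are smooth enough for the Besov space, so that the
  set is the dense class \<open>mihlin_hol\<close> on which the calculus is given.\<close>

definition Hinf_all :: "(complex \<Rightarrow> complex) set" where
  "Hinf_all = {F. \<forall>\<omega>. 0 < \<omega> \<and> \<omega> < pi \<longrightarrow> F \<in> Hinf \<omega>}"

lemma Hinf_all_D: "F \<in> Hinf_all \<Longrightarrow> 0 < \<omega> \<Longrightarrow> \<omega> < pi \<Longrightarrow> F \<in> Hinf \<omega>"
  by (simp add: Hinf_all_def)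

lemma HinfE:
  assumes "F \<in> Hinf \<omega>" "\<omega> \<le> pi"
  obtains B where "F holomorphic_on sector \<omega>" "(\<lambda>w. F (exp w)) holomorphic_on {w. \<bar>Im w\<bar> < \<omega>}"
    "\<And>w. \<bar>Im w\<bar> < \<omega> \<Longrightarrow> cmod (F (exp w)) \<le> B" "B \<ge> 0"
proof -
  have hol: "F holomorphic_on sector \<omega>" using assms by (simp add: Hinf_def)
  obtain B where B: "\<And>z. z \<in> sector \<omega> \<Longrightarrow> cmod (F z) \<le> B"
    using assms(1) unfolding Hinf_def bounded_iff by blast
  have e: "exp ` {w. \<bar>Im w\<bar> < \<omega>} \<subseteq> sector \<omega>" using exp_in_sector assms(2) by auto
  show ?thesis
  proof (rule that[OF hol, of "max B 0"])
    show "(\<lambda>w. F (exp w)) holomorphic_on {w. \<bar>Im w\<bar> < \<omega>}"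
      using holomorphic_on_compose_gen[OF holomorphic_on_exp hol e] by (simp add: o_def)
    show "cmod (F (exp w)) \<le> max B 0" if "\<bar>Im w\<bar> < \<omega>" for w
      using B[OF exp_in_sector[OF that assms(2)]] by simp
  qed simp
qed

text \<open>By Cauchy's estimates, since the function is bounded on a strip in the logarithmic variable.\<close>

lemma Hinf_all_Cinf: "F \<in> Hinf_all \<Longrightarrow> Cinf (\<lambda>x. F (of_real (exp x)))"
proof -
  assume "F \<in> Hinf_all"
  then have "F \<in> Hinf 1" using pi_gt3 by (intro Hinf_all_D) auto
  then obtain B where "(\<lambda>w. F (exp w)) holomorphic_on {w. \<bar>Im w\<bar> < 1}" "\<And>w. \<bar>Im w\<bar> < 1 \<Longrightarrow> cmod (F (exp w)) \<le> B"
    by (rule HinfE) (use pi_gt3 in auto)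
  from holomorphic_strip_Cinf[OF this(1) _ this(2)] show ?thesis by (simp add: exp_of_real)
qed

lemma Hinf_all_diff: "F \<in> Hinf_all \<Longrightarrow> G \<in> Hinf_all \<Longrightarrow> (\<lambda>z. F z - G z) \<in> Hinf_all"
  and Hinf_all_add: "F \<in> Hinf_all \<Longrightarrow> G \<in> Hinf_all \<Longrightarrow> (\<lambda>z. F z + G z) \<in> Hinf_all"
  and Hinf_all_mult: "F \<in> Hinf_all \<Longrightarrow> G \<in> Hinf_all \<Longrightarrow> (\<lambda>z. F z * G z) \<in> Hinf_all"
  and Hinf_all_const: "(\<lambda>_. c) \<in> Hinf_all"
proof -
  have b: "bounded ((\<lambda>z. F z + G z) ` S)" "bounded ((\<lambda>z. F z - G z) ` S)" "bounded ((\<lambda>z. F z * G z) ` S)"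
    if bF: "bounded (F ` S)" and bG: "bounded (G ` S)" for F G :: "complex \<Rightarrow> complex" and S
  proof -
    obtain B where B: "\<And>z. z \<in> S \<Longrightarrow> cmod (F z) \<le> B" using bF unfolding bounded_iff by blast
    obtain C where C: "\<And>z. z \<in> S \<Longrightarrow> cmod (G z) \<le> C" using bG unfolding bounded_iff by blast
    have "cmod (F z + G z) \<le> B + C" "cmod (F z - G z) \<le> B + C" if "z \<in> S" for z
      using B[OF that] C[OF that] norm_triangle_ineq[of "F z" "G z"] norm_triangle_ineq4[of "F z" "G z"] by linarith+
    then show "bounded ((\<lambda>z. F z + G z) ` S)" "bounded ((\<lambda>z. F z - G z) ` S)" unfolding bounded_iff by blast+
    have "cmod (F z * G z) \<le> B * C" if "z \<in> S" for z
      unfolding norm_mult using B[OF that] C[OF that] by (intro mult_mono) (auto intro: order_trans[OF norm_ge_zero])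
    then show "bounded ((\<lambda>z. F z * G z) ` S)" unfolding bounded_iff by blast
  qed
  show "F \<in> Hinf_all \<Longrightarrow> G \<in> Hinf_all \<Longrightarrow> (\<lambda>z. F z - G z) \<in> Hinf_all"
    "F \<in> Hinf_all \<Longrightarrow> G \<in> Hinf_all \<Longrightarrow> (\<lambda>z. F z + G z) \<in> Hinf_all"
    "F \<in> Hinf_all \<Longrightarrow> G \<in> Hinf_all \<Longrightarrow> (\<lambda>z. F z * G z) \<in> Hinf_all"
    by (auto simp: Hinf_all_def Hinf_def intro!: holomorphic_intros b)
  have "bounded ((\<lambda>_. c) ` S)" for S :: "complex set" unfolding bounded_iff by auto
  then show "(\<lambda>_. c) \<in> Hinf_all" by (simp add: Hinf_all_def Hinf_def)
qed

lemma Hinf0_Hinf_all: "(\<And>\<omega>. 0 < \<omega> \<Longrightarrow> \<omega> < pi \<Longrightarrow> f \<in> Hinf0 \<omega>) \<Longrightarrow> f \<in> Hinf_all"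
  by (auto simp: Hinf_all_def Hinf0_def)

lemma Hinf_all_rho_Hinf0:
  assumes "F \<in> Hinf_all" "0 < \<omega>" "\<omega> < pi"
  shows "(\<lambda>z. rho z ^ 1 * F z) \<in> Hinf0 \<omega>"
proof -
  obtain B where B: "F holomorphic_on sector \<omega>" "\<And>w. \<bar>Im w\<bar> < \<omega> \<Longrightarrow> cmod (F (exp w)) \<le> B"
    by (rule HinfE[OF Hinf_all_D[OF assms]]) (use assms in auto)
  show ?thesis by (rule rho_power_Hinf0[OF assms(2,3) B(1), of B]) (use B(2) in simp)
qed

lemma rho_Hinf0: "0 < \<omega> \<Longrightarrow> \<omega> < pi \<Longrightarrow> rho \<in> Hinf0 \<omega>"
  using Hinf_all_rho_Hinf0[OF Hinf_all_const[of 1]] by simp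

lemma rho_Hinf_all: "rho \<in> Hinf_all" by (intro Hinf0_Hinf_all rho_Hinf0)

locale mihlin_calculus = zero_sectorial_operator A + besov_setting \<alpha> \<phi>0 \<phi>1
  for A :: "'a::complex_banach op_graph" and \<alpha> \<phi>0 \<phi>1 +
  assumes calc: "has_mihlin_calculus \<alpha> \<phi>0 \<phi>1 A"
begin

lemma mihlin_hol_eq: "mihlin_hol \<alpha> \<phi>0 \<phi>1 = Hinf_all"
proof -
  have "on_reals F \<in> mihlin \<alpha> \<phi>0 \<phi>1" if F: "F \<in> Hinf_all" for F
  proof -
    obtain B where "Cb_le ord B (\<lambda>x. F (of_real (exp x)))" using Hinf_all_Cinf[OF F] unfolding Cinf_def by blast
    from Cb_in_besov[OF this] show ?thesis by (simp add: mihlin_def)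
  qed
  then show ?thesis unfolding mihlin_hol_def Hinf_all_def by blast
qed

text \<open>The regulariser \<open>\<rho>(A)\<close>, computed on the ray of angle 1; by \<open>log_calc_angle\<close> every other angle gives the
  same operator.\<close>

definition rhoA :: "'a \<Rightarrow> 'a" where "rhoA = log_calc 1 (\<lambda>w. rho (exp w))"

lemma contour_calc_eq:
  assumes "f \<in> Hinf0 \<omega>" "0 < \<sigma>" "\<sigma> < \<omega>" "\<omega> < pi" "\<And>\<omega>. 0 < \<omega> \<Longrightarrow> \<omega> < pi \<Longrightarrow> f \<in> Hinf0 \<omega>"
  shows "contour_calc \<sigma> A f x = log_calc 1 (\<lambda>w. f (exp w)) x"
proof -
  define \<omega>' where "\<omega>' = max 2 \<omega>"
  have w': "0 < \<omega>'" "\<omega>' < pi" "1 < \<omega>'" "\<sigma> < \<omega>'" using assms(3,4) pi_gt3 by (auto simp: \<omega>'_def)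
  show ?thesis unfolding contour_calc_eq_log_calc
    by (rule log_calc_angle[OF Hinf0_strip_decay[OF assms(5)[OF w'(1,2)]]]) (use w' assms in auto)
qed

lemma rho_strip_decay: "strip_decay 2 (\<lambda>w. rho (exp w))"
  by (rule Hinf0_strip_decay[OF rho_Hinf0]) (use pi_gt3 in auto)

lemma contour_calc_rho:
  assumes "0 < \<sigma>" "\<sigma> < \<omega>" "\<omega> < pi"
  shows "contour_calc \<sigma> A rho = rhoA"
  unfolding rhoA_def by (rule ext, rule contour_calc_eq[OF rho_Hinf0[of \<omega>] assms]) (use assms rho_Hinf0 in auto)

lemma rhoA_linear: "bounded_linear rhoA" "rhoA (c *\<^sub>C x) = c *\<^sub>C rhoA x"
  unfolding rhoA_def using log_calc_bounded_linear[OF rho_strip_decay, of 1] pi_gt3 by auto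

text \<open>If \<open>\<rho>(A) y = 0\<close>, then \<open>(0, y)\<close> lies in the graph of the operator of the constant function 1, and the
  norm bound of the calculus forces \<open>y = 0\<close>.\<close>

lemma rhoA_inj:
  assumes "rhoA y = 0" shows "y = 0"
proof -
  obtain C where C: "\<And>f x y. f \<in> Hinf_all \<Longrightarrow> (x, y) \<in> hol_calc A f \<Longrightarrow> norm y \<le> C * mihlin_norm \<alpha> \<phi>0 \<phi>1 (on_reals f) * norm x"
    using calc unfolding has_mihlin_calculus_def mihlin_hol_eq by fast
  have p: "(1::real) < 2" "2 < pi" using pi_gt3 by auto
  have "(\<lambda>z. rho z ^ 1 * 1) = rho" by simp
  then have "(0, y) \<in> hol_calc A (\<lambda>_. 1)"
    unfolding hol_calc_def mem_Collect_eq case_prod_conv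
    using p rho_Hinf0[of 2] contour_calc_rho[of 1 2] assms linear_simps(3)[OF rhoA_linear(1)]
    by (intro exI[of _ 1] exI[of _ 2] exI[of _ "1::nat"]) auto
  from C[OF Hinf_all_const this] show ?thesis by simp
qed

lemma rhoA_pow_inj: "(rhoA ^^ n) y = (rhoA ^^ n) z \<Longrightarrow> y = z"
proof (induction n)
  case (Suc n)
  have "rhoA ((rhoA ^^ n) y - (rhoA ^^ n) z) = 0"
    using Suc.prems linear_simps(2)[OF rhoA_linear(1)] by simp
  then have "(rhoA ^^ n) y = (rhoA ^^ n) z" using rhoA_inj by fastforce
  then show ?case by (rule Suc.IH)
qed simp

lemma rhoA_pow_log_calc:
  assumes p: "strip_decay \<omega> p" and "0 < \<sigma>" "\<sigma> < \<omega>" "\<omega> < pi"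
  shows "(rhoA ^^ n) (log_calc \<sigma> p x) = log_calc \<sigma> (\<lambda>w. rho (exp w) ^ n * p w) x"
    and "strip_decay \<omega> (\<lambda>w. rho (exp w) ^ n * p w)"
proof -
  have r: "strip_decay \<omega> (\<lambda>w. rho (exp w))" by (rule Hinf0_strip_decay[OF rho_Hinf0]) (use assms in auto)
  have rA: "rhoA = log_calc \<sigma> (\<lambda>w. rho (exp w))"
    using contour_calc_rho[OF assms(2-4)] contour_calc_eq_log_calc by (metis ext)
  have "(rhoA ^^ n) (log_calc \<sigma> p x) = log_calc \<sigma> (\<lambda>w. rho (exp w) ^ n * p w) x \<and> strip_decay \<omega> (\<lambda>w. rho (exp w) ^ n * p w)"
  proof (induction n)
    case (Suc n)
    have "(rhoA ^^ Suc n) (log_calc \<sigma> p x) = log_calc \<sigma> (\<lambda>w. rho (exp w)) (log_calc \<sigma> (\<lambda>w. rho (exp w) ^ n * p w) x)"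
      using Suc rA by simp
    also have "\<dots> = log_calc \<sigma> (\<lambda>w. rho (exp w) * (rho (exp w) ^ n * p w)) x"
      by (rule log_calc_mult[OF r conjunct2[OF Suc]]) (use assms in auto)
    finally show ?case using strip_decay_mult[OF r conjunct2[OF Suc]] by (simp add: mult.assoc)
  qed (use p in simp)
  then show "(rhoA ^^ n) (log_calc \<sigma> p x) = log_calc \<sigma> (\<lambda>w. rho (exp w) ^ n * p w) x"
    "strip_decay \<omega> (\<lambda>w. rho (exp w) ^ n * p w)" by auto
qed

text \<open>The graph does not depend on the angles and the power of \<open>\<rho>\<close> in its definition: multiplying by further
  powers of \<open>\<rho>(A)\<close> is reversible because \<open>\<rho>(A)\<close> is injective.\<close>

lemma hol_calc_iff:
  assumes adm: "\<And>\<omega>. 0 < \<omega> \<Longrightarrow> \<omega> < pi \<Longrightarrow> (\<lambda>z. rho z ^ n * f z) \<in> Hinf0 \<omega>"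
    and hol: "\<And>\<omega>. 0 < \<omega> \<Longrightarrow> \<omega> < pi \<Longrightarrow> f holomorphic_on sector \<omega>"
  shows "(x, y) \<in> hol_calc A f \<longleftrightarrow> (rhoA ^^ n) y = log_calc 1 (\<lambda>w. rho (exp w) ^ n * f (exp w)) x"
proof
  assume "(rhoA ^^ n) y = log_calc 1 (\<lambda>w. rho (exp w) ^ n * f (exp w)) x"
  moreover have p: "(1::real) < 2" "2 < pi" using pi_gt3 by auto
  ultimately show "(x, y) \<in> hol_calc A f"
    unfolding hol_calc_def mem_Collect_eq case_prod_conv
    using adm[of 2] hol[of 2] contour_calc_rho[of 1 2]
    by (intro exI[of _ 1] exI[of _ 2] exI[of _ n]) (simp add: contour_calc_eq_log_calc)
next
  assume "(x, y) \<in> hol_calc A f"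
  then obtain \<sigma> \<omega> k where *: "0 < \<sigma>" "\<sigma> < \<omega>" "\<omega> < pi" "(\<lambda>z. rho z ^ k * f z) \<in> Hinf0 \<omega>"
    "(contour_calc \<sigma> A rho ^^ k) y = contour_calc \<sigma> A (\<lambda>z. rho z ^ k * f z) x"
    unfolding hol_calc_def by auto
  have s1: "strip_decay \<omega> (\<lambda>w. rho (exp w) ^ k * f (exp w))" by (rule Hinf0_strip_decay[OF *(4)]) (use * in auto)
  have s2: "strip_decay \<omega> (\<lambda>w. rho (exp w) ^ n * f (exp w))"
    by (rule Hinf0_strip_decay[OF adm]) (use * in auto)
  have "(rhoA ^^ k) ((rhoA ^^ n) y) = (rhoA ^^ n) ((rhoA ^^ k) y)"
    by (simp add: funpow_add[symmetric, THEN fun_cong, unfolded o_apply] add.commute)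
  also have "(rhoA ^^ k) y = log_calc \<sigma> (\<lambda>w. rho (exp w) ^ k * f (exp w)) x"
    using *(5) contour_calc_rho[OF *(1-3)] by (simp add: contour_calc_eq_log_calc)
  also have "(rhoA ^^ n) \<dots> = log_calc \<sigma> (\<lambda>w. rho (exp w) ^ n * (rho (exp w) ^ k * f (exp w))) x"
    by (rule rhoA_pow_log_calc(1)[OF s1 *(1-3)])
  also have "\<dots> = log_calc \<sigma> (\<lambda>w. rho (exp w) ^ k * (rho (exp w) ^ n * f (exp w))) x"
    by (simp only: mult.left_commute)
  also have "\<dots> = (rhoA ^^ k) (log_calc \<sigma> (\<lambda>w. rho (exp w) ^ n * f (exp w)) x)"
    by (rule rhoA_pow_log_calc(1)[OF s2 *(1-3), symmetric])
  finally have "(rhoA ^^ n) y = log_calc \<sigma> (\<lambda>w. rho (exp w) ^ n * f (exp w)) x" by (rule rhoA_pow_inj)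
  also have "\<dots> = log_calc 1 (\<lambda>w. rho (exp w) ^ n * f (exp w)) x"
    using contour_calc_eq[OF adm[of \<omega>] *(1-3) adm, of x] * by (simp add: contour_calc_eq_log_calc)
  finally show "(rhoA ^^ n) y = log_calc 1 (\<lambda>w. rho (exp w) ^ n * f (exp w)) x" .
qed

definition hol_op :: "(complex \<Rightarrow> complex) \<Rightarrow> 'a \<Rightarrow> 'a" where
  "hol_op F = op_val (hol_calc A F)"

text \<open>The operator \<open>(\<rho> F)(A)\<close>, which is given by a convergent contour integral although \<open>F(A)\<close> need not be.\<close>

definition rho_calc :: "(complex \<Rightarrow> complex) \<Rightarrow> 'a \<Rightarrow> 'a" where
  "rho_calc F = log_calc 1 (\<lambda>w. rho (exp w) * F (exp w))"

lemma Hinf_all_holomorphic: "F \<in> Hinf_all \<Longrightarrow> 0 < \<omega> \<Longrightarrow> \<omega> < pi \<Longrightarrow> F holomorphic_on sector \<omega>"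
  using Hinf_all_D[of F \<omega>] by (simp add: Hinf_def)

lemma hol_calc_Hinf_all_iff:
  assumes "F \<in> Hinf_all"
  shows "(x, y) \<in> hol_calc A F \<longleftrightarrow> rhoA y = rho_calc F x"
  unfolding rho_calc_def using hol_calc_iff[OF Hinf_all_rho_Hinf0[OF assms] Hinf_all_holomorphic[OF assms]] by simp

lemma rhoA_hol_op:
  assumes "F \<in> Hinf_all"
  shows "rhoA (hol_op F x) = rho_calc F x" "(x, hol_op F x) \<in> hol_calc A F"
proof -
  have "Domain (hol_calc A F) = UNIV" using calc assms unfolding has_mihlin_calculus_def mihlin_hol_eq by blast
  then obtain y where y: "(x, y) \<in> hol_calc A F" by blast
  moreover have "hol_op F x = y" unfolding hol_op_def op_val_def
  proof (rule the_equality)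
    show "(x, y) \<in> hol_calc A F" by (rule y)
    fix z assume "(x, z) \<in> hol_calc A F"
    then have "rhoA z = rhoA y" using y hol_calc_Hinf_all_iff[OF assms] by simp
    then show "z = y" using rhoA_pow_inj[of 1 z y] by simp
  qed
  ultimately show "(x, hol_op F x) \<in> hol_calc A F" by simp
  then show "rhoA (hol_op F x) = rho_calc F x" using hol_calc_Hinf_all_iff[OF assms] by simp
qed

lemma hol_op_eqI: "F \<in> Hinf_all \<Longrightarrow> rhoA y = rho_calc F x \<Longrightarrow> hol_op F x = y"
  using rhoA_hol_op(1)[of F x] rhoA_pow_inj[of 1 "hol_op F x" y] by simp

lemma Hinf_all_strip: "F \<in> Hinf_all \<Longrightarrow> strip_decay 2 (\<lambda>w. rho (exp w) * F (exp w))"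
  using Hinf0_strip_decay[OF Hinf_all_rho_Hinf0[of F 2]] pi_gt3 by simp

lemma rho_calc_linear: "F \<in> Hinf_all \<Longrightarrow> bounded_linear (rho_calc F)"
  and rho_calc_scaleC: "F \<in> Hinf_all \<Longrightarrow> rho_calc F (c *\<^sub>C x) = c *\<^sub>C rho_calc F x"
  unfolding rho_calc_def using log_calc_bounded_linear[OF Hinf_all_strip, of F 1] pi_gt3 by auto

lemma hol_op_add_arg: "F \<in> Hinf_all \<Longrightarrow> hol_op F (x + y) = hol_op F x + hol_op F y"
  by (rule hol_op_eqI) (simp_all add: linear_simps(1)[OF rhoA_linear(1)] linear_simps(1)[OF rho_calc_linear] rhoA_hol_op)

lemma hol_op_scaleC: "F \<in> Hinf_all \<Longrightarrow> hol_op F (c *\<^sub>C x) = c *\<^sub>C hol_op F x"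
  by (rule hol_op_eqI) (simp_all add: rhoA_linear(2) rho_calc_scaleC rhoA_hol_op)

lemma hol_op_diff:
  assumes "F \<in> Hinf_all" "G \<in> Hinf_all"
  shows "hol_op (\<lambda>z. F z - G z) x = hol_op F x - hol_op G x"
proof (rule hol_op_eqI[OF Hinf_all_diff[OF assms]])
  have m: "strip_decay 2 (\<lambda>w. - 1 * (rho (exp w) * G (exp w)))"
    using strip_decay_mult_bounded[OF Hinf_all_strip[OF assms(2)] holomorphic_on_const, of "-1" 1] by simp
  have "rho_calc (\<lambda>z. F z - G z) x = log_calc 1 (\<lambda>w. rho (exp w) * F (exp w) + - 1 * (rho (exp w) * G (exp w))) x"
    by (simp add: rho_calc_def right_diff_distrib)
  also have "\<dots> = rho_calc F x + log_calc 1 (\<lambda>w. - 1 * (rho (exp w) * G (exp w))) x"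
    unfolding rho_calc_def by (rule log_calc_add[OF Hinf_all_strip[OF assms(1)] m]) (use pi_gt3 in auto)
  also have "log_calc 1 (\<lambda>w. - 1 * (rho (exp w) * G (exp w))) x = (-1) *\<^sub>C rho_calc G x"
    unfolding rho_calc_def by (rule log_calc_cmult[OF Hinf_all_strip[OF assms(2)]]) (use pi_gt3 in auto)
  also have "\<dots> = - rho_calc G x" by (simp add: scaleC.minus_left)
  finally show "rhoA (hol_op F x - hol_op G x) = rho_calc (\<lambda>z. F z - G z) x"
    using assms by (simp add: linear_simps(2)[OF rhoA_linear(1)] rhoA_hol_op)
qed

lemma hol_op_log_calc:
  assumes "\<And>\<omega>. 0 < \<omega> \<Longrightarrow> \<omega> < pi \<Longrightarrow> f \<in> Hinf0 \<omega>"
  shows "hol_op f x = log_calc 1 (\<lambda>w. f (exp w)) x"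
proof (rule hol_op_eqI[OF Hinf0_Hinf_all[OF assms]])
  have "strip_decay 2 (\<lambda>w. f (exp w))" by (rule Hinf0_strip_decay[OF assms]) (use pi_gt3 in auto)
  from rhoA_pow_log_calc(1)[OF this, of 1 1 x] pi_gt3
  show "rhoA (log_calc 1 (\<lambda>w. f (exp w)) x) = rho_calc f x" by (simp add: rho_calc_def)
qed

lemma hol_op_rho: "hol_op rho = rhoA"
  unfolding rhoA_def by (rule ext, rule hol_op_log_calc[OF rho_Hinf0])

lemma rcalc_rho_calc:
  assumes "F \<in> Hinf_all" "G \<in> Hinf_all"
  shows "rho_calc F (rho_calc G x) = rhoA (rho_calc (\<lambda>z. F z * G z) x)"
proof -
  have p: "(0::real) < 1" "(1::real) < 2" "2 \<le> pi" "2 < pi" using pi_gt3 by auto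
  have "rho_calc F (rho_calc G x) = log_calc 1 (\<lambda>w. rho (exp w) * F (exp w) * (rho (exp w) * G (exp w))) x"
    unfolding rho_calc_def by (rule log_calc_mult[OF Hinf_all_strip[OF assms(1)] Hinf_all_strip[OF assms(2)] p(3,1,2)])
  also have "\<dots> = log_calc 1 (\<lambda>w. rho (exp w) * (rho (exp w) * (F (exp w) * G (exp w)))) x"
    by (simp only: mult_ac)
  also have "\<dots> = rhoA (rho_calc (\<lambda>z. F z * G z) x)"
    unfolding rhoA_def rho_calc_def by (rule log_calc_mult[OF rho_strip_decay Hinf_all_strip[OF Hinf_all_mult[OF assms]] p(3,1,2), symmetric])
  finally show ?thesis .
qed

lemma rho_calc_rhoA: "F \<in> Hinf_all \<Longrightarrow> rho_calc F (rhoA x) = rhoA (rho_calc F x)"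
proof -
  assume F: "F \<in> Hinf_all"
  have r1: "rho_calc (\<lambda>_. 1) = rhoA" by (simp add: rho_calc_def rhoA_def)
  show ?thesis using rcalc_rho_calc[OF F Hinf_all_const[of 1], of x] r1 by simp
qed

text \<open>Multiplicativity of the contour calculus applies to \<open>\<rho> F\<close> and \<open>\<rho> G\<close>; the two powers of \<open>\<rho>(A)\<close> cancel.\<close>

lemma hol_op_mult:
  assumes "F \<in> Hinf_all" "G \<in> Hinf_all"
  shows "hol_op (\<lambda>z. F z * G z) x = hol_op F (hol_op G x)"
proof (rule hol_op_eqI[OF Hinf_all_mult[OF assms]])
  have "rhoA (rhoA (hol_op F (hol_op G x))) = rhoA (rho_calc F (hol_op G x))" using rhoA_hol_op[OF assms(1)] by simp
  also have "\<dots> = rho_calc F (rhoA (hol_op G x))" using rho_calc_rhoA[OF assms(1)] by simp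
  also have "\<dots> = rho_calc F (rho_calc G x)" using rhoA_hol_op[OF assms(2)] by simp
  also have "\<dots> = rhoA (rho_calc (\<lambda>z. F z * G z) x)" by (rule rcalc_rho_calc[OF assms])
  finally show "rhoA (hol_op F (hol_op G x)) = rho_calc (\<lambda>z. F z * G z) x"
    using rhoA_pow_inj[of 1] by simp
qed

definition hol_op_const :: real where
  "hol_op_const = (SOME C. 0 \<le> C \<and> (\<forall>F x. F \<in> Hinf_all \<longrightarrow> norm (hol_op F x) \<le> C * mihlin_norm \<alpha> \<phi>0 \<phi>1 (on_reals F) * norm x))"

lemma mihlin_norm_eq: "mihlin_norm \<alpha> \<phi>0 \<phi>1 f = besov_norm \<alpha> \<phi>0 \<phi>1 (\<lambda>x. f (exp x))"
  by (simp add: mihlin_norm_def)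

lemma hol_op_const: "0 \<le> hol_op_const" "F \<in> Hinf_all \<Longrightarrow> norm (hol_op F x) \<le> hol_op_const * mihlin_norm \<alpha> \<phi>0 \<phi>1 (on_reals F) * norm x"
proof -
  obtain C where C: "\<And>f x y. f \<in> Hinf_all \<Longrightarrow> (x, y) \<in> hol_calc A f \<Longrightarrow> norm y \<le> C * mihlin_norm \<alpha> \<phi>0 \<phi>1 (on_reals f) * norm x"
    using calc unfolding has_mihlin_calculus_def mihlin_hol_eq by fast
  have nn: "0 \<le> mihlin_norm \<alpha> \<phi>0 \<phi>1 (on_reals F)" if F: "F \<in> Hinf_all" for F
  proof -
    obtain B where "Cb_le ord B (\<lambda>x. F (of_real (exp x)))" using Hinf_all_Cinf[OF F] unfolding Cinf_def by blast
    from besov_norm_bound(1)[OF this] show ?thesis by (simp add: mihlin_norm_eq)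
  qed
  have "norm (hol_op F x) \<le> \<bar>C\<bar> * mihlin_norm \<alpha> \<phi>0 \<phi>1 (on_reals F) * norm x" if "F \<in> Hinf_all" for F x
  proof -
    have "norm (hol_op F x) \<le> C * mihlin_norm \<alpha> \<phi>0 \<phi>1 (on_reals F) * norm x" by (rule C[OF that rhoA_hol_op(2)[OF that]])
    also have "\<dots> \<le> \<bar>C\<bar> * mihlin_norm \<alpha> \<phi>0 \<phi>1 (on_reals F) * norm x"
      using nn[OF that] by (intro mult_right_mono) auto
    finally show ?thesis .
  qed
  then have "\<exists>C. 0 \<le> C \<and> (\<forall>F x. F \<in> Hinf_all \<longrightarrow> norm (hol_op F x) \<le> C * mihlin_norm \<alpha> \<phi>0 \<phi>1 (on_reals F) * norm x)"
    by (intro exI[of _ "\<bar>C\<bar>"]) auto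
  from someI_ex[OF this] show "0 \<le> hol_op_const" "F \<in> Hinf_all \<Longrightarrow> norm (hol_op F x) \<le> hol_op_const * mihlin_norm \<alpha> \<phi>0 \<phi>1 (on_reals F) * norm x"
    unfolding hol_op_const_def by blast+
qed

definition calc_const :: real where "calc_const = hol_op_const * emb_const"

lemma calc_const_nonneg: "0 \<le> calc_const" unfolding calc_const_def using hol_op_const(1) emb_const_nonneg by simp

lemma hol_op_bound:
  assumes F: "F \<in> Hinf_all" and b: "Cb_le ord B (\<lambda>x. F (of_real (exp x)))"
  shows "norm (hol_op F x) \<le> calc_const * B * norm x"
proof -
  have "norm (hol_op F x) \<le> hol_op_const * mihlin_norm \<alpha> \<phi>0 \<phi>1 (on_reals F) * norm x" by (rule hol_op_const(2)[OF F])
  also have "\<dots> \<le> hol_op_const * (emb_const * B) * norm x"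
    unfolding mihlin_norm_eq using besov_norm_bound(2)[OF b] hol_op_const(1) by (intro mult_right_mono mult_left_mono) auto
  finally show ?thesis by (simp add: calc_const_def mult_ac)
qed

end

section \<open>The calculus of smooth functions\<close>

context mihlin_calculus
begin

text \<open>Gaussian regularisation of width \<open>1 / (k + 1)\<close>, as a function of \<open>z = exp w\<close>. It is bounded on every sector
  because the extension is bounded on strips.\<close>

definition gauss_approx :: "(real \<Rightarrow> complex) \<Rightarrow> nat \<Rightarrow> complex \<Rightarrow> complex" where
  "gauss_approx u k z = gauss_ext u (1 / real (Suc k)) (Ln z)"

lemma gauss_approx_Hinf_all:
  assumes "Cinf u" shows "gauss_approx u k \<in> Hinf_all"
proof -
  obtain B where B: "Cb_le 0 B u" using assms unfolding Cinf_def by blast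
  \<comment> \<open>The width is shifted by one to be positive for \<open>k = 0\<close>.\<close>
  let ?e = "1 / real (Suc k)"
  have e: "?e > 0" by simp
  have "gauss_approx u k \<in> Hinf \<omega>" if w: "0 < \<omega>" "\<omega> < pi" for \<omega>
  proof -
    have nr: "z \<notin> \<real>\<^sub>\<le>\<^sub>0" if "z \<in> sector \<omega>" for z
    proof
      assume z: "z \<in> \<real>\<^sub>\<le>\<^sub>0"
      have "z \<noteq> 0" "\<bar>Arg z\<bar> < \<omega>" using that by (auto simp: sector_def)
      then have "Arg z = pi" using z by (auto simp: complex_nonpos_Reals_iff Arg_eq_pi complex_eq_iff less_le)
      then show False using \<open>\<bar>Arg z\<bar> < \<omega>\<close> w by simp
    qed
    have "Ln holomorphic_on sector \<omega>" using nr by (intro holomorphic_intros) auto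
    from holomorphic_on_compose_gen[OF this gauss_ext_holomorphic[OF B e]]
    have "gauss_approx u k holomorphic_on sector \<omega>" by (simp add: o_def gauss_approx_def[abs_def])
    moreover have "cmod (gauss_approx u k z) \<le> B * exp (pi\<^sup>2 / (2 * ?e\<^sup>2))" if "z \<in> sector \<omega>" for z
    proof -
      have "z \<noteq> 0" "\<bar>Arg z\<bar> < \<omega>" using that by (auto simp: sector_def)
      then have "\<bar>Im (Ln z)\<bar> \<le> pi" using w by (simp add: Arg_eq_Im_Ln)
      then have "(Im (Ln z))\<^sup>2 \<le> pi\<^sup>2" by (simp add: power2_le_iff_abs_le)
      then have "exp ((Im (Ln z))\<^sup>2 / (2 * ?e\<^sup>2)) \<le> exp (pi\<^sup>2 / (2 * ?e\<^sup>2))" by (simp add: divide_right_mono)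
      with gauss_ext_bound[OF B e, of "Ln z"] Cb_nonneg[OF B] show ?thesis
        unfolding gauss_approx_def by (meson mult_left_mono order_trans)
    qed
    ultimately show ?thesis unfolding Hinf_def bounded_iff by blast
  qed
  then show ?thesis by (simp add: Hinf_all_def)
qed

lemma gauss_approx_approx:
  assumes "Cb_le (Suc (Suc m)) B u"
  shows "Cb_le m (B * (1 / real (Suc k))) (\<lambda>x. gauss_approx u k (of_real (exp x)) - u x)"
proof -
  have "gauss_approx u k (of_real (exp x)) = gauss_conv u (1 / real (Suc k)) x" for x
    by (simp add: gauss_approx_def Ln_of_real gauss_ext_of_real)
  then show ?thesis using gauss_conv_Cb[OF assms, of "1 / real (Suc k)"] by simp
qed

lemma gauss_approx_exists:
  assumes "Cinf u"
  obtains F e where "\<And>k. F k \<in> Hinf_all" "e \<longlonglongrightarrow> 0" "\<And>k::nat. Cb_le ord (e k) (\<lambda>x. F k (of_real (exp x)) - u x)"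
proof -
  obtain B where B: "Cb_le (Suc (Suc ord)) B u" using assms unfolding Cinf_def by blast
  have "(\<lambda>k. B * (1 / real (Suc k))) \<longlonglongrightarrow> B * 0"
    using LIMSEQ_inverse_real_of_nat by (intro tendsto_mult tendsto_const) (simp add: inverse_eq_divide)
  then show ?thesis using that[of "gauss_approx u" "\<lambda>k. B * (1 / real (Suc k))"] gauss_approx_Hinf_all[OF assms] gauss_approx_approx[OF B] by simp
qed

text \<open>\<open>Phi u\<close> is \<open>u(log A)\<close>.\<close>

definition Phi :: "(real \<Rightarrow> complex) \<Rightarrow> 'a \<Rightarrow> 'a" where
  "Phi u x = mihlin_calc \<alpha> \<phi>0 \<phi>1 A (\<lambda>t. u (ln t)) x"

lemma hol_op_diff_bound:
  assumes "F \<in> Hinf_all" "G \<in> Hinf_all" "Cb_le ord a (\<lambda>x. F (of_real (exp x)) - u x)" "Cb_le ord b (\<lambda>x. G (of_real (exp x)) - u x)"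
  shows "norm (hol_op F x - hol_op G x) \<le> calc_const * (a + b) * norm x"
proof -
  have "Cb_le ord (a + b) (\<lambda>x. F (of_real (exp x)) - G (of_real (exp x)))"
    using Cb_diff[OF assms(3,4)] by simp
  from hol_op_bound[OF Hinf_all_diff[OF assms(1,2)] this, of x] show ?thesis by (simp add: hol_op_diff[OF assms(1,2)])
qed

text \<open>The sequence is Cauchy by the norm bound. Any other admissible sequence has the same limit, because
  the difference of the two tends to zero in the Besov norm; this is why the definite description in
  the definition of the calculus denotes this limit.\<close>

lemma Phi_lim:
  assumes u: "Cinf u" and F: "\<And>k. F k \<in> Hinf_all" and e: "e \<longlonglongrightarrow> 0"
    and b: "\<And>k. Cb_le ord (e k) (\<lambda>x. F k (of_real (exp x)) - u x)"
  shows "(\<lambda>k. hol_op (F k) x) \<longlonglongrightarrow> Phi u x"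
proof -
  have "Cauchy (\<lambda>k. hol_op (F k) x)"
  proof (rule metric_CauchyI)
    fix r :: real assume r: "r > 0"
    define S where "S k = calc_const * norm x * e k" for k
    have "S \<longlonglongrightarrow> calc_const * norm x * 0" unfolding S_def by (rule tendsto_mult[OF tendsto_const e])
    then have "S \<longlonglongrightarrow> 0" by simp
    then have "\<forall>\<^sub>F k in sequentially. S k < r / 2" by (rule order_tendstoD(2)) (use r in simp)
    then obtain K where K: "\<And>k. k \<ge> K \<Longrightarrow> S k < r / 2"
      unfolding eventually_sequentially by blast
    have "dist (hol_op (F j) x) (hol_op (F k) x) < r" if jk: "j \<ge> K" "k \<ge> K" for j k
    proof -
      have "dist (hol_op (F j) x) (hol_op (F k) x) \<le> calc_const * (e j + e k) * norm x"
        unfolding dist_norm by (rule hol_op_diff_bound[OF F F b b])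
      also have "\<dots> = S j + S k" by (simp add: S_def algebra_simps)
      also have "\<dots> < r" using K[OF jk(1)] K[OF jk(2)] by simp
      finally show ?thesis .
    qed
    then show "\<exists>M. \<forall>m\<ge>M. \<forall>n\<ge>M. dist (hol_op (F m) x) (hol_op (F n) x) < r" by blast
  qed
  then obtain y where y: "(\<lambda>k. hol_op (F k) x) \<longlonglongrightarrow> y" using Cauchy_convergent convergent_def by blast
  obtain Bu where Bu: "Cb_le ord Bu u" using u unfolding Cinf_def by blast
  have nrm: "mihlin_norm \<alpha> \<phi>0 \<phi>1 (\<lambda>t. on_reals G t - u (ln t)) = besov_norm \<alpha> \<phi>0 \<phi>1 (\<lambda>x. G (of_real (exp x)) - u x)" for G
    by (simp add: mihlin_norm_def)
  have n0: "(\<lambda>k. mihlin_norm \<alpha> \<phi>0 \<phi>1 (\<lambda>t. on_reals (F k) t - u (ln t))) \<longlonglongrightarrow> 0"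
  proof (rule Lim_null_comparison[OF always_eventually])
    show "\<forall>k. norm (mihlin_norm \<alpha> \<phi>0 \<phi>1 (\<lambda>t. on_reals (F k) t - u (ln t))) \<le> emb_const * e k"
      unfolding nrm using besov_norm_bound[OF b] by simp
    show "(\<lambda>k. emb_const * e k) \<longlonglongrightarrow> 0" using tendsto_mult[OF tendsto_const e, of emb_const] by simp
  qed
  have "Phi u x = y"
    unfolding Phi_def mihlin_calc_def mihlin_hol_eq hol_op_def[symmetric]
  proof (rule the_equality)
    show "\<exists>F. (\<forall>k. F k \<in> Hinf_all) \<and> (\<lambda>k. mihlin_norm \<alpha> \<phi>0 \<phi>1 (\<lambda>t. on_reals (F k) t - u (ln t))) \<longlonglongrightarrow> 0 \<and> (\<lambda>k. hol_op (F k) x) \<longlonglongrightarrow> y"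
      using F n0 y by blast
  next
    fix z assume "\<exists>F. (\<forall>k. F k \<in> Hinf_all) \<and> (\<lambda>k. mihlin_norm \<alpha> \<phi>0 \<phi>1 (\<lambda>t. on_reals (F k) t - u (ln t))) \<longlonglongrightarrow> 0 \<and> (\<lambda>k. hol_op (F k) x) \<longlonglongrightarrow> z"
    then obtain G where G: "\<And>k. G k \<in> Hinf_all" "(\<lambda>k. mihlin_norm \<alpha> \<phi>0 \<phi>1 (\<lambda>t. on_reals (G k) t - u (ln t))) \<longlonglongrightarrow> 0"
      "(\<lambda>k. hol_op (G k) x) \<longlonglongrightarrow> z" by blast
    let ?a = "\<lambda>k. mihlin_norm \<alpha> \<phi>0 \<phi>1 (\<lambda>t. on_reals (G k) t - u (ln t))"
    let ?b = "\<lambda>k. mihlin_norm \<alpha> \<phi>0 \<phi>1 (\<lambda>t. on_reals (F k) t - u (ln t))"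
    have "norm (hol_op (G k) x - hol_op (F k) x) \<le> hol_op_const * (?a k + ?b k) * norm x" for k
    proof -
      obtain Bg where Bg: "Cb_le ord Bg (\<lambda>x. G k (of_real (exp x)))" using Hinf_all_Cinf[OF G(1)] unfolding Cinf_def by blast
      have "mihlin_norm \<alpha> \<phi>0 \<phi>1 (on_reals (\<lambda>z. G k z - F k z)) = besov_norm \<alpha> \<phi>0 \<phi>1 (\<lambda>x. (G k (of_real (exp x)) - u x) - (F k (of_real (exp x)) - u x))"
        by (simp add: mihlin_norm_def)
      also have "\<dots> \<le> ?a k + ?b k" unfolding nrm by (rule besov_norm_triangle[OF Cb_diff[OF Bg Bu] b])
      finally have le: "mihlin_norm \<alpha> \<phi>0 \<phi>1 (on_reals (\<lambda>z. G k z - F k z)) \<le> ?a k + ?b k" .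
      have "norm (hol_op (G k) x - hol_op (F k) x) \<le> hol_op_const * mihlin_norm \<alpha> \<phi>0 \<phi>1 (on_reals (\<lambda>z. G k z - F k z)) * norm x"
        using hol_op_const(2)[OF Hinf_all_diff[OF G(1) F]] by (simp add: hol_op_diff[OF G(1) F])
      also have "\<dots> \<le> hol_op_const * (?a k + ?b k) * norm x" by (intro mult_right_mono mult_left_mono le hol_op_const(1)) simp
      finally show ?thesis .
    qed
    moreover have "(\<lambda>k. hol_op_const * (?a k + ?b k) * norm x) \<longlonglongrightarrow> 0"
    proof -
      have "(\<lambda>k. hol_op_const * (?a k + ?b k) * norm x) \<longlonglongrightarrow> hol_op_const * (0 + 0) * norm x"
        by (rule tendsto_mult[OF tendsto_mult[OF tendsto_const tendsto_add[OF G(2) n0]] tendsto_const])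
      then show ?thesis by simp
    qed
    ultimately have l0: "(\<lambda>k. hol_op (G k) x - hol_op (F k) x) \<longlonglongrightarrow> 0"
      by (rule Lim_null_comparison[OF always_eventually[OF allI]])
    have "z - y = 0" by (rule LIMSEQ_unique[OF tendsto_diff[OF G(3) y] l0])
    then show "z = y" by simp
  qed
  then show ?thesis using y by simp
qed

lemma Phi_hol:
  assumes F: "F \<in> Hinf_all"
  shows "Phi (\<lambda>x. F (of_real (exp x))) x = hol_op F x"
proof -
  have z: "Cb_le ord 0 (\<lambda>x. F (of_real (exp x)) - F (of_real (exp x)))" using Cb_const[of ord 0] by simp
  have "(\<lambda>k::nat. hol_op F x) \<longlonglongrightarrow> Phi (\<lambda>x. F (of_real (exp x))) x"
    by (rule Phi_lim[where F = "\<lambda>_. F" and e = "\<lambda>_. 0", OF Hinf_all_Cinf[OF F] F tendsto_const z])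
  then show ?thesis by (rule LIMSEQ_unique[OF _ tendsto_const])
qed

text \<open>The norm bound passes from the approximants to the limit.\<close>

lemma Phi_bound:
  assumes u: "Cinf u" and b: "Cb_le ord B u"
  shows "norm (Phi u x) \<le> calc_const * B * norm x"
proof -
  obtain F e where F: "\<And>k. F k \<in> Hinf_all" "e \<longlonglongrightarrow> 0" "\<And>k::nat. Cb_le ord (e k) (\<lambda>x. F k (of_real (exp x)) - u x)"
    by (rule gauss_approx_exists[OF u]) blast
  have "Cb_le ord (e k + B) (\<lambda>x. F k (of_real (exp x)))" for k using Cb_add[OF F(3) b] by simp
  then have "norm (hol_op (F k) x) \<le> calc_const * (e k + B) * norm x" for k by (rule hol_op_bound[OF F(1)])
  moreover have "(\<lambda>k. calc_const * (e k + B) * norm x) \<longlonglongrightarrow> calc_const * (0 + B) * norm x"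
    by (rule tendsto_mult[OF tendsto_mult[OF tendsto_const tendsto_add[OF F(2) tendsto_const]] tendsto_const])
  moreover have "(\<lambda>k. norm (hol_op (F k) x)) \<longlonglongrightarrow> norm (Phi u x)" by (rule tendsto_norm[OF Phi_lim[OF u F]])
  ultimately have "norm (Phi u x) \<le> calc_const * (0 + B) * norm x" by (intro LIMSEQ_le) auto
  then show ?thesis by simp
qed

text \<open>Products of approximants approximate the product, and the first factors stay uniformly bounded.\<close>

lemma Phi_mult:
  assumes u: "Cinf u" and v: "Cinf v"
  shows "Phi (\<lambda>x. u x * v x) x = Phi u (Phi v x)"
proof -
  obtain F e where F: "\<And>k. F k \<in> Hinf_all" "e \<longlonglongrightarrow> 0" "\<And>k::nat. Cb_le ord (e k) (\<lambda>x. F k (of_real (exp x)) - u x)"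
    by (rule gauss_approx_exists[OF u]) blast
  obtain G d where G: "\<And>k. G k \<in> Hinf_all" "d \<longlonglongrightarrow> 0" "\<And>k::nat. Cb_le ord (d k) (\<lambda>x. G k (of_real (exp x)) - v x)"
    by (rule gauss_approx_exists[OF v]) blast
  obtain B where B: "Cb_le ord B u" using u unfolding Cinf_def by blast
  obtain C where C: "Cb_le ord C v" using v unfolding Cinf_def by blast
  let ?r = "\<lambda>k. 2 ^ ord * e k * (d k + C) + 2 ^ ord * B * d k"
  have r: "Cb_le ord (?r k) (\<lambda>x. F k (of_real (exp x)) * G k (of_real (exp x)) - u x * v x)" for k
  proof -
    have Gb: "Cb_le ord (d k + C) (\<lambda>x. G k (of_real (exp x)))" using Cb_add[OF G(3) C] by simp
    have "Cb_le ord (?r k) (\<lambda>x. (F k (of_real (exp x)) - u x) * G k (of_real (exp x)) + u x * (G k (of_real (exp x)) - v x))"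
      by (rule Cb_add[OF Cb_mult[OF F(3) Gb] Cb_mult[OF B G(3)]])
    moreover have "(\<lambda>x. (F k (of_real (exp x)) - u x) * G k (of_real (exp x)) + u x * (G k (of_real (exp x)) - v x))
        = (\<lambda>x. F k (of_real (exp x)) * G k (of_real (exp x)) - u x * v x)"
      by (simp add: fun_eq_iff algebra_simps)
    ultimately show ?thesis by (simp only:)
  qed
  have "?r \<longlonglongrightarrow> 2 ^ ord * 0 * (0 + C) + 2 ^ ord * B * 0" by (intro tendsto_intros F(2) G(2))
  then have r0: "?r \<longlonglongrightarrow> 0" by simp
  have 1: "(\<lambda>k. hol_op (\<lambda>z. F k z * G k z) x) \<longlonglongrightarrow> Phi (\<lambda>x. u x * v x) x"
    by (rule Phi_lim[where e = ?r, OF Cinf_mult[OF u v] Hinf_all_mult[OF F(1) G(1)] r0 r])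
  have "(\<lambda>k. hol_op (F k) (hol_op (G k) x) - hol_op (F k) (Phi v x)) \<longlonglongrightarrow> 0"
  proof (rule Lim_null_comparison[OF always_eventually])
    show "\<forall>k. norm (hol_op (F k) (hol_op (G k) x) - hol_op (F k) (Phi v x)) \<le> calc_const * (e k + B) * norm (hol_op (G k) x - Phi v x)"
    proof
      fix k
      have "hol_op (F k) (hol_op (G k) x - Phi v x + Phi v x) = hol_op (F k) (hol_op (G k) x - Phi v x) + hol_op (F k) (Phi v x)"
        by (rule hol_op_add_arg[OF F(1)])
      then have "hol_op (F k) (hol_op (G k) x) - hol_op (F k) (Phi v x) = hol_op (F k) (hol_op (G k) x - Phi v x)" by simp
      moreover have "Cb_le ord (e k + B) (\<lambda>x. F k (of_real (exp x)))" using Cb_add[OF F(3) B] by simp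
      ultimately show "norm (hol_op (F k) (hol_op (G k) x) - hol_op (F k) (Phi v x)) \<le> calc_const * (e k + B) * norm (hol_op (G k) x - Phi v x)"
        using hol_op_bound[OF F(1)] by simp
    qed
    have "(\<lambda>k. calc_const * (e k + B) * norm (hol_op (G k) x - Phi v x)) \<longlonglongrightarrow> calc_const * (0 + B) * norm (Phi v x - Phi v x)"
      by (intro tendsto_intros F(2) Phi_lim[OF v G])
    then show "(\<lambda>k. calc_const * (e k + B) * norm (hol_op (G k) x - Phi v x)) \<longlonglongrightarrow> 0" by simp
  qed
  from tendsto_add[OF this Phi_lim[OF u F, of "Phi v x"]]
  have "(\<lambda>k. hol_op (F k) (hol_op (G k) x)) \<longlonglongrightarrow> Phi u (Phi v x)" by simp
  then have "(\<lambda>k. hol_op (\<lambda>z. F k z * G k z) x) \<longlonglongrightarrow> Phi u (Phi v x)" unfolding hol_op_mult[OF F(1) G(1)] .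
  with 1 show ?thesis by (rule LIMSEQ_unique)
qed

lemma Phi_diff:
  assumes u: "Cinf u" and v: "Cinf v"
  shows "Phi (\<lambda>x. u x - v x) x = Phi u x - Phi v x"
proof -
  obtain F e where F: "\<And>k. F k \<in> Hinf_all" "e \<longlonglongrightarrow> 0" "\<And>k::nat. Cb_le ord (e k) (\<lambda>x. F k (of_real (exp x)) - u x)"
    by (rule gauss_approx_exists[OF u]) blast
  obtain G d where G: "\<And>k. G k \<in> Hinf_all" "d \<longlonglongrightarrow> 0" "\<And>k::nat. Cb_le ord (d k) (\<lambda>x. G k (of_real (exp x)) - v x)"
    by (rule gauss_approx_exists[OF v]) blast
  have r: "Cb_le ord (e k + d k) (\<lambda>x. (F k (of_real (exp x)) - G k (of_real (exp x))) - (u x - v x))" for k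
    using Cb_diff[OF F(3) G(3), of k k] by (simp add: algebra_simps)
  have r0: "(\<lambda>k. e k + d k) \<longlonglongrightarrow> 0" using tendsto_add[OF F(2) G(2)] by simp
  have "(\<lambda>k. hol_op (\<lambda>z. F k z - G k z) x) \<longlonglongrightarrow> Phi (\<lambda>x. u x - v x) x"
    by (rule Phi_lim[where e = "\<lambda>k. e k + d k", OF Cinf_diff[OF u v] Hinf_all_diff[OF F(1) G(1)] r0 r])
  moreover have "(\<lambda>k. hol_op (\<lambda>z. F k z - G k z) x) \<longlonglongrightarrow> Phi u x - Phi v x"
    unfolding hol_op_diff[OF F(1) G(1)] by (intro tendsto_diff Phi_lim[OF u F] Phi_lim[OF v G])
  ultimately show ?thesis by (rule LIMSEQ_unique)
qed

lemma Phi_const: "Phi (\<lambda>_. c) x = c *\<^sub>C x"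
proof -
  have "rho_calc (\<lambda>_. c) x = c *\<^sub>C rhoA x"
  proof -
    have "rho_calc (\<lambda>_. c) x = log_calc 1 (\<lambda>w. c * rho (exp w)) x" by (simp add: rho_calc_def mult.commute)
    also have "\<dots> = c *\<^sub>C rhoA x" unfolding rhoA_def by (rule log_calc_cmult[OF rho_strip_decay]) (use pi_gt3 in auto)
    finally show ?thesis .
  qed
  then have "hol_op (\<lambda>_. c) x = c *\<^sub>C x" by (intro hol_op_eqI Hinf_all_const) (simp add: rhoA_linear)
  then show ?thesis using Phi_hol[OF Hinf_all_const, of c] by simp
qed

lemma Phi_cmult: "Cinf u \<Longrightarrow> Phi (\<lambda>x. c * u x) x = c *\<^sub>C Phi u x"
  using Phi_mult[OF Cinf_const, of u c x] Phi_const by simp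

lemma Phi_add:
  assumes u: "Cinf u" and v: "Cinf v"
  shows "Phi (\<lambda>x. u x + v x) x = Phi u x + Phi v x"
  using Phi_diff[OF u Cinf_cmult[OF v, of "-1"], of x] Phi_cmult[OF v, of "-1" x]
  by (simp add: scaleC.minus_left)

lemma Phi_sum: "finite F \<Longrightarrow> (\<And>n. n \<in> F \<Longrightarrow> Cinf (u n)) \<Longrightarrow> Phi (\<lambda>x. \<Sum>n\<in>F. u n x) x = (\<Sum>n\<in>F. Phi (u n) x)"
proof (induction F rule: finite_induct)
  case empty
  show ?case using Phi_const[of 0 x] by (simp add: scaleC.zero_left)
next
  case (insert n F)
  have "Cinf (\<lambda>x. \<Sum>n\<in>F. u n x)" by (rule Cinf_sum) (use insert.prems in simp)
  from Phi_add[OF _ this, of "u n" x] insert show ?case by simp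
qed

lemma Phi_bounded_linear:
  assumes u: "Cinf u"
  shows "bounded_linear (Phi u)"
proof -
  obtain F e where F: "\<And>k. F k \<in> Hinf_all" "e \<longlonglongrightarrow> 0" "\<And>k::nat. Cb_le ord (e k) (\<lambda>x. F k (of_real (exp x)) - u x)"
    by (rule gauss_approx_exists[OF u]) blast
  obtain B where B: "Cb_le ord B u" using u unfolding Cinf_def by blast
  note lim = Phi_lim[OF u F]
  have add: "Phi u (x + y) = Phi u x + Phi u y" for x y
  proof (rule LIMSEQ_unique[OF lim])
    show "(\<lambda>k. hol_op (F k) (x + y)) \<longlonglongrightarrow> Phi u x + Phi u y"
      unfolding hol_op_add_arg[OF F(1)] by (rule tendsto_add[OF lim lim])
  qed
  have sc: "Phi u (r *\<^sub>R x) = r *\<^sub>R Phi u x" for r x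
  proof (rule LIMSEQ_unique[OF lim])
    have "hol_op (F k) (r *\<^sub>R x) = r *\<^sub>R hol_op (F k) x" for k
      unfolding scaleR_scaleC[of r x] hol_op_scaleC[OF F(1)] by (rule scaleR_scaleC[symmetric])
    then show "(\<lambda>k. hol_op (F k) (r *\<^sub>R x)) \<longlonglongrightarrow> r *\<^sub>R Phi u x"
      using tendsto_scaleR[OF tendsto_const lim[of x], of r] by (simp only:)
  qed
  show ?thesis
  proof (rule bounded_linear_intro[OF add sc])
    show "norm (Phi u x) \<le> norm x * (calc_const * B)" for x using Phi_bound[OF u B, of x] by (simp only: mult_ac)
  qed
qed

end

section \<open>Approximate identities and fractional powers\<close>

lemma Cinf_power: "Cinf u \<Longrightarrow> Cinf (\<lambda>s. u s ^ n)"
proof (induction n)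
  case 0
  show ?case using Cinf_const[of 1] by simp
next
  case (Suc n)
  then show ?case using Cinf_mult[of u "\<lambda>s. u s ^ n"] by simp
qed

lemma one_plus_exp_bounded:
  obtains B where "\<And>w. \<bar>Im w\<bar> < 2 \<Longrightarrow> cmod (1 / (1 + exp w)) \<le> B" "\<And>w. \<bar>Im w\<bar> < 2 \<Longrightarrow> 1 + exp w \<noteq> 0"
proof -
  have p: "(2::real) < pi" using pi_gt3 by simp
  have s2: "0 < sin (2::real)" using p by (intro sin_gt_zero) auto
  have l: "sin 2 \<le> cmod (1 + exp w)" if w: "\<bar>Im w\<bar> < 2" for w
  proof -
    have "cos 2 \<le> cos \<bar>Im w\<bar>" using w p by (intro cos_monotone_0_pi_le) auto
    then have c: "cos (pi - Im w) \<le> cos (pi - 2)" by simp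
    have m1: "exp (\<i> * complex_of_real pi) = -1" by simp
    have "cmod (exp (\<i> * complex_of_real pi)) * sin (pi - 2) \<le> cmod (exp (\<i> * complex_of_real pi) - exp w)"
      by (rule exp_diff_lower_bound) (use c in simp)
    moreover have "cmod (- 1 - exp w) = cmod (1 + exp w)" by (metis minus_add_distrib norm_minus_cancel uminus_add_conv_diff add_uminus_conv_diff)
    ultimately show ?thesis unfolding m1 by simp
  qed
  show ?thesis
  proof (rule that[of "1 / sin 2"])
    show "1 + exp w \<noteq> 0" if "\<bar>Im w\<bar> < 2" for w using l[OF that] s2 by auto
    show "cmod (1 / (1 + exp w)) \<le> 1 / sin 2" if "\<bar>Im w\<bar> < 2" for w
      unfolding norm_divide norm_one using l[OF that] s2 by (intro divide_left_mono mult_pos_pos) auto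
  qed
qed

context mihlin_calculus
begin

abbreviation rho_log :: "real \<Rightarrow> complex" where "rho_log s \<equiv> rho (of_real (exp s))"

lemma Cinf_rho_log: "Cinf rho_log" by (rule Hinf_all_Cinf[OF rho_Hinf_all])

lemma Phi_rho_log: "Phi rho_log x = rhoA x"
  using Phi_hol[OF rho_Hinf_all] hol_op_rho by simp

lemma rhoA_pow_Phi: "(rhoA ^^ n) x = Phi (\<lambda>s. rho_log s ^ n) x"
proof (induction n)
  case 0
  show ?case using Phi_const[of 1 x] by simp
next
  case (Suc n)
  have "(rhoA ^^ Suc n) x = Phi rho_log (Phi (\<lambda>s. rho_log s ^ n) x)" using Suc Phi_rho_log by simp
  also have "\<dots> = Phi (\<lambda>s. rho_log s * rho_log s ^ n) x" by (rule Phi_mult[OF Cinf_rho_log Cinf_power[OF Cinf_rho_log], symmetric])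
  finally show ?case by simp
qed

text \<open>The operator \<open>(1 + A)\<^sup>-\<^sup>1\<close>.\<close>

abbreviation inv_one_plus :: "'a \<Rightarrow> 'a" where "inv_one_plus x \<equiv> - resolvent A (-1) x"

lemma off_m1: "Re (-1) < cmod (-1)" by simp

lemma inv_one_plus_linear: "bounded_linear inv_one_plus"
  by (intro bounded_linear_minus bounded_linear_resolvent off_m1)

lemma inv_one_plus_log_calc:
  assumes p: "strip_decay 2 p"
  shows "inv_one_plus (log_calc 1 p x) = log_calc 1 (\<lambda>w. p w * (1 / (1 + exp w))) x" "strip_decay 2 (\<lambda>w. p w * (1 / (1 + exp w)))"
proof -
  obtain B where B: "\<And>w. \<bar>Im w\<bar> < 2 \<Longrightarrow> cmod (1 / (1 + exp w)) \<le> B" "\<And>w. \<bar>Im w\<bar> < 2 \<Longrightarrow> 1 + exp w \<noteq> 0"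
    by (rule one_plus_exp_bounded) blast
  have h: "(\<lambda>w. 1 / (1 + exp w)) holomorphic_on {w. \<bar>Im w\<bar> < 2}" using B(2) by (intro holomorphic_intros) auto
  show sd: "strip_decay 2 (\<lambda>w. p w * (1 / (1 + exp w)))" by (rule strip_decay_mult_bounded[OF p h B(1)])
  have pp: "(2::real) \<le> pi" "(0::real) < 1" "(1::real) < 2" using pi_gt3 by auto
  have c: "cos (s - Im (\<i> * complex_of_real pi)) \<le> cos (pi / 2)" if "\<bar>s\<bar> \<le> 1" for s
  proof -
    have "0 \<le> cos s" using that pi_gt3 by (intro cos_ge_zero) auto
    then show ?thesis by simp
  qed
  have e: "exp (\<i> * complex_of_real pi) = -1" by simp
  have "resolvent A (exp (\<i> * of_real pi)) (log_calc 1 p x) = log_calc 1 (\<lambda>w. p w / (exp (\<i> * of_real pi) - exp w)) x"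
    by (rule resolvent_log_calc[OF p pp _ _ c]) simp_all
  then have "inv_one_plus (log_calc 1 p x) = - log_calc 1 (\<lambda>w. p w / (- 1 - exp w)) x" unfolding e by simp
  also have "(\<lambda>w. p w / (- 1 - exp w)) = (\<lambda>w. - 1 * (p w * (1 / (1 + exp w))))"
  proof
    fix w :: complex
    have *: "- 1 - exp w = - (1 + exp w)" by simp
    show "p w / (- 1 - exp w) = - 1 * (p w * (1 / (1 + exp w)))" unfolding * by (simp only: divide_minus_right) simp
  qed
  also have "log_calc 1 (\<lambda>w. - 1 * (p w * (1 / (1 + exp w)))) x = (- 1) *\<^sub>C log_calc 1 (\<lambda>w. p w * (1 / (1 + exp w))) x"
    by (rule log_calc_cmult[OF sd pp])
  finally show "inv_one_plus (log_calc 1 p x) = log_calc 1 (\<lambda>w. p w * (1 / (1 + exp w))) x" by (simp add: scaleC.minus_left)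
qed

lemma rhoA_inv_one_plus: "rhoA (inv_one_plus x) = inv_one_plus (rhoA x)"
proof -
  note R = bounded_linear_resolvent[OF off_m1]
  have pp: "(2::real) \<le> pi" "(0::real) < 1" "(1::real) < 2" using pi_gt3 by auto
  have "res_int (\<lambda>w. rho (exp w)) \<phi> (resolvent A (-1) x) = resolvent A (-1) (res_int (\<lambda>w. rho (exp w)) \<phi> x)"
    if \<phi>: "\<bar>\<phi>\<bar> = 1" for \<phi>
  proof -
    have f: "0 < \<bar>\<phi>\<bar>" "\<bar>\<phi>\<bar> < pi" using \<phi> pi_gt3 by auto
    have rd: "ray_decay \<phi> (\<lambda>w. rho (exp w))" by (rule strip_decay_imp_ray_decay[OF rho_strip_decay]) (use \<phi> in simp)
    have off: "Re (exp (log_ray \<phi> t)) < cmod (exp (log_ray \<phi> t))" for t using f by (intro exp_off_axis) auto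
    show ?thesis unfolding res_int_def
      using integral_linear[OF res_int_integrable_bound(1)[OF f rd, of x] R]
      by (simp add: o_def resolvent_scaleC[OF off_m1] resolvent_commute[OF off_m1 off])
  qed
  note * = this[of "-1"] this[of 1]
  have "rhoA (resolvent A (-1) x) = resolvent A (-1) (rhoA x)"
    unfolding rhoA_def log_calc_def using *
    by (simp add: resolvent_scaleC[OF off_m1] linear_simps(2)[OF R])
  then show ?thesis using linear_simps(4)[OF rhoA_linear(1)] by simp
qed

text \<open>\<open>\<rho>(\<lambda>) = (1 + \<lambda>)\<^sup>-\<^sup>1 - (1 + \<lambda>)\<^sup>-\<^sup>2\<close>. The identity is first obtained after applying \<open>\<rho>(A)\<close>, where all terms
  are contour integrals, and then \<open>\<rho>(A)\<close> is cancelled.\<close>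

lemma rhoA_eq: "rhoA x = inv_one_plus x - inv_one_plus (inv_one_plus x)"
proof -
  let ?p = "\<lambda>w. rho (exp w)" and ?q = "\<lambda>w. 1 / (1 + exp w)"
  have pp: "(2::real) \<le> pi" "(0::real) < 1" "(1::real) < 2" using pi_gt3 by auto
  note s1 = inv_one_plus_log_calc[OF rho_strip_decay]
  note s2 = inv_one_plus_log_calc[OF s1(2)]
  have ne: "1 + exp w \<noteq> 0" if "\<bar>Im w\<bar> < 2" for w :: complex
    by (rule one_plus_exp_bounded) (use that in blast)
  have "rhoA (rhoA x) = log_calc 1 (\<lambda>w. ?p w * ?p w) x"
    unfolding rhoA_def by (rule log_calc_mult[OF rho_strip_decay rho_strip_decay pp])
  moreover have "inv_one_plus (rhoA x) = log_calc 1 (\<lambda>w. ?p w * ?p w + ?p w * ?q w * ?q w) x"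
  proof -
    have "inv_one_plus (rhoA x) = log_calc 1 (\<lambda>w. ?p w * ?q w) x" unfolding rhoA_def by (rule s1(1))
    also have "\<dots> = log_calc 1 (\<lambda>w. ?p w * ?p w + ?p w * ?q w * ?q w) x"
    proof -
      have eq: "?p w * ?q w = ?p w * ?p w + ?p w * ?q w * ?q w" if w: "1 + exp w \<noteq> 0" for w :: complex
      proof -
        have "?p w + ?q w * ?q w = ?q w" using w by (simp add: rho_def divide_simps power2_eq_square)
        then have "?p w * (?p w + ?q w * ?q w) = ?p w * ?q w" by simp
        then show ?thesis by (simp only: distrib_left mult.assoc)
      qed
      have eq': "?p (log_ray \<phi> t) * ?q (log_ray \<phi> t) = ?p (log_ray \<phi> t) * ?p (log_ray \<phi> t) + ?p (log_ray \<phi> t) * ?q (log_ray \<phi> t) * ?q (log_ray \<phi> t)"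
        if "\<bar>\<phi>\<bar> = 1" for \<phi> t
        by (rule eq[of "log_ray \<phi> t"], rule ne[of "log_ray \<phi> t"]) (simp add: log_ray_def that)
      have "log_calc 1 f x = log_calc 1 g x" if "\<And>\<phi> t. \<bar>\<phi>\<bar> = 1 \<Longrightarrow> f (log_ray \<phi> t) = g (log_ray \<phi> t)" for f g
        using that[of 1] that[of "-1"] by (simp add: log_calc_def res_int_def)
      note cong = this
      show ?thesis by (rule cong, rule eq')
    qed
    finally show ?thesis .
  qed
  moreover have "\<dots> = log_calc 1 (\<lambda>w. ?p w * ?p w) x + log_calc 1 (\<lambda>w. ?p w * ?q w * ?q w) x"
    by (rule log_calc_add[OF strip_decay_mult[OF rho_strip_decay rho_strip_decay] s2(2) pp])
  moreover have "inv_one_plus (inv_one_plus (rhoA x)) = log_calc 1 (\<lambda>w. ?p w * ?q w * ?q w) x"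
    using s1(1)[of x] s2(1)[of x] unfolding rhoA_def by simp
  ultimately have "rhoA (rhoA x) = inv_one_plus (rhoA x) - inv_one_plus (inv_one_plus (rhoA x))" by simp
  also have "\<dots> = rhoA (inv_one_plus x) - rhoA (inv_one_plus (inv_one_plus x))" by (simp only: rhoA_inv_one_plus)
  also have "\<dots> = rhoA (inv_one_plus x - inv_one_plus (inv_one_plus x))" by (rule linear_simps(2)[OF rhoA_linear(1), symmetric])
  finally show ?thesis using rhoA_pow_inj[of 1] by simp
qed

text \<open>\<open>\<rho>(A) = A (1 + A)\<^sup>-\<^sup>1 (1 + A)\<^sup>-\<^sup>1\<close> is a product of bounded operators with ranges \<open>R(A)\<close> and \<open>D(A)\<close>, both
  dense.\<close>

lemma rhoA_dense: "closure (range rhoA) = UNIV"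
proof -
  define L where "L x = x - inv_one_plus x" for x
  have Lb: "bounded_linear L" unfolding L_def[abs_def] by (intro bounded_linear_sub bounded_linear_ident inv_one_plus_linear)
  have sv: "single_valued A" using linear_op by (simp add: linear_op_def)
  have gr: "(inv_one_plus x, L x) \<in> A" for x
  proof -
    have "((-1) *\<^sub>C resolvent A (-1) x, (-1) *\<^sub>C ((-1) *\<^sub>C resolvent A (-1) x - x)) \<in> A"
      using linear_op resolvent_in_graph[OF off_m1, of x] by (simp add: linear_op_def)
    then show ?thesis by (simp add: scaleC.minus_left L_def)
  qed
  have dom: "\<exists>z. v = inv_one_plus z \<and> w = L z" if "(v, w) \<in> A" for v w
  proof -
    let ?z = "v + w"
    have "(- 1) *\<^sub>C v = - v" by (simp add: scaleC.minus_left)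
    have "((-1) *\<^sub>C v, (-1) *\<^sub>C w) \<in> A" using linear_op that unfolding linear_op_def by blast
    then have "(- v, (-1) *\<^sub>C (- v) - ?z) \<in> A" by (simp add: scaleC.minus_left)
    then have "resolvent A (-1) ?z = - v" by (rule resolvent_unique[OF off_m1])
    then have "v = inv_one_plus ?z" by simp
    moreover from this have "w = L ?z" by (simp add: L_def)
    ultimately show ?thesis by blast
  qed
  have "Domain A \<subseteq> range inv_one_plus" "Range A \<subseteq> range L" using dom by blast+
  moreover have "closure (Domain A) = UNIV" "closure (Range A) = UNIV" using sectorial[of 1] by (auto simp: sectorial_def)
  ultimately have cJ: "closure (range inv_one_plus) = UNIV" and cL: "closure (range L) = UNIV"
    using closure_mono by (metis UNIV_I subsetI subset_antisym)+
  have "rhoA x = L (inv_one_plus x)" for x by (simp add: rhoA_eq L_def)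
  then have "range rhoA = L ` range inv_one_plus" by auto
  moreover have "L ` closure (range inv_one_plus) \<subseteq> closure (L ` range inv_one_plus)"
    by (rule image_closure_subset[OF linear_continuous_on[OF Lb] closed_closure closure_subset])
  ultimately have "range L \<subseteq> closure (range rhoA)" using cJ by simp
  then have "closure (range L) \<subseteq> closure (range rhoA)" by (intro closure_minimal closed_closure)
  then show ?thesis using cL by blast
qed

text \<open>On the range of \<open>\<rho>(A)\<close> convergence follows from norm convergence of \<open>(g k - 1) \<rho>\<close>; uniform boundedness
  and density of the range do the rest.\<close>

lemma Phi_strong:
  assumes g: "\<And>k. Cinf (g k)" "\<And>k. Cb_le ord B (g k)" and e: "e \<longlonglongrightarrow> 0" "\<And>k. Cb_le ord (e k) (\<lambda>s. (g k s - 1) * rho_log s)"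
  shows "(\<lambda>k. Phi (g k) y) \<longlonglongrightarrow> y"
proof (rule LIMSEQ_I)
  fix \<epsilon> :: real assume \<epsilon>: "\<epsilon> > 0"
  have B: "0 \<le> B" by (rule Cb_nonneg[OF g(2)])
  define M where "M = calc_const * B + 1"
  have M: "M > 0" using B calc_const_nonneg by (simp add: M_def add_nonneg_pos)
  have "y \<in> closure (range rhoA)" using rhoA_dense by simp
  then obtain x where x: "dist (rhoA x) y < \<epsilon> / (2 * M)"
    using \<epsilon> M unfolding closure_approachable by (metis (no_types, lifting) divide_pos_pos imageE mult_pos_pos zero_less_numeral)
  have "(\<lambda>k. calc_const * e k * norm x) \<longlonglongrightarrow> calc_const * 0 * norm x"
    by (rule tendsto_mult[OF tendsto_mult[OF tendsto_const e(1)] tendsto_const])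
  then have "\<forall>\<^sub>F k in sequentially. calc_const * e k * norm x < \<epsilon> / 2" by (rule order_tendstoD(2)) (use \<epsilon> in simp)
  then obtain K where K: "\<And>k. k \<ge> K \<Longrightarrow> calc_const * e k * norm x < \<epsilon> / 2" unfolding eventually_sequentially by blast
  show "\<exists>K. \<forall>k\<ge>K. norm (Phi (g k) y - y) < \<epsilon>"
  proof (intro exI[of _ K] allI impI)
    fix k assume k: "k \<ge> K"
    note L = Phi_bounded_linear[OF g(1)[of k]]
    have c1: "Cinf (\<lambda>s. g k s - 1)" by (rule Cinf_diff[OF g(1) Cinf_const])
    have "Phi (\<lambda>s. (g k s - 1) * rho_log s) x = Phi (\<lambda>s. g k s - 1) (rhoA x)"
      using Phi_mult[OF c1 Cinf_rho_log] Phi_rho_log by simp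
    also have "\<dots> = Phi (g k) (rhoA x) - rhoA x"
      using Phi_diff[OF g(1) Cinf_const[of 1]] Phi_const[of 1] by simp
    finally have n1: "norm (Phi (g k) (rhoA x) - rhoA x) \<le> calc_const * e k * norm x"
      using Phi_bound[OF Cinf_mult[OF c1 Cinf_rho_log] e(2)] by metis
    have n2: "norm (Phi (g k) (y - rhoA x)) \<le> calc_const * B * norm (y - rhoA x)" by (rule Phi_bound[OF g(1,2)])
    have "Phi (g k) y - y = Phi (g k) (y - rhoA x) + (Phi (g k) (rhoA x) - rhoA x) - (y - rhoA x)"
      using linear_simps(2)[OF L] by simp
    then have "norm (Phi (g k) y - y) \<le> norm (Phi (g k) (y - rhoA x)) + norm (Phi (g k) (rhoA x) - rhoA x) + norm (y - rhoA x)"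
      by (metis (no_types, lifting) norm_triangle_ineq4 norm_triangle_ineq add_right_mono order_trans)
    also have "\<dots> \<le> M * norm (y - rhoA x) + calc_const * e k * norm x" using n1 n2 by (simp add: M_def algebra_simps)
    also have "\<dots> < \<epsilon> / 2 + \<epsilon> / 2"
    proof (rule add_strict_mono[OF _ K[OF k]])
      have "norm (y - rhoA x) < \<epsilon> / (2 * M)" using x by (simp add: dist_norm norm_minus_commute)
      then have "M * norm (y - rhoA x) < M * (\<epsilon> / (2 * M))" using M by (rule mult_strict_left_mono)
      then show "M * norm (y - rhoA x) < \<epsilon> / 2" using M by simp
    qed
    finally show "norm (Phi (g k) y - y) < \<epsilon>" by simp
  qed
qed

text \<open>Where \<open>g k\<close> differs from one, \<open>\<rho>\<close> is exponentially small. So \<open>(g k - 1) \<rho>\<close> tends to zero uniformly, and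
  by interpolation together with its derivatives.\<close>

lemma Phi_cutoff:
  assumes g: "\<And>m. \<exists>B. \<forall>k. Cb_le m B (g k)" and one: "\<And>k s. \<bar>s\<bar> \<le> c * real k \<Longrightarrow> g k s = 1" and c: "c > 0"
  shows "(\<lambda>k. Phi (g k) y) \<longlonglongrightarrow> y"
proof -
  obtain B where B: "\<And>k. Cb_le ord B (g k)" using g by blast
  have B0: "0 \<le> B" by (rule Cb_nonneg[OF B])
  have pp: "(0::real) < 1" "1 < pi" using pi_gt3 by auto
  obtain K where K: "K \<ge> 0" "\<And>w. \<bar>Im w\<bar> < 1 \<Longrightarrow> cmod (rho (exp w)) \<le> K * exp (- \<bar>Re w\<bar>)"
    by (rule rho_bound[OF pp]) blast
  have rrb: "cmod (rho_log s) \<le> K * exp (- \<bar>s\<bar>)" for s using K(2)[of "of_real s"] by (simp add: exp_of_real)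
  have all: "\<exists>C. \<forall>k. Cb_le m C (\<lambda>s. (g k s - 1) * rho_log s)" for m
  proof -
    obtain B1 where B1: "\<And>k. Cb_le m B1 (g k)" using g by blast
    obtain B2 where B2: "Cb_le m B2 rho_log" using Cinf_rho_log unfolding Cinf_def by blast
    show ?thesis using Cb_mult[OF Cb_diff[OF B1 Cb_const[of m 1]] B2] by blast
  qed
  define e where "e k = (B + 1) * (K * exp (- (c * real k)))" for k
  have "filterlim (\<lambda>k. c * real k) at_top sequentially"
    by (rule filterlim_tendsto_pos_mult_at_top[OF tendsto_const c filterlim_real_sequentially])
  then have "(\<lambda>k. exp (- (c * real k))) \<longlonglongrightarrow> 0"
    by (intro filterlim_compose[OF exp_at_bot] filterlim_uminus_at_bot_at_top[THEN filterlim_compose])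
  then have "e \<longlonglongrightarrow> (B + 1) * (K * 0)" unfolding e_def by (intro tendsto_mult tendsto_const)
  then have e0: "e \<longlonglongrightarrow> 0" by simp
  have sup: "cmod ((g k s - 1) * rho_log s) \<le> e k" for k s
  proof (cases "\<bar>s\<bar> \<le> c * real k")
    case True
    then show ?thesis using one B0 K(1) by (simp add: e_def)
  next
    case False
    have "cmod (g k s - 1) \<le> B + 1" using Cb_bound[OF B, of k s] norm_triangle_ineq4[of "g k s" 1] by simp
    moreover have "cmod (rho_log s) \<le> K * exp (- (c * real k))"
    proof -
      have "exp (- \<bar>s\<bar>) \<le> exp (- (c * real k))" using False by simp
      from mult_left_mono[OF this K(1)] rrb[of s] show ?thesis by linarith
    qed
    ultimately show ?thesis unfolding e_def norm_mult using B0 K(1) by (intro mult_mono) auto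
  qed
  obtain e' where e': "e' \<longlonglongrightarrow> 0" "\<And>k. Cb_le ord (e' k) (\<lambda>s. (g k s - 1) * rho_log s)"
    using Cb_sequence_small[OF all e0 sup] by blast
  have "Cinf (g k)" for k unfolding Cinf_def using g by blast
  from Phi_strong[OF this B e'] show ?thesis .
qed

text \<open>A power of \<open>\<rho>\<close> large enough to regularise \<open>\<lambda>\<^sup>\<theta>\<close> at zero and at infinity.\<close>

definition frac_order :: "real \<Rightarrow> nat" where "frac_order \<theta> = nat \<lceil>\<bar>\<theta>\<bar>\<rceil> + 1"

lemma powr_admissible:
  assumes w: "0 < \<omega>" "\<omega> < pi"
  shows "(\<lambda>z. rho z ^ frac_order \<theta> * z powr of_real \<theta>) \<in> Hinf0 \<omega>" "(\<lambda>z. z powr of_real \<theta>) holomorphic_on sector \<omega>"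
proof -
  have nr: "z \<notin> \<real>\<^sub>\<le>\<^sub>0" if "z \<in> sector \<omega>" for z
  proof
    assume z: "z \<in> \<real>\<^sub>\<le>\<^sub>0"
    have "z \<noteq> 0" "\<bar>Arg z\<bar> < \<omega>" using that by (auto simp: sector_def)
    then have "Arg z = pi" using z by (auto simp: complex_nonpos_Reals_iff Arg_eq_pi complex_eq_iff less_le)
    then show False using \<open>\<bar>Arg z\<bar> < \<omega>\<close> w by simp
  qed
  show hol: "(\<lambda>z. z powr of_real \<theta>) holomorphic_on sector \<omega>" using nr by (intro holomorphic_intros) auto
  show "(\<lambda>z. rho z ^ frac_order \<theta> * z powr of_real \<theta>) \<in> Hinf0 \<omega>"
  proof (rule rho_power_Hinf0[OF w hol, where C = 1])
    fix v assume v: "\<bar>Im v\<bar> < \<omega>"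
    have "Ln (exp v) = v" using v w by (intro Ln_exp) auto
    then have "cmod (exp v powr of_real \<theta>) = exp (\<theta> * Re v)" by (simp add: powr_def)
    also have "\<theta> * Re v \<le> \<bar>\<theta>\<bar> * \<bar>Re v\<bar>" by (metis abs_ge_self abs_mult)
    also have "\<bar>\<theta>\<bar> * \<bar>Re v\<bar> \<le> (real (frac_order \<theta>) - 1) * \<bar>Re v\<bar>"
      by (rule mult_right_mono) (auto simp: frac_order_def)
    finally show "cmod (exp v powr of_real \<theta>) \<le> 1 * exp ((real (frac_order \<theta>) - 1) * \<bar>Re v\<bar>)" by simp
  qed
qed

lemma frac_iff: "(x, y) \<in> frac_power A \<theta> \<longleftrightarrow>
    Phi (\<lambda>s. rho_log s ^ frac_order \<theta>) y = Phi (\<lambda>s. rho_log s ^ frac_order \<theta> * of_real (exp (\<theta> * s))) x"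
  and frac_Cinf: "Cinf (\<lambda>s. rho_log s ^ frac_order \<theta> * of_real (exp (\<theta> * s)))"
proof -
  let ?h = "\<lambda>z. rho z ^ frac_order \<theta> * z powr complex_of_real \<theta>"
  have hH: "?h \<in> Hinf_all" by (rule Hinf0_Hinf_all[OF powr_admissible(1)])
  have ex: "of_real (exp s) powr complex_of_real \<theta> = of_real (exp (\<theta> * s))" for s
    by (simp add: powr_def Ln_of_real flip: exp_of_real)
  show "Cinf (\<lambda>s. rho_log s ^ frac_order \<theta> * of_real (exp (\<theta> * s)))" using Hinf_all_Cinf[OF hH] unfolding ex .
  have "(x, y) \<in> frac_power A \<theta> \<longleftrightarrow> (rhoA ^^ frac_order \<theta>) y = log_calc 1 (\<lambda>w. rho (exp w) ^ frac_order \<theta> * exp w powr of_real \<theta>) x"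
    unfolding frac_power_def by (rule hol_calc_iff[OF powr_admissible])
  also have "log_calc 1 (\<lambda>w. rho (exp w) ^ frac_order \<theta> * exp w powr of_real \<theta>) x = hol_op ?h x"
    by (rule hol_op_log_calc[OF powr_admissible(1), symmetric])
  also have "hol_op ?h x = Phi (\<lambda>s. rho_log s ^ frac_order \<theta> * of_real (exp (\<theta> * s))) x"
    using Phi_hol[OF hH, of x] unfolding ex by simp
  finally show "(x, y) \<in> frac_power A \<theta> \<longleftrightarrow>
    Phi (\<lambda>s. rho_log s ^ frac_order \<theta>) y = Phi (\<lambda>s. rho_log s ^ frac_order \<theta> * of_real (exp (\<theta> * s))) x"
    unfolding rhoA_pow_Phi .
qed

lemma frac_unique: "(x, y) \<in> frac_power A \<theta> \<Longrightarrow> (x, z) \<in> frac_power A \<theta> \<Longrightarrow> y = z"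
  unfolding frac_iff rhoA_pow_Phi[symmetric] by (rule rhoA_pow_inj[of "frac_order \<theta>"]) simp

lemma frac_diff:
  assumes "(x, y) \<in> frac_power A \<theta>" "(x', y') \<in> frac_power A \<theta>"
  shows "(x - x', y - y') \<in> frac_power A \<theta>"
  using assms unfolding frac_iff
  by (simp add: linear_simps(2)[OF Phi_bounded_linear[OF Cinf_power[OF Cinf_rho_log]]] linear_simps(2)[OF Phi_bounded_linear[OF frac_Cinf]])

lemma frac_op_val: "(x, y) \<in> frac_power A \<theta> \<Longrightarrow> op_val (frac_power A \<theta>) x = y"
  unfolding op_val_def by (rule the_equality) (auto intro: frac_unique)

text \<open>Both sides agree after applying a power of \<open>\<rho>(A)\<close>, where \<open>A\<^sup>\<theta>\<close> is by definition a multiplier;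
  injectivity removes this power. This is how \<open>A\<^sup>\<theta>\<close> is absorbed into bounded multipliers.\<close>

lemma frac_Phi:
  assumes xy: "(x, y) \<in> frac_power A \<theta>" and u: "Cinf u" and v: "Cinf (\<lambda>s. u s * of_real (exp (\<theta> * s)))"
  shows "Phi u y = Phi (\<lambda>s. u s * of_real (exp (\<theta> * s))) x"
proof -
  let ?r = "\<lambda>s. rho_log s ^ frac_order \<theta>" and ?t = "\<lambda>s. complex_of_real (exp (\<theta> * s))"
  have r: "Cinf ?r" by (rule Cinf_power[OF Cinf_rho_log])
  have "Phi ?r (Phi u y) = Phi (\<lambda>s. ?r s * u s) y" by (rule Phi_mult[OF r u, symmetric])
  also have "\<dots> = Phi (\<lambda>s. u s * ?r s) y" by (simp only: mult.commute)
  also have "\<dots> = Phi u (Phi ?r y)" by (rule Phi_mult[OF u r])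
  also have "Phi ?r y = Phi (\<lambda>s. ?r s * ?t s) x" using xy unfolding frac_iff .
  also have "Phi u \<dots> = Phi (\<lambda>s. u s * (?r s * ?t s)) x" by (rule Phi_mult[OF u frac_Cinf, symmetric])
  also have "\<dots> = Phi (\<lambda>s. ?r s * (u s * ?t s)) x" by (simp only: mult.left_commute)
  also have "\<dots> = Phi ?r (Phi (\<lambda>s. u s * ?t s) x)" by (rule Phi_mult[OF r v])
  finally show ?thesis unfolding rhoA_pow_Phi[symmetric] by (rule rhoA_pow_inj)
qed

end

section \<open>Unconditionally bounded families of multipliers\<close>

lemma zero_beyond_derivative:
  assumes d: "\<And>x. (p has_vector_derivative p' x) (at x)" and z: "\<forall>s>b. p s = 0" and s: "s > (b::real)"
  shows "p' s = (0::complex)"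
proof -
  have "((\<lambda>_. 0) has_vector_derivative 0) (at s)" by simp
  then have "(p has_vector_derivative 0) (at s)"
    by (rule has_vector_derivative_transform_within_open[where S = "{b<..}"]) (use s z in auto)
  then show ?thesis using d vector_derivative_unique_at by blast
qed

lemma exp_vector_derivative:
  "((\<lambda>s. complex_of_real (exp (c * s))) has_vector_derivative of_real c * of_real (exp (c * s))) (at s)"
proof -
  have "((\<lambda>s. exp (c * s)) has_real_derivative c * exp (c * s)) (at s)"
    by (auto intro!: derivative_eq_intros)
  from has_vector_derivative_of_real[OF this] show ?thesis by simp
qed

text \<open>Differentiation leads to functions \<open>(p' + \<theta> p) exp(\<theta> s)\<close> of the same kind, and \<open>exp(\<theta> s)\<close> is bounded
  on the half line where \<open>p\<close> lives.\<close>

lemma Cinf_mult_exp_half_line: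
  assumes p: "Cinf p" "\<forall>s>b. p s = 0" and \<theta>: "\<theta> \<ge> 0"
  shows "Cinf (\<lambda>s. p s * of_real (exp (\<theta> * s)))"
proof -
  have bound: "\<exists>B. \<forall>s. cmod (p s * of_real (exp (\<theta> * s))) \<le> B" if p: "Cinf p" "\<forall>s>b. p s = 0" for p
  proof -
    obtain B where B: "Cb_le 0 B p" using p(1) unfolding Cinf_def by blast
    have "cmod (p s * of_real (exp (\<theta> * s))) \<le> B * exp (\<theta> * b)" for s
    proof (cases "s > b")
      case True
      then show ?thesis using p(2) Cb_nonneg[OF B] by simp
    next
      case False
      then have "exp (\<theta> * s) \<le> exp (\<theta> * b)" using \<theta> by (simp add: mult_left_mono)
      then show ?thesis unfolding norm_mult using Cb_bound[OF B, of s] Cb_nonneg[OF B] by (intro mult_mono) auto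
    qed
    then show ?thesis by blast
  qed
  have "\<exists>B. Cb_le m B (\<lambda>s. p s * of_real (exp (\<theta> * s)))" if "Cinf p" "\<forall>s>b. p s = 0" for m p
    using that
  proof (induction m arbitrary: p)
    case 0
    obtain B where "Cb_le 0 B p" using 0(1) unfolding Cinf_def by blast
    then have "continuous_on UNIV (\<lambda>s. p s * complex_of_real (exp (\<theta> * s)))"
      by (intro continuous_intros) (rule Cb_continuous)
    then show ?case using bound[OF 0] by auto
  next
    case (Suc m)
    obtain p' where p': "\<And>x. (p has_vector_derivative p' x) (at x)" "Cinf p'" using Cinf_derivE[OF Suc.prems(1)] by blast
    let ?q = "\<lambda>s. p' s + of_real \<theta> * p s"
    have q: "Cinf ?q" by (rule Cinf_add[OF p'(2) Cinf_cmult[OF Suc.prems(1)]])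
    have "\<forall>s>b. ?q s = 0" using zero_beyond_derivative[OF p'(1) Suc.prems(2)] Suc.prems(2) by simp
    then obtain B where B: "Cb_le m B (\<lambda>s. ?q s * of_real (exp (\<theta> * s)))" using Suc.IH[OF q] by blast
    obtain C where C: "\<And>s. cmod (p s * of_real (exp (\<theta> * s))) \<le> C" using bound[OF Suc.prems] by blast
    have d: "((\<lambda>s. p s * of_real (exp (\<theta> * s))) has_vector_derivative ?q s * of_real (exp (\<theta> * s))) (at s)" for s
    proof -
      have eq: "?q s * E = p s * (of_real \<theta> * E) + p' s * E" for E by (simp add: algebra_simps)
      show ?thesis unfolding eq by (rule has_vector_derivative_mult[OF p'(1) exp_vector_derivative])
    qed
    have "Cb_le (Suc m) (max B C) (\<lambda>s. p s * of_real (exp (\<theta> * s)))"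
      by (rule Cb_SucI[OF _ d Cb_mono[OF B]]) (use C in \<open>auto simp: le_max_iff_disj\<close>)
    then show ?case by blast
  qed
  then show ?thesis using p unfolding Cinf_def by blast
qed

lemma Cinf_mult_exp_compact:
  assumes p: "Cinf p" "\<forall>x. x \<notin> {a..b} \<longrightarrow> p x = 0"
  shows "Cinf (\<lambda>s. p s * of_real (exp (\<theta> * s)))"
  using exp_vector_derivative[of \<theta>]
  by (intro Cinf_mult_local[where h = "\<lambda>_ s. of_real (exp (\<theta> * s))" and c = "\<lambda>_. of_real \<theta>", OF p])

text \<open>The derivatives of \<open>p (exp s)\<close> are combinations of \<open>p\<^sup>(\<^sup>i\<^sup>)(exp s) exp(j s)\<close>, which are bounded since \<open>exp s\<close> is
  bounded on the support. The induction runs over all exponents \<open>j\<close> at once.\<close>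

lemma Cinf_comp_exp:
  assumes p: "Cinf p" "\<forall>x. x \<notin> {a..b} \<longrightarrow> p x = 0"
  shows "Cinf (\<lambda>s. p (exp s))"
proof -
  let ?f = "\<lambda>p (j::nat) s. p (exp s) * complex_of_real (exp (real j * s))"
  have bound: "\<exists>B. \<forall>s. cmod (?f p j s) \<le> B" if p: "Cinf p" "\<forall>x. x \<notin> {a..b} \<longrightarrow> p x = 0" for p j
  proof -
    obtain B where B: "Cb_le 0 B p" using p(1) unfolding Cinf_def by blast
    have "cmod (?f p j s) \<le> B * \<bar>b\<bar> ^ j" for s
    proof (cases "exp s \<in> {a..b}")
      case False
      then show ?thesis using p(2) Cb_nonneg[OF B] by simp
    next
      case True
      then have "exp s ^ j \<le> \<bar>b\<bar> ^ j" by (intro power_mono) auto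
      then show ?thesis unfolding norm_mult exp_of_nat_mult using Cb_bound[OF B, of "exp s"] Cb_nonneg[OF B]
        by (intro mult_mono) (auto simp: norm_power)
    qed
    then show ?thesis by blast
  qed
  have "\<exists>B. Cb_le m B (?f p j)" if "Cinf p" "\<forall>x. x \<notin> {a..b} \<longrightarrow> p x = 0" for m p j
    using that
  proof (induction m arbitrary: p j)
    case 0
    obtain B where B: "Cb_le 0 B p" using 0(1) unfolding Cinf_def by blast
    have "continuous_on UNIV (\<lambda>s. p (exp s))"
      by (rule continuous_on_compose2[OF Cb_continuous[OF B, of UNIV]]) (auto intro: continuous_intros)
    then have "continuous_on UNIV (?f p j)" by (intro continuous_intros)
    then show ?case using bound[OF 0] by auto
  next
    case (Suc m)
    obtain p' where p': "\<And>x. (p has_vector_derivative p' x) (at x)" "Cinf p'" using Cinf_derivE[OF Suc.prems(1)] by blast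
    have z': "\<forall>x. x \<notin> {a..b} \<longrightarrow> p' x = 0" using derivative_zero_outside[OF p'(1), of a b] Suc.prems(2) by blast
    obtain B1 where B1: "Cb_le m B1 (?f p' (Suc j))" using Suc.IH[OF p'(2) z'] by blast
    obtain B2 where B2: "Cb_le m B2 (?f p j)" using Suc.IH[OF Suc.prems] by blast
    obtain C where C: "\<And>s. cmod (?f p j s) \<le> C" using bound[OF Suc.prems] by blast
    have d: "(?f p j has_vector_derivative ?f p' (Suc j) s + of_nat j * ?f p j s) (at s)" for s
    proof -
      note e = exp_vector_derivative[of "real j" s]
      have "(exp has_vector_derivative exp s) (at s)"
        using DERIV_exp[of s] by (simp add: has_real_derivative_iff_has_vector_derivative)
      from vector_diff_chain_at[OF this p'(1)] have "((\<lambda>s. p (exp s)) has_vector_derivative exp s *\<^sub>R p' (exp s)) (at s)"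
        by (simp add: o_def)
      from has_vector_derivative_mult[OF this e] show ?thesis
        by (simp add: algebra_simps scaleR_conv_of_real exp_add of_real_mult)
    qed
    have "Cb_le (Suc m) (max (B1 + cmod (of_nat j) * B2) C) (?f p j)"
      by (rule Cb_SucI[OF _ d Cb_mono[OF Cb_add[OF B1 Cb_cmult[OF B2]]]]) (use C in \<open>auto simp: le_max_iff_disj\<close>)
    then show ?case by blast
  qed
  from this[OF p, of _ 0] show ?thesis unfolding Cinf_def by simp
qed

text \<open>The two formulas overlap on an open interval, so the derivative may be computed from either.\<close>

lemma Cb_glue:
  fixes a b :: real
  assumes "Cb_le m B u" "Cb_le m B v" "\<forall>s<a. f s = u s" "\<forall>s>b. f s = v s" "b < a"
  shows "Cb_le m B f"
  using assms
proof (induction m arbitrary: u v f)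
  case 0
  have "continuous_on {..<a} f" "continuous_on {b<..} f"
    by (rule continuous_on_eq[OF Cb_continuous[OF 0(1)]], use 0 in simp)
      (rule continuous_on_eq[OF Cb_continuous[OF 0(2)]], use 0 in simp)
  then have "continuous_on ({..<a} \<union> {b<..}) f" by (intro continuous_on_open_Un) auto
  moreover have "{..<a} \<union> {b<..} = UNIV" using 0(5) by auto
  moreover have "cmod (f s) \<le> B" for s
    using 0 by (cases "s < a") auto
  ultimately show ?case by simp
next
  case (Suc m)
  obtain u' where u': "\<And>x. (u has_vector_derivative u' x) (at x)" "Cb_le m B u'" by (rule Cb_derivE[OF Suc.prems(1)]) blast
  obtain v' where v': "\<And>x. (v has_vector_derivative v' x) (at x)" "Cb_le m B v'" by (rule Cb_derivE[OF Suc.prems(2)]) blast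
  define f' where "f' s = (if s < a then u' s else v' s)" for s
  have l: "(f has_vector_derivative u' s) (at s)" if "s < a" for s
    by (rule has_vector_derivative_transform_within_open[OF u'(1), where S = "{..<a}"]) (use that Suc.prems in auto)
  have r: "(f has_vector_derivative v' s) (at s)" if "s > b" for s
    by (rule has_vector_derivative_transform_within_open[OF v'(1), where S = "{b<..}"]) (use that Suc.prems in auto)
  have "f' s = v' s" if "s > b" for s
    using l[of s] r[OF that] vector_derivative_unique_at by (auto simp: f'_def)
  then have f'v: "\<forall>s>b. f' s = v' s" by blast
  have "\<forall>s<a. f' s = u' s" by (simp add: f'_def)
  then have "Cb_le m B f'" by (rule Suc.IH[OF u'(2) v'(2) _ f'v Suc.prems(5)])
  moreover have "(f has_vector_derivative f' s) (at s)" for s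
    using l[of s] r[of s] Suc.prems(5) by (auto simp: f'_def)
  moreover have "cmod (f s) \<le> B" for s
    using Suc.prems Cb_bound[OF Suc.prems(1), of s] Cb_bound[OF Suc.prems(2), of s] by (cases "s < a") auto
  ultimately show ?case by auto
qed

lemma Cinf_glue:
  fixes a b :: real
  assumes u: "Cinf u" and v: "Cinf v" and "\<forall>s<a. f s = u s" "\<forall>s>b. f s = v s" "b < a"
  shows "Cinf f"
  unfolding Cinf_def
proof
  fix m
  obtain B C where "Cb_le m B u" "Cb_le m C v" using u v unfolding Cinf_def by blast
  then have "Cb_le m (max B C) u" "Cb_le m (max B C) v" by (auto elim: Cb_mono)
  from Cb_glue[OF this assms(3-)] show "\<exists>B. Cb_le m B f" by blast
qed

text \<open>The name refers to unconditional convergence: all sums with coefficients in the unit disc are bounded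
  together with their derivatives, uniformly.\<close>

definition uncond :: "('i \<Rightarrow> real \<Rightarrow> complex) \<Rightarrow> bool" where
  "uncond w \<longleftrightarrow> (\<forall>m. \<exists>B. \<forall>F c. finite F \<longrightarrow> (\<forall>n. cmod (c n) \<le> 1) \<longrightarrow> Cb_le m B (\<lambda>s. \<Sum>n\<in>F. c n * w n s))"

lemma uncond_Cinf: assumes "uncond w" shows "Cinf (w n)"
  unfolding Cinf_def
proof
  fix m
  obtain B where B: "\<And>F c. finite F \<Longrightarrow> (\<And>n. cmod (c n) \<le> 1) \<Longrightarrow> Cb_le m B (\<lambda>s. \<Sum>n\<in>F. c n * w n s)"
    using assms unfolding uncond_def by blast
  from B[of "{n}" "\<lambda>_. 1"] show "\<exists>B. Cb_le m B (w n)" by auto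
qed

lemma uncond_shifts:
  assumes w: "Cinf w" "\<forall>x. x \<notin> {-R..R} \<longrightarrow> w x = 0" and l: "l > 0" "R \<ge> 0"
  shows "uncond (\<lambda>(n::int) s. w (s - real_of_int n * l))"
  unfolding uncond_def
proof
  fix m
  obtain B where "Cb_le m B w" using w(1) unfolding Cinf_def by blast
  then show "\<exists>B. \<forall>F c. finite F \<longrightarrow> (\<forall>n. cmod (c n) \<le> 1) \<longrightarrow> Cb_le m B (\<lambda>s. \<Sum>n\<in>F. c n * w (s - real_of_int n * l))"
    using Cb_sum_shifts[of m B w R l] w(2) l by blast
qed

lemma uncond_scale:
  assumes "uncond w" "\<And>n. cmod (k n) \<le> 1"
  shows "uncond (\<lambda>n s. k n * w n s)"
  unfolding uncond_def
proof
  fix m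
  obtain B where B: "\<And>F c. finite F \<Longrightarrow> (\<And>n. cmod (c n) \<le> 1) \<Longrightarrow> Cb_le m B (\<lambda>s. \<Sum>n\<in>F. c n * w n s)"
    using assms unfolding uncond_def by blast
  have "Cb_le m B (\<lambda>s. \<Sum>n\<in>F. c n * (k n * w n s))" if "finite F" "\<forall>n. cmod (c n) \<le> 1" for F c
    using B[OF that(1), of "\<lambda>n. c n * k n"] that(2) assms(2) by (simp add: mult.assoc norm_mult mult_le_one)
  then show "\<exists>B. \<forall>F c. finite F \<longrightarrow> (\<forall>n. cmod (c n) \<le> 1) \<longrightarrow> Cb_le m B (\<lambda>s. \<Sum>n\<in>F. c n * (k n * w n s))" by blast
qed

text \<open>Passing from the integers to the natural numbers loses the negative indices; the member of index 0
  may then be replaced by any single smooth function, here by a low frequency part.\<close>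

lemma uncond_nat:
  fixes w :: "int \<Rightarrow> real \<Rightarrow> complex"
  assumes w: "uncond w" and g: "Cinf g"
  shows "uncond (\<lambda>n::nat. if n = 0 then g else w (int n))"
  unfolding uncond_def
proof
  fix m
  obtain B where B: "\<And>F c. finite F \<Longrightarrow> (\<And>n. cmod (c n) \<le> 1) \<Longrightarrow> Cb_le m B (\<lambda>s. \<Sum>n\<in>F. c n * w n s)"
    using w unfolding uncond_def by blast
  obtain D where D: "Cb_le m D g" using g unfolding Cinf_def by blast
  let ?w = "\<lambda>n::nat. if n = 0 then g else w (int n)"
  have "Cb_le m (B + D) (\<lambda>s. \<Sum>n\<in>F. c n * ?w n s)" if F: "finite F" and c: "\<forall>n. cmod (c n) \<le> 1" for F c
  proof -
    let ?d = "if 0 \<in> F then c 0 else 0"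
    have "Cb_le m (cmod ?d * D) (\<lambda>s. ?d * g s)" by (rule Cb_cmult[OF D])
    then have 1: "Cb_le m D (\<lambda>s. ?d * g s)"
      by (rule Cb_mono) (use c Cb_nonneg[OF D] in \<open>auto intro: mult_left_le_one_le\<close>)
    have 2: "Cb_le m B (\<lambda>s. \<Sum>k\<in>int ` (F - {0}). c (nat k) * w k s)" by (rule B) (use F c in auto)
    have "(\<Sum>n\<in>F. c n * ?w n s) = (\<Sum>k\<in>int ` (F - {0}). c (nat k) * w k s) + ?d * g s" for s
    proof -
      have "(\<Sum>n\<in>F. c n * ?w n s) = (\<Sum>n\<in>F - {0}. c n * ?w n s) + ?d * g s"
        using F by (cases "0 \<in> F") (simp_all add: sum.remove add.commute)
      also have "(\<Sum>n\<in>F - {0}. c n * ?w n s) = (\<Sum>n\<in>F - {0}. c n * w (int n) s)" by (intro sum.cong) auto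
      also have "\<dots> = (\<Sum>k\<in>int ` (F - {0}). c (nat k) * w k s)" by (subst sum.reindex) (auto simp: inj_on_def)
      finally show ?thesis .
    qed
    then show ?thesis using Cb_add[OF 2 1] by simp
  qed
  then show "\<exists>B. \<forall>F c. finite F \<longrightarrow> (\<forall>n. cmod (c n) \<le> 1) \<longrightarrow> Cb_le m B (\<lambda>s. \<Sum>n\<in>F. c n * ?w n s)" by blast
qed

context mihlin_calculus
begin

lemma Phi_signed_sum_bound:
  assumes w: "uncond w"
  obtains K where "K \<ge> 0" "\<And>F s y. finite F \<Longrightarrow> s \<in> signs F \<Longrightarrow> norm (\<Sum>n\<in>F. s n *\<^sub>R Phi (w n) y) \<le> K * norm y"
proof -
  obtain B where B: "\<And>F c. finite F \<Longrightarrow> (\<And>n. cmod (c n) \<le> 1) \<Longrightarrow> Cb_le ord B (\<lambda>s. \<Sum>n\<in>F. c n * w n s)"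
    using w unfolding uncond_def by blast
  have B0: "B \<ge> 0" using Cb_nonneg[OF B[of "{}" "\<lambda>_. 0"]] by simp
  have "norm (\<Sum>n\<in>F. s n *\<^sub>R Phi (w n) y) \<le> calc_const * B * norm y" if F: "finite F" and s: "s \<in> signs F" for F s y
  proof -
    define c where "c n = (if n \<in> F then complex_of_real (s n) else 0)" for n
    have c: "cmod (c n) \<le> 1" for n using signs_abs[OF s, of n] by (simp add: c_def)
    have Ci: "Cinf (\<lambda>t. c n * w n t)" for n by (rule Cinf_cmult[OF uncond_Cinf[OF w]])
    have "(\<Sum>n\<in>F. s n *\<^sub>R Phi (w n) y) = (\<Sum>n\<in>F. Phi (\<lambda>t. c n * w n t) y)"
      by (intro sum.cong refl) (simp add: Phi_cmult[OF uncond_Cinf[OF w]] scaleR_scaleC c_def)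
    also have "\<dots> = Phi (\<lambda>t. \<Sum>n\<in>F. c n * w n t) y" by (rule Phi_sum[OF F Ci, symmetric])
    finally show ?thesis using Phi_bound[OF Cinf_sum[OF Ci] B[OF F c], of y] by simp
  qed
  then show ?thesis using that[of "calc_const * B"] B0 calc_const_nonneg by simp
qed

lemma Phi_linear: "Cinf u \<Longrightarrow> linear (Phi u)"
  by (rule bounded_linear.linear[OF Phi_bounded_linear])

text \<open>The decoupling inequality for multipliers, whose signed sums are again multipliers of a bounded family.\<close>

lemma Phi_decoupling:
  fixes w :: "'i::countable \<Rightarrow> real \<Rightarrow> complex"
  assumes w: "uncond w" and rad: "rademacher M \<epsilon>"
  obtains K where "K > 0" "\<And>F a. finite F \<Longrightarrow> norm (\<Sum>n\<in>F. Phi (w n) (a n)) \<le> K * (\<integral>\<omega>. norm (\<Sum>n\<in>F. \<epsilon> n \<omega> *\<^sub>R a n) \<partial>M)"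
proof -
  obtain K where K: "K \<ge> 0" "\<And>F s y. finite F \<Longrightarrow> s \<in> signs F \<Longrightarrow> norm (\<Sum>n\<in>F. s n *\<^sub>R Phi (w n) y) \<le> K * norm y"
    by (rule Phi_signed_sum_bound[OF w]) blast
  have "norm (\<Sum>n\<in>F. Phi (w n) (a n)) \<le> (K + 1) * (\<integral>\<omega>. norm (\<Sum>n\<in>F. \<epsilon> n \<omega> *\<^sub>R a n) \<partial>M)" if F: "finite F" for F a
  proof (rule rademacher_decoupling[OF rad F])
    show "linear (Phi (w n))" for n by (rule Phi_linear[OF uncond_Cinf[OF w]])
    fix s z assume "s \<in> signs F"
    from K(2)[OF F this, of z] show "norm (\<Sum>n\<in>F. s n *\<^sub>R Phi (w n) z) \<le> (K + 1) * norm z"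
      by (rule order_trans) (simp add: mult_right_mono)
  qed
  then show ?thesis using that[of "K + 1"] K(1) by simp
qed

end

section \<open>The homogeneous estimate\<close>

lemma rad_sup_least:
  assumes "\<And>F. finite F \<Longrightarrow> (\<integral>w. norm (\<Sum>n\<in>F. \<epsilon> n w *\<^sub>R v n) \<partial>M) \<le> C"
  shows "rad_sup M \<epsilon> v \<le> ennreal C"
  unfolding rad_sup_def by (rule SUP_least) (use assms in \<open>auto intro: ennreal_leI\<close>)

text \<open>Reconstruction in the limit: \<open>y\<close> is approximated by vectors each of which is controlled by one
  Rademacher average.\<close>

lemma norm_limit_le_rad_sup:
  assumes S: "rad_sup M \<epsilon> v = ennreal r" "0 \<le> r" and z: "z \<longlonglongrightarrow> y" and K: "0 \<le> K"
    and F: "\<And>N::nat. finite (F N)" "\<And>N. norm (z N) \<le> K * (\<integral>w. norm (\<Sum>n\<in>F N. \<epsilon> n w *\<^sub>R v n) \<partial>M)"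
  shows "norm y \<le> K * r"
proof -
  have "norm (z N) \<le> K * r" for N
  proof -
    have "ennreal (\<integral>w. norm (\<Sum>n\<in>F N. \<epsilon> n w *\<^sub>R v n) \<partial>M) \<le> ennreal r"
      unfolding S(1)[symmetric] rad_sup_def by (rule SUP_upper) (simp add: F(1))
    then have "(\<integral>w. norm (\<Sum>n\<in>F N. \<epsilon> n w *\<^sub>R v n) \<partial>M) \<le> r" using S(2) by simp
    from mult_left_mono[OF this K] F(2)[of N] show ?thesis by linarith
  qed
  then show ?thesis using LIMSEQ_le_const2[OF tendsto_norm[OF z]] by blast
qed

locale dyadic_mihlin_calculus = mihlin_calculus A \<alpha> \<phi>0 \<phi>1
  for A :: "'a::complex_banach op_graph" and \<alpha> \<phi>0 \<phi>1 +
  fixes \<phi> :: "real \<Rightarrow> complex"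
  assumes dyadic: "dyadic_partition \<phi>"
begin

abbreviation base :: "real \<Rightarrow> complex" where "base s \<equiv> \<phi> (exp s)"

text \<open>Dilation of \<open>\<phi>\<close> by \<open>2 ^ n\<close> is translation by \<open>n ln 2\<close> in the logarithmic variable.\<close>

definition piece :: "int \<Rightarrow> real \<Rightarrow> complex" where
  "piece n s = base (s - real_of_int n * ln 2)"

lemma base_Cinf: "Cinf base" and base_zero: "\<forall>s. s \<notin> {- ln 2..ln 2} \<longrightarrow> base s = 0"
proof -
  have sm: "smooth \<phi>" "supp \<phi> \<subseteq> {1/2..2}" using dyadic by (auto simp: dyadic_partition_def)
  note c = smooth_compact_Cinf[OF sm]
  show "Cinf base" by (rule Cinf_comp_exp[OF c])
  show "\<forall>s. s \<notin> {- ln 2..ln 2} \<longrightarrow> base s = 0"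
  proof (intro allI impI)
    fix s :: real assume s: "s \<notin> {- ln 2..ln 2}"
    have "exp (- ln 2) = (1/2 :: real)" "exp (ln 2) = (2 :: real)" by (simp_all add: exp_minus)
    moreover have "s < - ln 2 \<or> ln 2 < s" using s by auto
    ultimately have "exp s < 1/2 \<or> 2 < exp s" by (metis exp_less_mono)
    then show "base s = 0" using c(2) by auto
  qed
qed

lemma hom_part_exp: "hom_part \<phi> n (exp s) = piece n s"
proof -
  have "(2::real) powi (- n) = 2 powr real_of_int (- n)" by (rule powr_real_of_int'[symmetric]) simp_all
  also have "\<dots> = exp (- (real_of_int n * ln 2))" by (simp add: powr_def)
  finally have "(2::real) powi (- n) * exp s = exp (s - real_of_int n * ln 2)" by (simp add: exp_diff exp_minus field_simps)
  then show ?thesis by (simp add: hom_part_def piece_def)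
qed

lemma piece_Cinf: "Cinf (piece n)"
  unfolding piece_def[abs_def] by (rule Cinf_shift[OF base_Cinf])

lemma piece_zero: "\<bar>s - real_of_int n * ln 2\<bar> > ln 2 \<Longrightarrow> piece n s = 0"
proof -
  assume "\<bar>s - real_of_int n * ln 2\<bar> > ln 2"
  then have "s - real_of_int n * ln 2 \<notin> {- ln 2..ln 2}" by auto
  then show ?thesis using base_zero unfolding piece_def by blast
qed

lemma piece_has_sum: "((\<lambda>n. piece n s) has_sum 1) UNIV"
proof -
  have "((\<lambda>n. hom_part \<phi> n (exp s)) has_sum 1) UNIV"
    using dyadic unfolding dyadic_partition_def by (metis exp_gt_zero)
  then show ?thesis unfolding hom_part_exp .
qed

text \<open>At a given point the infinite sum of the partition reduces to the indices whose support meets the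
  point.\<close>

lemma piece_sum_one:
  assumes F: "finite F" and c: "\<And>n. \<bar>s - real_of_int n * ln 2\<bar> \<le> ln 2 \<Longrightarrow> n \<in> F"
  shows "(\<Sum>n\<in>F. piece n s) = 1"
proof -
  have z: "piece n s = 0" if "n \<notin> F" for n using piece_zero[of s n] c[of n] that by force
  have "((\<lambda>n. piece n s) has_sum 1) F"
    using piece_has_sum[of s] by (subst has_sum_cong_neutral[of UNIV F "\<lambda>n. piece n s" "\<lambda>n. piece n s"]) (use z in auto)
  then show ?thesis using has_sum_finite[OF F] has_sum_unique by blast
qed

text \<open>A smooth function of compact support that is one on the support of \<open>base\<close>. The indices
  \<open>\<plusminus>2\<close> are included because their closed supports still touch the end points of that of \<open>base\<close>.\<close>

definition fat :: "real \<Rightarrow> complex" where "fat s = (\<Sum>n\<in>{-2..2}. piece n s)"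

lemma fat_Cinf: "Cinf fat"
  unfolding fat_def[abs_def] by (rule Cinf_sum) (rule piece_Cinf)

lemma int_less_mult_ln2: "m < n \<Longrightarrow> real_of_int m * ln 2 + ln 2 \<le> real_of_int n * ln 2"
proof -
  assume "m < n"
  then have "(real_of_int m + 1) * ln 2 \<le> real_of_int n * ln 2" by (intro mult_right_mono) auto
  then show ?thesis by (simp add: algebra_simps)
qed

lemma fat_zero: "\<forall>s. s \<notin> {- (3 * ln 2)..3 * ln 2} \<longrightarrow> fat s = 0"
proof (intro allI impI)
  fix s :: real assume s: "s \<notin> {- (3 * ln 2)..3 * ln 2}"
  have "piece n s = 0" if n: "n \<in> {-2..2}" for n
  proof (rule piece_zero)
    have "real_of_int n * ln 2 \<le> 2 * ln 2" using n by (intro mult_right_mono) auto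
    moreover have "-2 * ln 2 \<le> real_of_int n * ln 2" using n by (intro mult_right_mono) auto
    moreover have "s < - (3 * ln 2) \<or> 3 * ln 2 < s" using s by auto
    ultimately show "\<bar>s - real_of_int n * ln 2\<bar> > ln 2" by linarith
  qed
  then show "fat s = 0" by (simp add: fat_def)
qed

lemma fat_base: "fat s * base s = base s"
proof (cases "s \<in> {- ln 2..ln 2}")
  case False
  then show ?thesis using base_zero by simp
next
  case True
  have "fat s = 1" unfolding fat_def
  proof (rule piece_sum_one)
    fix n assume n: "\<bar>s - real_of_int n * ln 2\<bar> \<le> ln 2"
    show "n \<in> {-2..2}"
    proof (rule ccontr)
      assume "n \<notin> {-2..2}"
      then have "2 < n \<or> n < -2" by auto
      then have "3 * ln 2 \<le> real_of_int n * ln 2 \<or> real_of_int n * ln 2 \<le> - (3 * ln 2)"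
        using int_less_mult_ln2[of 2 n] int_less_mult_ln2[of n "-2"] by (elim disjE) simp_all
      moreover have "(0::real) < ln 2" by simp
      moreover have "- ln 2 \<le> s" "s \<le> ln 2" using True by auto
      ultimately show False using n by linarith
    qed
  qed simp
  then show ?thesis by simp
qed

text \<open>The multiplier \<open>2\<^sup>n\<^sup>\<theta> \<phi>\<^sub>n \<lambda>\<^sup>-\<^sup>\<theta>\<close>, written as a translate.\<close>

definition up_mult :: "real \<Rightarrow> int \<Rightarrow> real \<Rightarrow> complex" where
  "up_mult \<theta> n s = base (s - real_of_int n * ln 2) * of_real (exp (- \<theta> * (s - real_of_int n * ln 2)))"

text \<open>A multiplier that undoes \<open>up_mult\<close> up to the partition function itself.\<close>

definition dual_mult :: "real \<Rightarrow> int \<Rightarrow> real \<Rightarrow> complex" where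
  "dual_mult \<theta> n s = fat (s - real_of_int n * ln 2) * of_real (exp (\<theta> * (s - real_of_int n * ln 2)))"

lemma uncond_up_mult: "uncond (up_mult \<theta>)"
  unfolding up_mult_def[abs_def]
  by (rule uncond_shifts[where R = "ln 2" and l = "ln 2" and w = "\<lambda>s. base s * of_real (exp (- \<theta> * s))"])
    (use Cinf_mult_exp_compact[OF base_Cinf base_zero, of "- \<theta>"] base_zero in auto)

lemma uncond_dual_mult: "uncond (dual_mult \<theta>)"
  unfolding dual_mult_def[abs_def]
  by (rule uncond_shifts[where R = "3 * ln 2" and l = "ln 2" and w = "\<lambda>s. fat s * of_real (exp (\<theta> * s))"])
    (use Cinf_mult_exp_compact[OF fat_Cinf fat_zero] fat_zero in auto)

lemma uncond_piece: "uncond piece"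
  unfolding piece_def[abs_def]
  by (rule uncond_shifts[where R = "ln 2" and l = "ln 2" and w = base]) (use base_Cinf base_zero in auto)

lemma powr_dyadic: "complex_of_real (2 powr (real_of_int n * \<theta>)) = of_real (exp (\<theta> * (real_of_int n * ln 2)))"
  by (simp add: powr_def mult_ac)

lemma up_mult_eq: "up_mult \<theta> n s = of_real (2 powr (real_of_int n * \<theta>)) * (piece n s * of_real (exp (- \<theta> * s)))"
proof -
  have "exp (- \<theta> * (s - real_of_int n * ln 2)) = exp (\<theta> * (real_of_int n * ln 2)) * exp (- \<theta> * s)"
    by (simp add: exp_add[symmetric] algebra_simps)
  then show ?thesis unfolding up_mult_def powr_dyadic piece_def by simp
qed

lemma dual_mult_up_mult: "dual_mult \<theta> n s * up_mult \<theta> n s = piece n s"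
proof -
  let ?t = "s - real_of_int n * ln 2"
  have e: "complex_of_real (exp (\<theta> * ?t)) * of_real (exp (- \<theta> * ?t)) = 1"
    by (simp add: exp_minus flip: of_real_mult)
  have "dual_mult \<theta> n s * up_mult \<theta> n s = (fat ?t * base ?t) * (of_real (exp (\<theta> * ?t)) * of_real (exp (- \<theta> * ?t)))"
    by (simp only: dual_mult_def up_mult_def mult_ac)
  then show ?thesis unfolding e fat_base piece_def by simp
qed

text \<open>Stated for \<open>y = A\<^sup>\<theta> x\<close>, so that neither fractional powers nor completions are involved.\<close>

lemma hom_estimate:
  assumes rad: "rademacher M (\<epsilon> :: int \<Rightarrow> 'w \<Rightarrow> real)"
  shows "\<exists>c>0. \<exists>C>0. \<forall>y. ennreal (c * norm y) \<le> rad_sup M \<epsilon> (\<lambda>n. Phi (up_mult \<theta> n) y) \<and>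
      rad_sup M \<epsilon> (\<lambda>n. Phi (up_mult \<theta> n) y) \<le> ennreal (C * norm y)"
proof -
  obtain C where C: "C \<ge> 0" "\<And>(F::int set) s y. finite F \<Longrightarrow> s \<in> signs F \<Longrightarrow> norm (\<Sum>n\<in>F. s n *\<^sub>R Phi (up_mult \<theta> n) y) \<le> C * norm y"
    by (rule Phi_signed_sum_bound[OF uncond_up_mult]) blast
  obtain K where K: "K > 0" "\<And>F a. finite F \<Longrightarrow> norm (\<Sum>n\<in>F. Phi (dual_mult \<theta> n) (a n)) \<le> K * (\<integral>\<omega>. norm (\<Sum>n\<in>F. \<epsilon> n \<omega> *\<^sub>R a n) \<partial>M)"
    by (rule Phi_decoupling[OF uncond_dual_mult rad]) blast
  have up: "rad_sup M \<epsilon> (\<lambda>n. Phi (up_mult \<theta> n) y) \<le> ennreal ((C + 1) * norm y)" for y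
  proof (rule rad_sup_least, rule rademacher_norm_le[OF rad])
    fix F :: "int set" and s assume "finite F" "s \<in> signs F"
    from C(2)[OF this, of y] show "norm (\<Sum>n\<in>F. s n *\<^sub>R Phi (up_mult \<theta> n) y) \<le> (C + 1) * norm y"
      by (rule order_trans) (simp add: mult_right_mono)
  qed
  have low: "ennreal (inverse K * norm y) \<le> rad_sup M \<epsilon> (\<lambda>n. Phi (up_mult \<theta> n) y)" for y
  proof (cases "rad_sup M \<epsilon> (\<lambda>n. Phi (up_mult \<theta> n) y)")
    case (real r)
    \<comment> \<open>One index more than \<open>N\<close> on each side: the supports of the pieces have radius \<open>ln 2\<close>.\<close>
    define F where "F N = {- int (Suc N)..int (Suc N)}" for N
    let ?g = "\<lambda>N s. \<Sum>n\<in>F N. piece n s"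
    have lim: "(\<lambda>N. Phi (?g N) y) \<longlonglongrightarrow> y"
    proof (rule Phi_cutoff[where c = "ln 2"])
      show "\<exists>B. \<forall>k. Cb_le m B (?g k)" for m
      proof -
        obtain B where "\<And>F c. finite F \<Longrightarrow> (\<And>n. cmod (c n) \<le> 1) \<Longrightarrow> Cb_le m B (\<lambda>s. \<Sum>n\<in>F. c n * piece n s)"
          using uncond_piece unfolding uncond_def by blast
        from this[of "F _" "\<lambda>_. 1"] show ?thesis by (auto simp: F_def)
      qed
      show "?g N s = 1" if s: "\<bar>s\<bar> \<le> ln 2 * real N" for N s
      proof (rule piece_sum_one)
        fix n assume n: "\<bar>s - real_of_int n * ln 2\<bar> \<le> ln 2"
        show "n \<in> F N"
        proof (rule ccontr)
          assume "n \<notin> F N"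
          then have "int (Suc N) < n \<or> n < - int (Suc N)" by (auto simp: F_def)
          then have "real N * ln 2 + 2 * ln 2 \<le> real_of_int n * ln 2 \<or> real_of_int n * ln 2 + 2 * ln 2 \<le> - (real N * ln 2)"
            using int_less_mult_ln2[of "int (Suc N)" n] int_less_mult_ln2[of n "- int (Suc N)"] by (auto simp: algebra_simps)
          moreover have "(0::real) < ln 2" by simp
          moreover have "\<bar>s\<bar> \<le> real N * ln 2" using s by (simp add: mult.commute)
          ultimately show False using n by linarith
        qed
      qed (simp add: F_def)
    qed simp
    have "norm y \<le> K * r"
    proof (rule norm_limit_le_rad_sup[OF real(2,1) lim])
      show "0 \<le> K" using K(1) by simp
      show fin: "finite (F N)" for N by (simp add: F_def)
      fix N
      have "Phi (dual_mult \<theta> n) (Phi (up_mult \<theta> n) y) = Phi (piece n) y" for n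
        using Phi_mult[OF uncond_Cinf[OF uncond_dual_mult] uncond_Cinf[OF uncond_up_mult], of \<theta> n \<theta> n y] unfolding dual_mult_up_mult by simp
      then have "Phi (?g N) y = (\<Sum>n\<in>F N. Phi (dual_mult \<theta> n) (Phi (up_mult \<theta> n) y))"
        by (simp add: Phi_sum[OF fin piece_Cinf])
      then show "norm (Phi (?g N) y) \<le> K * (\<integral>\<omega>. norm (\<Sum>n\<in>F N. \<epsilon> n \<omega> *\<^sub>R Phi (up_mult \<theta> n) y) \<partial>M)"
        using K(2)[OF fin] by simp
    qed
    then show ?thesis unfolding real(2) using K(1) by (intro ennreal_leI) (simp add: field_simps)
  qed simp
  show ?thesis
    by (rule exI[of _ "inverse K"], rule conjI, simp add: K(1), rule exI[of _ "C + 1"]) (use up low C(1) in simp)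
qed

section \<open>The inhomogeneous estimate\<close>

text \<open>The function \<open>\<phi>\<^sub>0\<close> of the inhomogeneous partition in the logarithmic variable.\<close>

definition low :: "real \<Rightarrow> complex" where "low s = (\<Sum>\<^sub>\<infinity>k\<in>{..0}. piece k s)"

definition psi :: "nat \<Rightarrow> real \<Rightarrow> complex" where "psi n = (if n = 0 then low else piece (int n))"

lemma inhom_part_exp: "inhom_part \<phi> n (exp s) = psi n s"
  by (simp add: inhom_part_def psi_def low_def hom_part_exp)

lemma low_one: "s < 0 \<Longrightarrow> low s = 1"
proof -
  assume s: "s < 0"
  have z: "piece k s = 0" if "0 < k" for k
  proof (rule piece_zero)
    have "ln 2 \<le> real_of_int k * ln 2" using int_less_mult_ln2[OF that] by simp
    then show "ln 2 < \<bar>s - real_of_int k * ln 2\<bar>" using s by linarith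
  qed
  have "infsum (\<lambda>k. piece k s) {..0} = infsum (\<lambda>k. piece k s) UNIV"
    by (rule infsum_cong_neutral) (use z in auto)
  then show ?thesis using infsumI[OF piece_has_sum[of s]] by (simp add: low_def)
qed

lemma low_local: "s > - ln 2 \<Longrightarrow> low s = (\<Sum>k\<in>{-2..0}. piece k s)"
proof -
  assume s: "s > - ln 2"
  have z: "piece k s = 0" if "k < -2" for k
  proof (rule piece_zero)
    have "real_of_int k * ln 2 + ln 2 \<le> - (2 * ln 2)" using int_less_mult_ln2[OF that] by simp
    then show "ln 2 < \<bar>s - real_of_int k * ln 2\<bar>" using s by linarith
  qed
  have "infsum (\<lambda>k. piece k s) {..0} = infsum (\<lambda>k. piece k s) {-2..0}"
    by (rule infsum_cong_neutral) (use z in auto)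
  then show ?thesis by (simp add: low_def)
qed

lemma low_zero: "\<forall>s>ln 2. low s = 0"
proof (intro allI impI)
  fix s :: real assume s: "s > ln 2"
  have l: "(0::real) < ln 2" by simp
  have "piece k s = 0" if k: "k \<in> {-2..0}" for k
  proof (rule piece_zero)
    have "real_of_int k * ln 2 \<le> 0 * ln 2" using k by (intro mult_right_mono) auto
    then show "\<bar>s - real_of_int k * ln 2\<bar> > ln 2" using s by auto
  qed
  then show "low s = 0" using low_local[of s] s l by simp
qed

text \<open>Near any point the defining infinite sum is either the constant one or a finite sum of pieces.\<close>

lemma low_Cinf: "Cinf low"
proof (rule Cinf_glue[where a = 0 and b = "- ln 2" and u = "\<lambda>_. 1" and v = "\<lambda>s. \<Sum>k\<in>{-2..0}. piece k s"])
  show "Cinf (\<lambda>s. \<Sum>k\<in>{-2..0}. piece k s)" by (rule Cinf_sum) (rule piece_Cinf)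
qed (use low_one low_local Cinf_const in auto)

lemma uncond_psi: "uncond psi"
  using uncond_nat[OF uncond_piece low_Cinf] unfolding psi_def[abs_def] .

lemma psi_sum_one:
  fixes N :: nat
  assumes s: "s \<le> real N * ln 2"
  shows "(\<Sum>n\<le>Suc N. psi n s) = 1"
proof -
  have l: "(0::real) < ln 2" by simp
  have "{..Suc N} = insert 0 {1..Suc N}" by auto
  then have "(\<Sum>n\<le>Suc N. psi n s) = psi 0 s + (\<Sum>n\<in>{1..Suc N}. psi n s)" by simp
  also have "(\<Sum>n\<in>{1..Suc N}. psi n s) = (\<Sum>n\<in>{1..Suc N}. piece (int n) s)" by (intro sum.cong) (auto simp: psi_def)
  finally have eq: "(\<Sum>n\<le>Suc N. psi n s) = low s + (\<Sum>n\<in>{1..Suc N}. piece (int n) s)" by (simp add: psi_def)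
  show ?thesis
  proof (cases "s < 0")
    case True
    have "piece (int n) s = 0" if n: "n \<in> {1..Suc N}" for n
    proof (rule piece_zero)
      have "ln 2 \<le> real_of_int (int n) * ln 2" using int_less_mult_ln2[of 0 "int n"] n by simp
      then show "ln 2 < \<bar>s - real_of_int (int n) * ln 2\<bar>" using True by linarith
    qed
    then show ?thesis unfolding eq using low_one[OF True] by simp
  next
    case False
    have "(\<Sum>n\<in>{1..Suc N}. piece (int n) s) = (\<Sum>k\<in>int ` {1..Suc N}. piece k s)"
      by (subst sum.reindex) (auto simp: inj_on_def)
    moreover have "low s = (\<Sum>k\<in>{-2..0}. piece k s)" using False l by (intro low_local) linarith
    ultimately have "(\<Sum>n\<le>Suc N. psi n s) = (\<Sum>k\<in>{-2..0} \<union> int ` {1..Suc N}. piece k s)"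
      unfolding eq by (subst sum.union_disjoint) auto
    also have "\<dots> = 1"
    proof (rule piece_sum_one)
      fix n assume n: "\<bar>s - real_of_int n * ln 2\<bar> \<le> ln 2"
      have "n \<le> int (Suc N)"
      proof (rule ccontr)
        assume "\<not> n \<le> int (Suc N)"
        then have "(real N + 1) * ln 2 + ln 2 \<le> real_of_int n * ln 2"
          using int_less_mult_ln2[of "int (Suc N)" n] by (auto simp: algebra_simps)
        then show False using n s l by (simp add: algebra_simps)
      qed
      moreover have "-2 \<le> n"
      proof (rule ccontr)
        assume "\<not> -2 \<le> n"
        then have "real_of_int n * ln 2 + ln 2 \<le> -2 * ln 2" using int_less_mult_ln2[of n "-2"] by auto
        then show False using n False l by simp
      qed
      ultimately show "n \<in> {-2..0} \<union> int ` {1..Suc N}"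
        by (cases "n \<le> 0") (auto intro!: image_eqI[of _ _ "nat n"])
    qed simp
    finally show ?thesis .
  qed
qed

definition fatlow :: "real \<Rightarrow> complex" where "fatlow s = (\<Sum>n\<le>3. psi n s)"

lemma fatlow_Cinf: "Cinf fatlow"
  unfolding fatlow_def[abs_def] by (rule Cinf_sum) (rule uncond_Cinf[OF uncond_psi])

lemma fatlow_low: "fatlow s * low s = low s"
proof (cases "s > ln 2")
  case True
  then show ?thesis using low_zero by simp
next
  case False
  have "(0::real) < ln 2" by simp
  then have "s \<le> real 2 * ln 2" using False unfolding of_nat_numeral by linarith
  from psi_sum_one[OF this] show ?thesis by (simp add: fatlow_def numeral_3_eq_3 numeral_2_eq_2)
qed

lemma fatlow_zero: "\<forall>s>4 * ln 2. fatlow s = 0"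
proof (intro allI impI)
  fix s :: real assume s: "s > 4 * ln 2"
  have l: "(0::real) < ln 2" by simp
  have "psi n s = 0" if n: "n \<le> 3" for n
  proof (cases "n = 0")
    case True
    moreover have "ln 2 < s" using s l by linarith
    ultimately show ?thesis using low_zero by (simp add: psi_def)
  next
    case False
    have "real_of_int (int n) * ln 2 \<le> 3 * ln 2" using n by (intro mult_right_mono) auto
    then have "ln 2 < \<bar>s - real_of_int (int n) * ln 2\<bar>" using s by linarith
    then have "piece (int n) s = 0" by (rule piece_zero)
    then show ?thesis using False by (simp add: psi_def)
  qed
  then show "fatlow s = 0" by (simp add: fatlow_def)
qed


text \<open>Functions equal to one on the support of \<open>psi n\<close>.\<close>

definition fatpsi :: "nat \<Rightarrow> real \<Rightarrow> complex" where
  "fatpsi n s = (if n = 0 then fatlow s else fat (s - real n * ln 2))"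

lemma fatpsi_psi: "fatpsi n s * psi n s = psi n s"
  using fatlow_low[of s] fat_base[of "s - real n * ln 2"] by (simp add: fatpsi_def psi_def piece_def)

definition weighted_psi :: "real \<Rightarrow> nat \<Rightarrow> real \<Rightarrow> complex" where
  "weighted_psi \<theta> n s = of_real (2 powr (real n * \<theta>)) * psi n s"

text \<open>Multipliers that reconstruct \<open>x\<close> from \<open>2\<^sup>n\<^sup>\<theta> \<phi>\<^sub>n(A) x\<close>.\<close>

definition dual_mult_x :: "real \<Rightarrow> nat \<Rightarrow> real \<Rightarrow> complex" where
  "dual_mult_x \<theta> n s = of_real (2 powr (- (real n * \<theta>))) * fatpsi n s"

text \<open>Multipliers that reconstruct \<open>A\<^sup>\<theta> x\<close> from \<open>2\<^sup>n\<^sup>\<theta> \<phi>\<^sub>n(A) x\<close>.\<close>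

definition dual_mult_y :: "real \<Rightarrow> nat \<Rightarrow> real \<Rightarrow> complex" where
  "dual_mult_y \<theta> n s = dual_mult_x \<theta> n s * of_real (exp (\<theta> * s))"

lemma weighted_psi_Cinf: "Cinf (weighted_psi \<theta> n)"
  unfolding weighted_psi_def[abs_def] by (rule Cinf_cmult[OF uncond_Cinf[OF uncond_psi]])

lemma dual_mult_x_weighted_psi: "dual_mult_x \<theta> n s * weighted_psi \<theta> n s = psi n s"
proof -
  have "complex_of_real (2 powr (- (real n * \<theta>))) * of_real (2 powr (real n * \<theta>)) = 1"
    by (simp add: powr_minus flip: of_real_mult)
  then have "dual_mult_x \<theta> n s * weighted_psi \<theta> n s = fatpsi n s * psi n s" by (simp add: dual_mult_x_def weighted_psi_def algebra_simps)
  then show ?thesis by (simp only: fatpsi_psi)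
qed

lemma dual_mult_y_weighted_psi: "dual_mult_y \<theta> n s * weighted_psi \<theta> n s = psi n s * of_real (exp (\<theta> * s))"
  unfolding dual_mult_y_def dual_mult_x_weighted_psi[of \<theta> n s, symmetric] by (simp only: mult_ac)

text \<open>For \<open>n \<ge> 1\<close> these are translates with weights \<open>2\<^sup>-\<^sup>n\<^sup>\<theta> \<le> 1\<close>.\<close>

lemma uncond_dual_mult_x:
  assumes \<theta>: "\<theta> > 0"
  shows "uncond (dual_mult_x \<theta>)"
proof -
  have sh: "uncond (\<lambda>(n::int) s. fat (s - real_of_int n * ln 2))"
    by (rule uncond_shifts[where R = "3 * ln 2"]) (use fat_Cinf fat_zero in auto)
  have "uncond (\<lambda>n s. of_real (2 powr (- (real n * \<theta>))) * (if n = 0 then fatlow else (\<lambda>s. fat (s - real_of_int (int n) * ln 2))) s)"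
  proof (rule uncond_scale[OF uncond_nat[OF sh fatlow_Cinf]])
    fix n :: nat
    have "(2::real) powr (- (real n * \<theta>)) \<le> 2 powr 0" using \<theta> by (intro powr_mono) auto
    then show "cmod (of_real (2 powr (- (real n * \<theta>)))) \<le> 1" by simp
  qed
  then show ?thesis unfolding dual_mult_x_def[abs_def] fatpsi_def by (simp add: if_distribR cong: if_cong)
qed

text \<open>For \<open>n \<ge> 1\<close> the weight \<open>2\<^sup>-\<^sup>n\<^sup>\<theta> exp(\<theta> s)\<close> is the translate of \<open>exp(\<theta> s)\<close>; for \<open>n = 0\<close> the growing
  exponential is cut off on the right by \<open>fatlow\<close> and bounded on the left because \<open>\<theta> > 0\<close>.\<close>

lemma uncond_dual_mult_y:
  assumes \<theta>: "\<theta> > 0"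
  shows "uncond (dual_mult_y \<theta>)"
proof -
  have "Cinf (\<lambda>s. fatlow s * of_real (exp (\<theta> * s)))"
    by (rule Cinf_mult_exp_half_line[OF fatlow_Cinf fatlow_zero]) (use \<theta> in simp)
  from uncond_nat[OF uncond_dual_mult this, of \<theta>]
  have "uncond (\<lambda>n. if n = 0 then (\<lambda>s. fatlow s * of_real (exp (\<theta> * s))) else dual_mult \<theta> (int n))" .
  moreover have "(if n = 0 then (\<lambda>s. fatlow s * of_real (exp (\<theta> * s))) else dual_mult \<theta> (int n)) = dual_mult_y \<theta> n" for n
  proof (cases "n = 0")
    case True
    then show ?thesis by (simp add: fun_eq_iff dual_mult_y_def dual_mult_x_def fatpsi_def)
  next
    case False
    have "of_real (2 powr (- (real n * \<theta>))) * complex_of_real (exp (\<theta> * s)) = of_real (exp (\<theta> * (s - real n * ln 2)))" for s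
      by (simp add: powr_def exp_add[symmetric] algebra_simps flip: of_real_mult)
    then have "dual_mult \<theta> (int n) s = dual_mult_y \<theta> n s" for s
      using False by (simp add: dual_mult_def dual_mult_y_def dual_mult_x_def fatpsi_def)
    then show ?thesis using False by (simp add: fun_eq_iff)
  qed
  ultimately show ?thesis by simp
qed

text \<open>The consequence of \<open>y = A\<^sup>\<theta> x\<close> that is expressed by bounded operators alone. It passes to limits of
  pairs \<open>(x, y)\<close> and hence to the completion, where \<open>x\<close> and \<open>y\<close> are limits along a Cauchy sequence.\<close>

definition frac_rel :: "real \<Rightarrow> 'a \<Rightarrow> 'a \<Rightarrow> bool" where
  "frac_rel \<theta> x y \<longleftrightarrow> (\<forall>u. Cinf u \<longrightarrow> Cinf (\<lambda>s. u s * of_real (exp (\<theta> * s))) \<longrightarrow>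
     Phi u y = Phi (\<lambda>s. u s * of_real (exp (\<theta> * s))) x)"

lemma frac_relD:
  assumes "frac_rel \<theta> x y" "Cinf u" "Cinf v" "\<And>s. u s * of_real (exp (\<theta> * s)) = v s"
  shows "Phi u y = Phi v x"
  using assms unfolding frac_rel_def by simp

lemma uncond_zero: "uncond (\<lambda>_ _. 0)"
proof -
  have "Cb_le m 0 (\<lambda>_. 0)" for m using Cb_const[of m 0] by simp
  then show ?thesis unfolding uncond_def by auto
qed

text \<open>The upper estimate treats the low frequency part through \<open>x\<close> and all others through \<open>y\<close>.\<close>

lemma inhom_estimate:
  assumes rad: "rademacher M (\<epsilon> :: nat \<Rightarrow> 'w \<Rightarrow> real)" and \<theta>: "\<theta> > 0"
  shows "\<exists>c>0. \<exists>C>0. \<forall>x y. frac_rel \<theta> x y \<longrightarrow>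
      ennreal (c * (norm y + norm x)) \<le> rad_sup M \<epsilon> (\<lambda>n. Phi (weighted_psi \<theta> n) x) \<and>
      rad_sup M \<epsilon> (\<lambda>n. Phi (weighted_psi \<theta> n) x) \<le> ennreal (C * (norm y + norm x))"
proof -
  \<comment> \<open>The splitting of the upper estimate: high frequencies act on \<open>y\<close>, the low one acts on \<open>x\<close>.\<close>
  define p where "p = (\<lambda>n::nat. if n = 0 then (\<lambda>_. 0) else up_mult \<theta> (int n))"
  define q where "q = (\<lambda>n::nat. if n = 0 then low else (\<lambda>_. 0))"
  have p: "uncond p" unfolding p_def by (rule uncond_nat[OF uncond_up_mult]) (rule Cinf_const)
  have q: "uncond q" unfolding q_def by (rule uncond_nat[OF uncond_zero low_Cinf])
  obtain C where C: "C \<ge> 0" "\<And>(F::nat set) s y. finite F \<Longrightarrow> s \<in> signs F \<Longrightarrow> norm (\<Sum>n\<in>F. s n *\<^sub>R Phi (p n) y) \<le> C * norm y"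
    by (rule Phi_signed_sum_bound[OF p]) blast
  obtain D where D: "D \<ge> 0" "\<And>(F::nat set) s y. finite F \<Longrightarrow> s \<in> signs F \<Longrightarrow> norm (\<Sum>n\<in>F. s n *\<^sub>R Phi (q n) y) \<le> D * norm y"
    by (rule Phi_signed_sum_bound[OF q]) blast
  obtain K where K: "K > 0" "\<And>F a. finite F \<Longrightarrow> norm (\<Sum>n\<in>F. Phi (dual_mult_x \<theta> n) (a n)) \<le> K * (\<integral>\<omega>. norm (\<Sum>n\<in>F. \<epsilon> n \<omega> *\<^sub>R a n) \<partial>M)"
    by (rule Phi_decoupling[OF uncond_dual_mult_x[OF \<theta>] rad]) blast
  obtain L where L: "L > 0" "\<And>F a. finite F \<Longrightarrow> norm (\<Sum>n\<in>F. Phi (dual_mult_y \<theta> n) (a n)) \<le> L * (\<integral>\<omega>. norm (\<Sum>n\<in>F. \<epsilon> n \<omega> *\<^sub>R a n) \<partial>M)"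
    by (rule Phi_decoupling[OF uncond_dual_mult_y[OF \<theta>] rad]) blast
  have up: "rad_sup M \<epsilon> (\<lambda>n. Phi (weighted_psi \<theta> n) x) \<le> ennreal ((C + D + 1) * (norm y + norm x))" if r: "frac_rel \<theta> x y" for x y
  proof (rule rad_sup_least, rule rademacher_norm_le[OF rad])
    have dec: "Phi (weighted_psi \<theta> n) x = Phi (p n) y + Phi (q n) x" for n
    proof (cases "n = 0")
      case True
      have "weighted_psi \<theta> 0 = low" by (simp add: fun_eq_iff weighted_psi_def psi_def)
      then show ?thesis using True Phi_const[of 0 y] by (simp add: p_def q_def scaleC.zero_left)
    next
      case False
      have e: "up_mult \<theta> (int n) s * of_real (exp (\<theta> * s)) = weighted_psi \<theta> n s" for s
      proof -
        have "complex_of_real (exp (- \<theta> * s)) * of_real (exp (\<theta> * s)) = 1" by (simp add: exp_minus flip: of_real_mult)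
        then show ?thesis using False by (simp add: up_mult_eq weighted_psi_def psi_def mult.assoc)
      qed
      have "Phi (up_mult \<theta> (int n)) y = Phi (weighted_psi \<theta> n) x"
        by (rule frac_relD[OF r uncond_Cinf[OF uncond_up_mult] weighted_psi_Cinf e])
      then show ?thesis using False Phi_const[of 0 x] by (simp add: p_def q_def scaleC.zero_left)
    qed
    fix F :: "nat set" and s assume F: "finite F" "s \<in> signs F"
    have eq: "(\<Sum>n\<in>F. s n *\<^sub>R Phi (weighted_psi \<theta> n) x) = (\<Sum>n\<in>F. s n *\<^sub>R Phi (p n) y) + (\<Sum>n\<in>F. s n *\<^sub>R Phi (q n) x)"
      unfolding dec by (simp add: scaleR_add_right sum.distrib)
    have "norm (\<Sum>n\<in>F. s n *\<^sub>R Phi (weighted_psi \<theta> n) x) \<le> C * norm y + D * norm x"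
      unfolding eq using norm_triangle_ineq[of "\<Sum>n\<in>F. s n *\<^sub>R Phi (p n) y" "\<Sum>n\<in>F. s n *\<^sub>R Phi (q n) x"] C(2)[OF F, of y] D(2)[OF F, of x] by linarith
    also have "\<dots> \<le> (C + D + 1) * norm y + (C + D + 1) * norm x"
      by (intro add_mono mult_right_mono) (use C(1) D(1) in auto)
    finally show "norm (\<Sum>n\<in>F. s n *\<^sub>R Phi (weighted_psi \<theta> n) x) \<le> (C + D + 1) * (norm y + norm x)" by (simp only: distrib_left)
  qed
  have lower: "ennreal (inverse (K + L) * (norm y + norm x)) \<le> rad_sup M \<epsilon> (\<lambda>n. Phi (weighted_psi \<theta> n) x)" if rel: "frac_rel \<theta> x y" for x y
  proof (cases "rad_sup M \<epsilon> (\<lambda>n. Phi (weighted_psi \<theta> n) x)")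
    case (real r)
    let ?g = "\<lambda>N s. \<Sum>n\<le>Suc N. psi n s"
    have lim: "(\<lambda>N. Phi (?g N) z) \<longlonglongrightarrow> z" for z
    proof (rule Phi_cutoff[where c = "ln 2"])
      show "\<exists>B. \<forall>k. Cb_le m B (?g k)" for m
      proof -
        obtain B where "\<And>F c. finite F \<Longrightarrow> (\<And>n. cmod (c n) \<le> 1) \<Longrightarrow> Cb_le m B (\<lambda>s. \<Sum>n\<in>F. c n * psi n s)"
          using uncond_psi unfolding uncond_def by blast
        from this[of "{..Suc _}" "\<lambda>_. 1"] show ?thesis by auto
      qed
      show "?g N s = 1" if "\<bar>s\<bar> \<le> ln 2 * real N" for N s
      proof (rule psi_sum_one)
        show "s \<le> real N * ln 2" using that by (simp add: mult.commute)
      qed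
    qed simp
    have psiC: "Cinf (psi n)" for n by (rule uncond_Cinf[OF uncond_psi])
    have sum: "Phi (?g N) z = (\<Sum>n\<le>Suc N. Phi (psi n) z)" for N z by (rule Phi_sum[OF _ psiC]) simp
    have "norm x \<le> K * r"
    proof (rule norm_limit_le_rad_sup[OF real(2,1) lim])
      show "0 \<le> K" using K(1) by simp
      fix N
      show "finite {..Suc N}" by simp
      have "Phi (dual_mult_x \<theta> n) (Phi (weighted_psi \<theta> n) x) = Phi (psi n) x" for n
        using Phi_mult[OF uncond_Cinf[OF uncond_dual_mult_x[OF \<theta>], of n] weighted_psi_Cinf, of \<theta> n x] unfolding dual_mult_x_weighted_psi by simp
      then show "norm (Phi (?g N) x) \<le> K * (\<integral>\<omega>. norm (\<Sum>n\<le>Suc N. \<epsilon> n \<omega> *\<^sub>R Phi (weighted_psi \<theta> n) x) \<partial>M)"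
        unfolding sum using K(2)[of "{..Suc N}" "\<lambda>n. Phi (weighted_psi \<theta> n) x"] by simp
    qed
    moreover have "norm y \<le> L * r"
    proof (rule norm_limit_le_rad_sup[OF real(2,1) lim])
      show "0 \<le> L" using L(1) by simp
      fix N
      show "finite {..Suc N}" by simp
      have "Phi (dual_mult_y \<theta> n) (Phi (weighted_psi \<theta> n) x) = Phi (psi n) y" for n
      proof -
        note c = uncond_Cinf[OF uncond_dual_mult_y[OF \<theta>], of n]
        have "Cinf (\<lambda>s. psi n s * of_real (exp (\<theta> * s)))"
          using Cinf_mult[OF c weighted_psi_Cinf, of \<theta> n] unfolding dual_mult_y_weighted_psi .
        then have "Phi (psi n) y = Phi (\<lambda>s. psi n s * of_real (exp (\<theta> * s))) x"
          using rel psiC unfolding frac_rel_def by blast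
        then show ?thesis using Phi_mult[OF c weighted_psi_Cinf, of \<theta> n x] unfolding dual_mult_y_weighted_psi by simp
      qed
      then show "norm (Phi (?g N) y) \<le> L * (\<integral>\<omega>. norm (\<Sum>n\<le>Suc N. \<epsilon> n \<omega> *\<^sub>R Phi (weighted_psi \<theta> n) x) \<partial>M)"
        unfolding sum using L(2)[of "{..Suc N}" "\<lambda>n. Phi (weighted_psi \<theta> n) x"] by simp
    qed
    ultimately have "norm y + norm x \<le> (K + L) * r" by (simp add: distrib_right)
    then have "inverse (K + L) * (norm y + norm x) \<le> r" using K(1) L(1) by (simp add: field_simps)
    then show ?thesis unfolding real(2) by (rule ennreal_leI)
  qed simp
  show ?thesis
    by (rule exI[of _ "inverse (K + L)"], rule conjI, use K(1) L(1) in simp, rule exI[of _ "C + D + 1"])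
      (use up lower C(1) D(1) in simp)
qed

end

section \<open>Completions\<close>

lemma completion_memD:
  assumes "x \<in> completion D nrm" "v \<in> x"
  shows "v \<in> cauchy_seqs D nrm"
  using assms unfolding completion_def quotient_def by auto

lemma completion_nonempty:
  assumes "x \<in> completion D nrm" "nrm 0 = 0"
  shows "x \<noteq> {}"
  using assms unfolding completion_def quotient_def by auto

text \<open>A linear map dominated by the norm of the completion sends all Cauchy sequences of one class to
  convergent sequences with a common limit.\<close>

lemma completion_limit:
  fixes L :: "'a::ab_group_add \<Rightarrow> 'b::banach"
  assumes x: "x \<in> completion D nrm" and N0: "nrm 0 = 0"
    and D: "\<And>a b. a \<in> D \<Longrightarrow> b \<in> D \<Longrightarrow> L (a - b) = L a - L b \<and> norm (L (a - b)) \<le> nrm (a - b)"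
  obtains l where "\<And>v. v \<in> x \<Longrightarrow> (\<lambda>k. L (v k)) \<longlonglongrightarrow> l"
proof -
  obtain u where u: "u \<in> cauchy_seqs D nrm" "x = {v. v \<in> cauchy_seqs D nrm \<and> (\<lambda>k. nrm (u k - v k)) \<longlonglongrightarrow> 0}"
    using x unfolding completion_def quotient_def by auto
  have mem: "v k \<in> D" if "v \<in> cauchy_seqs D nrm" for v k using that by (auto simp: cauchy_seqs_def)
  have "Cauchy (\<lambda>k. L (u k))"
  proof (rule metric_CauchyI)
    fix e :: real assume "e > 0"
    then obtain K where "\<forall>j\<ge>K. \<forall>k\<ge>K. nrm (u j - u k) < e" using u(1) unfolding cauchy_seqs_def by blast
    moreover have "dist (L (u j)) (L (u k)) \<le> nrm (u j - u k)" for j k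
      using D[OF mem[OF u(1)] mem[OF u(1)], of j k] unfolding dist_norm by metis
    ultimately show "\<exists>K. \<forall>j\<ge>K. \<forall>k\<ge>K. dist (L (u j)) (L (u k)) < e" by (meson le_less_trans)
  qed
  then obtain l where l: "(\<lambda>k. L (u k)) \<longlonglongrightarrow> l" using Cauchy_convergent convergent_def by blast
  have "(\<lambda>k. L (v k)) \<longlonglongrightarrow> l" if "v \<in> x" for v
  proof -
    have v: "v \<in> cauchy_seqs D nrm" "(\<lambda>k. nrm (u k - v k)) \<longlonglongrightarrow> 0" using that u(2) by auto
    have "norm (L (u k) - L (v k)) \<le> nrm (u k - v k)" for k
      using D[OF mem[OF u(1)] mem[OF v(1)], of k k] by metis
    then have "(\<lambda>k. L (u k) - L (v k)) \<longlonglongrightarrow> 0"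
      by (intro Lim_null_comparison[OF always_eventually v(2)]) blast
    from tendsto_diff[OF l this] show ?thesis by simp
  qed
  then show ?thesis by (rule that)
qed

lemma completion_norm_eq:
  assumes "x \<noteq> {}" "\<And>v. v \<in> x \<Longrightarrow> (\<lambda>k. nrm (v k)) \<longlonglongrightarrow> r"
  shows "completion_norm nrm x = r"
  unfolding completion_norm_def
  by (rule the_equality) (use assms LIMSEQ_unique in blast)+

lemma completion_ext_eq:
  fixes T :: "'a \<Rightarrow> 'b::t2_space"
  assumes "x \<noteq> {}" "\<And>v. v \<in> x \<Longrightarrow> (\<lambda>k. T (v k)) \<longlonglongrightarrow> r"
  shows "completion_ext T x = r"
  unfolding completion_ext_def
  by (rule the_equality) (use assms LIMSEQ_unique in blast)+

context dyadic_mihlin_calculus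
begin

text \<open>The calculus sees a function on \<open>(0, \<infinity>)\<close> only through its composition with the exponential.\<close>

lemma mihlin_calc_Phi: "mihlin_calc \<alpha> \<phi>0 \<phi>1 A f = Phi (\<lambda>s. f (exp s))"
  by (simp add: fun_eq_iff Phi_def mihlin_calc_def mihlin_norm_def)

lemma Phi_tendsto: "Cinf u \<Longrightarrow> z \<longlonglongrightarrow> l \<Longrightarrow> (\<lambda>k. Phi u (z k)) \<longlonglongrightarrow> Phi u l"
  using bounded_linear.tendsto[OF Phi_bounded_linear] .

abbreviation Apow :: "real \<Rightarrow> 'a \<Rightarrow> 'a" where "Apow \<theta> \<equiv> op_val (frac_power A \<theta>)"

lemma Apow_graph: "x \<in> Domain (frac_power A \<theta>) \<Longrightarrow> (x, Apow \<theta> x) \<in> frac_power A \<theta>"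
  using frac_op_val by (metis DomainE)

lemma Apow_diff: "x \<in> Domain (frac_power A \<theta>) \<Longrightarrow> x' \<in> Domain (frac_power A \<theta>) \<Longrightarrow> Apow \<theta> (x - x') = Apow \<theta> x - Apow \<theta> x'"
  by (intro frac_op_val frac_diff Apow_graph)

lemma frac_rel_pow: "x \<in> Domain (frac_power A \<theta>) \<Longrightarrow> frac_rel \<theta> x (Apow \<theta> x)"
  unfolding frac_rel_def using frac_Phi[OF Apow_graph] by blast

lemma Apow_zero: "Apow \<theta> 0 = 0"
proof (rule frac_op_val)
  show "(0, 0) \<in> frac_power A \<theta>" unfolding frac_iff
    by (simp add: linear_simps(3)[OF Phi_bounded_linear[OF Cinf_power[OF Cinf_rho_log]]] linear_simps(3)[OF Phi_bounded_linear[OF frac_Cinf]])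
qed

text \<open>The vector \<open>y\<close> is the limit of \<open>A\<^sup>\<theta> x\<^sub>k\<close> along the Cauchy sequences \<open>x\<^sub>k\<close> of the class. The operators of
  the partition factor through \<open>A\<^sup>\<theta>\<close> by \<open>frac_Phi\<close>, so they converge along the sequence although \<open>x\<^sub>k\<close>
  itself need not.\<close>

lemma hom_space_element:
  assumes x: "x \<in> hom_space A \<theta>"
  obtains y where "hom_norm A \<theta> x = norm y"
    "\<And>n. 2 powr (real_of_int n * \<theta>) *\<^sub>R completion_ext (mihlin_calc \<alpha> \<phi>0 \<phi>1 A (hom_part \<phi> n)) x = Phi (up_mult \<theta> n) y"
proof -
  let ?D = "Domain (frac_power A \<theta>)"
  have c: "x \<in> completion ?D (hom_pre_norm A \<theta>)" using x by (simp add: hom_space_def)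
  have N0: "hom_pre_norm A \<theta> 0 = 0" by (simp add: hom_pre_norm_def Apow_zero)
  note ne = completion_nonempty[OF c N0]
  obtain y where y: "\<And>v. v \<in> x \<Longrightarrow> (\<lambda>k. Apow \<theta> (v k)) \<longlonglongrightarrow> y"
    by (rule completion_limit[OF c N0, of "Apow \<theta>"]) (auto simp: hom_pre_norm_def Apow_diff)
  have "hom_norm A \<theta> x = norm y" unfolding hom_norm_def
    by (rule completion_norm_eq[OF ne]) (unfold hom_pre_norm_def, rule tendsto_norm, rule y)
  moreover have "2 powr (real_of_int n * \<theta>) *\<^sub>R completion_ext (mihlin_calc \<alpha> \<phi>0 \<phi>1 A (hom_part \<phi> n)) x = Phi (up_mult \<theta> n) y" for n
  proof -
    let ?c = "2 powr (real_of_int n * \<theta>)"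
    let ?p = "\<lambda>s. of_real (inverse ?c) * up_mult \<theta> n s"
    have pC: "Cinf ?p" by (rule Cinf_cmult[OF uncond_Cinf[OF uncond_up_mult]])
    have e: "?p s * of_real (exp (\<theta> * s)) = piece n s" for s
    proof -
      have 1: "complex_of_real (exp (- \<theta> * s)) * of_real (exp (\<theta> * s)) = 1" by (simp add: exp_minus flip: of_real_mult)
      have 2: "complex_of_real (inverse ?c) * of_real ?c = 1" by (simp flip: of_real_mult)
      have "?p s * of_real (exp (\<theta> * s)) = (of_real (inverse ?c) * of_real ?c) * (of_real (exp (- \<theta> * s)) * of_real (exp (\<theta> * s))) * piece n s"
        unfolding up_mult_eq by (simp only: mult_ac)
      then show ?thesis unfolding 1 2 by simp
    qed
    have "completion_ext (mihlin_calc \<alpha> \<phi>0 \<phi>1 A (hom_part \<phi> n)) x = Phi ?p y"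
      unfolding mihlin_calc_Phi hom_part_exp
    proof (rule completion_ext_eq[OF ne])
      fix v assume v: "v \<in> x"
      have "v k \<in> ?D" for k using completion_memD[OF c v] by (auto simp: cauchy_seqs_def)
      then have "Phi ?p (Apow \<theta> (v k)) = Phi (piece n) (v k)" for k
        by (rule frac_relD[OF frac_rel_pow pC piece_Cinf e])
      then show "(\<lambda>k. Phi (piece n) (v k)) \<longlonglongrightarrow> Phi ?p y"
        using Phi_tendsto[OF pC y[OF v]] by simp
    qed
    also have "\<dots> = of_real (inverse ?c) *\<^sub>C Phi (up_mult \<theta> n) y" by (rule Phi_cmult[OF uncond_Cinf[OF uncond_up_mult]])
    finally have "?c *\<^sub>R completion_ext (mihlin_calc \<alpha> \<phi>0 \<phi>1 A (hom_part \<phi> n)) x = (?c * inverse ?c) *\<^sub>R Phi (up_mult \<theta> n) y"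
      unfolding scaleR_scaleC[symmetric] by (simp only: scaleR_scaleR)
    then show ?thesis by simp
  qed
  ultimately show ?thesis by (rule that)
qed

text \<open>Here both \<open>x\<^sub>k\<close> and \<open>A\<^sup>\<theta> x\<^sub>k\<close> converge, to \<open>z\<close> and \<open>y\<close>.\<close>

lemma inhom_space_element:
  assumes x: "x \<in> inhom_space A \<theta>"
  obtains z y where "frac_rel \<theta> z y" "inhom_norm A \<theta> x = norm y + norm z"
    "\<And>n. 2 powr (real n * \<theta>) *\<^sub>R completion_ext (mihlin_calc \<alpha> \<phi>0 \<phi>1 A (inhom_part \<phi> n)) x = Phi (weighted_psi \<theta> n) z"
proof -
  let ?D = "Domain (frac_power A \<theta>)"
  have c: "x \<in> completion ?D (inhom_pre_norm A \<theta>)" using x by (simp add: inhom_space_def)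
  have N0: "inhom_pre_norm A \<theta> 0 = 0" by (simp add: inhom_pre_norm_def Apow_zero)
  note ne = completion_nonempty[OF c N0]
  obtain y where y: "\<And>v. v \<in> x \<Longrightarrow> (\<lambda>k. Apow \<theta> (v k)) \<longlonglongrightarrow> y"
    by (rule completion_limit[OF c N0, of "Apow \<theta>"]) (auto simp: inhom_pre_norm_def Apow_diff)
  obtain z where z: "\<And>v. v \<in> x \<Longrightarrow> (\<lambda>k. v k) \<longlonglongrightarrow> z"
    by (rule completion_limit[OF c N0, of "\<lambda>a. a"]) (auto simp: inhom_pre_norm_def)
  have "frac_rel \<theta> z y" unfolding frac_rel_def
  proof (intro allI impI)
    fix u assume u: "Cinf u" "Cinf (\<lambda>s. u s * of_real (exp (\<theta> * s)))"
    obtain v where v: "v \<in> x" using ne by blast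
    have "v k \<in> ?D" for k using completion_memD[OF c v] by (auto simp: cauchy_seqs_def)
    from frac_rel_pow[OF this] have "Phi u (Apow \<theta> (v k)) = Phi (\<lambda>s. u s * of_real (exp (\<theta> * s))) (v k)" for k
      using u unfolding frac_rel_def by blast
    then have "(\<lambda>k. Phi u (Apow \<theta> (v k))) \<longlonglongrightarrow> Phi (\<lambda>s. u s * of_real (exp (\<theta> * s))) z"
      using Phi_tendsto[OF u(2) z[OF v]] by simp
    with Phi_tendsto[OF u(1) y[OF v]] show "Phi u y = Phi (\<lambda>s. u s * of_real (exp (\<theta> * s))) z"
      by (rule LIMSEQ_unique)
  qed
  moreover have "inhom_norm A \<theta> x = norm y + norm z" unfolding inhom_norm_def
    by (rule completion_norm_eq[OF ne]) (unfold inhom_pre_norm_def, rule tendsto_add[OF tendsto_norm[OF y] tendsto_norm[OF z]])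
  moreover have "2 powr (real n * \<theta>) *\<^sub>R completion_ext (mihlin_calc \<alpha> \<phi>0 \<phi>1 A (inhom_part \<phi> n)) x = Phi (weighted_psi \<theta> n) z" for n
  proof -
    have "completion_ext (mihlin_calc \<alpha> \<phi>0 \<phi>1 A (inhom_part \<phi> n)) x = Phi (psi n) z"
      unfolding mihlin_calc_Phi inhom_part_exp
      by (rule completion_ext_eq[OF ne]) (rule Phi_tendsto[OF uncond_Cinf[OF uncond_psi] z])
    then show ?thesis unfolding weighted_psi_def[abs_def] by (simp add: Phi_cmult[OF uncond_Cinf[OF uncond_psi]] scaleR_scaleC)
  qed
  ultimately show ?thesis by (rule that)
qed

end

section \<open>The randomised square function characterisation\<close>

theorem theorem4p5:
  fixes A :: "'a::complex_banach op_graph"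
    and \<alpha> :: real
    and \<phi>\<^sub>0 \<phi>\<^sub>1 \<phi> :: "real \<Rightarrow> complex"
    and M :: "'w measure" and \<epsilon> :: "int \<Rightarrow> 'w \<Rightarrow> real"
  assumes "zero_sectorial A"
    and "\<alpha> > 0"
    and "besov_partition \<phi>\<^sub>0 \<phi>\<^sub>1"
    and "has_mihlin_calculus \<alpha> \<phi>\<^sub>0 \<phi>\<^sub>1 A"
    and "dyadic_partition \<phi>"
    and "rademacher M \<epsilon>"
  shows "(\<forall>\<theta>::real. \<exists>c>0. \<exists>C>0. \<forall>x\<in>hom_space A \<theta>.
      let S = rad_sup M \<epsilon> (\<lambda>n. 2 powr (real_of_int n * \<theta>) *\<^sub>R
                completion_ext (mihlin_calc \<alpha> \<phi>\<^sub>0 \<phi>\<^sub>1 A (hom_part \<phi> n)) x)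
      in ennreal (c * hom_norm A \<theta> x) \<le> S \<and> S \<le> ennreal (C * hom_norm A \<theta> x)) \<and>
    (\<forall>\<theta>>0. \<exists>c>0. \<exists>C>0. \<forall>x\<in>inhom_space A \<theta>.
      let S = rad_sup M (\<lambda>n::nat. \<epsilon> (int n)) (\<lambda>n. 2 powr (real n * \<theta>) *\<^sub>R
                completion_ext (mihlin_calc \<alpha> \<phi>\<^sub>0 \<phi>\<^sub>1 A (inhom_part \<phi> n)) x)
      in ennreal (c * inhom_norm A \<theta> x) \<le> S \<and> S \<le> ennreal (C * inhom_norm A \<theta> x))"
proof -
  interpret dyadic_mihlin_calculus A \<alpha> \<phi>\<^sub>0 \<phi>\<^sub>1 \<phi>
    by unfold_locales (rule assms)+
  have rad': "rademacher M (\<lambda>n::nat. \<epsilon> (int n))"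
    by (rule rademacher_subfamily[OF assms(6)]) simp
  show ?thesis
  proof (intro conjI allI impI)
    fix \<theta> :: real
    obtain c C where calc_const: "c > 0" "C > 0" "\<And>y. ennreal (c * norm y) \<le> rad_sup M \<epsilon> (\<lambda>n. Phi (up_mult \<theta> n) y)"
      "\<And>y. rad_sup M \<epsilon> (\<lambda>n. Phi (up_mult \<theta> n) y) \<le> ennreal (C * norm y)"
      using hom_estimate[OF assms(6), of \<theta>] by blast
    show "\<exists>c>0. \<exists>C>0. \<forall>x\<in>hom_space A \<theta>.
      let S = rad_sup M \<epsilon> (\<lambda>n. 2 powr (real_of_int n * \<theta>) *\<^sub>R
                completion_ext (mihlin_calc \<alpha> \<phi>\<^sub>0 \<phi>\<^sub>1 A (hom_part \<phi> n)) x)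
      in ennreal (c * hom_norm A \<theta> x) \<le> S \<and> S \<le> ennreal (C * hom_norm A \<theta> x)"
    proof (rule exI[of _ c], rule conjI[OF calc_const(1)], rule exI[of _ C], rule conjI[OF calc_const(2)], rule ballI)
      fix x assume "x \<in> hom_space A \<theta>"
      then obtain y where y: "hom_norm A \<theta> x = norm y"
        "\<And>n. 2 powr (real_of_int n * \<theta>) *\<^sub>R completion_ext (mihlin_calc \<alpha> \<phi>\<^sub>0 \<phi>\<^sub>1 A (hom_part \<phi> n)) x = Phi (up_mult \<theta> n) y"
        by (rule hom_space_element) blast
      show "let S = rad_sup M \<epsilon> (\<lambda>n. 2 powr (real_of_int n * \<theta>) *\<^sub>R
                completion_ext (mihlin_calc \<alpha> \<phi>\<^sub>0 \<phi>\<^sub>1 A (hom_part \<phi> n)) x)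
        in ennreal (c * hom_norm A \<theta> x) \<le> S \<and> S \<le> ennreal (C * hom_norm A \<theta> x)"
        unfolding y Let_def using calc_const(3,4) by blast
    qed
  next
    fix \<theta> :: real assume \<theta>: "\<theta> > 0"
    obtain c C where calc_const: "c > 0" "C > 0"
      "\<And>x y. frac_rel \<theta> x y \<Longrightarrow> ennreal (c * (norm y + norm x)) \<le> rad_sup M (\<lambda>n::nat. \<epsilon> (int n)) (\<lambda>n. Phi (weighted_psi \<theta> n) x)"
      "\<And>x y. frac_rel \<theta> x y \<Longrightarrow> rad_sup M (\<lambda>n::nat. \<epsilon> (int n)) (\<lambda>n. Phi (weighted_psi \<theta> n) x) \<le> ennreal (C * (norm y + norm x))"
      using inhom_estimate[OF rad' \<theta>] by blast
    show "\<exists>c>0. \<exists>C>0. \<forall>x\<in>inhom_space A \<theta>.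
      let S = rad_sup M (\<lambda>n::nat. \<epsilon> (int n)) (\<lambda>n. 2 powr (real n * \<theta>) *\<^sub>R
                completion_ext (mihlin_calc \<alpha> \<phi>\<^sub>0 \<phi>\<^sub>1 A (inhom_part \<phi> n)) x)
      in ennreal (c * inhom_norm A \<theta> x) \<le> S \<and> S \<le> ennreal (C * inhom_norm A \<theta> x)"
    proof (rule exI[of _ c], rule conjI[OF calc_const(1)], rule exI[of _ C], rule conjI[OF calc_const(2)], rule ballI)
      fix x assume "x \<in> inhom_space A \<theta>"
      then obtain z y where y: "frac_rel \<theta> z y" "inhom_norm A \<theta> x = norm y + norm z"
        "\<And>n. 2 powr (real n * \<theta>) *\<^sub>R completion_ext (mihlin_calc \<alpha> \<phi>\<^sub>0 \<phi>\<^sub>1 A (inhom_part \<phi> n)) x = Phi (weighted_psi \<theta> n) z"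
        by (rule inhom_space_element) blast
      show "let S = rad_sup M (\<lambda>n::nat. \<epsilon> (int n)) (\<lambda>n. 2 powr (real n * \<theta>) *\<^sub>R
                completion_ext (mihlin_calc \<alpha> \<phi>\<^sub>0 \<phi>\<^sub>1 A (inhom_part \<phi> n)) x)
        in ennreal (c * inhom_norm A \<theta> x) \<le> S \<and> S \<le> ennreal (C * inhom_norm A \<theta> x)"
        unfolding y(2,3) Let_def using calc_const(3,4)[OF y(1)] by blast
    qed
  qed
qed

end
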